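(* Let $\Phi$ satisfy Assumption (A), $\omega\in A^{\mathrm{loc}}_{\infty}(\mathbb{R}^n)$, $R\in(0,\infty)$, and let $\psi_0\in\mathcal{D}(\mathbb{R}^n)$ with $\int_{\mathbb{R}^n}\psi_0(x)\,dx\neq0$. Let $A_1\equiv\max\{A_0,\,nq_\omega/p_\Phi\}$, $B_1\equiv B_0/p_\Phi$ and $N_0\equiv\lfloor 2A_1\rfloor+1$, where $A_0$ (depending on $\mathrm{supp}\,\psi_0$) and $B_0$ (depending on $\omega,n$) are the constants described in the context. Then for any $A\in(A_1,\infty)$, $B\in(B_1,\infty)$ and integer $N\ge N_0$, there exists a positive constant $C$, depending only on $A,B,N,R,\psi_0,\Phi,\omega$ and $n$, such that for all $f\in\mathcal{D}'(\mathbb{R}^n)$, $$\|\psi^{**}_{0,A,B}(f)\|_{L^\Phi_\omega(\mathbb{R}^n)}\le C\|\psi_0^+(f)\|_{L^\Phi_\omega(\mathbb{R}^n)}$$ and $$\|\widetilde{\mathcal{G}}_{N,R}(f)\|_{L^\Phi_\omega(\mathbb{R}^n)}\le C\|\psi_0^+(f)\|_{L^\Phi_\omega(\mathbb{R}^n)}.$$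
   Context: Cubes are closed with sides parallel to the axes; $\omega(E)=\int_E\omega\,dx$; $\mathbb{Z}_+=\{0,1,2,\dots\}$; $\lfloor r\rfloor$ is the largest integer not exceeding $r$. Weights. For $p\in(1,\infty)$, $A^{\mathrm{loc}}_p(\mathbb{R}^n)$ is the set of nonnegative locally integrable $\omega$ with $\sup_{|Q|\le1}|Q|^{-p}\int_Q\omega\,dx\,(\int_Q\omega^{-p'/p}dx)^{p/p'}<\infty$ ($1/p+1/p'=1$); $A^{\mathrm{loc}}_1$: $\sup_{|Q|\le1}|Q|^{-1}\int_Q\omega\,dx\cdot\mathrm{ess\,sup}_Q\,\omega^{-1}<\infty$; $A^{\mathrm{loc}}_\infty$: for every $\alpha\in(0,1)$, $\sup_{|Q|\le1}\sup\{\omega(Q)/\omega(F):F\subset Q\text{ measurable},|F|\ge\alpha|Q|\}<\infty$. Suprema are over cubes $Q$ with $|Q|\le 1$. $q_\omega=\inf\{p\in[1,\infty):\omega\in A^{\mathrm{loc}}_p\}$. Assumption (A) on $\Phi:(0,\infty)\to(0,\infty)$: $\Phi$ is continuous, strictly increasing, subadditive, concave, and of strictly lower type (for some $p>0$, $\Phi(st)\le t^p\Phi(s)$ for all $t\in(0,1)$, $s\in(0,\infty)$), with $p_\Phi=\sup\{p>0:\Phi(st)\le t^p\Phi(s)\ \forall t\in(0,1),s\in(0,\infty)\}\in(0,1]$. Set $\Phi(0)=0$. $\|g\|_{L^\Phi_\omega}=\inf\{\lambda>0:\int_{\mathbb{R}^n}\Phi(|g|/\lambda)\,\omega\,dx\le1\}$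 (with $\inf\emptyset=\infty$). $\mathcal{D}(\mathbb{R}^n)=C_c^\infty(\mathbb{R}^n)$ with the inductive limit topology, $\mathcal{D}'(\mathbb{R}^n)$ its dual. $\psi_t(x)=t^{-n}\psi(x/t)$ for $t\in(0,\infty)$, whereas for $j\in\mathbb{Z}_+$, $(\psi_0)_j(x)=2^{jn}\psi_0(2^jx)$. $m_{j,A,B}(y)=(1+2^j|y|)^A2^{B|y|}$. Maximal functions: $\psi_0^+(f)(x)=\sup_{j\in\mathbb{Z}_+}|(\psi_0)_j*f(x)|$; $\psi^{**}_{0,A,B}(f)(x)=\sup_{j\in\mathbb{Z}_+,y\in\mathbb{R}^n}|(\psi_0)_j*f(x-y)|/m_{j,A,B}(y)$; $\widetilde{\mathcal{G}}_{N,R}(f)(x)=\sup\{|\psi_t*f(z)|:|x-z|<t<1,\psi\in\mathcal{D}_{N,R}(\mathbb{R}^n)\}$, where $\mathcal{D}_{N,R}(\mathbb{R}^n)$ is the set of $\psi\in\mathcal{D}(\mathbb{R}^n)$ with $\mathrm{supp}\,\psi\subset B(0,R)$ and $\sup_x\sup_{|\alpha|\le N}|\partial^\alpha\psi(x)|\le1$. Constants. $M^{\mathrm{loc}}g(x)=\sup_{Q\ni x,|Q|\le1}|Q|^{-1}\int_Q|g|$ and $K_Bg(x)=\int_{\mathbb{R}^n}|g(y)|2^{-B|x-y|}dy$. $A_0$ is a positive constant depending only on $\mathrm{supp}\,\psi_0$ such that for every $r\in(0,\infty)$, $A>\max\{A_0,n/r\}$ and $B\ge0$ there is $C=C(n,r,\psi_0,A,B)$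 with $$\Big[\sup_{y}\tfrac{|(\psi_0)_j*f(x-y)|}{m_{j,A,B}(y)}\Big]^r\le C\sum_{k=j}^\infty2^{(j-k)(Ar-n)}\{M^{\mathrm{loc}}(|(\psi_0)_k*f|^r)(x)+K_{Br}(|(\psi_0)_k*f|^r)(x)\}$$ for all $f\in\mathcal{D}'(\mathbb{R}^n)$, $x\in\mathbb{R}^n$, $j\in\mathbb{Z}_+$. $B_0=B_0(\omega,n)$ is a positive constant such that for every $p\in(1,\infty)$ with $\omega\in A^{\mathrm{loc}}_p$, every $q\in(1,\infty]$ and $B\ge B_0/p$ there is $C$ with $\|(\sum_j|K_Bf^j|^q)^{1/q}\|_{L^p_\omega}\le C\|(\sum_j|f^j|^q)^{1/q}\|_{L^p_\omega}$ for all sequences $\{f^j\}_j$ of measurable functions (usual modification if $q=\infty$), where $\|g\|_{L^p_\omega}=(\int|g|^p\omega)^{1/p}$. Such constants exist. *)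

theory Defs
  imports "HOL-Analysis.Analysis" "HOL-Probability.Essential_Supremum"
begin

subsection \<open>Powers in the extended half-line\<close>

text \<open>Only used for exponents \<open>r > 0\<close>, so that \<open>\<infinity>\<close> is sent to \<open>\<infinity>\<close>; negative
  powers are written as the inverse of a positive power, with \<open>inverse 0 = \<infinity>\<close>.\<close>

definition epowr :: "ennreal \<Rightarrow> real \<Rightarrow> ennreal" where
  "epowr x r = (if x = top then top else ennreal (enn2real x powr r))"


subsection \<open>Local weights\<close>

text \<open>Cubes are nondegenerate; \<^term>\<open>One\<close> is the vector all of whose coordinates are 1.\<close>

definition cubes :: "(real^'n) set set" where
  "cubes = {cbox a (a + l *\<^sub>R One) | a l. 0 < l}"

definition local_cubes :: "(real^'n) set set" where
  "local_cubes = {Q \<in> cubes. measure lebesgue Q \<le> 1}"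

definition locally_integrable :: "(real^'n \<Rightarrow> real) \<Rightarrow> bool" where
  "locally_integrable w \<longleftrightarrow> (\<forall>K. compact K \<longrightarrow> set_integrable lebesgue K w)"

definition weight :: "(real^'n \<Rightarrow> real) \<Rightarrow> bool" where
  "weight w \<longleftrightarrow> (\<forall>x. 0 \<le> w x) \<and> locally_integrable w"

definition wmeas :: "(real^'n \<Rightarrow> real) \<Rightarrow> (real^'n) set \<Rightarrow> ennreal" where
  "wmeas w E = (\<integral>\<^sup>+x\<in>E. ennreal (w x) \<partial>lebesgue)"

text \<open>Local \<open>A\<^sub>p\<close> classes, meant for \<open>1 \<le> p < \<infinity>\<close>. Below \<open>p' = p / (p - 1)\<close> is the
  conjugate exponent.\<close>

definition Ap_loc :: "real \<Rightarrow> (real^'n \<Rightarrow> real) set" where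
  "Ap_loc p = {w. weight w \<and>
     (if p = 1
      then (SUP Q\<in>local_cubes. wmeas w Q / emeasure lebesgue Q
              * esssup (lebesgue_on Q) (\<lambda>x. inverse (ennreal (w x)))) < top
      else (let p' = p / (p - 1) in
            (SUP Q\<in>local_cubes. ennreal (measure lebesgue Q powr (- p)) * wmeas w Q
              * epowr (\<integral>\<^sup>+x\<in>Q. inverse (epowr (ennreal (w x)) (p' / p)) \<partial>lebesgue) (p / p'))
            < top))}"

definition Ainf_loc :: "(real^'n \<Rightarrow> real) set" where
  "Ainf_loc = {w. weight w \<and>
     (\<forall>\<alpha>\<in>{0<..<1::real}.
        (SUP Q\<in>local_cubes.
           SUP F\<in>{F \<in> sets lebesgue. F \<subseteq> Q \<and> \<alpha> * measure lebesgue Q \<le> measure lebesgue F}.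
             wmeas w Q / wmeas w F) < top)}"

definition crit_index :: "(real^'n \<Rightarrow> real) \<Rightarrow> real" where
  "crit_index w = Inf {p. 1 \<le> p \<and> w \<in> Ap_loc p}"


subsection \<open>Orlicz functions and weighted Orlicz norms\<close>

definition lower_type :: "(real \<Rightarrow> real) \<Rightarrow> real \<Rightarrow> bool" where
  "lower_type \<Phi> p \<longleftrightarrow> (\<forall>t\<in>{0<..<1}. \<forall>s>0. \<Phi> (s * t) \<le> t powr p * \<Phi> s)"

definition crit_lower_type :: "(real \<Rightarrow> real) \<Rightarrow> real" where
  "crit_lower_type \<Phi> = Sup {p. 0 < p \<and> lower_type \<Phi> p}"

definition orlicz_function :: "(real \<Rightarrow> real) \<Rightarrow> bool" where
  "orlicz_function \<Phi> \<longleftrightarrow>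
     (\<forall>t>0. 0 < \<Phi> t) \<and>
     continuous_on {0<..} \<Phi> \<and>
     strict_mono_on {0<..} \<Phi> \<and>
     (\<forall>s>0. \<forall>t>0. \<Phi> (s + t) \<le> \<Phi> s + \<Phi> t) \<and>
     concave_on {0<..} \<Phi> \<and>
     (\<exists>p>0. lower_type \<Phi> p) \<and>
     0 < crit_lower_type \<Phi> \<and> crit_lower_type \<Phi> \<le> 1"

text \<open>Only the values of \<open>\<Phi>\<close> on the open half-line are relevant. A function of strictly lower
  type satisfies \<open>\<Phi> t \<ge> t powr p * \<Phi> 1\<close> for \<open>t > 1\<close>, so its limit at \<open>\<infinity>\<close> is \<open>\<infinity>\<close>;
  this value is needed because maximal functions may be infinite.\<close>

definition orlicz_ext :: "(real \<Rightarrow> real) \<Rightarrow> ennreal \<Rightarrow> ennreal" where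
  "orlicz_ext \<Phi> u =
     (if u = 0 then 0 else if u = top then top else ennreal (\<Phi> (enn2real u)))"

definition orlicz_norm ::
  "(real \<Rightarrow> real) \<Rightarrow> (real^'n \<Rightarrow> real) \<Rightarrow> (real^'n \<Rightarrow> ennreal) \<Rightarrow> ennreal" where
  "orlicz_norm \<Phi> w g =
     Inf {ennreal c | c. 0 < c \<and>
            (\<integral>\<^sup>+x. orlicz_ext \<Phi> (g x / ennreal c) * ennreal (w x) \<partial>lebesgue) \<le> 1}"


subsection \<open>Test functions and distributions\<close>

text \<open>A multi-index is given as a list of coordinate directions, its order being the length of the
  list. For smooth functions partial derivatives commute, so lists with the same multiplicities
  give the same derivative.\<close>

fun pderivs :: "'n list \<Rightarrow> (real^'n \<Rightarrow> complex) \<Rightarrow> real^'n \<Rightarrow> complex" where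
  "pderivs [] \<phi> = \<phi>"
| "pderivs (i # is) \<phi> = (\<lambda>x. frechet_derivative (pderivs is \<phi>) (at x) (axis i 1))"

definition supp :: "(real^'n \<Rightarrow> complex) \<Rightarrow> (real^'n) set" where
  "supp \<phi> = closure (support_on UNIV \<phi>)"

text \<open>\<open>\<phi>\<close> is \<open>C\<^sup>\<infinity>\<close> iff all its iterated partial derivatives exist and are (totally)
  differentiable.\<close>

definition test_functions :: "(real^'n \<Rightarrow> complex) set" where
  "test_functions = {\<phi>. (\<forall>is. pderivs is \<phi> differentiable_on UNIV) \<and> compact (supp \<phi>)}"

definition test_functions_in :: "(real^'n) set \<Rightarrow> (real^'n \<Rightarrow> complex) set" where
  "test_functions_in K = {\<phi> \<in> test_functions. supp \<phi> \<subseteq> K}"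

text \<open>On \<^const>\<open>test_functions\<close> the supremum below is that of a bounded set.\<close>

definition CN_norm :: "nat \<Rightarrow> (real^'n \<Rightarrow> complex) \<Rightarrow> real" where
  "CN_norm N \<phi> = (SUP (is, x)\<in>{is. length is \<le> N} \<times> UNIV. cmod (pderivs is \<phi> x))"

definition test_topology_in :: "(real^'n) set \<Rightarrow> (real^'n \<Rightarrow> complex) topology" where
  "test_topology_in K = topology_generated_by
     {{\<eta> \<in> test_functions_in K. CN_norm N (\<lambda>x. \<eta> x - \<phi> x) < e} | \<phi> N e.
        \<phi> \<in> test_functions_in K \<and> 0 < e}"

text \<open>Convex balanced sets of functions, for the pointwise vector space structure.\<close>

definition convex_balanced :: "(real^'n \<Rightarrow> complex) set \<Rightarrow> bool" where
  "convex_balanced W \<longleftrightarrow>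
     (\<forall>\<phi>\<in>W. \<forall>\<eta>\<in>W. \<forall>u\<in>{0..1::real}. (\<lambda>x. (1 - u) *\<^sub>R \<phi> x + u *\<^sub>R \<eta> x) \<in> W) \<and>
     (\<forall>\<phi>\<in>W. \<forall>c::complex. cmod c \<le> 1 \<longrightarrow> (\<lambda>x. c * \<phi> x) \<in> W)"

text \<open>The inductive limit topology, as in Rudin, Functional Analysis, Definition 6.3: the local base
  at 0 consists of the convex balanced sets that meet every space of test functions supported in a
  fixed compact set in an open set.\<close>

definition test_topology :: "(real^'n \<Rightarrow> complex) topology" where
  "test_topology = topology_generated_by
     {(\<lambda>\<eta> x. \<phi> x + \<eta> x) ` W | \<phi> W.
        \<phi> \<in> test_functions \<and> W \<subseteq> test_functions \<and> convex_balanced W \<and>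
        (\<forall>K. compact K \<longrightarrow> openin (test_topology_in K) (test_functions_in K \<inter> W))}"

text \<open>A distribution is represented by a function on all of \<^typ>\<open>real^'n \<Rightarrow> complex\<close>, of which only
  the values at test functions matter.\<close>

definition distributions :: "((real^'n \<Rightarrow> complex) \<Rightarrow> complex) set" where
  "distributions = {f.
     (\<forall>\<phi>\<in>test_functions. \<forall>\<eta>\<in>test_functions. f (\<lambda>x. \<phi> x + \<eta> x) = f \<phi> + f \<eta>) \<and>
     (\<forall>\<phi>\<in>test_functions. \<forall>c. f (\<lambda>x. c * \<phi> x) = c * f \<phi>) \<and>
     continuous_map test_topology euclidean f}"

definition conv ::
  "(real^'n \<Rightarrow> complex) \<Rightarrow> ((real^'n \<Rightarrow> complex) \<Rightarrow> complex) \<Rightarrow> real^'n \<Rightarrow> complex" where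
  "conv \<psi> f x = f (\<lambda>y. \<psi> (x - y))"


subsection \<open>Maximal functions\<close>

definition dilate :: "real \<Rightarrow> (real^'n \<Rightarrow> complex) \<Rightarrow> real^'n \<Rightarrow> complex" where
  "dilate t \<psi> x = (1 / t ^ CARD('n)) *\<^sub>R \<psi> ((1 / t) *\<^sub>R x)"

definition dyadic :: "nat \<Rightarrow> (real^'n \<Rightarrow> complex) \<Rightarrow> real^'n \<Rightarrow> complex" where
  "dyadic j \<psi> x = 2 ^ (j * CARD('n)) * \<psi> (2 ^ j *\<^sub>R x)"

definition mfac :: "nat \<Rightarrow> real \<Rightarrow> real \<Rightarrow> real^'n \<Rightarrow> real" where
  "mfac j A B y = (1 + 2 ^ j * norm y) powr A * 2 powr (B * norm y)"

definition radial_max ::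
  "(real^'n \<Rightarrow> complex) \<Rightarrow> ((real^'n \<Rightarrow> complex) \<Rightarrow> complex) \<Rightarrow> real^'n \<Rightarrow> ennreal" where
  "radial_max \<psi> f x = (SUP j. ennreal (cmod (conv (dyadic j \<psi>) f x)))"

definition peetre ::
  "(real^'n \<Rightarrow> complex) \<Rightarrow> real \<Rightarrow> real \<Rightarrow> nat \<Rightarrow> ((real^'n \<Rightarrow> complex) \<Rightarrow> complex) \<Rightarrow>
     real^'n \<Rightarrow> ennreal" where
  "peetre \<psi> A B j f x =
     (SUP y. ennreal (cmod (conv (dyadic j \<psi>) f (x - y)) / mfac j A B y))"

definition peetre_max ::
  "(real^'n \<Rightarrow> complex) \<Rightarrow> real \<Rightarrow> real \<Rightarrow> ((real^'n \<Rightarrow> complex) \<Rightarrow> complex) \<Rightarrow>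
     real^'n \<Rightarrow> ennreal" where
  "peetre_max \<psi> A B f x = (SUP j. peetre \<psi> A B j f x)"

definition grand_class :: "nat \<Rightarrow> real \<Rightarrow> (real^'n \<Rightarrow> complex) set" where
  "grand_class N R = {\<psi> \<in> test_functions. supp \<psi> \<subseteq> ball 0 R \<and> CN_norm N \<psi> \<le> 1}"

definition grand_max ::
  "nat \<Rightarrow> real \<Rightarrow> ((real^'n \<Rightarrow> complex) \<Rightarrow> complex) \<Rightarrow> real^'n \<Rightarrow> ennreal" where
  "grand_max N R f x =
     Sup {ennreal (cmod (conv (dilate t \<psi>) f z)) | t z \<psi>.
            norm (x - z) < t \<and> t < 1 \<and> \<psi> \<in> grand_class N R}"


subsection \<open>The constants\<close>

text \<open>The operators are applied to \<open>[0,\<infinity>]\<close>-valued functions, which stand for \<open>\<bar>g\<bar>\<close>.\<close>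

definition local_maximal :: "(real^'n \<Rightarrow> ennreal) \<Rightarrow> real^'n \<Rightarrow> ennreal" where
  "local_maximal g x =
     (SUP Q\<in>{Q \<in> local_cubes. x \<in> Q}. (\<integral>\<^sup>+y\<in>Q. g y \<partial>lebesgue) / emeasure lebesgue Q)"

definition exp_kernel_op :: "real \<Rightarrow> (real^'n \<Rightarrow> ennreal) \<Rightarrow> real^'n \<Rightarrow> ennreal" where
  "exp_kernel_op B g x = (\<integral>\<^sup>+y. g y * ennreal (2 powr (- B * norm (x - y))) \<partial>lebesgue)"

text \<open>\<open>A0\<close> is an admissible constant for the compact set \<open>S\<close> if the pointwise estimate holds for
  all \<open>\<psi>\<close> with support \<open>S\<close>; this is how \<open>A0\<close> depends only on the support of \<open>\<psi>\<close>.\<close>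

definition admissible_A0 :: "(real^'n) set \<Rightarrow> real \<Rightarrow> bool" where
  "admissible_A0 S A0 \<longleftrightarrow> 0 < A0 \<and>
     (\<forall>\<psi>\<in>test_functions. supp \<psi> = S \<and> integral\<^sup>L lebesgue \<psi> \<noteq> 0 \<longrightarrow>
       (\<forall>r>0. \<forall>A > max A0 (real CARD('n) / r). \<forall>B\<ge>0. \<exists>C>0. \<forall>f\<in>distributions. \<forall>x j.
          epowr (peetre \<psi> A B j f x) r \<le>
          ennreal C *
            (\<Sum>\<^sub>\<infinity>k\<in>{j..}. ennreal (2 powr ((real j - real k) * (A * r - real CARD('n)))) *
               (local_maximal (\<lambda>z. ennreal (cmod (conv (dyadic k \<psi>) f z) powr r)) x +
                exp_kernel_op (B * r) (\<lambda>z. ennreal (cmod (conv (dyadic k \<psi>) f z) powr r)) x))))"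

definition Lp_norm :: "real \<Rightarrow> (real^'n \<Rightarrow> real) \<Rightarrow> (real^'n \<Rightarrow> ennreal) \<Rightarrow> ennreal" where
  "Lp_norm p w g = epowr (\<integral>\<^sup>+x. epowr (g x) p * ennreal (w x) \<partial>lebesgue) (1 / p)"

definition lq_norm :: "ennreal \<Rightarrow> (nat \<Rightarrow> ennreal) \<Rightarrow> ennreal" where
  "lq_norm q a =
     (if q = top then (SUP j. a j)
      else epowr (\<Sum>j. epowr (a j) (enn2real q)) (1 / enn2real q))"

definition admissible_B0 :: "(real^'n \<Rightarrow> real) \<Rightarrow> real \<Rightarrow> bool" where
  "admissible_B0 w B0 \<longleftrightarrow> 0 < B0 \<and>
     (\<forall>p>1. w \<in> Ap_loc p \<longrightarrow>
       (\<forall>q>1. \<forall>B \<ge> B0 / p. \<exists>C>0. \<forall>g :: nat \<Rightarrow> real^'n \<Rightarrow> complex.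
          (\<forall>j. g j \<in> borel_measurable lebesgue) \<longrightarrow>
          Lp_norm p w (\<lambda>x. lq_norm q (\<lambda>j. exp_kernel_op B (\<lambda>y. ennreal (cmod (g j y))) x)) \<le>
          ennreal C * Lp_norm p w (\<lambda>x. lq_norm q (\<lambda>j. ennreal (cmod (g j x))))))"

end

theory Submission
  imports Defs
begin

text \<open>
  Write \<open>g\<close> for the radial maximal function of \<open>f\<close>. The defining property of \<open>A\<^sub>0\<close> bounds the \<open>r\<close>-th
  power of the Peetre function at one dyadic level by a geometric series in the finer levels. Since
  every term of the series is controlled by \<open>g\<close>, summation gives the pointwise estimate
  \<open>peetre_max\<^sup>r \<le> C (M(g\<^sup>r) + K(g\<^sup>r))\<close>, where \<open>M\<close> is the local maximal operator and \<open>K\<close> the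
  exponential kernel operator (\<open>peetre_max_pointwise\<close>). The strict inequalities satisfied by \<open>A\<close> and
  \<open>B\<close> leave room for exponents \<open>v\<close> slightly below the critical lower type of \<open>\<Phi>\<close> and \<open>p > 1\<close>
  slightly above the critical index of the weight; with \<open>r = v / p\<close> the pointwise estimate applies,
  \<open>M\<close> and \<open>K\<close> are of weak type \<open>(p, p)\<close> for the weight and bounded on bounded functions, and
  \<open>r p = v\<close> is below a lower type of \<open>\<Phi>\<close>. The truncation argument of Marcinkiewicz then bounds the
  modular of \<open>peetre_max\<close> by that of \<open>g\<close> (\<open>orlicz_weak_type_interpolation\<close>), and the lower type turns
  the modular inequality into one for norms (\<open>orlicz_norm_le\<close>).

  A weight in the local \<open>A\<^sub>\<infinity>\<close> class lies in some local \<open>A\<^sub>p\<close> class (\<open>Ainf_imp_Ap\<close>), so the critical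
  index is an infimum over a nonempty set and \<open>p\<close> can indeed be chosen. Reading
  the \<open>A\<^sub>\<infinity>\<close> condition backwards, a subset of a cube that carries little weight has small measure, which
  forces the measure of the sublevel sets of the weight to decay geometrically. The weak type of \<open>M\<close>
  comes from Vitali's covering lemma and the doubling property (\<open>local_maximal_weak_type\<close>), that
  of \<open>K\<close> from the defining property of \<open>B\<^sub>0\<close>.

  For the grand maximal function, let \<open>S\<^sub>j\<close> be convolution with a fixed combination of the dilates
  of \<open>\<psi>\<^sub>0\<close> at the levels \<open>j, \<dots>, j + N - 1\<close>, normalised to have integral 1 and with the moments of
  orders \<open>1, \<dots>, N - 1\<close> equal to 0. Then \<open>S\<^sub>j \<phi> - \<phi>\<close> is of size \<open>2\<^sup>-\<^sup>j\<^sup>N\<close>, \<open>S\<^sub>j S\<^sub>j \<phi>\<close> converges to \<open>\<phi>\<close> in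
  the space of test functions, and, because the \<open>S\<^sub>j\<close> commute,
  \<open>S\<^sub>j\<^sub>+\<^sub>1 S\<^sub>j\<^sub>+\<^sub>1 \<phi> - S\<^sub>j S\<^sub>j \<phi> = (S\<^sub>j\<^sub>+\<^sub>1 + S\<^sub>j) (S\<^sub>j\<^sub>+\<^sub>1 - S\<^sub>j) \<phi>\<close>. Tested against \<open>f\<close>, the right-hand side is an
  integral of \<open>(\<psi>\<^sub>0)\<^sub>k * f\<close> against a kernel of size \<open>2\<^sup>-\<^sup>j\<^sup>N\<close>. For \<open>\<phi> = \<psi>\<^sub>t\<close> and \<open>2\<^sup>j t \<ge> 1\<close> the Peetre
  function loses a factor \<open>(2\<^sup>j t)\<^sup>A\<^sup>'\<close> and the kernel gains \<open>(2\<^sup>j t)\<^sup>-\<^sup>N\<close>, so the telescoping series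
  converges as soon as \<open>A' < N\<close> (\<open>grand_max_le_peetre_max\<close>). Since \<open>N > 2 A\<^sub>1\<close>, some \<open>A'\<close> lies strictly
  between \<open>A\<^sub>1\<close> and \<open>N\<close>, and the estimate for the Peetre maximal function with \<open>A'\<close> finishes the proof.
\<close>

section \<open>Local cubes and weights\<close>

lemma cube_measure:
  fixes a :: "real^'n"
  assumes "0 \<le> l"
  shows "measure lebesgue (cbox a (a + l *\<^sub>R One)) = l ^ CARD('n)"
    and "emeasure lebesgue (cbox a (a + l *\<^sub>R One)) = ennreal (l ^ CARD('n))"
proof -
  have le: "\<And>b. b \<in> Basis \<Longrightarrow> a \<bullet> b \<le> (a + l *\<^sub>R One) \<bullet> b"
    using assms by (simp add: inner_add_left)
  have "(\<Prod>b\<in>(Basis::(real^'n) set). ((a + l *\<^sub>R One) - a) \<bullet> b) = l ^ CARD('n)"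
    by (simp add: inner_add_left)
  then have "measure lborel (cbox a (a + l *\<^sub>R One)) = l ^ CARD('n)"
    by (subst measure_lborel_cbox_eq) (use le in auto)
  then show *: "measure lebesgue (cbox a (a + l *\<^sub>R One)) = l ^ CARD('n)"
    by simp
  have "emeasure lebesgue (cbox a (a + l *\<^sub>R One)) = ennreal (measure lebesgue (cbox a (a + l *\<^sub>R One)))"
    by (intro emeasure_eq_ennreal_measure) (simp add: emeasure_lborel_cbox_eq)
  then show "emeasure lebesgue (cbox a (a + l *\<^sub>R One)) = ennreal (l ^ CARD('n))"
    using * by simp
qed

lemma mem_cube_iff:
  fixes a :: "real^'n"
  shows "x \<in> cbox a (a + l *\<^sub>R One) \<longleftrightarrow> (\<forall>i. a $ i \<le> x $ i \<and> x $ i \<le> a $ i + l)"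
proof -
  have "(One::real^'n) $ i = 1" for i
    by (simp add: cart_eq_inner_axis axis_in_Basis_iff)
  then show ?thesis
    by (simp add: mem_box_cart)
qed

lemma weight_measurable:
  assumes "weight w"
  shows "w \<in> borel_measurable lebesgue"
proof (rule borel_measurable_LIMSEQ_real)
  show "(\<lambda>k. indicator (cball 0 (real k)) x *\<^sub>R w x) \<longlonglongrightarrow> w x" for x
  proof (rule tendsto_eventually)
    obtain m where "norm x \<le> real m"
      using real_arch_simple by blast
    then show "\<forall>\<^sub>F k in sequentially. indicator (cball 0 (real k)) x *\<^sub>R w x = w x"
      by (intro eventually_sequentiallyI[of m]) (auto simp: indicator_def)
  qed
  show "(\<lambda>x. indicator (cball 0 (real k)) x *\<^sub>R w x) \<in> borel_measurable lebesgue" for k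
    using assms unfolding weight_def locally_integrable_def set_integrable_def
    by (meson borel_measurable_integrable compact_cball)
qed

lemma wmeas_density:
  assumes "weight w" "E \<in> sets lebesgue"
  shows "wmeas w E = emeasure (density lebesgue (\<lambda>x. ennreal (w x))) E"
  using weight_measurable[OF assms(1)] assms(2) unfolding wmeas_def
  by (subst emeasure_density) auto

lemma wmeas_mono: "E \<subseteq> F \<Longrightarrow> wmeas w E \<le> wmeas w F"
  unfolding wmeas_def by (intro nn_integral_mono) (auto simp: indicator_def)

lemma wmeas_compact:
  assumes "weight w" "compact K"
  shows "wmeas w K < top"
proof -
  have "set_integrable lebesgue K w"
    using assms by (auto simp: weight_def locally_integrable_def)
  then have "(\<integral>\<^sup>+x. ennreal (norm (indicator K x *\<^sub>R w x)) \<partial>lebesgue) < \<infinity>"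
    unfolding set_integrable_def integrable_iff_bounded by blast
  moreover have "wmeas w K = (\<integral>\<^sup>+x. ennreal (norm (indicator K x *\<^sub>R w x)) \<partial>lebesgue)"
    using assms unfolding wmeas_def
    by (intro nn_integral_cong) (auto simp: indicator_def weight_def)
  ultimately show ?thesis by simp
qed

lemma local_cubesE:
  fixes Q :: "(real^'n) set"
  assumes "Q \<in> local_cubes"
  obtains a l where "Q = cbox a (a + l *\<^sub>R One)" "0 < l" "l \<le> 1"
proof -
  obtain a l where al: "Q = cbox a (a + l *\<^sub>R One)" "0 < l"
    using assms by (auto simp: local_cubes_def cubes_def)
  have "l ^ CARD('n) \<le> 1"
    using assms al cube_measure(1)[of l a] by (auto simp: local_cubes_def)
  then have "l \<le> 1"
    using al(2) by (metis linorder_not_le one_less_power zero_less_card_finite)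
  with al that show ?thesis by blast
qed

lemma local_cubesI:
  fixes a :: "real^'n"
  assumes "0 < l" "l \<le> 1"
  shows "cbox a (a + l *\<^sub>R One) \<in> local_cubes"
  using assms cube_measure(1)[of l a] by (auto simp: local_cubes_def cubes_def power_le_one)

text \<open>In extended arithmetic a finite quotient \<open>wmeas w Q / wmeas w F\<close> with vanishing denominator has
  vanishing numerator, so the supremum in the definition is equivalent to a product bound, which also
  makes sense when the weight vanishes almost everywhere on \<open>F\<close>.\<close>

lemma Ainf_comparison:
  fixes w :: "real^'n \<Rightarrow> real"
  assumes "w \<in> Ainf_loc" "0 < \<alpha>" "\<alpha> < 1"
  obtains C where "1 \<le> C"
    "\<And>Q F. Q \<in> local_cubes \<Longrightarrow> F \<in> sets lebesgue \<Longrightarrow> F \<subseteq> Q \<Longrightarrow>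
       \<alpha> * measure lebesgue Q \<le> measure lebesgue F \<Longrightarrow> wmeas w Q \<le> ennreal C * wmeas w F"
proof -
  let ?S = "SUP Q\<in>local_cubes.
           SUP F\<in>{F \<in> sets lebesgue. F \<subseteq> Q \<and> \<alpha> * measure lebesgue Q \<le> measure lebesgue F}.
             wmeas w Q / wmeas w F"
  have fin: "?S < top" and w: "weight w"
    using assms by (auto simp: Ainf_loc_def)
  define C where "C = max 1 (enn2real ?S)"
  show ?thesis
  proof
    show "1 \<le> C" by (simp add: C_def)
    fix Q F :: "(real^'n) set"
    assume Q: "Q \<in> local_cubes" and F: "F \<in> sets lebesgue" "F \<subseteq> Q"
      "\<alpha> * measure lebesgue Q \<le> measure lebesgue F"
    have "wmeas w Q / wmeas w F \<le> (SUP F\<in>{F \<in> sets lebesgue. F \<subseteq> Q \<and> \<alpha> * measure lebesgue Q \<le> measure lebesgue F}.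
             wmeas w Q / wmeas w F)"
      by (rule SUP_upper) (use F in auto)
    also have "\<dots> \<le> ?S"
      by (rule SUP_upper[OF Q])
    finally have 1: "wmeas w Q / wmeas w F \<le> ?S" .
    have "?S = ennreal (enn2real ?S)"
      using fin by simp
    also have "\<dots> \<le> ennreal C"
      by (intro ennreal_leI) (simp add: C_def)
    finally have "wmeas w Q / wmeas w F \<le> ennreal C"
      using 1 by order
    then have le: "wmeas w Q / wmeas w F * wmeas w F \<le> ennreal C * wmeas w F"
      by (rule mult_right_mono) auto
    obtain a l where al: "Q = cbox a (a + l *\<^sub>R One)" using local_cubesE[OF Q] by metis
    then have fQ: "wmeas w Q < top" using wmeas_compact[OF w] by auto
    have fF: "wmeas w F < top" using fQ wmeas_mono[OF F(2), of w] by order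
    show "wmeas w Q \<le> ennreal C * wmeas w F"
    proof (cases "wmeas w F = 0")
      case True
      then have "wmeas w Q = 0"
        using \<open>wmeas w Q / wmeas w F \<le> ennreal C\<close>
        by (metis ennreal_divide_zero ennreal_divide_eq_top_iff ennreal_neq_top neq_top_trans)
      then show ?thesis by simp
    next
      case False
      then have "wmeas w Q / wmeas w F * wmeas w F = wmeas w Q"
        using fF ennreal_mult_divide_eq[of "wmeas w F" "wmeas w Q"]
        by (simp add: ennreal_divide_times ennreal_times_divide mult.commute[of "wmeas w Q"])
      then show ?thesis using le by simp
    qed
  qed
qed

lemma wmeas_eq_integral:
  assumes "weight w" "compact K"
  shows "wmeas w K = ennreal (integral K w)" "w integrable_on K"
proof -
  have si: "set_integrable lebesgue K w"
    using assms by (auto simp: weight_def locally_integrable_def)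
  then have 1: "w integrable_on K" "(LINT x:K|lebesgue. w x) = integral K w"
    by (auto intro: set_lebesgue_integral_eq_integral)
  have "wmeas w K = (\<integral>\<^sup>+x. ennreal (indicator K x *\<^sub>R w x) \<partial>lebesgue)"
    using assms unfolding wmeas_def
    by (intro nn_integral_cong) (auto simp: indicator_def weight_def)
  also have "\<dots> = ennreal (LINT x:K|lebesgue. w x)"
    using si assms(1) unfolding set_integrable_def set_lebesgue_integral_def
    by (intro nn_integral_eq_integral) (auto simp: weight_def)
  finally show "wmeas w K = ennreal (integral K w)" using 1 by simp
  show "w integrable_on K" by fact
qed

text \<open>Lebesgue's differentiation theorem along the cubes whose lower corner is the given point. The
  one-sided form, with \<open>w x < \<beta>\<close> as hypothesis, is what stopping-time arguments consume.\<close>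

lemma weight_differentiation:
  fixes w :: "real^'n \<Rightarrow> real"
  assumes "weight w"
  obtains N where "negligible N"
    "\<And>x \<beta>. x \<notin> N \<Longrightarrow> w x < \<beta> \<Longrightarrow>
       \<exists>d>0. \<forall>h. 0 < h \<and> h < d \<longrightarrow> wmeas w (cbox x (x + h *\<^sub>R One)) < ennreal (\<beta> * h ^ CARD('n))"
proof -
  obtain N where N: "negligible N"
     "\<And>x e. \<lbrakk>x \<notin> N; 0 < e\<rbrakk> \<Longrightarrow>
        \<exists>d>0. \<forall>h. 0 < h \<and> h < d \<longrightarrow>
              norm(integral (cbox x (x + h *\<^sub>R One)) w /\<^sub>R h ^ DIM(real^'n) - w x) < e"
    using integrable_ccontinuous_explicit[of w] wmeas_eq_integral(2)[OF assms compact_cbox] by blast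
  show ?thesis
  proof
    show "negligible N" by fact
    fix x \<beta> assume x: "x \<notin> N" "w x < \<beta>"
    then obtain d where d: "d > 0" "\<And>h. 0 < h \<Longrightarrow> h < d \<Longrightarrow>
        norm(integral (cbox x (x + h *\<^sub>R One)) w /\<^sub>R h ^ DIM(real^'n) - w x) < \<beta> - w x"
      using N(2)[of x "\<beta> - w x"] by auto
    have "wmeas w (cbox x (x + h *\<^sub>R One)) < ennreal (\<beta> * h ^ CARD('n))" if h: "0 < h" "h < d" for h
    proof -
      let ?I = "integral (cbox x (x + h *\<^sub>R One)) w"
      have "?I /\<^sub>R h ^ CARD('n) < \<beta>"
        using d(2)[OF h] by auto
      then have "?I < \<beta> * h ^ CARD('n)"
        using h by (simp add: field_simps)
      moreover have "0 \<le> ?I"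
        using assms by (intro integral_nonneg wmeas_eq_integral(2)[OF assms]) (auto simp: weight_def)
      ultimately show ?thesis
        unfolding wmeas_eq_integral(1)[OF assms compact_cbox] by (simp add: ennreal_lessI)
    qed
    with d(1) show "\<exists>d>0. \<forall>h. 0 < h \<and> h < d \<longrightarrow> wmeas w (cbox x (x + h *\<^sub>R One)) < ennreal (\<beta> * h ^ CARD('n))"
      by blast
  qed
qed

text \<open>The cube of side \<open>t\<close> centred at \<open>x\<close>, pushed back into the cube with lower corner \<open>a\<close> and side \<open>l\<close>
  where it sticks out. These cubes increase with \<open>t\<close>, exhaust the big cube at \<open>t = l\<close> and never leave
  it, so a stopping-time argument in a local cube meets local cubes only.\<close>

definition clamped_cube :: "real^'n \<Rightarrow> real \<Rightarrow> real \<Rightarrow> real^'n \<Rightarrow> (real^'n) set" where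
  "clamped_cube a l t x =
     (let c = (\<chi> i. max (a $ i) (min (x $ i - t / 2) (a $ i + l - t))) in cbox c (c + t *\<^sub>R One))"

lemma mem_clamped_cube:
  "y \<in> clamped_cube a l t x \<longleftrightarrow> (\<forall>i. max (a $ i) (min (x $ i - t / 2) (a $ i + l - t)) \<le> y $ i \<and>
      y $ i \<le> max (a $ i) (min (x $ i - t / 2) (a $ i + l - t)) + t)"
  by (simp add: clamped_cube_def Let_def mem_cube_iff)

lemma clamped_cube_local:
  assumes "0 < t" "t \<le> 1"
  shows "clamped_cube a l t x \<in> local_cubes"
  unfolding clamped_cube_def Let_def by (rule local_cubesI[OF assms])

lemma clamped_cube_measure:
  fixes a :: "real^'n"
  assumes "0 < t"
  shows "measure lebesgue (clamped_cube a l t x) = t ^ CARD('n)"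
    "emeasure lebesgue (clamped_cube a l t x) = ennreal (t ^ CARD('n))"
  unfolding clamped_cube_def Let_def using assms by (intro cube_measure; simp)+

lemma clamped_cube_sets: "clamped_cube a l t x \<in> sets lebesgue" "compact (clamped_cube a l t x)"
  by (auto simp: clamped_cube_def Let_def)

lemma clamped_cube_subset:
  assumes "0 < t" "t \<le> l"
  shows "clamped_cube a l t x \<subseteq> cbox a (a + l *\<^sub>R One)"
proof
  fix y assume y: "y \<in> clamped_cube a l t x"
  show "y \<in> cbox a (a + l *\<^sub>R One)" unfolding mem_cube_iff
  proof (intro allI)
    fix i
    show "a $ i \<le> y $ i \<and> y $ i \<le> a $ i + l"
      using y[unfolded mem_clamped_cube, THEN spec[of _ i]] assms
      by (auto simp: max_def min_def split: if_splits)
  qed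
qed

lemma near_in_clamped_cube:
  assumes "0 < t" "t \<le> l" "x \<in> cbox a (a + l *\<^sub>R One)" "y \<in> cbox a (a + l *\<^sub>R One)"
    and "\<And>i. \<bar>y $ i - x $ i\<bar> \<le> t / 2"
  shows "y \<in> clamped_cube a l t x"
  unfolding mem_clamped_cube
proof (intro allI)
  fix i
  show "max (a $ i) (min (x $ i - t / 2) (a $ i + l - t)) \<le> y $ i \<and>
      y $ i \<le> max (a $ i) (min (x $ i - t / 2) (a $ i + l - t)) + t"
    using assms(3,4)[unfolded mem_cube_iff, THEN spec[of _ i]] assms(1,2)
      assms(5)[of i, THEN abs_le_D1] assms(5)[of i, THEN abs_le_D2]
    by (simp add: max_def min_def)
qed

lemma clamped_cube_near:
  assumes "0 < t" "t \<le> l" "x \<in> cbox a (a + l *\<^sub>R One)" "y \<in> clamped_cube a l t x"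
  shows "\<bar>y $ i - x $ i\<bar> \<le> t"
  using assms(3)[unfolded mem_cube_iff, THEN spec[of _ i]]
    assms(4)[unfolded mem_clamped_cube, THEN spec[of _ i]] assms(1,2)
  by (auto simp: max_def min_def split: if_splits)

lemma clamped_cube_mono:
  assumes "0 < t" "t \<le> t'" "t' \<le> l" "x \<in> cbox a (a + l *\<^sub>R One)"
  shows "clamped_cube a l t x \<subseteq> clamped_cube a l t' x"
proof
  fix y assume y: "y \<in> clamped_cube a l t x"
  show "y \<in> clamped_cube a l t' x" unfolding mem_clamped_cube
  proof (intro allI)
    fix i
    show "max (a $ i) (min (x $ i - t' / 2) (a $ i + l - t')) \<le> y $ i \<and>
      y $ i \<le> max (a $ i) (min (x $ i - t' / 2) (a $ i + l - t')) + t'"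
      using assms(4)[unfolded mem_cube_iff, THEN spec[of _ i]]
        y[unfolded mem_clamped_cube, THEN spec[of _ i]] assms(1-3)
      by (auto simp: max_def min_def split: if_splits)
  qed
qed

lemma clamped_cube_full:
  assumes "0 < l" "x \<in> cbox a (a + l *\<^sub>R One)"
  shows "clamped_cube a l l x = cbox a (a + l *\<^sub>R One)"
proof -
  have "max (a $ i) (min (x $ i - l / 2) (a $ i + l - l)) = a $ i" for i
    using assms by auto
  then show ?thesis unfolding clamped_cube_def Let_def by simp
qed

lemma clamped_cube_subset_cball:
  fixes a :: "real^'n" and t :: real
  assumes "0 < t" "t \<le> l" "x \<in> cbox a (a + l *\<^sub>R One)"
  shows "clamped_cube a l t x \<subseteq> cball x (CARD('n) * t)"
proof
  fix y assume y: "y \<in> clamped_cube a l t x"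
  have "dist x y \<le> (\<Sum>i\<in>UNIV. \<bar>(x - y) $ i\<bar>)"
    unfolding dist_norm by (rule norm_le_l1_cart)
  also have "\<dots> \<le> (\<Sum>i\<in>(UNIV::'n set). t)"
    by (intro sum_mono) (use clamped_cube_near[OF assms y] in \<open>simp add: abs_minus_commute\<close>)
  finally show "y \<in> cball x (CARD('n) * t)" by simp
qed

section \<open>Sublevel sets of local A-infinity weights\<close>

lemma emeasure_UN_le_count_space:
  assumes "countable I" and [measurable]: "\<And>i. i \<in> I \<Longrightarrow> X i \<in> sets M"
  shows "emeasure M (\<Union>i\<in>I. X i) \<le> (\<integral>\<^sup>+i. emeasure M (X i) \<partial>count_space I)"
proof -
  have [measurable]: "(\<Union>i\<in>I. X i) \<in> sets M"
    using assms by (intro sets.countable_UN'') auto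
  have "emeasure M (\<Union>i\<in>I. X i) = (\<integral>\<^sup>+x. indicator (\<Union>i\<in>I. X i) x \<partial>M)" by simp
  also have "\<dots> \<le> (\<integral>\<^sup>+x. (\<integral>\<^sup>+i. indicator (X i) x \<partial>count_space I) \<partial>M)"
  proof (intro nn_integral_mono)
    fix x
    show "indicator (\<Union>i\<in>I. X i) x \<le> (\<integral>\<^sup>+i. indicator (X i) x \<partial>count_space I)"
    proof (cases "x \<in> (\<Union>i\<in>I. X i)")
      case True
      then obtain i where "i \<in> I" "x \<in> X i" by blast
      then have "1 \<le> (\<integral>\<^sup>+i. indicator (X i) x \<partial>count_space I)"
        using nn_integral_ge_point[of i I "\<lambda>i. indicator (X i) x"] by simp
      with True show ?thesis by (simp only: indicator_simps)
    qed simp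
  qed
  also have "\<dots> = (\<integral>\<^sup>+i. (\<integral>\<^sup>+x. indicator (X i) x \<partial>M) \<partial>count_space I)"
    by (rule nn_integral_count_space_nn_integral) (use assms in auto)
  also have "\<dots> = (\<integral>\<^sup>+i. emeasure M (X i) \<partial>count_space I)"
    by (intro nn_integral_cong) (use assms in auto)
  finally show ?thesis .
qed

text \<open>By the differentiation theorem almost every point \<open>x\<close> of \<open>Q\<close> with \<open>w x < \<beta>\<close> lies in clamped cubes
  over which \<open>w\<close> has average below a fixed multiple of \<open>\<beta>\<close>. The largest such cube of side
  \<open>l / 2\<^sup>m\<close> has average comparable to \<open>\<beta>\<close> from both sides, because halving the side costs only a
  constant. Vitali's lemma selects disjoint stopping cubes whose enlargements cover the sublevel
  set. In an enlargement, the part where \<open>w < b \<beta>\<close> carries so little weight that, by the \<open>A\<^sub>\<infinity>\<close>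
  condition, it has tiny measure; in the stopping cube itself, \<open>w\<close> is at most twice its average on half
  of the cube by Chebyshev's inequality. Comparing the two and summing yields the claim.\<close>

lemma Ainf_sublevel_halving:
  fixes w :: "real^'n \<Rightarrow> real"
  assumes w: "w \<in> Ainf_loc"
  obtains b where "0 < b" "b < 1"
    "\<And>Q \<gamma>. Q \<in> local_cubes \<Longrightarrow> 0 < \<gamma> \<Longrightarrow> ennreal \<gamma> * emeasure lebesgue Q \<le> 2 * wmeas w Q \<Longrightarrow>
       2 * emeasure lebesgue {x\<in>Q. w x < b * \<gamma>} \<le> emeasure lebesgue {x\<in>Q. w x < \<gamma>}"
proof -
  let ?n = "CARD('n)"
  have wt: "weight w" using w by (simp add: Ainf_loc_def)
  have meas[measurable]: "w \<in> borel_measurable lebesgue" by (rule weight_measurable[OF wt])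
  obtain k where k: "10 * real ?n \<le> 2 ^ k"
    using real_arch_pow[of 2 "10 * real ?n"] by (auto intro: less_imp_le)
  have half: "(1/2::real) ^ ?n < 1" "0 < (1/2::real) ^ ?n"
    by (simp_all add: power_less_one_iff)
  obtain K where K: "1 \<le> K" "\<And>Q F. Q \<in> local_cubes \<Longrightarrow> F \<in> sets lebesgue \<Longrightarrow> F \<subseteq> Q \<Longrightarrow>
       (1/2) ^ ?n * measure lebesgue Q \<le> measure lebesgue F \<Longrightarrow> wmeas w Q \<le> ennreal K * wmeas w F"
    using Ainf_comparison[OF w half(2,1)] by metis
  \<comment> \<open>Small enough to outweigh the factor \<open>2\<^sup>k\<^sup>n\<close> lost by enlarging a stopping cube and the factor 2
    lost by Chebyshev's inequality, and to gain the factor 2 of the claim.\<close>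
  define \<alpha> :: real where "\<alpha> = 1 / (4 * 2 ^ (k * ?n))"
  have \<alpha>: "0 < \<alpha>" "\<alpha> < 1" "\<alpha> * 2 ^ (k * ?n) = 1/4"
  proof -
    have "(1::real) \<le> 2 ^ (k * ?n)" by simp
    then have "1 < 4 * (2::real) ^ (k * ?n)" by linarith
    then show "\<alpha> < 1" by (simp add: \<alpha>_def)
  qed (auto simp: \<alpha>_def)
  obtain C where C: "1 \<le> C" "\<And>Q F. Q \<in> local_cubes \<Longrightarrow> F \<in> sets lebesgue \<Longrightarrow> F \<subseteq> Q \<Longrightarrow>
       \<alpha> * measure lebesgue Q \<le> measure lebesgue F \<Longrightarrow> wmeas w Q \<le> ennreal C * wmeas w F"
    using Ainf_comparison[OF w \<alpha>(1,2)] by metis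
  \<comment> \<open>Makes the weight of \<open>w < b \<beta>\<close> inside an enlarged cube at most \<open>1 / (2 C)\<close> of the weight of the cube.\<close>
  define b where "b = 1 / (2 * C * 2 ^ (k * ?n))"
  have b: "0 < b" "b \<le> 1/2"
  proof -
    have "1 * 1 \<le> C * 2 ^ (k * ?n)" by (intro mult_mono) (use C(1) in auto)
    then show "b \<le> 1/2" using C(1) by (simp add: b_def field_simps)
    show "0 < b" using C(1) by (simp add: b_def)
  qed
  have bC: "C * (b * 2 ^ (k * ?n)) = 1/2" using C(1) by (simp add: b_def)
  obtain N where N: "negligible N"
    "\<And>x \<beta>. x \<notin> N \<Longrightarrow> w x < \<beta> \<Longrightarrow>
       \<exists>d>0. \<forall>h. 0 < h \<and> h < d \<longrightarrow> wmeas w (cbox x (x + h *\<^sub>R One)) < ennreal (\<beta> * h ^ ?n)"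
    using weight_differentiation[OF wt] by metis
  have main: "2 * emeasure lebesgue {x\<in>Q. w x < b * \<beta>} \<le> emeasure lebesgue {x\<in>Q. w x < 2 * K * \<beta>}"
    if Q: "Q \<in> local_cubes" and \<beta>: "0 < \<beta>" and le: "ennreal (K * \<beta>) * emeasure lebesgue Q \<le> wmeas w Q"
    for Q \<beta>
  proof -
    obtain a l where Qe: "Q = cbox a (a + l *\<^sub>R One)" and l: "0 < l" "l \<le> 1"
      using local_cubesE[OF Q] by metis
    define t where "t m = l / 2 ^ m" for m :: nat
    have t: "0 < t m" "t m \<le> l" "t m \<le> 1" "t 0 = l" "t (Suc m) = t m / 2" for m
    proof -
      show "t m \<le> l" using l by (simp add: t_def field_simps)
      then show "t m \<le> 1" using l by linarith
    qed (use l in \<open>auto simp: t_def\<close>)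
    define P where "P m x = clamped_cube a l (t m) x" for m x
    have Ploc: "P m x \<in> local_cubes" for m x unfolding P_def by (rule clamped_cube_local) (use t in auto)
    have Pmeas: "measure lebesgue (P m x) = t m ^ ?n" "emeasure lebesgue (P m x) = ennreal (t m ^ ?n)" for m x
      unfolding P_def by (intro clamped_cube_measure t)+
    have Psets[measurable]: "P m x \<in> sets lebesgue" for m x unfolding P_def by (rule clamped_cube_sets)
    have Pfin: "wmeas w (P m x) < top" for m x
      unfolding P_def by (intro wmeas_compact wt clamped_cube_sets)
    have PQ: "P m x \<subseteq> Q" for m x unfolding P_def Qe by (rule clamped_cube_subset) (use t in auto)
    have P0: "P 0 x = Q" if "x \<in> Q" for x
      unfolding P_def t(4) Qe by (rule clamped_cube_full) (use l that Qe in auto)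
    have Pmono: "P m x \<subseteq> P m' x" if "m' \<le> m" "x \<in> Q" for m m' x
      unfolding P_def
    proof (rule clamped_cube_mono)
      show "t m \<le> t m'" using that(1) l by (auto simp: t_def intro!: divide_left_mono power_increasing)
    qed (use t that Qe in auto)
    define E where "E \<gamma> = {x\<in>Q. w x < \<gamma>}" for \<gamma>
    have Esets[measurable]: "E \<gamma> \<in> sets lebesgue" for \<gamma>
    proof -
      have "E \<gamma> = Q \<inter> (w -` {..<\<gamma>} \<inter> space lebesgue)" by (auto simp: E_def)
      moreover have "w -` {..<\<gamma>} \<inter> space lebesgue \<in> sets lebesgue" by (rule measurable_sets[OF meas]) simp
      moreover have "Q \<in> sets lebesgue" by (simp add: Qe)
      ultimately show ?thesis by (metis sets.Int)
    qed
    define N' where "N' = N \<union> frontier Q"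
    have N'0: "negligible N'" unfolding N'_def Qe
      by (intro negligible_Un N(1) negligible_convex_frontier) auto
    have N': "N' \<in> null_sets lebesgue" using N'0 by (simp add: negligible_iff_null_sets)
    have small: "\<exists>m. wmeas w (P m x) < ennreal (K * \<beta> * t m ^ ?n)" if x: "x \<in> E \<beta>" "x \<notin> N'" for x
    proof -
      have xQ: "x \<in> Q" "w x < \<beta>" using x by (auto simp: E_def)
      then have "x \<in> interior Q" using x(2) by (auto simp: N'_def frontier_def Qe)
      then obtain e where e: "e > 0" "ball x e \<subseteq> Q" by (meson mem_interior)
      obtain d where d: "d > 0" "\<And>h. 0 < h \<Longrightarrow> h < d \<Longrightarrow> wmeas w (cbox x (x + h *\<^sub>R One)) < ennreal (\<beta> * h ^ ?n)"
        using N(2)[of x \<beta>] x(2) xQ(2) by (auto simp: N'_def)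
      have "(\<lambda>m. t m) \<longlonglongrightarrow> 0"
        unfolding t_def using LIMSEQ_divide_realpow_zero[of 2 l] by simp
      then have "\<forall>\<^sub>F m in sequentially. t m < min d (e / real ?n)"
        using d(1) e(1) by (intro order_tendstoD(2)) auto
      then obtain m where m: "t m < d" "t m < e / real ?n"
        by (auto simp: eventually_sequentially)
      let ?h = "t m / 2"
      let ?D = "cbox x (x + ?h *\<^sub>R One)"
      have h: "0 < ?h" "?h < d" using t(1)[of m] m by auto
      have "?D \<subseteq> P m x"
      proof
        fix y assume y: "y \<in> ?D"
        have yi: "\<bar>y $ i - x $ i\<bar> \<le> ?h" for i
          using y[unfolded mem_cube_iff, THEN spec[of _ i]] by auto
        have "dist x y \<le> (\<Sum>i\<in>UNIV. \<bar>(x - y) $ i\<bar>)"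
          unfolding dist_norm by (rule norm_le_l1_cart)
        also have "\<dots> \<le> (\<Sum>i\<in>(UNIV::'n set). t m)"
        proof (intro sum_mono)
          show "\<bar>(x - y) $ i\<bar> \<le> t m" for i using yi[of i] t(1)[of m] by (simp add: abs_minus_commute)
        qed
        also have "\<dots> < e" using m(2) by (simp add: field_simps)
        finally have "y \<in> Q" using e(2) by auto
        then show "y \<in> P m x"
          unfolding P_def using yi xQ(1) unfolding Qe by (intro near_in_clamped_cube t(1,2)) blast+
      qed
      moreover have "(1/2) ^ ?n * measure lebesgue (P m x) \<le> measure lebesgue ?D"
        using h(1) unfolding Pmeas by (subst cube_measure) (auto simp: power_divide)
      ultimately have "wmeas w (P m x) \<le> ennreal K * wmeas w ?D"
        by (intro K(2) Ploc) auto
      also have "\<dots> < ennreal K * ennreal (\<beta> * ?h ^ ?n)"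
        using K(1) d(2)[OF h] by (intro ennreal_mult_strict_left_mono) auto
      also have "\<dots> \<le> ennreal (K * \<beta> * t m ^ ?n)"
      proof -
        have "?h ^ ?n \<le> t m ^ ?n" using t(1)[of m] by (intro power_mono) auto
        then have "K * (\<beta> * ?h ^ ?n) \<le> K * \<beta> * t m ^ ?n"
          using K(1) \<beta> by (simp add: mult_left_mono)
        then show ?thesis using K(1) \<beta> t(1)[of m] by (simp flip: ennreal_mult)
      qed
      finally show ?thesis by blast
    qed
    define S where "S = E \<beta> - N'"
    define m where "m x = (LEAST m. wmeas w (P m x) < ennreal (K * \<beta> * t m ^ ?n))" for x
    have SQ: "x \<in> Q" if "x \<in> S" for x using that by (auto simp: S_def E_def)
    have mlow: "wmeas w (P (m x) x) < ennreal (K * \<beta> * t (m x) ^ ?n)" if "x \<in> S" for x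
      unfolding m_def by (rule LeastI_ex[OF small]) (use that in \<open>auto simp: S_def\<close>)
    have mup: "ennreal (\<beta> * t (m x) ^ ?n) \<le> wmeas w (P (m x) x)" if x: "x \<in> S" for x
    proof -
      have "m x \<noteq> 0"
      proof
        assume "m x = 0"
        then have "wmeas w Q < ennreal (K * \<beta> * l ^ ?n)" using mlow[OF x] P0[OF SQ[OF x]] t(4) by simp
        also have "\<dots> = ennreal (K * \<beta>) * emeasure lebesgue Q"
          unfolding Qe using K(1) \<beta> l by (subst cube_measure(2)) (auto simp: ennreal_mult)
        finally show False using le by simp
      qed
      then obtain j where j: "m x = Suc j" by (cases "m x") auto
      then have "\<not> wmeas w (P j x) < ennreal (K * \<beta> * t j ^ ?n)"
        using not_less_Least[of j] by (metis lessI m_def)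
      then have "ennreal (K * \<beta> * t j ^ ?n) \<le> wmeas w (P j x)" by simp
      also have "\<dots> \<le> ennreal K * wmeas w (P (m x) x)"
      proof (intro K(2) Ploc Psets)
        show "P (m x) x \<subseteq> P j x" using Pmono[OF _ SQ[OF x]] j by auto
        show "(1/2) ^ ?n * measure lebesgue (P j x) \<le> measure lebesgue (P (m x) x)"
          unfolding Pmeas j t(5) by (simp add: power_divide)
      qed
      finally have "ennreal K * ennreal (\<beta> * t j ^ ?n) \<le> ennreal K * wmeas w (P (m x) x)"
        using K(1) \<beta> t(1)[of j] by (simp add: ennreal_mult'' ennreal_mult' mult.assoc)
      then have "ennreal (\<beta> * t j ^ ?n) \<le> wmeas w (P (m x) x)"
        using K(1) by (subst (asm) ennreal_mult_le_mult_iff) auto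
      moreover have "\<beta> * t (m x) ^ ?n \<le> \<beta> * t j ^ ?n"
        unfolding j t(5) using t(1)[of j] \<beta> by (intro mult_left_mono power_mono) auto
      ultimately show ?thesis by (meson ennreal_leI order_trans)
    qed
    have "S \<subseteq> (\<Union>x\<in>S. cball x (real ?n * t (m x)))"
    proof
      fix x assume "x \<in> S"
      moreover have "x \<in> cball x (real ?n * t (m x))" using t(1)[of "m x"] by simp
      ultimately show "x \<in> (\<Union>x\<in>S. cball x (real ?n * t (m x)))" by blast
    qed
    then obtain D where D: "countable D" "D \<subseteq> S"
      "pairwise (\<lambda>i j. disjnt (cball i (real ?n * t (m i))) (cball j (real ?n * t (m j)))) D"
      "S \<subseteq> (\<Union>i\<in>D. cball i (5 * (real ?n * t (m i))))"
    proof (rule Vitali_covering_lemma_cballs[where a="\<lambda>x. x" and r="\<lambda>x. real ?n * t (m x)" and B="real ?n"])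
      show "0 < real ?n * t (m i) \<and> real ?n * t (m i) \<le> real ?n" for i
        using t(1,3)[of "m i"] by simp
    qed blast
    \<comment> \<open>The enlarged cube. Truncated subtraction makes it all of \<open>Q\<close> when the stopping cube is large.\<close>
    define R where "R x = P (m x - k) x" for x
    have cover: "cball x (5 * (real ?n * t (m x))) \<inter> Q \<subseteq> R x" if x: "x \<in> S" for x
    proof
      fix y assume y: "y \<in> cball x (5 * (real ?n * t (m x))) \<inter> Q"
      show "y \<in> R x"
      proof (cases "m x \<le> k")
        case True
        then show ?thesis using y P0[OF SQ[OF x]] by (simp add: R_def)
      next
        case False
        have "t (m x - k) = t (m x) * 2 ^ k"
          using False unfolding t_def by (simp add: field_simps flip: power_add)
        then have "10 * real ?n * t (m x) \<le> t (m x - k)"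
          using k t(1)[of "m x"] by (simp add: mult.commute mult_left_mono)
        moreover have "\<bar>y $ i - x $ i\<bar> \<le> 5 * (real ?n * t (m x))" for i
        proof -
          have "\<bar>(y - x) $ i\<bar> \<le> norm (y - x)" by (rule component_le_norm_cart)
          also have "\<dots> \<le> 5 * (real ?n * t (m x))" using y by (simp add: dist_norm norm_minus_commute)
          finally show ?thesis by simp
        qed
        ultimately have "\<bar>y $ i - x $ i\<bar> \<le> t (m x - k) / 2" for i
          using order_trans[of "\<bar>y $ i - x $ i\<bar>" "5 * (real ?n * t (m x))" "t (m x - k) / 2"] by simp
        then show ?thesis
          unfolding R_def P_def using SQ[OF x] y unfolding Qe
          by (intro near_in_clamped_cube t(1,2)) blast+
      qed
    qed
    have Rsize: "measure lebesgue (R x) \<le> 2 ^ (k * ?n) * t (m x) ^ ?n" for x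
    proof -
      have "t (m x - k) \<le> 2 ^ k * t (m x)"
        using l unfolding t_def
        by (cases "m x \<le> k") (auto simp: field_simps simp flip: power_add intro!: mult_left_mono power_increasing)
      then have "t (m x - k) ^ ?n \<le> (2 ^ k * t (m x)) ^ ?n"
        using t(1)[of "m x - k"] by (intro power_mono) auto
      then show ?thesis unfolding R_def Pmeas by (simp add: power_mult_distrib power_mult)
    qed
    have Rsmall: "emeasure lebesgue (R x \<inter> E (b * \<beta>)) \<le> ennreal (t (m x) ^ ?n / 4)" if x: "x \<in> S" for x
    proof -
      let ?F = "R x \<inter> E (b * \<beta>)"
      have Rm[measurable]: "R x \<in> sets lebesgue" by (simp add: R_def)
      have eF: "emeasure lebesgue ?F = ennreal (measure lebesgue ?F)"
      proof (rule emeasure_eq_ennreal_measure)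
        have "emeasure lebesgue ?F \<le> emeasure lebesgue (R x)" by (rule emeasure_mono) auto
        then show "emeasure lebesgue ?F \<noteq> top" unfolding R_def Pmeas by (auto simp: top_unique)
      qed
      have PR: "P (m x) x \<subseteq> R x" unfolding R_def using SQ[OF x] by (intro Pmono) auto
      have "\<not> \<alpha> * measure lebesgue (R x) \<le> measure lebesgue ?F"
      proof
        assume "\<alpha> * measure lebesgue (R x) \<le> measure lebesgue ?F"
        then have 1: "wmeas w (R x) \<le> ennreal C * wmeas w ?F"
          by (intro C(2)) (auto simp: R_def Ploc)
        have "wmeas w ?F \<le> (\<integral>\<^sup>+y. ennreal (b * \<beta>) * indicator ?F y \<partial>lebesgue)"
          unfolding wmeas_def by (intro nn_integral_mono) (auto simp: indicator_def E_def intro!: ennreal_leI)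
        also have "\<dots> = ennreal (b * \<beta>) * emeasure lebesgue ?F"
          by (rule nn_integral_cmult_indicator) auto
        also have "\<dots> \<le> ennreal (b * \<beta>) * ennreal (2 ^ (k * ?n) * t (m x) ^ ?n)"
        proof (rule mult_left_mono)
          have "emeasure lebesgue ?F \<le> emeasure lebesgue (R x)" by (rule emeasure_mono) auto
          also have "\<dots> = ennreal (measure lebesgue (R x))" unfolding R_def Pmeas ..
          also have "\<dots> \<le> ennreal (2 ^ (k * ?n) * t (m x) ^ ?n)" using Rsize by (rule ennreal_leI)
          finally show "emeasure lebesgue ?F \<le> ennreal (2 ^ (k * ?n) * t (m x) ^ ?n)" .
        qed auto
        finally have "ennreal C * wmeas w ?F \<le> ennreal C * (ennreal (b * \<beta>) * ennreal (2 ^ (k * ?n) * t (m x) ^ ?n))"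
          by (rule mult_left_mono) simp
        also have "\<dots> = ennreal (C * ((b * \<beta>) * (2 ^ (k * ?n) * t (m x) ^ ?n)))"
          using C(1) b(1) \<beta> t(1)[of "m x"] by (simp add: ennreal_mult)
        also have "C * ((b * \<beta>) * (2 ^ (k * ?n) * t (m x) ^ ?n)) = (C * (b * 2 ^ (k * ?n))) * (\<beta> * t (m x) ^ ?n)"
          by (simp only: mult_ac)
        also have "\<dots> = 1/2 * (\<beta> * t (m x) ^ ?n)" unfolding bC ..
        finally have "wmeas w (R x) \<le> ennreal (1/2 * (\<beta> * t (m x) ^ ?n))"
          using 1 by (rule order_trans[rotated])
        moreover have "ennreal (\<beta> * t (m x) ^ ?n) \<le> wmeas w (R x)"
          using mup[OF x] wmeas_mono[OF PR, of w] by order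
        ultimately have "ennreal (\<beta> * t (m x) ^ ?n) \<le> ennreal (1/2 * (\<beta> * t (m x) ^ ?n))" by order
        then show False using \<beta> t(1)[of "m x"] by (simp add: ennreal_le_iff)
      qed
      then have "measure lebesgue ?F \<le> \<alpha> * measure lebesgue (R x)" by simp
      also have "\<dots> \<le> \<alpha> * (2 ^ (k * ?n) * t (m x) ^ ?n)"
        using Rsize \<alpha>(1) by (intro mult_left_mono) auto
      also have "\<dots> = (\<alpha> * 2 ^ (k * ?n)) * t (m x) ^ ?n" by (simp only: mult.assoc)
      also have "\<dots> = t (m x) ^ ?n / 4" unfolding \<alpha>(3) by simp
      finally show ?thesis unfolding eF by (rule ennreal_leI)
    qed
    have Plarge: "ennreal (t (m x) ^ ?n / 2) \<le> emeasure lebesgue (P (m x) x \<inter> E (2 * K * \<beta>))" if x: "x \<in> S" for x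
    proof -
      let ?P = "P (m x) x" and ?G = "P (m x) x - E (2 * K * \<beta>)"
      have "ennreal (2 * K * \<beta>) * emeasure lebesgue ?G = (\<integral>\<^sup>+y. ennreal (2 * K * \<beta>) * indicator ?G y \<partial>lebesgue)"
        by (rule nn_integral_cmult_indicator[symmetric]) auto
      also have "\<dots> \<le> wmeas w ?P"
        unfolding wmeas_def using PQ[of "m x" x]
        by (intro nn_integral_mono) (auto simp: indicator_def E_def intro!: ennreal_leI)
      also have "\<dots> \<le> ennreal (K * \<beta> * t (m x) ^ ?n)" using mlow[OF x] by simp
      also have "\<dots> = ennreal (2 * K * \<beta>) * ennreal (t (m x) ^ ?n / 2)"
        using K(1) \<beta> t(1)[of "m x"] by (simp flip: ennreal_mult)
      finally have G: "emeasure lebesgue ?G \<le> ennreal (t (m x) ^ ?n / 2)"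
        using K(1) \<beta> by (subst (asm) ennreal_mult_le_mult_iff) auto
      have "ennreal (t (m x) ^ ?n / 2) + ennreal (t (m x) ^ ?n / 2) = emeasure lebesgue ?P"
        unfolding Pmeas using t(1)[of "m x"] by (simp flip: ennreal_plus)
      also have "\<dots> = emeasure lebesgue ((?P \<inter> E (2 * K * \<beta>)) \<union> ?G)" by (rule arg_cong[where f="emeasure lebesgue"]) auto
      also have "\<dots> \<le> emeasure lebesgue (?P \<inter> E (2 * K * \<beta>)) + emeasure lebesgue ?G"
        by (rule emeasure_subadditive) auto
      also have "\<dots> \<le> emeasure lebesgue (?P \<inter> E (2 * K * \<beta>)) + ennreal (t (m x) ^ ?n / 2)"
        using G by (rule add_left_mono)
      finally show ?thesis by (simp add: ennreal_add_left_cancel_le add.commute)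
    qed
    have disj: "disjoint_family_on (\<lambda>x. P (m x) x \<inter> E (2 * K * \<beta>)) D"
      unfolding disjoint_family_on_def
    proof (intro ballI impI)
      fix x y assume xy: "x \<in> D" "y \<in> D" "x \<noteq> y"
      have "P (m x) x \<subseteq> cball x (real ?n * t (m x))" if "x \<in> D" for x
        unfolding P_def using t(1,2) SQ D(2) that
        by (intro clamped_cube_subset_cball) (auto simp flip: Qe)
      then show "(P (m x) x \<inter> E (2 * K * \<beta>)) \<inter> (P (m y) y \<inter> E (2 * K * \<beta>)) = {}"
        using pairwiseD[OF D(3) xy] xy(1,2) unfolding disjnt_def by blast
    qed
    have "E (b * \<beta>) - N' \<subseteq> (\<Union>x\<in>D. R x \<inter> E (b * \<beta>))"
    proof
      fix y assume y: "y \<in> E (b * \<beta>) - N'"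
      have "b * \<beta> \<le> \<beta>" using b \<beta> by simp
      then have "y \<in> S" using y by (auto simp: S_def E_def)
      then obtain x where "x \<in> D" "y \<in> cball x (5 * (real ?n * t (m x)))"
        using subsetD[OF D(4)] by (meson UN_E)
      moreover have "x \<in> S" "y \<in> Q" using D(2) \<open>x \<in> D\<close> y by (auto simp: E_def)
      ultimately have "y \<in> R x" using cover[of x] by blast
      then show "y \<in> (\<Union>x\<in>D. R x \<inter> E (b * \<beta>))" using \<open>x \<in> D\<close> y by blast
    qed
    then have "emeasure lebesgue (E (b * \<beta>) - N') \<le> emeasure lebesgue (\<Union>x\<in>D. R x \<inter> E (b * \<beta>))"
      by (intro emeasure_mono sets.countable_UN'' D(1)) (auto simp: R_def)
    also have "\<dots> \<le> (\<integral>\<^sup>+x. emeasure lebesgue (R x \<inter> E (b * \<beta>)) \<partial>count_space D)"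
      by (intro emeasure_UN_le_count_space) (use D(1) in \<open>auto simp: R_def\<close>)
    also have "\<dots> \<le> (\<integral>\<^sup>+x. ennreal (t (m x) ^ ?n / 4) \<partial>count_space D)"
      using Rsmall D(2) by (intro nn_integral_mono) auto
    finally have 1: "emeasure lebesgue (E (b * \<beta>)) \<le> (\<integral>\<^sup>+x. ennreal (t (m x) ^ ?n / 4) \<partial>count_space D)"
      using emeasure_Diff_null_set[OF N' Esets, of "b * \<beta>"] by simp
    have "2 * (\<integral>\<^sup>+x. ennreal (t (m x) ^ ?n / 4) \<partial>count_space D) = (\<integral>\<^sup>+x. ennreal (t (m x) ^ ?n / 2) \<partial>count_space D)"
    proof (subst nn_integral_cmult[symmetric])
      have "2 * ennreal (t (m x) ^ ?n / 4) = ennreal (t (m x) ^ ?n / 2)" for x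
        using t(1)[of "m x"] ennreal_mult[of 2 "t (m x) ^ ?n / 4"] by (simp add: less_imp_le)
      then show "(\<integral>\<^sup>+x. 2 * ennreal (t (m x) ^ ?n / 4) \<partial>count_space D) = (\<integral>\<^sup>+x. ennreal (t (m x) ^ ?n / 2) \<partial>count_space D)"
        by simp
    qed simp
    also have "\<dots> \<le> (\<integral>\<^sup>+x. emeasure lebesgue (P (m x) x \<inter> E (2 * K * \<beta>)) \<partial>count_space D)"
      using Plarge D(2) by (intro nn_integral_mono) auto
    also have "\<dots> = emeasure lebesgue (\<Union>x\<in>D. P (m x) x \<inter> E (2 * K * \<beta>))"
      by (rule emeasure_UN_countable[symmetric]) (use disj D(1) in auto)
    also have "\<dots> \<le> emeasure lebesgue (E (2 * K * \<beta>))"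
      by (rule emeasure_mono) auto
    finally have 2: "2 * (\<integral>\<^sup>+x. ennreal (t (m x) ^ ?n / 4) \<partial>count_space D) \<le> emeasure lebesgue (E (2 * K * \<beta>))" .
    have "2 * emeasure lebesgue (E (b * \<beta>)) \<le> 2 * (\<integral>\<^sup>+x. ennreal (t (m x) ^ ?n / 4) \<partial>count_space D)"
      by (rule mult_left_mono[OF 1]) simp
    then show ?thesis using 2 unfolding E_def by (rule order_trans)
  qed
  show ?thesis
  proof
    show "0 < b / (2 * K)" "b / (2 * K) < 1" using b K(1) by (auto simp: field_simps)
    fix Q :: "(real^'n) set" and \<gamma> :: real
    assume Q: "Q \<in> local_cubes" and \<gamma>: "0 < \<gamma>" "ennreal \<gamma> * emeasure lebesgue Q \<le> 2 * wmeas w Q"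
    have "2 * (ennreal (\<gamma> / 2) * emeasure lebesgue Q) = ennreal \<gamma> * emeasure lebesgue Q"
      using \<gamma>(1) ennreal_mult[of 2 "\<gamma> / 2"] by (simp add: mult.assoc[symmetric])
    then have "2 * (ennreal (\<gamma> / 2) * emeasure lebesgue Q) \<le> 2 * wmeas w Q" using \<gamma>(2) by simp
    then have "ennreal (\<gamma> / 2) * emeasure lebesgue Q \<le> wmeas w Q"
      by (subst (asm) ennreal_mult_le_mult_iff) auto
    then have "2 * emeasure lebesgue {x\<in>Q. w x < b * (\<gamma> / (2 * K))} \<le> emeasure lebesgue {x\<in>Q. w x < 2 * K * (\<gamma> / (2 * K))}"
      using K(1) \<gamma>(1) by (intro main Q) auto
    then show "2 * emeasure lebesgue {x\<in>Q. w x < b / (2 * K) * \<gamma>} \<le> emeasure lebesgue {x\<in>Q. w x < \<gamma>}"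
      using K(1) by simp
  qed
qed

section \<open>Every local A-infinity weight is a local A-p weight\<close>

lemma epowr_ennreal: "0 \<le> x \<Longrightarrow> epowr (ennreal x) r = ennreal (x powr r)"
  by (simp add: epowr_def)

lemma epowr_zero [simp]: "epowr 0 r = 0"
  by (simp add: epowr_def)

lemma epowr_mono:
  assumes "0 \<le> r" "x \<le> y"
  shows "epowr x r \<le> epowr y r"
proof (cases "y = top")
  case False
  then have "x \<noteq> top" using assms(2) by (auto simp: top_unique)
  moreover have "enn2real x \<le> enn2real y"
    using assms(2) False by (intro enn2real_mono) (auto simp: top.not_eq_extremum)
  ultimately show ?thesis
    using False assms(1) by (auto simp: epowr_def intro!: ennreal_leI powr_mono2)
qed (simp add: epowr_def)

lemma suminf_ge_one_eq_top:
  fixes f :: "nat \<Rightarrow> ennreal"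
  assumes "\<And>j. 1 \<le> f j"
  shows "(\<Sum>j. f j) = top"
proof (rule ccontr)
  assume "(\<Sum>j. f j) \<noteq> top"
  then obtain r where r: "(\<Sum>j. f j) = ennreal r" "0 \<le> r" by (cases "\<Sum>j. f j") auto
  obtain m where m: "r < real m" using reals_Archimedean2 by blast
  have "ennreal (real m) = (\<Sum>j<m. 1)" by (simp add: ennreal_of_nat_eq_real_of_nat)
  also have "\<dots> \<le> (\<Sum>j<m. f j)" by (intro sum_mono assms)
  also have "\<dots> \<le> (\<Sum>j. f j)" by (intro sum_le_suminf) auto
  finally show False using r m by (simp add: ennreal_le_iff)
qed

text \<open>Starting from the average of \<open>w\<close> over \<open>Q\<close>, the sublevel sets at the levels \<open>b\<^sup>j\<close> times the average
  have measure at most \<open>2\<^sup>-\<^sup>j |Q|\<close>. If \<open>\<epsilon>\<close> is so small that \<open>b\<^sup>-\<^sup>\<epsilon> < 2\<close>, the integral of \<open>w\<^sup>-\<^sup>\<epsilon>\<close> over \<open>Q\<close> is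
  dominated by a convergent geometric series, and this is the \<open>A\<^sub>p\<close> condition with \<open>1 / (p - 1) = \<epsilon>\<close>.\<close>

lemma Ainf_imp_Ap:
  fixes w :: "real^'n \<Rightarrow> real"
  assumes w: "w \<in> Ainf_loc"
  shows "\<exists>p>1. w \<in> Ap_loc p"
proof -
  let ?n = "CARD('n)"
  have wt: "weight w" and nn: "\<And>x. 0 \<le> w x" using w by (auto simp: Ainf_loc_def weight_def)
  have meas[measurable]: "w \<in> borel_measurable lebesgue" by (rule weight_measurable[OF wt])
  obtain b where b: "0 < b" "b < 1" and halve:
    "\<And>Q \<gamma>. Q \<in> local_cubes \<Longrightarrow> 0 < \<gamma> \<Longrightarrow> ennreal \<gamma> * emeasure lebesgue Q \<le> 2 * wmeas w Q \<Longrightarrow>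
       2 * emeasure lebesgue {x\<in>Q. w x < b * \<gamma>} \<le> emeasure lebesgue {x\<in>Q. w x < \<gamma>}"
    using Ainf_sublevel_halving[OF w] by blast
  \<comment> \<open>The exponent with \<open>b\<^sup>-\<^sup>\<epsilon> = 3/2\<close>, so that the series below has ratio \<open>3/2 * 1/2 < 1\<close>.\<close>
  define \<epsilon> where "\<epsilon> = ln (3/2) / ln (1/b)"
  have \<epsilon>: "0 < \<epsilon>" using b by (auto simp: \<epsilon>_def)
  have b\<epsilon>: "b powr (-\<epsilon>) = 3/2"
  proof -
    have "ln b \<noteq> 0" using b by auto
    then have "-\<epsilon> * ln b = ln (3/2)" using b by (simp add: \<epsilon>_def ln_div field_simps)
    then show ?thesis using b by (simp add: powr_def)
  qed
  define p where "p = 1 + 1 / \<epsilon>"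
  have p: "1 < p" using \<epsilon> by (simp add: p_def)
  define p' where "p' = p / (p - 1)"
  have p': "p' / p = \<epsilon>" "p / p' = 1 / \<epsilon>"
  proof -
    have a: "p = (1 + \<epsilon>) / \<epsilon>" "p' = 1 + \<epsilon>" using \<epsilon> by (simp_all add: p'_def p_def field_simps)
    show "p' / p = \<epsilon>" "p / p' = 1 / \<epsilon>" unfolding a using \<epsilon> by (simp_all add: divide_simps)
  qed
  have main: "ennreal (measure lebesgue Q powr (- p)) * wmeas w Q
              * epowr (\<integral>\<^sup>+x\<in>Q. inverse (epowr (ennreal (w x)) \<epsilon>) \<partial>lebesgue) (1 / \<epsilon>) \<le> ennreal (7 powr (1 / \<epsilon>))"
    if Q: "Q \<in> local_cubes" for Q
  proof (cases "wmeas w Q = 0")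
    case False
    obtain a l where Qe: "Q = cbox a (a + l *\<^sub>R One)" and l: "0 < l" "l \<le> 1"
      using local_cubesE[OF Q] by metis
    have Qs[measurable]: "Q \<in> sets lebesgue" by (simp add: Qe)
    define q where "q = l ^ ?n"
    have q: "0 < q" "measure lebesgue Q = q" "emeasure lebesgue Q = ennreal q"
      using l cube_measure[of l a] by (auto simp: Qe q_def)
    have "wmeas w Q < top" using wt by (simp add: Qe wmeas_compact)
    then obtain V where V: "wmeas w Q = ennreal V" "0 \<le> V" by (cases "wmeas w Q") auto
    have V0: "0 < V" using False V by auto
    define u where "u = V / q"
    have u: "0 < u" "V = u * q" using V0 q by (auto simp: u_def)
    define E where "E j = {x\<in>Q. w x < b ^ j * u}" for j
    have Esets[measurable]: "E j \<in> sets lebesgue" for j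
    proof -
      have "E j = Q \<inter> (w -` {..<b ^ j * u} \<inter> space lebesgue)" by (auto simp: E_def)
      moreover have "w -` {..<b ^ j * u} \<inter> space lebesgue \<in> sets lebesgue" by (rule measurable_sets[OF meas]) simp
      ultimately show ?thesis using Qs by (metis sets.Int)
    qed
    have decay: "emeasure lebesgue (E j) \<le> ennreal ((1/2) ^ j * q)" for j
    proof (induction j)
      case 0
      have "emeasure lebesgue (E 0) \<le> emeasure lebesgue Q" by (rule emeasure_mono) (auto simp: E_def)
      then show ?case by (simp add: q)
    next
      case (Suc j)
      have "b ^ j * u * q \<le> 2 * (u * q)"
        using b u(1) q(1) power_le_one[of b j] by (simp add: mult_le_cancel_right)
      then have le: "ennreal (b ^ j * u) * emeasure lebesgue Q \<le> 2 * wmeas w Q"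
      proof -
        have "ennreal (b ^ j * u) * emeasure lebesgue Q = ennreal (b ^ j * u * q)"
          using b u q by (simp add: ennreal_mult)
        also have "\<dots> \<le> ennreal (2 * V)" using \<open>b ^ j * u * q \<le> 2 * (u * q)\<close> u(2) by (simp add: ennreal_leI)
        also have "\<dots> = 2 * wmeas w Q" using V ennreal_mult[of 2 V] by simp
        finally show ?thesis .
      qed
      have "2 * emeasure lebesgue (E (Suc j)) \<le> emeasure lebesgue (E j)"
        using halve[OF Q _ le] b u by (simp add: E_def mult.assoc)
      also have "\<dots> \<le> ennreal ((1/2) ^ j * q)" by (rule Suc)
      also have "\<dots> = 2 * ennreal ((1/2) ^ Suc j * q)"
        using q ennreal_mult[of 2 "(1/2) ^ Suc j * q"] by simp
      finally show ?case by (subst (asm) ennreal_mult_le_mult_iff) auto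
    qed
    have pt: "inverse (epowr (ennreal (w x)) \<epsilon>) * indicator Q x
        \<le> ennreal (u powr (-\<epsilon>)) * (indicator Q x + (\<Sum>j. ennreal ((3/2) ^ Suc j) * indicator (E j) x))" for x
    proof (cases "x \<in> Q")
      case x: True
      have ue: "ennreal (u powr (-\<epsilon>)) \<noteq> 0" using u by simp
      consider "u \<le> w x" | "w x = 0" | "0 < w x" "w x < u" using nn[of x] by linarith
      then show ?thesis
      proof cases
        case 1
        have "inverse (epowr (ennreal (w x)) \<epsilon>) = ennreal (w x powr (-\<epsilon>))"
          using nn[of x] 1 u by (simp add: epowr_ennreal inverse_ennreal powr_minus)
        also have "\<dots> \<le> ennreal (u powr (-\<epsilon>))"
          using 1 u \<epsilon> by (intro ennreal_leI powr_mono2') auto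
        finally have 1: "inverse (epowr (ennreal (w x)) \<epsilon>) \<le> ennreal (u powr (-\<epsilon>)) * 1" by simp
        have "ennreal (u powr (-\<epsilon>)) * 1 \<le> ennreal (u powr (-\<epsilon>)) * (indicator Q x + (\<Sum>j. ennreal ((3/2) ^ Suc j) * indicator (E j) x))"
          using x by (intro mult_left_mono) auto
        then show ?thesis using x 1 by simp
      next
        case 2
        have "(\<Sum>j. ennreal ((3/2) ^ Suc j) * indicator (E j) x) = top"
        proof (rule suminf_ge_one_eq_top)
          fix j
          have "x \<in> E j" using 2 x b u by (simp add: E_def)
          moreover have "1 \<le> ennreal ((3/2) ^ Suc j)" by (subst ennreal_1[symmetric], rule ennreal_leI, rule one_le_power) simp
          ultimately show "1 \<le> ennreal ((3/2) ^ Suc j) * indicator (E j) x" by simp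
        qed
        then show ?thesis using ue by (simp add: ennreal_mult_top)
      next
        case 3
        define J where "J = (LEAST j. b ^ j * u \<le> w x)"
        have ex: "\<exists>j. b ^ j * u \<le> w x"
        proof -
          obtain j where "b ^ j < w x / u" using real_arch_pow_inv[of "w x / u" b] 3 u b by auto
          then show ?thesis using u by (intro exI[of _ j]) (simp add: field_simps)
        qed
        have J: "b ^ J * u \<le> w x" unfolding J_def by (rule LeastI_ex[OF ex])
        then have "J \<noteq> 0" using 3 by (intro notI) simp
        then obtain j where j: "J = Suc j" by (cases J) auto
        have "x \<in> E j" using not_less_Least[of j "\<lambda>j. b ^ j * u \<le> w x"] j x by (auto simp: E_def J_def)
        have "inverse (epowr (ennreal (w x)) \<epsilon>) = ennreal (w x powr (-\<epsilon>))"
          using 3 by (simp add: epowr_ennreal inverse_ennreal powr_minus)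
        also have "\<dots> \<le> ennreal ((b ^ J * u) powr (-\<epsilon>))"
          using 3 u \<epsilon> J b by (intro ennreal_leI powr_mono2') auto
        also have "(b ^ J * u) powr (-\<epsilon>) = u powr (-\<epsilon>) * (3/2) ^ Suc j"
        proof -
          have "(b ^ J) powr (-\<epsilon>) = (b powr (-\<epsilon>)) ^ J"
            using b by (simp add: powr_powr powr_realpow[symmetric] mult.commute)
          then show ?thesis using b u j by (simp add: powr_mult b\<epsilon>)
        qed
        also have "ennreal (u powr (-\<epsilon>) * (3/2) ^ Suc j) = ennreal (u powr (-\<epsilon>)) * (ennreal ((3/2) ^ Suc j) * indicator (E j) x)"
          using \<open>x \<in> E j\<close> by (simp add: ennreal_mult del: power_Suc)
        also have "\<dots> \<le> ennreal (u powr (-\<epsilon>)) * (indicator Q x + (\<Sum>j. ennreal ((3/2) ^ Suc j) * indicator (E j) x))"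
        proof (rule mult_left_mono)
          define f :: "nat \<Rightarrow> ennreal" where "f i = ennreal ((3/2) ^ Suc i) * indicator (E i) x" for i
          have "sum f {j} \<le> (\<Sum>i. f i)"
            by (rule sum_le_suminf) auto
          then have "f j \<le> indicator Q x + (\<Sum>i. f i)" by (simp add: add_increasing)
          then show "ennreal ((3/2) ^ Suc j) * indicator (E j) x \<le> indicator Q x + (\<Sum>j. ennreal ((3/2) ^ Suc j) * indicator (E j) x)"
            unfolding f_def .
        qed simp
        finally show ?thesis using x by simp
      qed
    qed simp
    have geo: "(\<lambda>j. ennreal ((3/2) ^ Suc j) * ennreal ((1/2) ^ j * q)) = (\<lambda>j. ennreal (3/2 * q * (3/4) ^ j))"
    proof
      fix j :: nat
      have "(3/2::real) ^ Suc j * ((1/2) ^ j * q) = 3/2 * q * ((3/2) * (1/2)) ^ j"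
        unfolding power_mult_distrib by simp
      then show "ennreal ((3/2) ^ Suc j) * ennreal ((1/2) ^ j * q) = ennreal (3/2 * q * (3/4) ^ j)"
        using q by (simp add: ennreal_mult[symmetric])
    qed
    have geo_sum: "(\<Sum>j. ennreal ((3/2) ^ Suc j) * ennreal ((1/2) ^ j * q)) = ennreal (6 * q)"
      unfolding geo
    proof (rule suminf_ennreal_eq)
      have "(\<lambda>j. 3/2 * q * (3/4::real) ^ j) sums (3/2 * q * (1 / (1 - 3/4)))"
        by (intro sums_mult geometric_sums) simp
      then show "(\<lambda>j. 3/2 * q * (3/4::real) ^ j) sums (6 * q)" by simp
    qed (use q in auto)
    have "(\<integral>\<^sup>+x\<in>Q. inverse (epowr (ennreal (w x)) \<epsilon>) \<partial>lebesgue)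
      \<le> (\<integral>\<^sup>+x. ennreal (u powr (-\<epsilon>)) * (indicator Q x + (\<Sum>j. ennreal ((3/2) ^ Suc j) * indicator (E j) x)) \<partial>lebesgue)"
      by (intro nn_integral_mono pt)
    also have "\<dots> = ennreal (u powr (-\<epsilon>)) * (emeasure lebesgue Q + (\<Sum>j. ennreal ((3/2) ^ Suc j) * emeasure lebesgue (E j)))"
      by (simp add: nn_integral_cmult nn_integral_add nn_integral_suminf)
    also have "\<dots> \<le> ennreal (u powr (-\<epsilon>)) * (ennreal q + (\<Sum>j. ennreal ((3/2) ^ Suc j) * ennreal ((1/2) ^ j * q)))"
      by (intro mult_left_mono add_mono suminf_le decay) (auto simp: q)
    also have "\<dots> = ennreal (7 * q * u powr (-\<epsilon>))"
      unfolding geo_sum using q by (simp add: ennreal_mult[symmetric] ennreal_plus[symmetric] mult.commute del: ennreal_plus)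
    finally have I: "(\<integral>\<^sup>+x\<in>Q. inverse (epowr (ennreal (w x)) \<epsilon>) \<partial>lebesgue) \<le> ennreal (7 * q * u powr (-\<epsilon>))" .
    have I2: "epowr (\<integral>\<^sup>+x\<in>Q. inverse (epowr (ennreal (w x)) \<epsilon>) \<partial>lebesgue) (1 / \<epsilon>)
        \<le> ennreal ((7 * q * u powr (-\<epsilon>)) powr (1 / \<epsilon>))"
      using epowr_mono[OF _ I, of "1 / \<epsilon>"] \<epsilon> q by (simp add: epowr_ennreal)
    have "ennreal (measure lebesgue Q powr (- p)) * wmeas w Q
              * epowr (\<integral>\<^sup>+x\<in>Q. inverse (epowr (ennreal (w x)) \<epsilon>) \<partial>lebesgue) (1 / \<epsilon>)
        \<le> ennreal (q powr (- p)) * ennreal (u * q) * ennreal ((7 * q * u powr (-\<epsilon>)) powr (1 / \<epsilon>))"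
      unfolding q(2) V(1) u(2)[symmetric] using I2 by (intro mult_left_mono) auto
    also have "\<dots> = ennreal (q powr (- p) * (u * q) * (7 * q * u powr (-\<epsilon>)) powr (1 / \<epsilon>))"
      using q u by (simp add: ennreal_mult)
    also have "q powr (- p) * (u * q) * (7 * q * u powr (-\<epsilon>)) powr (1 / \<epsilon>) = 7 powr (1 / \<epsilon>)"
    proof -
      have "(7 * q * u powr (-\<epsilon>)) powr (1 / \<epsilon>) = 7 powr (1/\<epsilon>) * q powr (1/\<epsilon>) * u powr (-1)"
        using q u \<epsilon> by (simp add: powr_mult powr_powr)
      moreover have "q powr (- p) = q powr (-1) * q powr (- (1/\<epsilon>))" unfolding powr_add[symmetric] by (simp add: p_def)
      ultimately show ?thesis using q u by (simp add: powr_minus field_simps)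
    qed
    finally show ?thesis .
  qed simp
  have "(SUP Q\<in>local_cubes. ennreal (measure lebesgue Q powr (- p)) * wmeas w Q
              * epowr (\<integral>\<^sup>+x\<in>Q. inverse (epowr (ennreal (w x)) \<epsilon>) \<partial>lebesgue) (1 / \<epsilon>)) \<le> ennreal (7 powr (1 / \<epsilon>))"
    by (rule SUP_least) (rule main)
  also have "\<dots> < top" by simp
  finally have "w \<in> Ap_loc p"
    using p wt unfolding Ap_loc_def Let_def p'_def[symmetric] p' by simp
  with p show ?thesis by blast
qed

section \<open>Doubling and monotonicity of the classes\<close>

lemma epowr_mult:
  assumes "0 < r"
  shows "epowr (ennreal c * x) r = epowr (ennreal c) r * epowr x r"
proof (cases "c \<le> 0")
  case True
  then have "ennreal c = 0" by (simp add: ennreal_neg)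
  then show ?thesis using assms by (simp add: epowr_def)
next
  case False
  then show ?thesis
  proof (cases x)
    case (real u)
    then show ?thesis using False assms
      by (simp add: epowr_ennreal powr_mult flip: ennreal_mult)
  next
    case top
    then show ?thesis using False assms by (simp add: epowr_def ennreal_mult_top)
  qed
qed

lemma epowr_epowr:
  assumes "0 < r" "0 < s"
  shows "epowr (epowr x r) s = epowr x (r * s)"
  using assms by (cases x) (auto simp: epowr_ennreal powr_powr, simp_all add: epowr_def)

lemma epowr_one: "epowr x 1 = x"
  by (cases x) (auto simp: epowr_ennreal, simp add: epowr_def)

lemma measurable_epowr[measurable]:
  assumes [measurable]: "g \<in> borel_measurable M"
  shows "(\<lambda>x. epowr (g x) r) \<in> borel_measurable M"
  unfolding epowr_def by measurable

lemma inverse_epowr: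
  assumes "0 < r"
  shows "inverse (epowr x r) = epowr (inverse x) r"
proof (cases x)
  case (real u)
  show ?thesis
  proof (cases "u = 0")
    case True
    then show ?thesis using real assms by (simp add: epowr_def)
  next
    case False
    then show ?thesis using real assms
      by (simp add: epowr_ennreal inverse_ennreal inverse_powr)
  qed
next
  case top
  then show ?thesis using assms by (simp add: epowr_def)
qed

text \<open>The mean of \<open>w\<^sup>-\<^sup>1\<^sup>/\<^sup>(\<^sup>q\<^sup>-\<^sup>1\<^sup>)\<close> over \<open>Q\<close> is at most the power \<open>1 / (q - 1)\<close> of the essential supremum of \<open>1 / w\<close>.\<close>

lemma A1_imp_Ap:
  fixes w :: "real^'n \<Rightarrow> real"
  assumes w: "w \<in> Ap_loc 1" and q: "1 < q"
  shows "w \<in> Ap_loc q"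
proof -
  let ?F = "\<lambda>Q. wmeas w Q / emeasure lebesgue Q * esssup (lebesgue_on Q) (\<lambda>x. inverse (ennreal (w x)))"
  have wt: "weight w" and fin: "(SUP Q\<in>local_cubes. ?F Q) < top"
    using w by (auto simp: Ap_loc_def)
  have meas[measurable]: "w \<in> borel_measurable lebesgue" by (rule weight_measurable[OF wt])
  define q' where "q' = q / (q - 1)"
  define \<sigma> where "\<sigma> = 1 / (q - 1)"
  have \<sigma>: "q' / q = \<sigma>" "q / q' = q - 1" "\<sigma> * (q - 1) = 1" "0 < \<sigma>"
    using q by (auto simp: q'_def \<sigma>_def)
  have main: "ennreal (measure lebesgue Q powr (- q)) * wmeas w Q
              * epowr (\<integral>\<^sup>+x\<in>Q. inverse (epowr (ennreal (w x)) \<sigma>) \<partial>lebesgue) (q - 1) \<le> ?F Q"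
    if Q: "Q \<in> local_cubes" for Q
  proof (cases "wmeas w Q = 0")
    case False
    let ?e = "esssup (lebesgue_on Q) (\<lambda>x. inverse (ennreal (w x)))"
    obtain a l where Qe: "Q = cbox a (a + l *\<^sub>R One)" and l: "0 < l" "l \<le> 1"
      using local_cubesE[OF Q] by metis
    have Qs[measurable]: "Q \<in> sets lebesgue" by (simp add: Qe)
    define m where "m = l ^ CARD('n)"
    have m: "0 < m" "measure lebesgue Q = m" "emeasure lebesgue Q = ennreal m"
      using l cube_measure[of l a] by (auto simp: Qe m_def)
    have le: "?F Q < top" using fin SUP_upper[OF Q, of ?F] by order
    have "?e \<noteq> top"
    proof
      assume e: "?e = top"
      have "wmeas w Q / emeasure lebesgue Q \<noteq> 0" using False m by (simp add: ennreal_divide_eq_0_iff)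
      then show False using le e by (simp add: ennreal_mult_top)
    qed
    then obtain e where e: "?e = ennreal e" "0 \<le> e" by (cases ?e) auto
    have "AE x in lebesgue_on Q. inverse (ennreal (w x)) \<le> ?e"
      by (rule esssup_AE)
    then have "AE x in lebesgue. x \<in> Q \<longrightarrow> inverse (ennreal (w x)) \<le> ennreal e"
      unfolding e using Qs by (simp add: AE_restrict_space_iff)
    then have "(\<integral>\<^sup>+x\<in>Q. inverse (epowr (ennreal (w x)) \<sigma>) \<partial>lebesgue) \<le> (\<integral>\<^sup>+x. epowr (ennreal e) \<sigma> * indicator Q x \<partial>lebesgue)"
      using \<sigma>(4) by (intro nn_integral_mono_AE)
        (auto simp: indicator_def inverse_epowr elim!: eventually_mono intro!: epowr_mono)
    also have "\<dots> = epowr (ennreal e) \<sigma> * ennreal m"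
      by (simp add: nn_integral_cmult_indicator m)
    also have "\<dots> = ennreal (e powr \<sigma> * m)" using e m by (simp add: epowr_ennreal ennreal_mult)
    finally have "epowr (\<integral>\<^sup>+x\<in>Q. inverse (epowr (ennreal (w x)) \<sigma>) \<partial>lebesgue) (q - 1) \<le> epowr (ennreal (e powr \<sigma> * m)) (q - 1)"
      using q by (intro epowr_mono) auto
    also have "\<dots> = ennreal (e * m powr (q - 1))"
      using e m q \<sigma> by (simp add: epowr_ennreal powr_mult powr_powr)
    finally have 1: "epowr (\<integral>\<^sup>+x\<in>Q. inverse (epowr (ennreal (w x)) \<sigma>) \<partial>lebesgue) (q - 1) \<le> ennreal (e * m powr (q - 1))" .
    have "wmeas w Q < top" using wt by (simp add: Qe wmeas_compact)
    then obtain V where V: "wmeas w Q = ennreal V" "0 \<le> V" by (cases "wmeas w Q") auto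
    have "ennreal (measure lebesgue Q powr (- q)) * wmeas w Q
              * epowr (\<integral>\<^sup>+x\<in>Q. inverse (epowr (ennreal (w x)) \<sigma>) \<partial>lebesgue) (q - 1)
        \<le> ennreal (m powr (- q)) * ennreal V * ennreal (e * m powr (q - 1))"
      unfolding m(2) V(1) by (rule mult_left_mono[OF 1]) simp
    also have "\<dots> = ennreal (m powr (- q) * V * (e * m powr (q - 1)))"
      using V e m by (simp add: ennreal_mult)
    also have "m powr (- q) * V * (e * m powr (q - 1)) = V / m * e"
    proof -
      have "m powr (- q) * m powr (q - 1) = m powr (-1)" unfolding powr_add[symmetric] by simp
      then show ?thesis using m by (simp add: powr_minus field_simps)
    qed
    also have "ennreal (V / m * e) = ?F Q"
      unfolding e V(1) m(3) using V e m ennreal_mult[of "V / m" e] divide_ennreal[of V m] by simp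
    finally show ?thesis .
  qed simp
  have "(SUP Q\<in>local_cubes. ennreal (measure lebesgue Q powr (- q)) * wmeas w Q
              * epowr (\<integral>\<^sup>+x\<in>Q. inverse (epowr (ennreal (w x)) \<sigma>) \<partial>lebesgue) (q - 1)) \<le> (SUP Q\<in>local_cubes. ?F Q)"
    by (rule SUP_mono) (use main in blast)
  also have "\<dots> < top" by (rule fin)
  finally show ?thesis
    using q wt unfolding Ap_loc_def Let_def q'_def[symmetric] \<sigma>(1,2) by simp
qed

text \<open>The dilated ball may be larger than any local cube, so the comparison is made in steps: a
  cube of side \<open>h \<le> 1/2\<close> and its translate by at most \<open>h\<close> in each coordinate both lie in one local
  cube of side \<open>2 h\<close>. Boundedly many such steps reach each cube of a finite grid that covers the ball.\<close>

lemma Ainf_doubling: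
  fixes w :: "real^'n \<Rightarrow> real"
  assumes w: "w \<in> Ainf_loc"
  obtains D where "1 \<le> D"
    "\<And>a l. 0 < l \<Longrightarrow> l \<le> 1 \<Longrightarrow>
       wmeas w (cball a (5 * (real CARD('n) * l))) \<le> ennreal D * wmeas w (cbox a (a + l *\<^sub>R One))"
proof -
  let ?n = "CARD('n)"
  have wt: "weight w" using w by (simp add: Ainf_loc_def)
  have half: "(1/2::real) ^ ?n < 1" "0 < (1/2::real) ^ ?n"
    by (simp_all add: power_less_one_iff)
  obtain K where K: "1 \<le> K" "\<And>Q F. Q \<in> local_cubes \<Longrightarrow> F \<in> sets lebesgue \<Longrightarrow> F \<subseteq> Q \<Longrightarrow>
       (1/2) ^ ?n * measure lebesgue Q \<le> measure lebesgue F \<Longrightarrow> wmeas w Q \<le> ennreal K * wmeas w F"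
    using Ainf_comparison[OF w half(2,1)] by metis
  define W where "W a h = wmeas w (cbox a (a + h *\<^sub>R One))" for a h
  have step: "W (a + u) h \<le> ennreal K * W a h"
    if h: "0 < h" "h \<le> 1/2" and u: "\<And>i. \<bar>u $ i\<bar> \<le> h" for a u h
  proof -
    define a' where "a' = (\<chi> i. min (a $ i) (a $ i + u $ i))"
    let ?Q = "cbox a' (a' + (2 * h) *\<^sub>R One)"
    have "cbox (a + u) (a + u + h *\<^sub>R One) \<subseteq> ?Q" "cbox a (a + h *\<^sub>R One) \<subseteq> ?Q"
    proof -
      have "a' $ i \<le> a $ i" "a $ i \<le> a' $ i + h" "a' $ i \<le> (a + u) $ i" "(a + u) $ i \<le> a' $ i + h" for i
        using u[of i] by (auto simp: a'_def min_def)
      note * = this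
      have "cbox v (v + h *\<^sub>R One) \<subseteq> ?Q" if "\<And>i. a' $ i \<le> v $ i \<and> v $ i \<le> a' $ i + h" for v
      proof
        fix y assume y: "y \<in> cbox v (v + h *\<^sub>R One)"
        show "y \<in> ?Q" unfolding mem_cube_iff
        proof
          fix i show "a' $ i \<le> y $ i \<and> y $ i \<le> a' $ i + 2 * h"
            using that[of i] y[unfolded mem_cube_iff, THEN spec[of _ i]] by linarith
        qed
      qed
      with * show "cbox (a + u) (a + u + h *\<^sub>R One) \<subseteq> ?Q" "cbox a (a + h *\<^sub>R One) \<subseteq> ?Q" by blast+
    qed
    moreover have "(1/2) ^ ?n * measure lebesgue ?Q \<le> measure lebesgue (cbox a (a + h *\<^sub>R One))"
      using cube_measure(1)[of "2 * h" a'] cube_measure(1)[of h a] h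
      by (simp add: power_mult_distrib power_divide)
    ultimately have "W (a + u) h \<le> wmeas w ?Q" "wmeas w ?Q \<le> ennreal K * W a h"
      unfolding W_def using h by (auto intro!: wmeas_mono K(2) local_cubesI)
    then show ?thesis by (rule order_trans)
  qed
  have chain: "W (a + real k *\<^sub>R u) h \<le> ennreal (K ^ k) * W a h"
    if h: "0 < h" "h \<le> 1/2" and u: "\<And>i. \<bar>u $ i\<bar> \<le> h" for a u h k
  proof (induction k)
    case (Suc k)
    have "W (a + real (Suc k) *\<^sub>R u) h = W ((a + real k *\<^sub>R u) + u) h"
      by (simp add: algebra_simps)
    also have "\<dots> \<le> ennreal K * W (a + real k *\<^sub>R u) h" by (rule step[OF h u])
    also have "\<dots> \<le> ennreal K * (ennreal (K ^ k) * W a h)" by (rule mult_left_mono[OF Suc]) simp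
    also have "\<dots> = ennreal (K ^ Suc k) * W a h"
      using K(1) by (simp add: ennreal_mult mult.assoc)
    finally show ?case .
  qed simp
  define I where "I = (PiE UNIV (\<lambda>_::'n. {- int (10 * ?n) .. int (10 * ?n)}))"
  have I: "finite I" unfolding I_def by (intro finite_PiE) auto
  define D where "D = max 1 (real (card I) * K ^ (10 * ?n))"
  show ?thesis
  proof
    show "1 \<le> D" by (simp add: D_def)
    fix a :: "real^'n" and l :: real assume l: "0 < l" "l \<le> 1"
    define h where "h = l / 2"
    have h: "0 < h" "h \<le> 1/2" using l by (auto simp: h_def)
    define c where "c k = a + h *\<^sub>R (\<chi> i. real_of_int (k i))" for k :: "'n \<Rightarrow> int"
    have cov: "cball a (5 * (real ?n * l)) \<subseteq> (\<Union>k\<in>I. cbox (c k) (c k + h *\<^sub>R One))"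
    proof
      fix y assume y: "y \<in> cball a (5 * (real ?n * l))"
      define k where "k i = \<lfloor>(y $ i - a $ i) / h\<rfloor>" for i
      have "\<bar>(y $ i - a $ i) / h\<bar> \<le> 10 * real ?n" for i
      proof -
        have "\<bar>(y - a) $ i\<bar> \<le> norm (y - a)" by (rule component_le_norm_cart)
        also have "\<dots> \<le> 10 * real ?n * h" using y by (simp add: dist_norm norm_minus_commute h_def mult_ac)
        finally show ?thesis using h by (simp add: abs_divide field_simps)
      qed
      then have "\<lfloor>- (10 * real ?n)\<rfloor> \<le> k i \<and> k i \<le> \<lfloor>10 * real ?n\<rfloor>" for i
        unfolding k_def using abs_le_D1[of "(y $ i - a $ i) / h" "10 * real ?n"] abs_le_D2[of "(y $ i - a $ i) / h" "10 * real ?n"]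
        by (intro conjI floor_mono) force+
      moreover have "\<lfloor>10 * real ?n\<rfloor> = int (10 * ?n)" "\<lfloor>- (10 * real ?n)\<rfloor> = - int (10 * ?n)"
        by (simp_all add: floor_eq_iff)
      ultimately have "k \<in> I" unfolding I_def by (auto simp: PiE_def)
      moreover have "y \<in> cbox (c k) (c k + h *\<^sub>R One)" unfolding mem_cube_iff
      proof
        fix i
        have "of_int (k i) \<le> (y $ i - a $ i) / h" "(y $ i - a $ i) / h \<le> of_int (k i) + 1"
          unfolding k_def by linarith+
        then have "h * of_int (k i) \<le> y $ i - a $ i" "y $ i - a $ i \<le> h * of_int (k i) + h"
          using h by (simp_all add: field_simps)
        then show "c k $ i \<le> y $ i \<and> y $ i \<le> c k $ i + h" by (simp add: c_def)
      qed
      ultimately show "y \<in> (\<Union>k\<in>I. cbox (c k) (c k + h *\<^sub>R One))" by blast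
    qed
    have each: "W (c k) h \<le> ennreal (K ^ (10 * ?n)) * W a h" if "k \<in> I" for k
    proof -
      define u where "u = (h / real (10 * ?n)) *\<^sub>R (\<chi> i. real_of_int (k i))"
      have "c k = a + real (10 * ?n) *\<^sub>R u" by (simp add: c_def u_def)
      moreover have "\<bar>u $ i\<bar> \<le> h" for i
      proof -
        have "k i \<in> {- int (10 * ?n) .. int (10 * ?n)}" using that by (auto simp: I_def PiE_def)
        then have "\<bar>real_of_int (k i)\<bar> \<le> real (10 * ?n)" by auto
        then have "h * \<bar>real_of_int (k i)\<bar> \<le> h * real (10 * ?n)" using h by (intro mult_left_mono) auto
        then show ?thesis using h by (simp add: u_def abs_mult field_simps)
      qed
      ultimately show ?thesis using chain[OF h, of u a "10 * ?n"] by metis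
    qed
    have "wmeas w (cball a (5 * (real ?n * l))) \<le> wmeas w (\<Union>k\<in>I. cbox (c k) (c k + h *\<^sub>R One))"
      by (rule wmeas_mono[OF cov])
    also have "\<dots> = emeasure (density lebesgue (\<lambda>x. ennreal (w x))) (\<Union>k\<in>I. cbox (c k) (c k + h *\<^sub>R One))"
      by (rule wmeas_density[OF wt]) (use I in \<open>auto intro!: sets.finite_UN\<close>)
    also have "\<dots> \<le> (\<Sum>k\<in>I. emeasure (density lebesgue (\<lambda>x. ennreal (w x))) (cbox (c k) (c k + h *\<^sub>R One)))"
      by (rule emeasure_subadditive_finite) (use I in auto)
    also have "\<dots> = (\<Sum>k\<in>I. W (c k) h)"
      unfolding W_def by (intro sum.cong refl wmeas_density[OF wt, symmetric]) auto
    also have "\<dots> \<le> (\<Sum>k\<in>I. ennreal (K ^ (10 * ?n)) * W a h)" by (rule sum_mono[OF each])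
    also have "\<dots> = ennreal (real (card I) * K ^ (10 * ?n)) * W a h"
      using K(1) by (simp add: ennreal_mult ennreal_of_nat_eq_real_of_nat mult.assoc)
    also have "\<dots> \<le> ennreal D * W a h" by (intro mult_right_mono ennreal_leI) (auto simp: D_def)
    also have "\<dots> \<le> ennreal D * wmeas w (cbox a (a + l *\<^sub>R One))"
      unfolding W_def
    proof (intro mult_left_mono wmeas_mono)
      show "cbox a (a + h *\<^sub>R One) \<subseteq> cbox a (a + l *\<^sub>R One)"
      proof
        fix y assume y: "y \<in> cbox a (a + h *\<^sub>R One)"
        show "y \<in> cbox a (a + l *\<^sub>R One)" unfolding mem_cube_iff
        proof
          fix i show "a $ i \<le> y $ i \<and> y $ i \<le> a $ i + l"
            using y[unfolded mem_cube_iff, THEN spec[of _ i]] l by (auto simp: h_def)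
        qed
      qed
    qed simp
    finally show "wmeas w (cball a (5 * (real ?n * l))) \<le> ennreal D * wmeas w (cbox a (a + l *\<^sub>R One))" .
  qed
qed

section \<open>Weak type estimates\<close>

text \<open>Stated with a measurable superset of the level set, which spares a discussion of the measurability
  of maximal functions over closed cubes.\<close>

definition weak_type :: "(real^'n \<Rightarrow> real) \<Rightarrow> real \<Rightarrow> ((real^'n \<Rightarrow> ennreal) \<Rightarrow> real^'n \<Rightarrow> ennreal) \<Rightarrow> bool" where
  "weak_type w p T \<longleftrightarrow> (\<exists>C>0. \<forall>g\<in>borel_measurable borel. \<forall>\<alpha>>0. \<exists>S\<in>sets lebesgue.
     {x. ennreal \<alpha> < T g x} \<subseteq> S \<and>
     wmeas w S \<le> ennreal (C * \<alpha> powr (- p)) * (\<integral>\<^sup>+x. epowr (g x) p * ennreal (w x) \<partial>lebesgue))"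

text \<open>With \<open>v = u\<^sup>-\<^sup>1\<^sup>/\<^sup>(\<^sup>p\<^sup>-\<^sup>1\<^sup>)\<close>, either \<open>g\<close> is at most the second summand \<open>v / s\<close>, or \<open>g s / v > 1\<close> and then the
  first summand \<open>g (g s / v)\<^sup>p\<^sup>-\<^sup>1\<close> exceeds \<open>g\<close>. This replaces Hoelder's inequality and copes with
  infinite values.\<close>

lemma epowr_young:
  fixes g :: ennreal and u s :: real
  assumes p: "1 < p" and u: "0 \<le> u" and s: "0 < s"
  shows "g \<le> ennreal (s powr (p - 1)) * (epowr g p * ennreal u) + ennreal (1 / s) * inverse (epowr (ennreal u) (1 / (p - 1)))"
proof (cases "u = 0")
  case True
  then show ?thesis using s by (simp add: epowr_def ennreal_mult_top)
next
  case False
  then have u0: "0 < u" using u by simp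
  show ?thesis
  proof (cases g)
    case top
    then show ?thesis using u0 s by (simp add: epowr_def ennreal_top_mult ennreal_mult_top)
  next
    case (real r)
    define v where "v = u powr (- 1 / (p - 1))"
    have v: "0 < v" "u = v powr (- (p - 1))" "inverse (epowr (ennreal u) (1 / (p - 1))) = ennreal v"
    proof -
      have "- 1 / (p - 1) * - (p - 1) = 1" using p by (simp add: field_simps)
      then show "u = v powr (- (p - 1))" unfolding v_def powr_powr using u0 by simp
      show "0 < v" using u0 by (simp add: v_def)
      have "v = inverse (u powr (1 / (p - 1)))" by (simp add: v_def powr_minus[symmetric])
      then show "inverse (epowr (ennreal u) (1 / (p - 1))) = ennreal v"
        using u0 by (simp add: epowr_ennreal inverse_ennreal)
    qed
    have "r \<le> s powr (p - 1) * (r powr p * u) + 1 / s * v"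
    proof (cases "r \<le> v / s")
      case True
      then show ?thesis using u0 by (simp add: add_increasing)
    next
      case False
      then have r: "v / s < r" by simp
      then have r0: "0 < r" using v s by (meson divide_pos_pos less_trans)
      have "1 \<le> (r * s / v) powr (p - 1)"
        using r p v s by (intro ge_one_powr_ge_zero) (auto simp: field_simps)
      then have "r * 1 \<le> r * (r * s / v) powr (p - 1)" using r0 by (intro mult_left_mono) auto
      also have "\<dots> = s powr (p - 1) * (r powr p * u)"
      proof -
        have "r powr p = r * r powr (p - 1)" using r0 powr_add[of r 1 "p - 1"] by simp
        moreover have "v powr (- (p - 1)) = 1 / v powr (p - 1)" by (rule powr_minus_divide)
        ultimately show ?thesis unfolding v(2) using r0 v(1) s
          by (simp add: powr_mult powr_divide powr_minus divide_simps)
      qed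
      finally show ?thesis using v(1) s by (simp add: add_increasing2)
    qed
    then have "ennreal r \<le> ennreal (s powr (p - 1) * (r powr p * u) + 1 / s * v)" by (rule ennreal_leI)
    also have "\<dots> = ennreal (s powr (p - 1)) * (ennreal (r powr p) * ennreal u) + ennreal (1 / s) * ennreal v"
    proof -
      have "ennreal (1 / s * v) = ennreal (1 / s) * ennreal v" by (rule ennreal_mult) (use v(1) s in auto)
      moreover have "ennreal (s powr (p - 1) * (r powr p * u)) = ennreal (s powr (p - 1)) * (ennreal (r powr p) * ennreal u)"
        using u by (simp add: ennreal_mult)
      ultimately show ?thesis using u v(1) s by (subst ennreal_plus) auto
    qed
    finally show ?thesis using real by (simp add: v(3) epowr_ennreal)
  qed
qed

text \<open>Integrate \<open>epowr_young\<close> over \<open>Q\<close> with the parameter \<open>s\<close> for which the dual term equals half of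
  \<open>\<alpha> |Q|\<close>; the other half is then absorbed by the first term, and the \<open>A\<^sub>p\<close> condition bounds the
  resulting power of the dual integral.\<close>

lemma Ap_cube_bound:
  fixes w :: "real^'n \<Rightarrow> real"
  assumes w: "w \<in> Ap_loc p" and p: "1 < p"
  obtains C where "0 < C"
    "\<And>Q g \<alpha>. Q \<in> local_cubes \<Longrightarrow> g \<in> borel_measurable borel \<Longrightarrow> 0 < \<alpha> \<Longrightarrow>
       ennreal \<alpha> < (\<integral>\<^sup>+y\<in>Q. g y \<partial>lebesgue) / emeasure lebesgue Q \<Longrightarrow>
       wmeas w Q \<le> ennreal (C * \<alpha> powr (- p)) * (\<integral>\<^sup>+y\<in>Q. epowr (g y) p * ennreal (w y) \<partial>lebesgue)"
proof -
  define \<sigma> where "\<sigma> = 1 / (p - 1)"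
  define p' where "p' = p / (p - 1)"
  have \<sigma>: "0 < \<sigma>" "p' / p = \<sigma>" "p / p' = p - 1" using p by (auto simp: \<sigma>_def p'_def)
  let ?Y = "\<lambda>Q. \<integral>\<^sup>+x\<in>Q. inverse (epowr (ennreal (w x)) \<sigma>) \<partial>lebesgue"
  let ?F = "\<lambda>Q. ennreal (measure lebesgue Q powr (- p)) * wmeas w Q * epowr (?Y Q) (p - 1)"
  have wt: "weight w" using w by (simp add: Ap_loc_def)
  have fin: "(SUP Q\<in>local_cubes. ?F Q) < top"
    using w p unfolding Ap_loc_def Let_def p'_def[symmetric] \<sigma> by simp
  have nn: "0 \<le> w x" for x using wt by (simp add: weight_def)
  have [measurable]: "w \<in> borel_measurable lebesgue" by (rule weight_measurable[OF wt])
  define A where "A = enn2real (SUP Q\<in>local_cubes. ?F Q) + 1"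
  have A: "0 < A" "?F Q \<le> ennreal A" if "Q \<in> local_cubes" for Q
  proof -
    show "0 < A" by (simp add: A_def add_nonneg_pos)
    have "?F Q \<le> (SUP Q\<in>local_cubes. ?F Q)" by (rule SUP_upper[OF that])
    also have "\<dots> = ennreal (enn2real (SUP Q\<in>local_cubes. ?F Q))" using fin by simp
    also have "\<dots> \<le> ennreal A" by (rule ennreal_leI) (simp add: A_def)
    finally show "?F Q \<le> ennreal A" .
  qed
  have A0: "0 < A" by (simp add: A_def add_nonneg_pos)
  show ?thesis
  proof
    show "0 < 2 powr p * A" using A0 by simp
    fix Q :: "(real^'n) set" and g :: "real^'n \<Rightarrow> ennreal" and \<alpha> :: real
    assume Q: "Q \<in> local_cubes" and g[measurable]: "g \<in> borel_measurable borel" and \<alpha>: "0 < \<alpha>"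
      and big: "ennreal \<alpha> < (\<integral>\<^sup>+y\<in>Q. g y \<partial>lebesgue) / emeasure lebesgue Q"
    have gl[measurable]: "g \<in> borel_measurable lebesgue" using g by (intro measurable_completion) simp
    obtain a l where Qe: "Q = cbox a (a + l *\<^sub>R One)" and l: "0 < l" "l \<le> 1"
      using local_cubesE[OF Q] by metis
    have Qs[measurable]: "Q \<in> sets lebesgue" by (simp add: Qe)
    define m where "m = l ^ CARD('n)"
    have m: "0 < m" "measure lebesgue Q = m" "emeasure lebesgue Q = ennreal m"
      using l cube_measure[of l a] by (auto simp: Qe m_def)
    let ?X = "\<integral>\<^sup>+y\<in>Q. epowr (g y) p * ennreal (w y) \<partial>lebesgue"
    show "wmeas w Q \<le> ennreal (2 powr p * A * \<alpha> powr (- p)) * ?X"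
    proof (cases "wmeas w Q = 0 \<or> ?X = top")
      case True
      then show ?thesis using A0 \<alpha> by (auto simp: ennreal_mult_top)
    next
      case False
      then have V0: "wmeas w Q \<noteq> 0" and "?X \<noteq> top" by auto
      then obtain X where X: "?X = ennreal X" "0 \<le> X" by (cases ?X) auto
      have "wmeas w Q < top" using wt by (simp add: Qe wmeas_compact)
      with V0 obtain V where V: "wmeas w Q = ennreal V" "0 < V"
        by (cases "wmeas w Q") (auto simp: less_le)
      have "?Y Q \<noteq> top"
      proof
        assume "?Y Q = top"
        then have "?F Q = top" using V m by (simp add: epowr_def ennreal_mult_top)
        then show False using A(2)[OF Q] by (simp add: top_unique)
      qed
      moreover have "?Y Q \<noteq> 0"
      proof
        assume "?Y Q = 0"
        then have "AE x in lebesgue. inverse (epowr (ennreal (w x)) \<sigma>) * indicator Q x = 0"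
          by (subst (asm) nn_integral_0_iff_AE) auto
        then have "AE x in lebesgue. x \<notin> Q"
          by (rule eventually_mono) (auto simp: indicator_def epowr_def split: if_splits)
        then have "emeasure lebesgue Q = 0"
          using emeasure_eq_0_AE[of "\<lambda>x. x \<in> Q" lebesgue] by simp
        then show False using m by simp
      qed
      ultimately obtain Y where Y: "?Y Q = ennreal Y" "0 < Y"
        by (cases "?Y Q") (auto simp: less_le)
      \<comment> \<open>The value for which \<open>Y / s\<close> is half of \<open>\<alpha> |Q|\<close>.\<close>
      define s where "s = 2 * Y / (\<alpha> * m)"
      have s: "0 < s" using Y \<alpha> m by (simp add: s_def)
      have "ennreal (\<alpha> * m) = ennreal \<alpha> * emeasure lebesgue Q" using m \<alpha> by (simp add: ennreal_mult)
      also have "\<dots> \<le> (\<integral>\<^sup>+y\<in>Q. g y \<partial>lebesgue)"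
      proof -
        have "ennreal \<alpha> * emeasure lebesgue Q \<le> (\<integral>\<^sup>+y\<in>Q. g y \<partial>lebesgue) / emeasure lebesgue Q * emeasure lebesgue Q"
          using big by (intro mult_right_mono) auto
        also have "\<dots> = (\<integral>\<^sup>+y\<in>Q. g y \<partial>lebesgue)"
          using m by (simp add: ennreal_divide_times ennreal_times_divide ennreal_mult_divide_eq ennreal_divide_self)
        finally show ?thesis .
      qed
      also have "\<dots> \<le> (\<integral>\<^sup>+y. ennreal (s powr (p - 1)) * (epowr (g y) p * ennreal (w y) * indicator Q y)
          + ennreal (1 / s) * (inverse (epowr (ennreal (w y)) \<sigma>) * indicator Q y) \<partial>lebesgue)"
        using epowr_young[OF p nn s] by (intro nn_integral_mono) (auto simp: indicator_def \<sigma>_def)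
      also have "\<dots> = ennreal (s powr (p - 1)) * ?X + ennreal (1 / s) * ?Y Q"
        by (simp add: nn_integral_add nn_integral_cmult)
      also have "\<dots> = ennreal (s powr (p - 1) * X + 1 / s * Y)"
      proof -
        have "ennreal (1 / s * Y) = ennreal (1 / s) * ennreal Y" by (rule ennreal_mult) (use Y(2) s in auto)
        moreover have "ennreal (s powr (p - 1) * X) = ennreal (s powr (p - 1)) * ennreal X"
          using X by (simp add: ennreal_mult)
        ultimately show ?thesis unfolding X(1) Y(1) using X(2) Y(2) s by (subst ennreal_plus) auto
      qed
      finally have "\<alpha> * m \<le> s powr (p - 1) * X + 1 / s * Y"
        using X(2) Y(2) s by (subst (asm) ennreal_le_iff) auto
      moreover have "1 / s * Y = \<alpha> * m / 2" using Y(2) by (simp add: s_def)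
      ultimately have 1: "\<alpha> * m / 2 \<le> s powr (p - 1) * X" by simp
      have "?F Q = ennreal (m powr (- p) * V * Y powr (p - 1))"
        unfolding m(2) V(1) Y(1) using V(2) Y(2) by (simp add: epowr_ennreal ennreal_mult)
      then have 2: "m powr (- p) * V * Y powr (p - 1) \<le> A"
        using A(2)[OF Q] A0 by (simp add: ennreal_le_iff)
      have "\<alpha> powr p * V = 2 * (\<alpha> powr (p - 1) * m powr (-1) * V * (\<alpha> * m / 2))"
      proof -
        have "\<alpha> powr p = \<alpha> * \<alpha> powr (p - 1)" using \<alpha> powr_add[of \<alpha> 1 "p - 1"] by simp
        then show ?thesis using m by (simp add: powr_minus)
      qed
      also have "\<dots> \<le> 2 * (\<alpha> powr (p - 1) * m powr (-1) * V * (s powr (p - 1) * X))"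
        using 1 V(2) by (intro mult_left_mono) auto
      also have "\<dots> = 2 powr p * (m powr (- p) * V * Y powr (p - 1)) * X"
      proof -
        have "s powr (p - 1) = 2 powr (p - 1) * Y powr (p - 1) / (\<alpha> powr (p - 1) * m powr (p - 1))"
          using \<alpha> m Y(2) by (simp add: s_def powr_divide powr_mult)
        moreover have "m powr (- p) = m powr (-1) / m powr (p - 1)"
          using m powr_diff[of m "-1" "p - 1"] by simp
        moreover have "2 powr p = 2 * 2 powr (p - 1)" using powr_add[of 2 1 "p - 1"] by simp
        ultimately show ?thesis using \<alpha> by simp
      qed
      also have "\<dots> \<le> 2 powr p * A * X" using 2 X(2) by (intro mult_right_mono mult_left_mono) auto
      finally have "V \<le> 2 powr p * A * \<alpha> powr (- p) * X"
        using \<alpha> by (simp add: powr_minus field_simps)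
      then show ?thesis unfolding V(1) X(1) using A0 X(2) by (simp add: ennreal_leI flip: ennreal_mult)
    qed
  qed
qed

text \<open>The level set is covered by balls around local cubes with large average. Vitali's lemma makes them
  disjoint at the cost of a dilation, which doubling undoes, and \<open>Ap_cube_bound\<close> is summed over the
  disjoint cubes.\<close>

lemma local_maximal_weak_type:
  fixes w :: "real^'n \<Rightarrow> real"
  assumes inf: "w \<in> Ainf_loc" and w: "w \<in> Ap_loc p" and p: "1 < p"
  shows "weak_type w p local_maximal"
proof -
  let ?n = "CARD('n)"
  have wt: "weight w" using inf by (simp add: Ainf_loc_def)
  have [measurable]: "w \<in> borel_measurable lebesgue" by (rule weight_measurable[OF wt])
  obtain D where D: "1 \<le> D" "\<And>a l. 0 < l \<Longrightarrow> l \<le> 1 \<Longrightarrow>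
       wmeas w (cball a (5 * (real ?n * l))) \<le> ennreal D * wmeas w (cbox a (a + l *\<^sub>R One))"
    using Ainf_doubling[OF inf] by blast
  obtain C where C: "0 < C"
    "\<And>Q g \<alpha>. Q \<in> local_cubes \<Longrightarrow> g \<in> borel_measurable borel \<Longrightarrow> 0 < \<alpha> \<Longrightarrow>
       ennreal \<alpha> < (\<integral>\<^sup>+y\<in>Q. g y \<partial>lebesgue) / emeasure lebesgue Q \<Longrightarrow>
       wmeas w Q \<le> ennreal (C * \<alpha> powr (- p)) * (\<integral>\<^sup>+y\<in>Q. epowr (g y) p * ennreal (w y) \<partial>lebesgue)"
    using Ap_cube_bound[OF w p] by blast
  show ?thesis unfolding weak_type_def
  proof (intro exI conjI ballI allI impI)
    show "0 < D * C" using D C by simp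
    fix g :: "real^'n \<Rightarrow> ennreal" and \<alpha> :: real
    assume g[measurable]: "g \<in> borel_measurable borel" and \<alpha>: "0 < \<alpha>"
    have gl[measurable]: "g \<in> borel_measurable lebesgue" using g by (intro measurable_completion) simp
    define q where "q al = cbox (fst al) (fst al + snd al *\<^sub>R One)" for al :: "(real^'n) \<times> real"
    define I where "I = {al :: (real^'n) \<times> real. 0 < snd al \<and> snd al \<le> 1 \<and>
        ennreal \<alpha> < (\<integral>\<^sup>+y\<in>q al. g y \<partial>lebesgue) / emeasure lebesgue (q al)}"
    let ?r = "\<lambda>al :: (real^'n) \<times> real. real ?n * snd al"
    have qb: "q al \<subseteq> cball (fst al) (?r al)" if "al \<in> I" for al
    proof
      fix y assume y: "y \<in> q al"
      have "dist (fst al) y \<le> (\<Sum>i\<in>UNIV. \<bar>(fst al - y) $ i\<bar>)"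
        unfolding dist_norm by (rule norm_le_l1_cart)
      also have "\<dots> \<le> (\<Sum>i\<in>(UNIV::'n set). snd al)"
      proof (intro sum_mono)
        show "\<bar>(fst al - y) $ i\<bar> \<le> snd al" for i
          using y[unfolded q_def mem_cube_iff, THEN spec[of _ i]] by simp
      qed
      finally show "y \<in> cball (fst al) (?r al)" by simp
    qed
    have cov: "{x. ennreal \<alpha> < local_maximal g x} \<subseteq> (\<Union>al\<in>I. cball (fst al) (?r al))"
    proof
      fix x assume "x \<in> {x. ennreal \<alpha> < local_maximal g x}"
      then obtain Q where Q: "Q \<in> local_cubes" "x \<in> Q" "ennreal \<alpha> < (\<integral>\<^sup>+y\<in>Q. g y \<partial>lebesgue) / emeasure lebesgue Q"
        by (auto simp: local_maximal_def less_SUP_iff)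
      obtain a l where al: "Q = cbox a (a + l *\<^sub>R One)" "0 < l" "l \<le> 1"
        using local_cubesE[OF Q(1)] by metis
      then have "(a, l) \<in> I" "x \<in> q (a, l)" using Q by (auto simp: I_def q_def)
      then show "x \<in> (\<Union>al\<in>I. cball (fst al) (?r al))" using qb by blast
    qed
    obtain J where J: "countable J" "J \<subseteq> I"
      "pairwise (\<lambda>i j. disjnt (cball (fst i) (?r i)) (cball (fst j) (?r j))) J"
      "{x. ennreal \<alpha> < local_maximal g x} \<subseteq> (\<Union>i\<in>J. cball (fst i) (5 * ?r i))"
    proof (rule Vitali_covering_lemma_cballs[OF cov, where B="real ?n"])
      show "0 < ?r i \<and> ?r i \<le> real ?n" if "i \<in> I" for i
        using that by (auto simp: I_def)
    qed blast
    define S where "S = (\<Union>i\<in>J. cball (fst i) (5 * ?r i))"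
    let ?\<nu> = "density lebesgue (\<lambda>x. epowr (g x) p * ennreal (w x))"
    have Ssets: "S \<in> sets lebesgue" unfolding S_def using J(1) by (intro sets.countable_UN'') auto
    have qs: "q i \<in> sets lebesgue" for i by (simp add: q_def)
    have "wmeas w S = emeasure (density lebesgue (\<lambda>x. ennreal (w x))) S"
      by (rule wmeas_density[OF wt Ssets])
    also have "\<dots> \<le> (\<integral>\<^sup>+i. emeasure (density lebesgue (\<lambda>x. ennreal (w x))) (cball (fst i) (5 * ?r i)) \<partial>count_space J)"
      unfolding S_def by (rule emeasure_UN_le_count_space[OF J(1)]) auto
    also have "\<dots> \<le> (\<integral>\<^sup>+i. ennreal (D * C * \<alpha> powr (- p)) * emeasure ?\<nu> (q i) \<partial>count_space J)"
    proof (intro nn_integral_mono)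
      fix i assume "i \<in> space (count_space J)"
      then have i: "i \<in> I" using J(2) by auto
      have "emeasure (density lebesgue (\<lambda>x. ennreal (w x))) (cball (fst i) (5 * ?r i)) = wmeas w (cball (fst i) (5 * ?r i))"
        by (rule wmeas_density[OF wt, symmetric]) simp
      also have "\<dots> \<le> ennreal D * wmeas w (q i)"
        unfolding q_def using i by (intro D(2)) (auto simp: I_def)
      also have "\<dots> \<le> ennreal D * (ennreal (C * \<alpha> powr (- p)) * (\<integral>\<^sup>+y\<in>q i. epowr (g y) p * ennreal (w y) \<partial>lebesgue))"
      proof (rule mult_left_mono[OF C(2)[OF _ g \<alpha>]])
        show "q i \<in> local_cubes" using i by (auto simp: q_def I_def intro: local_cubesI)
      qed (use i in \<open>auto simp: I_def\<close>)
      also have "\<dots> = ennreal (D * C * \<alpha> powr (- p)) * emeasure ?\<nu> (q i)"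
        using C(1) D(1) qs by (simp add: emeasure_density ennreal_mult mult.assoc)
      finally show "emeasure (density lebesgue (\<lambda>x. ennreal (w x))) (cball (fst i) (5 * ?r i))
        \<le> ennreal (D * C * \<alpha> powr (- p)) * emeasure ?\<nu> (q i)" .
    qed
    also have "\<dots> = ennreal (D * C * \<alpha> powr (- p)) * (\<integral>\<^sup>+i. emeasure ?\<nu> (q i) \<partial>count_space J)"
      by (rule nn_integral_cmult) simp
    also have "(\<integral>\<^sup>+i. emeasure ?\<nu> (q i) \<partial>count_space J) = emeasure ?\<nu> (\<Union>i\<in>J. q i)"
    proof (rule emeasure_UN_countable[symmetric])
      show "disjoint_family_on q J"
        unfolding disjoint_family_on_def
      proof (intro ballI impI)
        fix i j assume ij: "i \<in> J" "j \<in> J" "i \<noteq> j"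
        then show "q i \<inter> q j = {}"
          using pairwiseD[OF J(3) ij] qb[of i] qb[of j] J(2) unfolding disjnt_def by blast
      qed
    qed (use J(1) qs in auto)
    finally have 1: "wmeas w S \<le> ennreal (D * C * \<alpha> powr (- p)) * emeasure ?\<nu> (\<Union>i\<in>J. q i)" .
    have "emeasure ?\<nu> (\<Union>i\<in>J. q i) \<le> emeasure ?\<nu> UNIV" by (rule emeasure_mono) auto
    also have "\<dots> = (\<integral>\<^sup>+x. epowr (g x) p * ennreal (w x) \<partial>lebesgue)" by (simp add: emeasure_density)
    finally have 2: "emeasure ?\<nu> (\<Union>i\<in>J. q i) \<le> (\<integral>\<^sup>+x. epowr (g x) p * ennreal (w x) \<partial>lebesgue)" .
    have "wmeas w S \<le> ennreal (D * C * \<alpha> powr (- p)) * (\<integral>\<^sup>+x. epowr (g x) p * ennreal (w x) \<partial>lebesgue)"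
      by (rule order_trans[OF 1 mult_left_mono[OF 2]]) simp
    then show "\<exists>S\<in>sets lebesgue. {x. ennreal \<alpha> < local_maximal g x} \<subseteq> S \<and>
      wmeas w S \<le> ennreal (D * C * \<alpha> powr (- p)) * (\<integral>\<^sup>+x. epowr (g x) p * ennreal (w x) \<partial>lebesgue)"
      using Ssets J(4) unfolding S_def by blast
  qed
qed

text \<open>If the infimum is only approached by the exponent 1, the inclusion of \<open>A\<^sub>1\<close> in the larger classes
  provides an exponent above 1.\<close>

lemma Ainf_Ap_near_crit_index:
  assumes w: "w \<in> Ainf_loc" and q: "crit_index w < q"
  obtains p where "1 < p" "p < q" "w \<in> Ap_loc p"
proof -
  have "{p. 1 \<le> p \<and> w \<in> Ap_loc p} \<noteq> {}" using Ainf_imp_Ap[OF w] by (auto intro: less_imp_le)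
  then obtain p where p: "1 \<le> p" "w \<in> Ap_loc p" "p < q"
    using cInf_lessD[OF _ q[unfolded crit_index_def]] by auto
  show ?thesis
  proof (cases "p = 1")
    case True
    then obtain p' where "1 < p'" "p' < q" using p(3) dense by blast
    then show ?thesis using that A1_imp_Ap p(2) True by blast
  next
    case False
    then show ?thesis using that[of p] p by auto
  qed
qed

lemma measurable_lebesgueI: "g \<in> borel_measurable borel \<Longrightarrow> g \<in> borel_measurable lebesgue"
  by (intro measurable_completion) simp

lemma exp_kernel_op_lborel:
  assumes [measurable]: "g \<in> borel_measurable borel"
  shows "exp_kernel_op B g x = (\<integral>\<^sup>+y. g y * ennreal (2 powr (- B * norm (x - y))) \<partial>lborel)"
  unfolding exp_kernel_op_def by (rule nn_integral_completion) measurable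

lemma measurable_exp_kernel_op:
  fixes g :: "real^'n \<Rightarrow> ennreal"
  assumes [measurable]: "g \<in> borel_measurable borel"
  shows "exp_kernel_op B g \<in> borel_measurable borel"
proof -
  have "(\<lambda>x. \<integral>\<^sup>+y. g y * ennreal (2 powr (- B * norm (x - y))) \<partial>lborel) \<in> borel_measurable borel"
    by measurable
  then show ?thesis by (simp add: exp_kernel_op_lborel[OF assms, abs_def])
qed

text \<open>The admissibility condition speaks of finite-valued functions. Applied with \<open>q = \<infinity>\<close> to the sequence
  of truncations \<open>min g j\<close> it covers functions with infinite values, since the suprema on both
  sides are monotone limits.\<close>

lemma exp_kernel_op_Lp:
  fixes w :: "real^'n \<Rightarrow> real"
  assumes B0: "admissible_B0 w B0" and p: "1 < p" and w: "w \<in> Ap_loc p" and B: "B0 / p \<le> B"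
  obtains C where "0 < C"
    "\<And>g. g \<in> borel_measurable borel \<Longrightarrow>
      (\<integral>\<^sup>+x. epowr (exp_kernel_op B g x) p * ennreal (w x) \<partial>lebesgue)
      \<le> ennreal C * (\<integral>\<^sup>+x. epowr (g x) p * ennreal (w x) \<partial>lebesgue)"
proof -
  have "(1::ennreal) < top" by simp
  then obtain C where C: "0 < C" "\<And>g :: nat \<Rightarrow> real^'n \<Rightarrow> complex. (\<And>j. g j \<in> borel_measurable lebesgue) \<Longrightarrow>
          Lp_norm p w (\<lambda>x. lq_norm top (\<lambda>j. exp_kernel_op B (\<lambda>y. ennreal (cmod (g j y))) x)) \<le>
          ennreal C * Lp_norm p w (\<lambda>x. lq_norm top (\<lambda>j. ennreal (cmod (g j x))))"
    using B0 p w B unfolding admissible_B0_def by meson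
  show ?thesis
  proof
    show "0 < C powr p" using C(1) by simp
    fix g :: "real^'n \<Rightarrow> ennreal" assume g[measurable]: "g \<in> borel_measurable borel"
    define h where "h j y = min (g y) (ennreal (real j))" for j y
    have hm[measurable]: "h j \<in> borel_measurable borel" for j unfolding h_def by measurable
    have hfin: "h j y < top" for j y by (auto simp: h_def min_less_iff_disj)
    have sup: "(SUP j. h j y) = g y" for y
    proof -
      have "(SUP j. h j y) = inf (g y) (SUP j. ennreal (real j))"
        unfolding h_def inf_min[symmetric] by (rule inf_SUP[symmetric])
      also have "(SUP j. ennreal (real j)) = (top::ennreal)"
        using ennreal_SUP_of_nat_eq_top by (simp add: ennreal_of_nat_eq_real_of_nat)
      finally show ?thesis by simp
    qed
    have inc: "incseq (\<lambda>j. h j y)" for y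
      by (rule monoI) (auto simp: h_def min_def intro: order_trans[OF _ ennreal_leI])
    define f where "f j y = complex_of_real (enn2real (h j y))" for j y
    have "(\<lambda>y. enn2real (h j y)) \<in> borel_measurable lebesgue" for j
      by (intro measurable_completion) (simp, measurable)
    then have fm: "f j \<in> borel_measurable lebesgue" for j
      unfolding f_def by (rule measurable_compose[OF _ borel_measurable_of_real])
    have fh: "ennreal (cmod (f j y)) = h j y" for j y
      using hfin[of j y] by (simp add: f_def)
    have K: "(SUP j. exp_kernel_op B (h j) x) = exp_kernel_op B g x" for x
    proof -
      have "exp_kernel_op B g x = (\<integral>\<^sup>+y. (SUP j. h j y * ennreal (2 powr (- B * norm (x - y)))) \<partial>lborel)"
        unfolding exp_kernel_op_lborel[OF g] by (simp add: SUP_mult_right_ennreal[symmetric] sup)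
      also have "\<dots> = (SUP j. \<integral>\<^sup>+y. h j y * ennreal (2 powr (- B * norm (x - y))) \<partial>lborel)"
      proof (rule nn_integral_monotone_convergence_SUP)
        show "incseq (\<lambda>j y. h j y * ennreal (2 powr (- B * norm (x - y))))"
          using inc by (auto simp: incseq_def le_fun_def intro!: mult_right_mono)
      qed measurable
      also have "\<dots> = (SUP j. exp_kernel_op B (h j) x)"
        by (simp add: exp_kernel_op_lborel)
      finally show ?thesis by simp
    qed
    have "Lp_norm p w (exp_kernel_op B g) \<le> ennreal C * Lp_norm p w g"
      using C(2)[of f, OF fm] by (simp add: fh lq_norm_def K sup)
    then have "epowr (Lp_norm p w (exp_kernel_op B g)) p \<le> epowr (ennreal C * Lp_norm p w g) p"
      using p by (intro epowr_mono) auto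
    then show "(\<integral>\<^sup>+x. epowr (exp_kernel_op B g x) p * ennreal (w x) \<partial>lebesgue)
      \<le> ennreal (C powr p) * (\<integral>\<^sup>+x. epowr (g x) p * ennreal (w x) \<partial>lebesgue)"
      using p C(1) by (simp add: epowr_mult Lp_norm_def epowr_epowr epowr_one epowr_ennreal)
  qed
qed

lemma ennreal_less_imp_powr_le:
  assumes "ennreal \<alpha> < x" "0 < \<alpha>" "0 < p"
  shows "ennreal (\<alpha> powr p) \<le> epowr x p"
  using epowr_mono[of p "ennreal \<alpha>" x] assms by (simp add: epowr_ennreal)

lemma exp_kernel_op_weak_type:
  fixes w :: "real^'n \<Rightarrow> real"
  assumes B0: "admissible_B0 w B0" and p: "1 < p" and w: "w \<in> Ap_loc p" and B: "B0 / p \<le> B"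
  shows "weak_type w p (exp_kernel_op B)"
proof -
  have wt: "weight w" using w by (simp add: Ap_loc_def)
  have [measurable]: "w \<in> borel_measurable lebesgue" by (rule weight_measurable[OF wt])
  obtain C where C: "0 < C"
    "\<And>g. g \<in> borel_measurable borel \<Longrightarrow>
      (\<integral>\<^sup>+x. epowr (exp_kernel_op B g x) p * ennreal (w x) \<partial>lebesgue)
      \<le> ennreal C * (\<integral>\<^sup>+x. epowr (g x) p * ennreal (w x) \<partial>lebesgue)"
    using exp_kernel_op_Lp[OF B0 p w B] by blast
  show ?thesis unfolding weak_type_def
  proof (intro exI conjI ballI allI impI)
    show "0 < C" by fact
    fix g :: "real^'n \<Rightarrow> ennreal" and \<alpha> :: real
    assume g[measurable]: "g \<in> borel_measurable borel" and \<alpha>: "0 < \<alpha>"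
    have Km[measurable]: "exp_kernel_op B g \<in> borel_measurable borel" by (rule measurable_exp_kernel_op[OF g])
    let ?S = "{x. ennreal \<alpha> < exp_kernel_op B g x}"
    have "?S \<in> sets borel" by measurable
    then have S[measurable]: "?S \<in> sets lebesgue" by auto
    have "ennreal (\<alpha> powr p) * wmeas w ?S = (\<integral>\<^sup>+x. ennreal (\<alpha> powr p) * (ennreal (w x) * indicator ?S x) \<partial>lebesgue)"
      unfolding wmeas_def by (rule nn_integral_cmult[symmetric]) measurable
    also have "\<dots> \<le> (\<integral>\<^sup>+x. epowr (exp_kernel_op B g x) p * ennreal (w x) \<partial>lebesgue)"
      using ennreal_less_imp_powr_le[OF _ \<alpha>] p
      by (intro nn_integral_mono) (auto simp: indicator_def intro!: mult_right_mono)
    also have "\<dots> \<le> ennreal C * (\<integral>\<^sup>+x. epowr (g x) p * ennreal (w x) \<partial>lebesgue)" by (rule C(2)[OF g])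
    finally have 1: "ennreal (\<alpha> powr p) * wmeas w ?S \<le> ennreal C * (\<integral>\<^sup>+x. epowr (g x) p * ennreal (w x) \<partial>lebesgue)" .
    have "wmeas w ?S = ennreal (\<alpha> powr (- p)) * (ennreal (\<alpha> powr p) * wmeas w ?S)"
      using \<alpha> by (simp add: mult.assoc[symmetric] powr_add[symmetric] flip: ennreal_mult)
    also have "\<dots> \<le> ennreal (\<alpha> powr (- p)) * (ennreal C * (\<integral>\<^sup>+x. epowr (g x) p * ennreal (w x) \<partial>lebesgue))"
      by (rule mult_left_mono[OF 1]) simp
    also have "\<dots> = ennreal (C * \<alpha> powr (- p)) * (\<integral>\<^sup>+x. epowr (g x) p * ennreal (w x) \<partial>lebesgue)"
      using C(1) by (simp add: ennreal_mult mult_ac)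
    finally show "\<exists>S\<in>sets lebesgue. ?S \<subseteq> S \<and> wmeas w S \<le> ennreal (C * \<alpha> powr (- p)) * (\<integral>\<^sup>+x. epowr (g x) p * ennreal (w x) \<partial>lebesgue)"
      using S by blast
  qed
qed

lemma weak_type_add:
  fixes w :: "real^'n \<Rightarrow> real"
  assumes wt: "weight w" and S: "weak_type w p S" and T: "weak_type w p T" and p: "0 < p" and c: "0 < c"
  shows "weak_type w p (\<lambda>g x. ennreal c * (S g x + T g x))"
proof -
  obtain C where C: "0 < C" "\<And>g \<alpha>. g\<in>borel_measurable borel \<Longrightarrow> 0 < \<alpha> \<Longrightarrow> \<exists>E\<in>sets lebesgue.
     {x. ennreal \<alpha> < S g x} \<subseteq> E \<and>
     wmeas w E \<le> ennreal (C * \<alpha> powr (- p)) * (\<integral>\<^sup>+x. epowr (g x) p * ennreal (w x) \<partial>lebesgue)"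
    using S unfolding weak_type_def by blast
  obtain D where D: "0 < D" "\<And>g \<alpha>. g\<in>borel_measurable borel \<Longrightarrow> 0 < \<alpha> \<Longrightarrow> \<exists>E\<in>sets lebesgue.
     {x. ennreal \<alpha> < T g x} \<subseteq> E \<and>
     wmeas w E \<le> ennreal (D * \<alpha> powr (- p)) * (\<integral>\<^sup>+x. epowr (g x) p * ennreal (w x) \<partial>lebesgue)"
    using T unfolding weak_type_def by blast
  show ?thesis unfolding weak_type_def
  proof (intro exI conjI ballI allI impI)
    show "0 < (C + D) * (1 / (2 * c)) powr (- p)" using C D c by simp
    fix g :: "real^'n \<Rightarrow> ennreal" and \<alpha> :: real
    assume g: "g \<in> borel_measurable borel" and \<alpha>: "0 < \<alpha>"
    define \<beta> where "\<beta> = \<alpha> * (1 / (2 * c))"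
    have \<beta>: "0 < \<beta>" using \<alpha> c by (simp add: \<beta>_def)
    let ?I = "\<integral>\<^sup>+x. epowr (g x) p * ennreal (w x) \<partial>lebesgue"
    obtain E where E: "E \<in> sets lebesgue" "{x. ennreal \<beta> < S g x} \<subseteq> E" "wmeas w E \<le> ennreal (C * \<beta> powr (- p)) * ?I"
      using C(2)[OF g \<beta>] by blast
    obtain F where F: "F \<in> sets lebesgue" "{x. ennreal \<beta> < T g x} \<subseteq> F" "wmeas w F \<le> ennreal (D * \<beta> powr (- p)) * ?I"
      using D(2)[OF g \<beta>] by blast
    have "{x. ennreal \<alpha> < ennreal c * (S g x + T g x)} \<subseteq> E \<union> F"
    proof
      fix x assume x: "x \<in> {x. ennreal \<alpha> < ennreal c * (S g x + T g x)}"
      show "x \<in> E \<union> F"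
      proof (rule ccontr)
        assume "x \<notin> E \<union> F"
        then have "S g x \<le> ennreal \<beta>" "T g x \<le> ennreal \<beta>" using E(2) F(2) by (auto simp: not_less[symmetric])
        then have "ennreal c * (S g x + T g x) \<le> ennreal c * (ennreal \<beta> + ennreal \<beta>)"
          by (intro mult_left_mono add_mono) auto
        also have "\<dots> = ennreal \<alpha>" using \<beta> c by (simp add: \<beta>_def flip: ennreal_plus ennreal_mult)
        finally show False using x by simp
      qed
    qed
    moreover have "wmeas w (E \<union> F) \<le> ennreal ((C + D) * (1 / (2 * c)) powr (- p) * \<alpha> powr (- p)) * ?I"
    proof -
      have "wmeas w (E \<union> F) \<le> wmeas w E + wmeas w F"
        using E(1) F(1) by (simp add: wmeas_density[OF wt] emeasure_subadditive)
      also have "\<dots> \<le> ennreal (C * \<beta> powr (- p)) * ?I + ennreal (D * \<beta> powr (- p)) * ?I"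
        by (rule add_mono[OF E(3) F(3)])
      also have "\<dots> = ennreal ((C + D) * \<beta> powr (- p)) * ?I"
        using C D by (simp add: distrib_right[symmetric] flip: ennreal_plus)
      also have "(C + D) * \<beta> powr (- p) = (C + D) * (1 / (2 * c)) powr (- p) * \<alpha> powr (- p)"
      proof -
        have "\<beta> powr (- p) = \<alpha> powr (- p) * (1 / (2 * c)) powr (- p)"
          unfolding \<beta>_def by (rule powr_mult)
        then show ?thesis by (simp only: mult_ac)
      qed
      finally show ?thesis .
    qed
    ultimately show "\<exists>Sa\<in>sets lebesgue. {x. ennreal \<alpha> < ennreal c * (S g x + T g x)} \<subseteq> Sa \<and>
      wmeas w Sa \<le> ennreal ((C + D) * (1 / (2 * c)) powr (- p) * \<alpha> powr (- p)) * ?I"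
      using E(1) F(1) by (meson sets.Un)
  qed
qed

section \<open>Interpolation in Orlicz classes\<close>

text \<open>Series over the integers are written as integrals for the counting measure, so that they can be
  interchanged with integrals by Tonelli's theorem.\<close>

lemma nn_integral_geometric_int:
  fixes u d :: real
  assumes u: "0 < u" and d: "0 < d"
  shows "(\<integral>\<^sup>+k. ennreal (if 2 powr real_of_int k < u then 2 powr (d * real_of_int k) else 0) \<partial>count_space UNIV)
    \<le> ennreal (u powr d / (1 - 2 powr (- d)))"
proof -
  define K where "K = \<lceil>log 2 u\<rceil> - 1"
  have K: "2 powr real_of_int k < u \<longleftrightarrow> k \<le> K" for k
  proof -
    have "2 powr real_of_int k < u \<longleftrightarrow> real_of_int k < log 2 u" using u by (simp add: less_log_iff)
    also have "\<dots> \<longleftrightarrow> k < \<lceil>log 2 u\<rceil>" by (simp add: less_ceiling_iff)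
    finally show ?thesis by (simp add: K_def)
  qed
  have q: "0 < 2 powr (- d)" "2 powr (- d) < (1::real)" using d by (auto simp: powr_less_one)
  have "(\<integral>\<^sup>+k. ennreal (if 2 powr real_of_int k < u then 2 powr (d * real_of_int k) else 0) \<partial>count_space UNIV)
    = (\<integral>\<^sup>+k. ennreal (2 powr (d * real_of_int k)) \<partial>count_space {..K})"
    unfolding K by (subst (2) nn_integral_count_space_indicator) (auto intro!: nn_integral_cong simp: indicator_def)
  also have "\<dots> = (\<integral>\<^sup>+i. ennreal (2 powr (d * real_of_int (K - int i))) \<partial>count_space UNIV)"
  proof (rule nn_integral_bij_count_space[symmetric])
    show "bij_betw (\<lambda>i. K - int i) UNIV {..K}"
      by (rule bij_betw_byWitness[where f'="\<lambda>k. nat (K - k)"]) auto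
  qed
  also have "\<dots> = (\<Sum>i. ennreal (2 powr (d * real_of_int K) * (2 powr (- d)) ^ i))"
  proof (subst nn_integral_count_space_nat, rule arg_cong[where f=suminf], rule ext)
    fix i
    have "2 powr (d * real_of_int (K - int i)) = 2 powr (d * real_of_int K + (- d) * real i)"
      by (simp add: algebra_simps)
    also have "\<dots> = 2 powr (d * real_of_int K) * (2 powr (- d)) ^ i"
    proof -
      have "(2 powr (- d)) ^ i = (2 powr (- d)) powr real i" by (simp add: powr_realpow)
      then show ?thesis unfolding powr_add powr_powr by simp
    qed
    finally show "ennreal (2 powr (d * real_of_int (K - int i))) = ennreal (2 powr (d * real_of_int K) * (2 powr (- d)) ^ i)"
      by simp
  qed
  also have "\<dots> = ennreal (2 powr (d * real_of_int K) * (1 / (1 - 2 powr (- d))))"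
    using q by (intro suminf_ennreal_eq sums_mult geometric_sums) auto
  also have "\<dots> \<le> ennreal (u powr d / (1 - 2 powr (- d)))"
  proof (intro ennreal_leI)
    have "(2 powr real_of_int K) powr d \<le> u powr d"
      using K[of K] d by (intro powr_mono2) auto
    then show "2 powr (d * real_of_int K) * (1 / (1 - 2 powr (- d))) \<le> u powr d / (1 - 2 powr (- d))"
      using q by (simp add: powr_powr mult.commute divide_right_mono)
  qed
  finally show ?thesis .
qed

lemma orlicz_pos: "orlicz_function \<Phi> \<Longrightarrow> 0 < t \<Longrightarrow> 0 < \<Phi> t"
  by (simp add: orlicz_function_def)

lemma orlicz_mono: "orlicz_function \<Phi> \<Longrightarrow> 0 < s \<Longrightarrow> s \<le> t \<Longrightarrow> \<Phi> s \<le> \<Phi> t"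
  unfolding orlicz_function_def using strict_mono_on_leD[of "{0<..}" \<Phi> s t] by auto

lemma orlicz_nat_mult:
  assumes "orlicz_function \<Phi>" "0 < t"
  shows "\<Phi> (real (Suc m) * t) \<le> real (Suc m) * \<Phi> t"
proof (induction m)
  case (Suc m)
  have "\<Phi> (real (Suc m) * t + t) \<le> \<Phi> (real (Suc m) * t) + \<Phi> t"
    using assms unfolding orlicz_function_def by simp
  then show ?case using Suc by (simp add: algebra_simps)
qed simp

lemma orlicz_ext_mono:
  assumes \<Phi>: "orlicz_function \<Phi>" and uv: "u \<le> v"
  shows "orlicz_ext \<Phi> u \<le> orlicz_ext \<Phi> v"
proof (cases "u = 0 \<or> v = top")
  case False
  then have v: "v \<noteq> top" "u \<noteq> top" "u \<noteq> 0" "v \<noteq> 0" using uv by (auto simp: top_unique)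
  then have "0 < enn2real u" "enn2real u \<le> enn2real v"
    using uv by (auto intro: enn2real_mono simp: enn2real_positive_iff top.not_eq_extremum zero_less_iff_neq_zero)
  then show ?thesis
    using v orlicz_mono[OF \<Phi>] by (auto simp: orlicz_ext_def intro!: ennreal_leI)
qed (auto simp: orlicz_ext_def)

lemma measurable_orlicz_ext:
  assumes \<Phi>: "orlicz_function \<Phi>" and g[measurable]: "g \<in> borel_measurable M"
  shows "(\<lambda>x. orlicz_ext \<Phi> (g x)) \<in> borel_measurable M"
proof -
  have [measurable]: "(\<lambda>x. if x \<in> {0<..} then \<Phi> x else 0) \<in> borel_measurable borel"
    using \<Phi> unfolding orlicz_function_def by (intro borel_measurable_continuous_on_if) auto
  have eq: "orlicz_ext \<Phi> u = (if u = 0 then 0 else if u = top then top else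
      ennreal ((\<lambda>x. if x \<in> {0<..} then \<Phi> x else 0) (enn2real u)))" for u
    by (auto simp: orlicz_ext_def enn2real_positive_iff top.not_eq_extremum zero_less_iff_neq_zero)
  show ?thesis unfolding eq by measurable
qed

text \<open>A discrete layer-cake formula. It holds at \<open>\<infinity>\<close> too: each of the infinitely many terms
  with \<open>k \<ge> 0\<close> is at least \<open>\<Phi> 1 > 0\<close>.\<close>

lemma orlicz_ext_dyadic:
  assumes \<Phi>: "orlicz_function \<Phi>"
  shows "orlicz_ext \<Phi> v \<le> (\<integral>\<^sup>+k. ennreal (\<Phi> (2 powr (real_of_int k + 1))) * indicator {k. ennreal (2 powr real_of_int k) < v} k \<partial>count_space UNIV)"
proof (cases v)
  case (real r)
  show ?thesis
  proof (cases "r = 0")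
    case True
    then show ?thesis using real by (simp add: orlicz_ext_def)
  next
    case False
    then have r: "0 < r" using real by simp
    define k where "k = \<lceil>log 2 r\<rceil> - 1"
    have "real_of_int k < log 2 r" "log 2 r \<le> real_of_int k + 1" unfolding k_def by linarith+
    then have k: "2 powr real_of_int k < r" "r \<le> 2 powr (real_of_int k + 1)"
      using r by (auto simp: less_log_iff log_le_iff)
    have "orlicz_ext \<Phi> v = ennreal (\<Phi> r)" using real r by (simp add: orlicz_ext_def)
    also have "\<dots> \<le> ennreal (\<Phi> (2 powr (real_of_int k + 1))) * indicator {k. ennreal (2 powr real_of_int k) < v} k"
      using k real r by (auto simp: indicator_def ennreal_less_iff intro!: ennreal_leI orlicz_mono[OF \<Phi>])
    also have "\<dots> \<le> (\<integral>\<^sup>+k. ennreal (\<Phi> (2 powr (real_of_int k + 1))) * indicator {k. ennreal (2 powr real_of_int k) < v} k \<partial>count_space UNIV)"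
      by (rule nn_integral_ge_point) simp
    finally show ?thesis .
  qed
next
  case top
  have "infinite {0::int..}" by (simp add: infinite_Ici)
  then have "ennreal (\<Phi> 1) * emeasure (count_space UNIV) {0::int..} = top"
    using orlicz_pos[OF \<Phi>, of 1] by (simp add: ennreal_mult_top)
  moreover have "ennreal (\<Phi> 1) * emeasure (count_space UNIV) {0::int..} = (\<integral>\<^sup>+k. ennreal (\<Phi> 1) * indicator {0::int..} k \<partial>count_space UNIV)"
    by (rule nn_integral_cmult_indicator[symmetric]) simp
  moreover have "\<dots> \<le> (\<integral>\<^sup>+k. ennreal (\<Phi> (2 powr (real_of_int k + 1))) * indicator {k. ennreal (2 powr real_of_int k) < v} k \<partial>count_space UNIV)"
    using top by (intro nn_integral_mono)
      (auto simp: indicator_def intro!: ennreal_leI orlicz_mono[OF \<Phi>] ge_one_powr_ge_zero)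
  ultimately show ?thesis by (simp add: top_unique)
qed

lemma lower_type_mult:
  assumes "lower_type \<Phi> p" "0 < t" "t < 1" "0 < s"
  shows "\<Phi> (s * t) \<le> t powr p * \<Phi> s"
  using assms by (auto simp: lower_type_def)

text \<open>The condition on \<open>k\<close> says \<open>2\<^sup>k < u\<close> with \<open>u = c\<^sup>1\<^sup>/\<^sup>r g\<close>. The lower type gives
  \<open>\<Phi>(2\<^sup>k\<^sup>+\<^sup>1) \<le> (2\<^sup>k / u)\<^sup>p\<^sup>0 \<Phi>(2 u)\<close>, so the terms are dominated by a geometric series
  with exponent \<open>p0 - r p > 0\<close>, summed up to its largest term \<open>2\<^sup>k \<approx> u\<close>.\<close>

lemma orlicz_dyadic_sum_bound:
  fixes c r p p0 :: real
  assumes \<Phi>: "orlicz_function \<Phi>" and lt: "lower_type \<Phi> p0" and r: "0 < r" and p: "0 < p" "r * p < p0" and c: "0 < c"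
  obtains C where "0 < C"
    "\<And>g. (\<integral>\<^sup>+k. ennreal (\<Phi> (2 powr (real_of_int k + 1)) * 2 powr (- (r * p * real_of_int k))) *
        (if ennreal (2 powr (r * real_of_int k) / c) < epowr g r then epowr g (r * p) else 0) \<partial>count_space UNIV) \<le> ennreal C * orlicz_ext \<Phi> g"
proof -
  define d where "d = p0 - r * p"
  have d: "0 < d" using p by (simp add: d_def)
  define b where "b = c powr (1 / r)"
  have b: "0 < b" using c by (simp add: b_def)
  obtain m where m: "2 * b \<le> real (Suc m)" by (meson real_arch_simple order_trans of_nat_mono le_add2 Suc_leD le_refl le_SucI)
  have q: "0 < 1 - 2 powr (- d)" using d by (simp add: powr_less_one)
  define C where "C = real (Suc m) / (1 - 2 powr (- d)) * b powr (- (r * p))"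
  have C: "0 < C" using q b by (simp add: C_def)
  show ?thesis
  proof
    show "0 < C" by fact
    fix g :: ennreal
    show "(\<integral>\<^sup>+k. ennreal (\<Phi> (2 powr (real_of_int k + 1)) * 2 powr (- (r * p * real_of_int k))) *
        (if ennreal (2 powr (r * real_of_int k) / c) < epowr g r then epowr g (r * p) else 0) \<partial>count_space UNIV) \<le> ennreal C * orlicz_ext \<Phi> g"
    proof (cases g)
      case top
      then show ?thesis using C by (simp add: orlicz_ext_def ennreal_mult_top)
    next
      case (real x)
      show ?thesis
      proof (cases "x = 0")
        case True
        then show ?thesis using real r by (simp add: epowr_def)
      next
        case False
        then have x: "0 < x" using real by simp
        define u where "u = b * x"
        have u: "0 < u" using b x by (simp add: u_def)
        have lev: "2 powr (r * real_of_int k) / c < x powr r \<longleftrightarrow> 2 powr real_of_int k < u" for k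
        proof -
          have "u powr r = c * x powr r" using b c x r by (simp add: u_def powr_mult b_def powr_powr)
          moreover have "2 powr (r * real_of_int k) = (2 powr real_of_int k) powr r" by (simp add: powr_powr mult.commute)
          moreover have "(2 powr real_of_int k) powr r < u powr r \<longleftrightarrow> 2 powr real_of_int k < u"
            using powr_less_mono2[of r "2 powr real_of_int k" u] powr_mono2[of r u "2 powr real_of_int k"] r u by fastforce
          ultimately show ?thesis using c by (simp add: field_simps)
        qed
        have bound: "\<Phi> (2 powr (real_of_int k + 1)) * 2 powr (- (r * p * real_of_int k)) * x powr (r * p)
            \<le> (\<Phi> (2 * u) * u powr (- p0) * x powr (r * p)) * 2 powr (d * real_of_int k)" if k: "2 powr real_of_int k < u" for k
        proof -
          let ?t = "2 powr real_of_int k / u"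
          have "\<Phi> ((2 * u) * ?t) \<le> ?t powr p0 * \<Phi> (2 * u)"
            using k u by (intro lower_type_mult[OF lt]) auto
          moreover have "(2 * u) * ?t = 2 powr (real_of_int k + 1)" using u by (simp add: powr_add)
          moreover have "?t powr p0 = 2 powr (p0 * real_of_int k) * u powr (- p0)"
          proof -
            have "?t powr p0 = (2 powr real_of_int k) powr p0 / u powr p0" by (rule powr_divide)
            then show ?thesis by (simp add: powr_powr powr_minus_divide mult.commute)
          qed
          ultimately have "\<Phi> (2 powr (real_of_int k + 1)) \<le> 2 powr (p0 * real_of_int k) * u powr (- p0) * \<Phi> (2 * u)" by simp
          then have "\<Phi> (2 powr (real_of_int k + 1)) * (2 powr (- (r * p * real_of_int k)) * x powr (r * p))
              \<le> (2 powr (p0 * real_of_int k) * u powr (- p0) * \<Phi> (2 * u)) * (2 powr (- (r * p * real_of_int k)) * x powr (r * p))"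
            by (rule mult_right_mono) simp
          moreover have "2 powr (d * real_of_int k) = 2 powr (p0 * real_of_int k) * 2 powr (- (r * p * real_of_int k))"
            unfolding powr_add[symmetric] by (simp add: d_def algebra_simps)
          ultimately show ?thesis by (simp add: mult_ac)
        qed
        have "(\<integral>\<^sup>+k. ennreal (\<Phi> (2 powr (real_of_int k + 1)) * 2 powr (- (r * p * real_of_int k))) *
            (if ennreal (2 powr (r * real_of_int k) / c) < epowr g r then epowr g (r * p) else 0) \<partial>count_space UNIV)
          \<le> (\<integral>\<^sup>+k. ennreal (\<Phi> (2 * u) * u powr (- p0) * x powr (r * p)) *
              ennreal (if 2 powr real_of_int k < u then 2 powr (d * real_of_int k) else 0) \<partial>count_space UNIV)"
        proof (rule nn_integral_mono)
          fix k :: int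
          have Pk: "0 < \<Phi> (2 powr (real_of_int k + 1))" by (rule orlicz_pos[OF \<Phi>]) simp
          have Pu: "0 < \<Phi> (2 * u)" by (rule orlicz_pos[OF \<Phi>]) (use u in simp)
          have iff: "ennreal (2 powr (r * real_of_int k) / c) < epowr g r \<longleftrightarrow> 2 powr real_of_int k < u"
            using lev[of k] x real c by (simp add: epowr_ennreal ennreal_less_iff)
          show "ennreal (\<Phi> (2 powr (real_of_int k + 1)) * 2 powr (- (r * p * real_of_int k))) *
              (if ennreal (2 powr (r * real_of_int k) / c) < epowr g r then epowr g (r * p) else 0)
            \<le> ennreal (\<Phi> (2 * u) * u powr (- p0) * x powr (r * p)) *
              ennreal (if 2 powr real_of_int k < u then 2 powr (d * real_of_int k) else 0)"
          proof (cases "2 powr real_of_int k < u")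
            case True
            have "ennreal (\<Phi> (2 powr (real_of_int k + 1)) * 2 powr (- (r * p * real_of_int k))) * epowr g (r * p)
              = ennreal (\<Phi> (2 powr (real_of_int k + 1)) * 2 powr (- (r * p * real_of_int k)) * x powr (r * p))"
              using Pk real by (simp add: epowr_ennreal ennreal_mult)
            also have "\<dots> \<le> ennreal ((\<Phi> (2 * u) * u powr (- p0) * x powr (r * p)) * 2 powr (d * real_of_int k))"
              by (rule ennreal_leI[OF bound[OF True]])
            also have "\<dots> = ennreal (\<Phi> (2 * u) * u powr (- p0) * x powr (r * p)) * ennreal (2 powr (d * real_of_int k))"
              using Pu by (intro ennreal_mult) auto
            finally show ?thesis using True iff by simp
          qed (simp add: iff)
        qed
        also have "\<dots> = ennreal (\<Phi> (2 * u) * u powr (- p0) * x powr (r * p)) *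
            (\<integral>\<^sup>+k. ennreal (if 2 powr real_of_int k < u then 2 powr (d * real_of_int k) else 0) \<partial>count_space UNIV)"
          by (rule nn_integral_cmult) simp
        also have "\<dots> \<le> ennreal (\<Phi> (2 * u) * u powr (- p0) * x powr (r * p)) * ennreal (u powr d / (1 - 2 powr (- d)))"
          by (rule mult_left_mono[OF nn_integral_geometric_int[OF u d]]) simp
        also have "\<dots> = ennreal (\<Phi> (2 * u) * (u powr (- p0) * u powr d * x powr (r * p) / (1 - 2 powr (- d))))"
          using orlicz_pos[OF \<Phi>, of "2 * u"] u q by (simp add: mult_ac flip: ennreal_mult)
        also have "u powr (- p0) * u powr d * x powr (r * p) / (1 - 2 powr (- d)) = b powr (- (r * p)) / (1 - 2 powr (- d))"
        proof -
          have "u powr (- p0) * u powr d = u powr (- (r * p))" unfolding powr_add[symmetric] by (simp add: d_def)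
          also have "\<dots> = b powr (- (r * p)) * x powr (- (r * p))" using b x by (simp add: u_def powr_mult)
          finally show ?thesis using x by (simp add: powr_minus)
        qed
        also have "ennreal (\<Phi> (2 * u) * (b powr (- (r * p)) / (1 - 2 powr (- d)))) \<le> ennreal (C * \<Phi> x)"
        proof (rule ennreal_leI)
          have "\<Phi> (2 * u) \<le> \<Phi> (real (Suc m) * x)"
            using u x m by (intro orlicz_mono[OF \<Phi>]) (auto simp: u_def mult.assoc[symmetric] intro!: mult_right_mono)
          also have "\<dots> \<le> real (Suc m) * \<Phi> x" by (rule orlicz_nat_mult[OF \<Phi> x])
          finally have "\<Phi> (2 * u) * (b powr (- (r * p)) / (1 - 2 powr (- d))) \<le> (real (Suc m) * \<Phi> x) * (b powr (- (r * p)) / (1 - 2 powr (- d)))"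
            using q by (intro mult_right_mono) auto
          also have "\<dots> = C * \<Phi> x" by (simp add: C_def)
          finally show "\<Phi> (2 * u) * (b powr (- (r * p)) / (1 - 2 powr (- d))) \<le> C * \<Phi> x" .
        qed
        also have "\<dots> = ennreal C * orlicz_ext \<Phi> g"
          using real x C orlicz_pos[OF \<Phi> x] by (simp add: orlicz_ext_def ennreal_mult)
        finally show ?thesis .
      qed
    qed
  qed
qed

text \<open>Marcinkiewicz interpolation between the weak type \<open>(p, p)\<close> and the bound on bounded functions. At the
  level \<open>2\<^sup>k\<close> the function \<open>g\<^sup>r\<close> is cut at a multiple of \<open>2\<^sup>k\<^sup>r\<close> chosen such that the image of the lower part
  stays below half the level; the weak type is applied to the upper part, and the sum over \<open>k\<close> is
  carried out pointwise by \<open>orlicz_dyadic_sum_bound\<close>.\<close>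

lemma orlicz_weak_type_interpolation:
  fixes w :: "real^'n \<Rightarrow> real" and T :: "(real^'n \<Rightarrow> ennreal) \<Rightarrow> real^'n \<Rightarrow> ennreal"
  assumes \<Phi>: "orlicz_function \<Phi>" and lt: "lower_type \<Phi> p0" and wt: "weight w"
    and r: "0 < r" and p: "0 < p" "r * p < p0"
    and weak: "weak_type w p T"
    and sub: "\<And>f g x. f \<in> borel_measurable borel \<Longrightarrow> g \<in> borel_measurable borel \<Longrightarrow>
        T (\<lambda>y. f y + g y) x \<le> T f x + T g x"
    and bd: "\<And>f s x. 0 \<le> s \<Longrightarrow> (\<And>y. f y \<le> ennreal s) \<Longrightarrow> T f x \<le> ennreal (c * s)"
    and c: "0 < c"
  obtains C where "0 < C"
    "\<And>g. g \<in> borel_measurable borel \<Longrightarrow>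
       (\<integral>\<^sup>+x. orlicz_ext \<Phi> (epowr (T (\<lambda>y. epowr (g y) r) x) (1 / r)) * ennreal (w x) \<partial>lebesgue)
       \<le> ennreal C * (\<integral>\<^sup>+x. orlicz_ext \<Phi> (g x) * ennreal (w x) \<partial>lebesgue)"
proof -
  have [measurable]: "w \<in> borel_measurable lebesgue" by (rule weight_measurable[OF wt])
  obtain D where D: "0 < D" "\<And>g \<alpha>. g\<in>borel_measurable borel \<Longrightarrow> 0 < \<alpha> \<Longrightarrow> \<exists>E\<in>sets lebesgue.
     {x. ennreal \<alpha> < T g x} \<subseteq> E \<and>
     wmeas w E \<le> ennreal (D * \<alpha> powr (- p)) * (\<integral>\<^sup>+x. epowr (g x) p * ennreal (w x) \<partial>lebesgue)"
    using weak unfolding weak_type_def by blast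
  have c2: "0 < 2 * c" using c by simp
  obtain A where A: "0 < A"
    "\<And>g. (\<integral>\<^sup>+k. ennreal (\<Phi> (2 powr (real_of_int k + 1)) * 2 powr (- (r * p * real_of_int k))) *
        (if ennreal (2 powr (r * real_of_int k) / (2 * c)) < epowr g r then epowr g (r * p) else 0) \<partial>count_space UNIV) \<le> ennreal A * orlicz_ext \<Phi> g"
    using orlicz_dyadic_sum_bound[OF \<Phi> lt r p c2] by blast
  show ?thesis
  proof
    show "0 < D * 2 powr p * A" using D A by simp
    fix g :: "real^'n \<Rightarrow> ennreal" assume g[measurable]: "g \<in> borel_measurable borel"
    have gl[measurable]: "g \<in> borel_measurable lebesgue" by (rule measurable_lebesgueI[OF g])
    define f where "f y = epowr (g y) r" for y
    have f[measurable]: "f \<in> borel_measurable borel" unfolding f_def by measurable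
    define hi where "hi k y = (if ennreal (2 powr (r * real_of_int k) / (2 * c)) < f y then f y else 0)" for k y
    define lo where "lo k y = (if ennreal (2 powr (r * real_of_int k) / (2 * c)) < f y then 0 else f y)" for k y
    have hm[measurable]: "hi k \<in> borel_measurable borel" "lo k \<in> borel_measurable borel" for k
      unfolding hi_def lo_def by measurable
    let ?J = "\<lambda>k. \<integral>\<^sup>+x. (if ennreal (2 powr (r * real_of_int k) / (2 * c)) < epowr (g x) r then epowr (g x) (r * p) else 0) * ennreal (w x) \<partial>lebesgue"
    define good where "good k E \<longleftrightarrow> E \<in> sets lebesgue \<and> {x. ennreal (2 powr real_of_int k) < epowr (T f x) (1 / r)} \<subseteq> E \<and>
        wmeas w E \<le> ennreal (D * 2 powr p * 2 powr (- (r * p * real_of_int k))) * ?J k" for k E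
    have "\<exists>E. good k E" for k
    proof -
      define \<alpha> where "\<alpha> = 2 powr (r * real_of_int k) / 2"
      have \<alpha>: "0 < \<alpha>" by (simp add: \<alpha>_def)
      obtain E where E: "E \<in> sets lebesgue" "{x. ennreal \<alpha> < T (hi k) x} \<subseteq> E"
        "wmeas w E \<le> ennreal (D * \<alpha> powr (- p)) * (\<integral>\<^sup>+x. epowr (hi k x) p * ennreal (w x) \<partial>lebesgue)"
        using D(2)[OF hm(1) \<alpha>] by blast
      have "{x. ennreal (2 powr real_of_int k) < epowr (T f x) (1 / r)} \<subseteq> E"
      proof (intro subsetI E(2)[THEN subsetD] CollectI)
        fix x assume x: "x \<in> {x. ennreal (2 powr real_of_int k) < epowr (T f x) (1 / r)}"
        show "ennreal \<alpha> < T (hi k) x"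
        proof (rule ccontr)
          assume "\<not> ennreal \<alpha> < T (hi k) x"
          then have hi: "T (hi k) x \<le> ennreal \<alpha>" by simp
          have lo: "T (lo k) x \<le> ennreal (c * (2 powr (r * real_of_int k) / (2 * c)))"
            using c by (intro bd) (auto simp: lo_def)
          have "c * (2 powr (r * real_of_int k) / (2 * c)) = \<alpha>" using c by (simp add: \<alpha>_def)
          with lo have lo: "T (lo k) x \<le> ennreal \<alpha>" by simp
          have "f = (\<lambda>y. hi k y + lo k y)" by (auto simp: hi_def lo_def)
          then have "T f x \<le> T (hi k) x + T (lo k) x" using sub[of "hi k" "lo k" x] by simp
          also have "\<dots> \<le> ennreal \<alpha> + ennreal \<alpha>" by (rule add_mono[OF hi lo])
          also have "\<dots> = ennreal (2 powr (r * real_of_int k))" using \<alpha> by (simp add: \<alpha>_def flip: ennreal_plus)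
          finally have "epowr (T f x) (1 / r) \<le> epowr (ennreal (2 powr (r * real_of_int k))) (1 / r)"
            using r by (intro epowr_mono) auto
          also have "\<dots> = ennreal (2 powr real_of_int k)" using r by (simp add: epowr_ennreal powr_powr)
          finally show False using x by simp
        qed
      qed
      moreover have J: "(\<integral>\<^sup>+x. epowr (hi k x) p * ennreal (w x) \<partial>lebesgue) = ?J k"
        using r p by (intro nn_integral_cong) (simp add: hi_def f_def epowr_epowr)
      have D\<alpha>: "D * \<alpha> powr (- p) = D * 2 powr p * 2 powr (- (r * p * real_of_int k))"
      proof -
        have "\<alpha> powr (- p) = (2 powr (r * real_of_int k)) powr (- p) / 2 powr (- p)" unfolding \<alpha>_def by (rule powr_divide)
        also have "\<dots> = 2 powr p * 2 powr (- (r * p * real_of_int k))"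
          by (simp add: powr_powr powr_minus_divide mult_ac)
        finally show ?thesis by simp
      qed
      ultimately have "good k E" unfolding good_def using E(1) E(3)[unfolded J D\<alpha>] by blast
      then show ?thesis ..
    qed
    then have "\<forall>k. \<exists>E. good k E" ..
    then obtain E where "\<forall>k. good k (E k)" by (rule exE[OF choice])
    then have E: "\<And>k. E k \<in> sets lebesgue"
      "\<And>k. {x. ennreal (2 powr real_of_int k) < epowr (T f x) (1 / r)} \<subseteq> E k"
      "\<And>k. wmeas w (E k) \<le> ennreal (D * 2 powr p * 2 powr (- (r * p * real_of_int k))) * ?J k"
      unfolding good_def by blast+
    note [measurable] = E(1)
    have P: "0 < \<Phi> (2 powr (real_of_int k + 1))" for k by (rule orlicz_pos[OF \<Phi>]) simp
    have "(\<integral>\<^sup>+x. orlicz_ext \<Phi> (epowr (T f x) (1 / r)) * ennreal (w x) \<partial>lebesgue)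
      \<le> (\<integral>\<^sup>+x. (\<integral>\<^sup>+k. ennreal (\<Phi> (2 powr (real_of_int k + 1))) * (ennreal (w x) * indicator (E k) x) \<partial>count_space UNIV) \<partial>lebesgue)"
    proof (rule nn_integral_mono)
      fix x
      have "orlicz_ext \<Phi> (epowr (T f x) (1 / r)) * ennreal (w x)
        \<le> (\<integral>\<^sup>+k. ennreal (\<Phi> (2 powr (real_of_int k + 1))) * indicator {k. ennreal (2 powr real_of_int k) < epowr (T f x) (1 / r)} k \<partial>count_space UNIV) * ennreal (w x)"
        by (rule mult_right_mono[OF orlicz_ext_dyadic[OF \<Phi>]]) simp
      also have "\<dots> = (\<integral>\<^sup>+k. ennreal (\<Phi> (2 powr (real_of_int k + 1))) * indicator {k. ennreal (2 powr real_of_int k) < epowr (T f x) (1 / r)} k * ennreal (w x) \<partial>count_space UNIV)"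
        by (rule nn_integral_multc[symmetric]) simp
      also have "\<dots> \<le> (\<integral>\<^sup>+k. ennreal (\<Phi> (2 powr (real_of_int k + 1))) * (ennreal (w x) * indicator (E k) x) \<partial>count_space UNIV)"
        using E(2) by (intro nn_integral_mono) (auto simp: indicator_def)
      finally show "orlicz_ext \<Phi> (epowr (T f x) (1 / r)) * ennreal (w x)
        \<le> (\<integral>\<^sup>+k. ennreal (\<Phi> (2 powr (real_of_int k + 1))) * (ennreal (w x) * indicator (E k) x) \<partial>count_space UNIV)" .
    qed
    also have "\<dots> = (\<integral>\<^sup>+k. (\<integral>\<^sup>+x. ennreal (\<Phi> (2 powr (real_of_int k + 1))) * (ennreal (w x) * indicator (E k) x) \<partial>lebesgue) \<partial>count_space UNIV)"
      by (rule nn_integral_count_space_nn_integral) measurable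
    also have "\<dots> = (\<integral>\<^sup>+k. ennreal (\<Phi> (2 powr (real_of_int k + 1))) * wmeas w (E k) \<partial>count_space UNIV)"
      unfolding wmeas_def by (intro nn_integral_cong nn_integral_cmult) measurable
    also have "\<dots> \<le> (\<integral>\<^sup>+k. (\<integral>\<^sup>+x. ennreal (D * 2 powr p) * (ennreal (\<Phi> (2 powr (real_of_int k + 1)) * 2 powr (- (r * p * real_of_int k))) *
        (if ennreal (2 powr (r * real_of_int k) / (2 * c)) < epowr (g x) r then epowr (g x) (r * p) else 0) * ennreal (w x)) \<partial>lebesgue) \<partial>count_space UNIV)"
    proof (rule nn_integral_mono)
      fix k :: int
      have "ennreal (\<Phi> (2 powr (real_of_int k + 1))) * wmeas w (E k) \<le> ennreal (\<Phi> (2 powr (real_of_int k + 1))) *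
          (ennreal (D * 2 powr p * 2 powr (- (r * p * real_of_int k))) * ?J k)"
        by (rule mult_left_mono[OF E(3)]) simp
      also have "\<dots> = ennreal (D * 2 powr p * (\<Phi> (2 powr (real_of_int k + 1)) * 2 powr (- (r * p * real_of_int k)))) * ?J k"
      proof -
        have "ennreal (\<Phi> (2 powr (real_of_int k + 1))) * ennreal (D * 2 powr p * 2 powr (- (r * p * real_of_int k)))
          = ennreal (\<Phi> (2 powr (real_of_int k + 1)) * (D * 2 powr p * 2 powr (- (r * p * real_of_int k))))"
          using P[of k] D(1) by (intro ennreal_mult[symmetric]) auto
        also have "\<Phi> (2 powr (real_of_int k + 1)) * (D * 2 powr p * 2 powr (- (r * p * real_of_int k)))
          = D * 2 powr p * (\<Phi> (2 powr (real_of_int k + 1)) * 2 powr (- (r * p * real_of_int k)))" by (simp only: mult_ac)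
        finally show ?thesis by (subst mult.assoc[symmetric]) (rule arg_cong)
      qed
      also have "\<dots> = (\<integral>\<^sup>+x. ennreal (D * 2 powr p * (\<Phi> (2 powr (real_of_int k + 1)) * 2 powr (- (r * p * real_of_int k)))) *
        ((if ennreal (2 powr (r * real_of_int k) / (2 * c)) < epowr (g x) r then epowr (g x) (r * p) else 0) * ennreal (w x)) \<partial>lebesgue)"
        by (rule nn_integral_cmult[symmetric]) measurable
      also have "\<dots> = (\<integral>\<^sup>+x. ennreal (D * 2 powr p) * (ennreal (\<Phi> (2 powr (real_of_int k + 1)) * 2 powr (- (r * p * real_of_int k))) *
        (if ennreal (2 powr (r * real_of_int k) / (2 * c)) < epowr (g x) r then epowr (g x) (r * p) else 0) * ennreal (w x)) \<partial>lebesgue)"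
      proof -
        have "ennreal (D * 2 powr p * (\<Phi> (2 powr (real_of_int k + 1)) * 2 powr (- (r * p * real_of_int k))))
          = ennreal (D * 2 powr p) * ennreal (\<Phi> (2 powr (real_of_int k + 1)) * 2 powr (- (r * p * real_of_int k)))"
          using P[of k] D(1) by (intro ennreal_mult) auto
        then show ?thesis by (simp only: mult.assoc)
      qed
      finally show "ennreal (\<Phi> (2 powr (real_of_int k + 1))) * wmeas w (E k) \<le> (\<integral>\<^sup>+x. ennreal (D * 2 powr p) * (ennreal (\<Phi> (2 powr (real_of_int k + 1)) * 2 powr (- (r * p * real_of_int k))) *
        (if ennreal (2 powr (r * real_of_int k) / (2 * c)) < epowr (g x) r then epowr (g x) (r * p) else 0) * ennreal (w x)) \<partial>lebesgue)" .
    qed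
    also have "\<dots> = (\<integral>\<^sup>+x. (\<integral>\<^sup>+k. ennreal (D * 2 powr p) * (ennreal (\<Phi> (2 powr (real_of_int k + 1)) * 2 powr (- (r * p * real_of_int k))) *
        (if ennreal (2 powr (r * real_of_int k) / (2 * c)) < epowr (g x) r then epowr (g x) (r * p) else 0) * ennreal (w x)) \<partial>count_space UNIV) \<partial>lebesgue)"
      by (rule nn_integral_count_space_nn_integral[symmetric]) measurable
    also have "\<dots> \<le> (\<integral>\<^sup>+x. ennreal (D * 2 powr p * A) * (orlicz_ext \<Phi> (g x) * ennreal (w x)) \<partial>lebesgue)"
    proof (rule nn_integral_mono)
      fix x
      have "(\<integral>\<^sup>+k. ennreal (D * 2 powr p) * (ennreal (\<Phi> (2 powr (real_of_int k + 1)) * 2 powr (- (r * p * real_of_int k))) *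
        (if ennreal (2 powr (r * real_of_int k) / (2 * c)) < epowr (g x) r then epowr (g x) (r * p) else 0) * ennreal (w x)) \<partial>count_space UNIV)
       = ennreal (D * 2 powr p) * ((\<integral>\<^sup>+k. ennreal (\<Phi> (2 powr (real_of_int k + 1)) * 2 powr (- (r * p * real_of_int k))) *
        (if ennreal (2 powr (r * real_of_int k) / (2 * c)) < epowr (g x) r then epowr (g x) (r * p) else 0) \<partial>count_space UNIV) * ennreal (w x))"
        by (subst nn_integral_cmult, simp, subst nn_integral_multc) simp_all
      also have "\<dots> \<le> ennreal (D * 2 powr p) * (ennreal A * orlicz_ext \<Phi> (g x) * ennreal (w x))"
        by (intro mult_left_mono mult_right_mono A(2)) auto
      also have "\<dots> = ennreal (D * 2 powr p * A) * (orlicz_ext \<Phi> (g x) * ennreal (w x))"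
        using ennreal_mult[of "D * 2 powr p" A] D(1) A(1) by (simp add: mult.assoc)
      finally show "(\<integral>\<^sup>+k. ennreal (D * 2 powr p) * (ennreal (\<Phi> (2 powr (real_of_int k + 1)) * 2 powr (- (r * p * real_of_int k))) *
        (if ennreal (2 powr (r * real_of_int k) / (2 * c)) < epowr (g x) r then epowr (g x) (r * p) else 0) * ennreal (w x)) \<partial>count_space UNIV)
        \<le> ennreal (D * 2 powr p * A) * (orlicz_ext \<Phi> (g x) * ennreal (w x))" .
    qed
    also have "\<dots> = ennreal (D * 2 powr p * A) * (\<integral>\<^sup>+x. orlicz_ext \<Phi> (g x) * ennreal (w x) \<partial>lebesgue)"
      by (intro nn_integral_cmult borel_measurable_times_ennreal measurable_orlicz_ext[OF \<Phi> gl]) measurable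
    finally show "(\<integral>\<^sup>+x. orlicz_ext \<Phi> (epowr (T (\<lambda>y. epowr (g y) r) x) (1 / r)) * ennreal (w x) \<partial>lebesgue)
       \<le> ennreal (D * 2 powr p * A) * (\<integral>\<^sup>+x. orlicz_ext \<Phi> (g x) * ennreal (w x) \<partial>lebesgue)"
      unfolding f_def .
  qed
qed

lemma orlicz_ext_lower_type:
  assumes \<Phi>: "orlicz_function \<Phi>" and lt: "lower_type \<Phi> p0" and L: "1 < L"
  shows "orlicz_ext \<Phi> (u / ennreal L) \<le> ennreal (L powr (- p0)) * orlicz_ext \<Phi> u"
proof (cases u)
  case top
  then show ?thesis using L by (simp add: orlicz_ext_def ennreal_mult_top)
next
  case (real x)
  show ?thesis
  proof (cases "x = 0")
    case True
    then show ?thesis using real by (simp add: orlicz_ext_def)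
  next
    case False
    then have x: "0 < x" using real by simp
    have uL: "u / ennreal L = ennreal (x / L)" using real L by (simp add: divide_ennreal)
    have "\<Phi> (x * (1 / L)) \<le> (1 / L) powr p0 * \<Phi> x" using x L by (intro lower_type_mult[OF lt]) auto
    also have "(1 / L) powr p0 = L powr (- p0)" using L by (simp add: powr_divide powr_minus_divide)
    finally have "ennreal (\<Phi> (x / L)) \<le> ennreal (L powr (- p0)) * ennreal (\<Phi> x)"
      using orlicz_pos[OF \<Phi> x] by (simp add: ennreal_leI flip: ennreal_mult)
    then show ?thesis using real x L unfolding uL by (simp add: orlicz_ext_def)
  qed
qed

text \<open>Enlarging the norm parameter by a factor \<open>L\<close> shrinks the modular of \<open>g\<close> by \<open>L\<^sup>-\<^sup>p\<^sup>0\<close>, which absorbs the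
  constant of the modular inequality.\<close>

lemma orlicz_norm_le:
  fixes w :: "real^'n \<Rightarrow> real" and G g :: "real^'n \<Rightarrow> ennreal"
  assumes \<Phi>: "orlicz_function \<Phi>" and lt: "lower_type \<Phi> p0" "0 < p0" and wt: "weight w"
    and g: "g \<in> borel_measurable borel" and L: "1 < L" "C \<le> L powr p0" and C: "0 < C"
    and le: "\<And>c. 0 < c \<Longrightarrow> (\<integral>\<^sup>+x. orlicz_ext \<Phi> (G x / ennreal c) * ennreal (w x) \<partial>lebesgue)
        \<le> ennreal C * (\<integral>\<^sup>+x. orlicz_ext \<Phi> (g x / ennreal c) * ennreal (w x) \<partial>lebesgue)"
  shows "orlicz_norm \<Phi> w G \<le> ennreal L * orlicz_norm \<Phi> w g"
proof -
  have [measurable]: "w \<in> borel_measurable lebesgue" by (rule weight_measurable[OF wt])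
  have gl[measurable]: "g \<in> borel_measurable lebesgue" by (rule measurable_lebesgueI[OF g])
  have "orlicz_norm \<Phi> w G / ennreal L \<le> orlicz_norm \<Phi> w g"
    unfolding orlicz_norm_def[of \<Phi> w g]
  proof (rule Inf_greatest)
    fix z assume "z \<in> {ennreal c |c. 0 < c \<and> (\<integral>\<^sup>+x. orlicz_ext \<Phi> (g x / ennreal c) * ennreal (w x) \<partial>lebesgue) \<le> 1}"
    then obtain c where z: "z = ennreal c" and c: "0 < c"
      and 1: "(\<integral>\<^sup>+x. orlicz_ext \<Phi> (g x / ennreal c) * ennreal (w x) \<partial>lebesgue) \<le> 1" by blast
    have m: "(\<lambda>x. orlicz_ext \<Phi> (g x / ennreal c) * ennreal (w x)) \<in> borel_measurable lebesgue"
      by (intro borel_measurable_times_ennreal measurable_orlicz_ext[OF \<Phi>]) measurable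
    have "(\<integral>\<^sup>+x. orlicz_ext \<Phi> (G x / ennreal (L * c)) * ennreal (w x) \<partial>lebesgue)
        \<le> ennreal C * (\<integral>\<^sup>+x. orlicz_ext \<Phi> (g x / ennreal (L * c)) * ennreal (w x) \<partial>lebesgue)"
      using L c by (intro le) simp
    also have "\<dots> \<le> ennreal C * (\<integral>\<^sup>+x. ennreal (L powr (- p0)) * (orlicz_ext \<Phi> (g x / ennreal c) * ennreal (w x)) \<partial>lebesgue)"
    proof (intro mult_left_mono nn_integral_mono)
      fix x
      have "g x / ennreal (L * c) = g x / ennreal c / ennreal L"
        using L c by (cases "g x") (auto simp: divide_ennreal mult.commute ennreal_top_divide)
      then have "orlicz_ext \<Phi> (g x / ennreal (L * c)) \<le> ennreal (L powr (- p0)) * orlicz_ext \<Phi> (g x / ennreal c)"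
        using orlicz_ext_lower_type[OF \<Phi> lt(1) L(1)] by simp
      then show "orlicz_ext \<Phi> (g x / ennreal (L * c)) * ennreal (w x) \<le> ennreal (L powr (- p0)) * (orlicz_ext \<Phi> (g x / ennreal c) * ennreal (w x))"
        unfolding mult.assoc[symmetric] by (rule mult_right_mono) simp
    qed simp
    also have "\<dots> = ennreal C * (ennreal (L powr (- p0)) * (\<integral>\<^sup>+x. orlicz_ext \<Phi> (g x / ennreal c) * ennreal (w x) \<partial>lebesgue))"
      by (simp only: nn_integral_cmult[OF m])
    also have "\<dots> \<le> ennreal C * (ennreal (L powr (- p0)) * 1)" by (intro mult_left_mono 1) auto
    also have "\<dots> = ennreal (C * L powr (- p0))" using C by (simp add: ennreal_mult)
    also have "\<dots> \<le> 1"
    proof -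
      have "C * L powr (- p0) \<le> L powr p0 * L powr (- p0)" using L by (intro mult_right_mono) auto
      also have "\<dots> = 1" using L by (simp add: powr_minus)
      finally show ?thesis by (simp add: ennreal_le_1)
    qed
    finally have "orlicz_norm \<Phi> w G \<le> ennreal (L * c)"
      unfolding orlicz_norm_def using L c by (intro Inf_lower) auto
    then have "orlicz_norm \<Phi> w G / ennreal L \<le> ennreal (L * c) / ennreal L" by (rule divide_right_mono_ennreal)
    also have "\<dots> = z" using L c z by (simp add: divide_ennreal)
    finally show "orlicz_norm \<Phi> w G / ennreal L \<le> z" .
  qed
  then have "ennreal L * (orlicz_norm \<Phi> w G / ennreal L) \<le> ennreal L * orlicz_norm \<Phi> w g"
    by (rule mult_left_mono) simp
  moreover have "ennreal L * (orlicz_norm \<Phi> w G / ennreal L) = orlicz_norm \<Phi> w G"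
    using L ennreal_mult_divide_eq[of "ennreal L" "orlicz_norm \<Phi> w G"]
    by (simp add: ennreal_times_divide mult.commute[of "ennreal L"])
  ultimately show ?thesis by simp
qed

section \<open>Test functions\<close>

lemma pderivs_Cons_eqI:
  assumes "(pderivs is \<phi> has_derivative F) (at x)"
  shows "pderivs (i # is) \<phi> x = F (axis i 1)"
  using frechet_derivative_at[OF assms] by simp

text \<open>Once \<open>test_has_derivative\<close> expresses the total derivative through partial derivatives, unfolding
  a partial derivative into a total one would lead the simplifier in circles.\<close>

declare pderivs.simps(2) [simp del]

lemma test_has_derivative:
  assumes "\<phi> \<in> test_functions"
  shows "(pderivs is \<phi> has_derivative (\<lambda>h. \<Sum>i\<in>UNIV. h $ i *\<^sub>R pderivs (i # is) \<phi> x)) (at x)"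
proof -
  have "pderivs is \<phi> differentiable (at x)"
    using assms by (auto simp: test_functions_def differentiable_on_def)
  then have d: "(pderivs is \<phi> has_derivative frechet_derivative (pderivs is \<phi>) (at x)) (at x)"
    by (simp add: frechet_derivative_works)
  then interpret bounded_linear "frechet_derivative (pderivs is \<phi>) (at x)"
    by (rule has_derivative_bounded_linear)
  have "frechet_derivative (pderivs is \<phi>) (at x) h = (\<Sum>i\<in>UNIV. h $ i *\<^sub>R pderivs (i # is) \<phi> x)" for h
  proof -
    have "frechet_derivative (pderivs is \<phi>) (at x) h = frechet_derivative (pderivs is \<phi>) (at x) (\<Sum>i\<in>UNIV. h $ i *\<^sub>R axis i 1)"
      by (simp add: basis_expansion[of h, unfolded scalar_mult_eq_scaleR])
    then show ?thesis by (simp add: sum scaleR pderivs.simps(2))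
  qed
  then have "frechet_derivative (pderivs is \<phi>) (at x) = (\<lambda>h. \<Sum>i\<in>UNIV. h $ i *\<^sub>R pderivs (i # is) \<phi> x)" ..
  with d show ?thesis by (simp only:)
qed

lemma test_continuous: "\<phi> \<in> test_functions \<Longrightarrow> continuous_on S (pderivs is \<phi>)"
  by (intro continuous_at_imp_continuous_on ballI has_derivative_continuous[OF test_has_derivative])

lemma test_continuous0: "\<phi> \<in> test_functions \<Longrightarrow> continuous_on S \<phi>"
  using test_continuous[of \<phi> S "[]"] by simp

lemma not_in_supp: "x \<notin> supp \<phi> \<Longrightarrow> \<phi> x = 0"
  using closure_subset[of "support_on UNIV \<phi>"] by (auto simp: supp_def in_support_on)

lemma pderivs_outside_open:
  assumes "open U" "\<And>x. x \<in> U \<Longrightarrow> \<phi> x = 0" "x \<in> U"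
  shows "pderivs is \<phi> x = 0"
  using assms(3)
proof (induction "is" arbitrary: x)
  case Nil
  then show ?case using assms(2) by simp
next
  case (Cons i "is")
  have "((\<lambda>_. 0) has_derivative (\<lambda>_. 0)) (at x)" by simp
  then have "(pderivs is \<phi> has_derivative (\<lambda>_. 0)) (at x)"
    by (rule has_derivative_transform_within_open[OF _ assms(1) Cons.prems]) (simp add: Cons.IH)
  then show ?case by (subst pderivs_Cons_eqI) auto
qed

lemma pderivs_outside_supp:
  assumes "x \<notin> supp \<phi>"
  shows "pderivs is \<phi> x = 0"
proof (rule pderivs_outside_open[of "- supp \<phi>"])
  show "open (- supp \<phi>)" by (simp add: supp_def open_Compl)
  show "x \<in> - supp \<phi>" using assms by simp
  show "\<And>x. x \<in> - supp \<phi> \<Longrightarrow> \<phi> x = 0" by (rule not_in_supp) simp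
qed

lemma supp_subsetI:
  assumes "compact K" "\<And>x. x \<notin> K \<Longrightarrow> \<phi> x = 0"
  shows "supp \<phi> \<subseteq> K" "compact (supp \<phi>)"
proof -
  have "support_on UNIV \<phi> \<subseteq> K"
  proof
    fix x assume "x \<in> support_on UNIV \<phi>"
    then have "\<phi> x \<noteq> 0" by (simp add: support_on_def)
    then show "x \<in> K" using assms(2)[of x] by blast
  qed
  then show "supp \<phi> \<subseteq> K"
    unfolding supp_def using compact_imp_closed[OF assms(1)] by (rule closure_minimal)
  then show "compact (supp \<phi>)"
    using assms(1) unfolding supp_def by (meson bounded_subset closed_closure compact_eq_bounded_closed)
qed

lemma test_compact_supp: "\<phi> \<in> test_functions \<Longrightarrow> compact (supp \<phi>)"
  by (simp add: test_functions_def)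

lemma test_supp_cball:
  assumes "\<phi> \<in> test_functions"
  obtains \<rho> where "0 < \<rho>" "supp \<phi> \<subseteq> cball 0 \<rho>"
proof -
  have "bounded (supp \<phi>)" using test_compact_supp[OF assms] by (rule compact_imp_bounded)
  then obtain b where "0 < b" "\<forall>x\<in>supp \<phi>. norm x \<le> b" by (auto simp: bounded_pos)
  then have "supp \<phi> \<subseteq> cball 0 b" by auto
  with \<open>0 < b\<close> show ?thesis by (rule that)
qed

lemma test_functionI:
  assumes "\<And>is x. \<exists>F. (pderivs is \<phi> has_derivative F) (at x)" "compact K" "\<And>x. x \<notin> K \<Longrightarrow> \<phi> x = 0"
  shows "\<phi> \<in> test_functions"
  using assms(1) supp_subsetI[OF assms(2,3)]
  by (auto simp: test_functions_def differentiable_on_def differentiable_def intro: has_derivative_at_withinI)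

lemma pderivs_add:
  assumes a: "\<phi> \<in> test_functions" and b: "\<eta> \<in> test_functions"
  shows "pderivs is (\<lambda>x. \<phi> x + \<eta> x) = (\<lambda>x. pderivs is \<phi> x + pderivs is \<eta> x)"
proof (induction "is")
  case (Cons i "is")
  show ?case
  proof
    fix x
    have "(pderivs is (\<lambda>x. \<phi> x + \<eta> x) has_derivative
        (\<lambda>h. (\<Sum>i\<in>UNIV. h $ i *\<^sub>R pderivs (i # is) \<phi> x) + (\<Sum>i\<in>UNIV. h $ i *\<^sub>R pderivs (i # is) \<eta> x))) (at x)"
      unfolding Cons by (intro has_derivative_add test_has_derivative a b)
    from pderivs_Cons_eqI[OF this]
    show "pderivs (i # is) (\<lambda>x. \<phi> x + \<eta> x) x = pderivs (i # is) \<phi> x + pderivs (i # is) \<eta> x"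
      by (simp add: axis_def if_distrib[of "\<lambda>c. c *\<^sub>R _"] sum.delta cong: if_cong)
  qed
qed simp

lemma pderivs_cmult:
  assumes a: "\<phi> \<in> test_functions"
  shows "pderivs is (\<lambda>x. c * \<phi> x) = (\<lambda>x. c * pderivs is \<phi> x)"
proof (induction "is")
  case (Cons i "is")
  show ?case
  proof
    fix x
    have "(pderivs is (\<lambda>x. c * \<phi> x) has_derivative
        (\<lambda>h. c * (\<Sum>i\<in>UNIV. h $ i *\<^sub>R pderivs (i # is) \<phi> x))) (at x)"
      unfolding Cons by (intro has_derivative_mult_right test_has_derivative a)
    from pderivs_Cons_eqI[OF this]
    show "pderivs (i # is) (\<lambda>x. c * \<phi> x) x = c * pderivs (i # is) \<phi> x"
      by (simp add: axis_def if_distrib[of "\<lambda>c. c *\<^sub>R _"] sum.delta cong: if_cong)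
  qed
qed simp

lemma pderivs_affine:
  fixes z :: "real^'n" and k :: real
  assumes a: "\<phi> \<in> test_functions"
  shows "pderivs is (\<lambda>x. \<phi> (k *\<^sub>R x + z)) = (\<lambda>x. k ^ length is *\<^sub>R pderivs is \<phi> (k *\<^sub>R x + z))"
    and "((\<lambda>x. k ^ m *\<^sub>R pderivs is \<phi> (k *\<^sub>R x + z)) has_derivative
        (\<lambda>h. k ^ m *\<^sub>R (\<Sum>i\<in>UNIV. (k *\<^sub>R h) $ i *\<^sub>R pderivs (i # is) \<phi> (k *\<^sub>R x + z)))) (at x)"
proof -
  have *: "((\<lambda>x. k ^ m *\<^sub>R pderivs is \<phi> (k *\<^sub>R x + z)) has_derivative
        (\<lambda>h. k ^ m *\<^sub>R (\<Sum>i\<in>UNIV. (k *\<^sub>R h) $ i *\<^sub>R pderivs (i # is) \<phi> (k *\<^sub>R x + z)))) (at x)" for m "is" x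
  proof (rule has_derivative_scaleR_right)
    have "((\<lambda>x. k *\<^sub>R x + z) has_derivative (\<lambda>h. k *\<^sub>R h)) (at x)"
      by (auto intro!: derivative_eq_intros)
    from has_derivative_compose[OF this test_has_derivative[OF a]]
    show "((\<lambda>x. pderivs is \<phi> (k *\<^sub>R x + z)) has_derivative
        (\<lambda>h. \<Sum>i\<in>UNIV. (k *\<^sub>R h) $ i *\<^sub>R pderivs (i # is) \<phi> (k *\<^sub>R x + z))) (at x)" .
  qed
  show "((\<lambda>x. k ^ m *\<^sub>R pderivs is \<phi> (k *\<^sub>R x + z)) has_derivative
        (\<lambda>h. k ^ m *\<^sub>R (\<Sum>i\<in>UNIV. (k *\<^sub>R h) $ i *\<^sub>R pderivs (i # is) \<phi> (k *\<^sub>R x + z)))) (at x)" by (rule *)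
  show "pderivs is (\<lambda>x. \<phi> (k *\<^sub>R x + z)) = (\<lambda>x. k ^ length is *\<^sub>R pderivs is \<phi> (k *\<^sub>R x + z))"
  proof (induction "is")
    case (Cons i "is")
    show ?case
    proof
      fix x
      have "pderivs (i # is) (\<lambda>x. \<phi> (k *\<^sub>R x + z)) x
          = k ^ length is *\<^sub>R (\<Sum>j\<in>UNIV. (k *\<^sub>R axis i 1) $ j *\<^sub>R pderivs (j # is) \<phi> (k *\<^sub>R x + z))"
        by (rule pderivs_Cons_eqI) (unfold Cons, rule *)
      also have "(\<Sum>j\<in>UNIV. (k *\<^sub>R axis i 1) $ j *\<^sub>R pderivs (j # is) \<phi> (k *\<^sub>R x + z)) = k *\<^sub>R pderivs (i # is) \<phi> (k *\<^sub>R x + z)"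
        by (subst sum.remove[of UNIV i]) (auto simp: axis_def intro!: sum.neutral)
      finally show "pderivs (i # is) (\<lambda>x. \<phi> (k *\<^sub>R x + z)) x = k ^ length (i # is) *\<^sub>R pderivs (i # is) \<phi> (k *\<^sub>R x + z)"
        by (simp add: mult.commute)
    qed
  qed simp
qed

lemma test_add:
  assumes a: "\<phi> \<in> test_functions" and b: "\<eta> \<in> test_functions"
  shows "(\<lambda>x. \<phi> x + \<eta> x) \<in> test_functions"
proof (rule test_functionI[of _ "supp \<phi> \<union> supp \<eta>"])
  show "\<exists>F. (pderivs is (\<lambda>x. \<phi> x + \<eta> x) has_derivative F) (at x)" for "is" x
    unfolding pderivs_add[OF a b] using test_has_derivative[OF a] test_has_derivative[OF b] has_derivative_add by blast
qed (use a b not_in_supp[of _ \<phi>] not_in_supp[of _ \<eta>] in \<open>auto intro: test_compact_supp\<close>)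

lemma test_cmult:
  assumes a: "\<phi> \<in> test_functions"
  shows "(\<lambda>x. c * \<phi> x) \<in> test_functions"
proof (rule test_functionI[of _ "supp \<phi>"])
  show "\<exists>F. (pderivs is (\<lambda>x. c * \<phi> x) has_derivative F) (at x)" for "is" x
    unfolding pderivs_cmult[OF a] using has_derivative_mult_right[OF test_has_derivative[OF a]] by blast
qed (use a not_in_supp[of _ \<phi>] in \<open>auto intro: test_compact_supp\<close>)

lemma test_affine:
  fixes z :: "real^'n"
  assumes a: "\<phi> \<in> test_functions" and k: "k \<noteq> 0"
  shows "(\<lambda>x. \<phi> (k *\<^sub>R x + z)) \<in> test_functions"
proof (rule test_functionI[of _ "(\<lambda>y. (1/k) *\<^sub>R (y - z)) ` supp \<phi>"])
  show "\<exists>F. (pderivs is (\<lambda>x. \<phi> (k *\<^sub>R x + z)) has_derivative F) (at x)" for "is" x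
    unfolding pderivs_affine(1)[OF a] using pderivs_affine(2)[OF a] by blast
  show "compact ((\<lambda>y. (1/k) *\<^sub>R (y - z)) ` supp \<phi>)"
    by (intro compact_continuous_image continuous_intros test_compact_supp a)
  fix x assume "x \<notin> (\<lambda>y. (1/k) *\<^sub>R (y - z)) ` supp \<phi>"
  moreover have "x = (1/k) *\<^sub>R ((k *\<^sub>R x + z) - z)" using k by simp
  ultimately have "k *\<^sub>R x + z \<notin> supp \<phi>" by blast
  then show "\<phi> (k *\<^sub>R x + z) = 0" by (rule not_in_supp)
qed

lemma test_diff:
  assumes a: "\<phi> \<in> test_functions" and b: "\<eta> \<in> test_functions"
  shows "(\<lambda>x. \<phi> x - \<eta> x) \<in> test_functions"
    and "pderivs is (\<lambda>x. \<phi> x - \<eta> x) = (\<lambda>x. pderivs is \<phi> x - pderivs is \<eta> x)"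
  using test_add[OF a test_cmult[OF b, of "-1"]] pderivs_add[OF a test_cmult[OF b, of "-1"], of "is"]
  by (simp_all add: pderivs_cmult[OF b, of "is" "-1", simplified])

lemma test_zero: "(\<lambda>x. 0) \<in> test_functions"
proof (rule test_functionI[of _ "{}"])
  fix "is" x
  have "pderivs is (\<lambda>x. 0) = (\<lambda>x. 0)"
    using pderivs_outside_open[of UNIV "\<lambda>x. 0"] by auto
  then show "\<exists>F. (pderivs is (\<lambda>x. 0) has_derivative F) (at x)"
    by (auto intro: exI[of _ "\<lambda>_. 0"])
qed auto

lemma test_sum:
  assumes "finite I" "\<And>i. i \<in> I \<Longrightarrow> \<phi> i \<in> test_functions"
  shows "(\<lambda>x. \<Sum>i\<in>I. \<phi> i x) \<in> test_functions"
    and "pderivs is (\<lambda>x. \<Sum>i\<in>I. \<phi> i x) = (\<lambda>x. \<Sum>i\<in>I. pderivs is (\<phi> i) x)"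
proof -
  have "(\<lambda>x. \<Sum>i\<in>I. \<phi> i x) \<in> test_functions \<and> pderivs is (\<lambda>x. \<Sum>i\<in>I. \<phi> i x) = (\<lambda>x. \<Sum>i\<in>I. pderivs is (\<phi> i) x)"
    using assms
  proof (induction I rule: finite_induct)
    case empty
    then show ?case using test_zero pderivs_outside_open[of UNIV "\<lambda>x. 0"] by auto
  next
    case (insert i I)
    then have i: "\<phi> i \<in> test_functions" and I: "(\<lambda>x. \<Sum>i\<in>I. \<phi> i x) \<in> test_functions"
      "pderivs is (\<lambda>x. \<Sum>i\<in>I. \<phi> i x) = (\<lambda>x. \<Sum>i\<in>I. pderivs is (\<phi> i) x)" by auto
    show ?case using test_add[OF i I(1)] pderivs_add[OF i I(1), of "is"] I(2) insert.hyps by simp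
  qed
  then show "(\<lambda>x. \<Sum>i\<in>I. \<phi> i x) \<in> test_functions" "pderivs is (\<lambda>x. \<Sum>i\<in>I. \<phi> i x) = (\<lambda>x. \<Sum>i\<in>I. pderivs is (\<phi> i) x)" by auto
qed

lemma finite_multi_indices: "finite {is :: 'n::finite list. length is \<le> N}"
  using finite_lists_length_le[of "UNIV :: 'n set" N] by simp

lemma test_bounded:
  assumes "\<phi> \<in> test_functions"
  obtains B where "0 \<le> B" "\<And>x. cmod (pderivs is \<phi> x) \<le> B"
proof -
  have "bounded (pderivs is \<phi> ` supp \<phi>)"
    by (intro compact_imp_bounded compact_continuous_image test_continuous assms test_compact_supp)
  then obtain B where B: "0 < B" "\<forall>x\<in>supp \<phi>. cmod (pderivs is \<phi> x) \<le> B" by (auto simp: bounded_pos)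
  have "cmod (pderivs is \<phi> x) \<le> B" for x
    using B pderivs_outside_supp[of x \<phi> "is"] by (cases "x \<in> supp \<phi>") auto
  then show ?thesis using that[of B] B(1) by auto
qed

lemma CN_norm_ge:
  fixes \<phi> :: "real^'n \<Rightarrow> complex"
  assumes \<phi>: "\<phi> \<in> test_functions" and len: "length is \<le> N"
  shows "cmod (pderivs is \<phi> x) \<le> CN_norm N \<phi>"
proof -
  have "\<exists>B. \<forall>x. cmod (pderivs is \<phi> x) \<le> B" for "is" using test_bounded[OF \<phi>, of "is"] by blast
  then obtain B where B: "\<And>is x. cmod (pderivs is \<phi> x) \<le> B is" by metis
  have "bdd_above ((\<lambda>(is, x). cmod (pderivs is \<phi> x)) ` ({is. length is \<le> N} \<times> UNIV))"
  proof (rule bdd_aboveI2)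
    fix z assume z: "z \<in> {is :: 'n list. length is \<le> N} \<times> (UNIV :: (real^'n) set)"
    obtain "is" x where zz: "z = (is, x)" by (cases z)
    have "cmod (pderivs is \<phi> x) \<le> B is" by (rule B)
    also have "\<dots> \<le> Max (B ` {is. length is \<le> N})"
      by (rule Max_ge) (use z zz finite_multi_indices in auto)
    finally show "(case z of (is, x) \<Rightarrow> cmod (pderivs is \<phi> x)) \<le> Max (B ` {is. length is \<le> N})" by (simp add: zz)
  qed
  then have "(case (is, x) of (is, x) \<Rightarrow> cmod (pderivs is \<phi> x)) \<le> CN_norm N \<phi>"
    unfolding CN_norm_def by (rule cSUP_upper[rotated]) (use len in auto)
  then show ?thesis by simp
qed

lemma CN_norm_nonneg:
  assumes "\<phi> \<in> test_functions"
  shows "0 \<le> CN_norm N \<phi>"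
proof -
  have "cmod (pderivs [] \<phi> 0) \<le> CN_norm N \<phi>" by (rule CN_norm_ge[OF assms]) simp
  then show ?thesis by (rule order_trans[OF norm_ge_zero])
qed

lemma CN_norm_le:
  fixes \<phi> :: "real^'n \<Rightarrow> complex"
  assumes "\<And>is x. length is \<le> N \<Longrightarrow> cmod (pderivs is \<phi> x) \<le> B"
  shows "CN_norm N \<phi> \<le> B"
  unfolding CN_norm_def
proof (rule cSUP_least)
  show "{is :: 'n list. length is \<le> N} \<times> (UNIV :: (real^'n) set) \<noteq> {}" by (auto intro: exI[of _ "[]"])
qed (use assms in auto)

lemma test_Lipschitz:
  fixes \<phi> :: "real^'n \<Rightarrow> complex"
  assumes \<phi>: "\<phi> \<in> test_functions" and len: "length is < N"
  shows "cmod (pderivs is \<phi> x - pderivs is \<phi> y) \<le> real CARD('n) * CN_norm N \<phi> * norm (x - y)"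
proof -
  have bd: "norm (\<Sum>i\<in>UNIV. h $ i *\<^sub>R pderivs (i # is) \<phi> z) \<le> real CARD('n) * CN_norm N \<phi> * norm h" for h z
  proof -
    have "norm (\<Sum>i\<in>UNIV. h $ i *\<^sub>R pderivs (i # is) \<phi> z) \<le> (\<Sum>i\<in>(UNIV::'n set). norm h * CN_norm N \<phi>)"
    proof (rule order_trans[OF norm_sum sum_mono])
      fix i
      show "norm (h $ i *\<^sub>R pderivs (i # is) \<phi> z) \<le> norm h * CN_norm N \<phi>"
        unfolding norm_scaleR using component_le_norm_cart[of h i] CN_norm_ge[OF \<phi>, of "i # is" N z] len
        by (intro mult_mono) auto
    qed
    then show ?thesis by (simp add: mult_ac)
  qed
  show ?thesis
  proof (rule differentiable_bound[where S=UNIV and f'="\<lambda>x h. \<Sum>i\<in>UNIV. h $ i *\<^sub>R pderivs (i # is) \<phi> x"])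
    show "(pderivs is \<phi> has_derivative (\<lambda>h. \<Sum>i\<in>UNIV. h $ i *\<^sub>R pderivs (i # is) \<phi> z)) (at z within UNIV)" for z
      using test_has_derivative[OF \<phi>] by simp
    show "onorm (\<lambda>h. \<Sum>i\<in>UNIV. h $ i *\<^sub>R pderivs (i # is) \<phi> z) \<le> real CARD('n) * CN_norm N \<phi>" for z
      by (rule onorm_le) (rule bd)
  qed auto
qed

section \<open>Distributions are sequentially continuous\<close>

lemma eventually_generate_topology:
  assumes "generate_topology_on S U" "\<eta> \<in> U"
    and base: "\<And>B. B \<in> S \<Longrightarrow> \<eta> \<in> B \<Longrightarrow> \<forall>\<^sub>F m in F. \<phi> m \<in> B"
  shows "\<forall>\<^sub>F m in F. \<phi> m \<in> U"
  using assms(1,2)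
proof (induction rule: generate_topology_on.induct)
  case (Int a b)
  then show ?case by (simp add: eventually_conj)
next
  case (UN K)
  then obtain k where k: "k \<in> K" "\<eta> \<in> k" by blast
  then have "\<forall>\<^sub>F m in F. \<phi> m \<in> k" using UN by blast
  then show ?case by (rule eventually_mono) (use k in blast)
next
  case (Basis s)
  then show ?case using base by blast
qed simp

lemma test_functions_inD: "\<phi> \<in> test_functions_in K \<Longrightarrow> \<phi> \<in> test_functions" "\<phi> \<in> test_functions_in K \<Longrightarrow> supp \<phi> \<subseteq> K"
  by (auto simp: test_functions_in_def)

lemma test_functions_inI:
  assumes "\<phi> \<in> test_functions" "closed K" "\<And>x. x \<notin> K \<Longrightarrow> \<phi> x = 0"
  shows "\<phi> \<in> test_functions_in K"
proof -
  have "support_on UNIV \<phi> \<subseteq> K"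
  proof
    fix x assume "x \<in> support_on UNIV \<phi>"
    then have "\<phi> x \<noteq> 0" by (simp add: in_support_on)
    then show "x \<in> K" using assms(3)[of x] by blast
  qed
  then have "supp \<phi> \<subseteq> K" unfolding supp_def using assms(2) by (rule closure_minimal)
  with assms(1) show ?thesis by (simp add: test_functions_in_def)
qed

lemma in_test_functions_in_zero: "\<phi> \<in> test_functions_in K \<Longrightarrow> x \<notin> K \<Longrightarrow> \<phi> x = 0"
  by (meson not_in_supp subsetD test_functions_inD(2))

lemma CN_norm_triangle:
  assumes a: "\<phi> \<in> test_functions" and b: "\<eta> \<in> test_functions"
  shows "CN_norm N (\<lambda>x. \<phi> x + \<eta> x) \<le> CN_norm N \<phi> + CN_norm N \<eta>"
proof (rule CN_norm_le)
  fix "is" :: "'a list" and x :: "real^'a" assume len: "length is \<le> N"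
  have "cmod (pderivs is \<phi> x + pderivs is \<eta> x) \<le> cmod (pderivs is \<phi> x) + cmod (pderivs is \<eta> x)"
    by (rule norm_triangle_ineq)
  also have "\<dots> \<le> CN_norm N \<phi> + CN_norm N \<eta>"
    by (intro add_mono CN_norm_ge a b len)
  finally show "cmod (pderivs is (\<lambda>x. \<phi> x + \<eta> x) x) \<le> CN_norm N \<phi> + CN_norm N \<eta>"
    unfolding pderivs_add[OF a b] .
qed

text \<open>It suffices to treat sub-basic sets, that is, seminorm balls with arbitrary centres, and these are
  handled by the triangle inequality.\<close>

lemma test_topology_in_eventually:
  assumes U: "openin (test_topology_in K) U" and \<eta>: "\<eta> \<in> U" "\<eta> \<in> test_functions_in K"
    and \<phi>: "\<And>m. \<phi> m \<in> test_functions_in K"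
    and lim: "\<And>N. ((\<lambda>m. CN_norm N (\<lambda>x. \<phi> m x - \<eta> x)) \<longlongrightarrow> 0) F"
  shows "\<forall>\<^sub>F m in F. \<phi> m \<in> U"
proof (rule eventually_generate_topology[OF _ \<eta>(1)])
  show "generate_topology_on {{\<eta> \<in> test_functions_in K. CN_norm N (\<lambda>x. \<eta> x - \<phi> x) < e} | \<phi> N e.
        \<phi> \<in> test_functions_in K \<and> 0 < e} U"
    using U by (simp add: test_topology_in_def openin_topology_generated_by_iff)
  fix B assume B: "B \<in> {{\<eta> \<in> test_functions_in K. CN_norm N (\<lambda>x. \<eta> x - \<phi> x) < e} | \<phi> N e.
        \<phi> \<in> test_functions_in K \<and> 0 < e}" "\<eta> \<in> B"
  then obtain \<zeta> N e where B': "B = {\<eta> \<in> test_functions_in K. CN_norm N (\<lambda>x. \<eta> x - \<zeta> x) < e}"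
    "\<zeta> \<in> test_functions_in K" by blast
  have lt: "CN_norm N (\<lambda>x. \<eta> x - \<zeta> x) < e" using B(2) B'(1) by blast
  then have "\<forall>\<^sub>F m in F. CN_norm N (\<lambda>x. \<phi> m x - \<eta> x) < e - CN_norm N (\<lambda>x. \<eta> x - \<zeta> x)"
    by (intro order_tendstoD(2)[OF lim]) simp
  then show "\<forall>\<^sub>F m in F. \<phi> m \<in> B"
  proof (rule eventually_mono)
    fix m assume m: "CN_norm N (\<lambda>x. \<phi> m x - \<eta> x) < e - CN_norm N (\<lambda>x. \<eta> x - \<zeta> x)"
    have "CN_norm N (\<lambda>x. (\<phi> m x - \<eta> x) + (\<eta> x - \<zeta> x)) \<le> CN_norm N (\<lambda>x. \<phi> m x - \<eta> x) + CN_norm N (\<lambda>x. \<eta> x - \<zeta> x)"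
      by (intro CN_norm_triangle test_diff test_functions_inD(1)[OF \<phi>] test_functions_inD(1)[OF \<eta>(2)] test_functions_inD(1)[OF B'(2)])
    with m have "CN_norm N (\<lambda>x. \<phi> m x - \<zeta> x) < e" by simp
    then show "\<phi> m \<in> B" using \<phi> B'(1) by blast
  qed
qed

text \<open>A sub-basic neighbourhood of the limit is a translate \<open>\<zeta> + W\<close>. After translation by \<open>- \<zeta>\<close> the supports
  lie in the compact set \<open>K \<union> supp \<zeta>\<close>, where \<open>W\<close> is open for the topology of the seminorms.\<close>

lemma test_topology_eventually:
  assumes U: "openin test_topology U" and \<eta>: "\<eta> \<in> U" "\<eta> \<in> test_functions_in K" and K: "compact K"
    and \<phi>: "\<And>m. \<phi> m \<in> test_functions_in K"
    and lim: "\<And>N. ((\<lambda>m. CN_norm N (\<lambda>x. \<phi> m x - \<eta> x)) \<longlongrightarrow> 0) F"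
  shows "\<forall>\<^sub>F m in F. \<phi> m \<in> U"
proof (rule eventually_generate_topology[OF _ \<eta>(1)])
  let ?S = "{(\<lambda>\<eta> x. \<phi> x + \<eta> x) ` W | \<phi> W.
        \<phi> \<in> test_functions \<and> W \<subseteq> test_functions \<and> convex_balanced W \<and>
        (\<forall>K. compact K \<longrightarrow> openin (test_topology_in K) (test_functions_in K \<inter> W))}"
  show "generate_topology_on ?S U"
    using U by (simp add: test_topology_def openin_topology_generated_by_iff)
  fix B assume B: "B \<in> ?S" "\<eta> \<in> B"
  then obtain \<zeta> W where W: "B = (\<lambda>\<eta> x. \<zeta> x + \<eta> x) ` W" "\<zeta> \<in> test_functions" "W \<subseteq> test_functions"
    "\<And>K. compact K \<Longrightarrow> openin (test_topology_in K) (test_functions_in K \<inter> W)" by blast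
  then obtain \<kappa> where \<kappa>: "\<kappa> \<in> W" "\<eta> = (\<lambda>x. \<zeta> x + \<kappa> x)" using B(2) by blast
  define K' where "K' = K \<union> supp \<zeta>"
  have K': "compact K'" "closed K'" unfolding K'_def using K test_compact_supp[OF W(2)]
    by (auto intro: compact_Un compact_imp_closed)
  have \<kappa>e: "\<kappa> = (\<lambda>x. \<eta> x - \<zeta> x)" by (simp add: \<kappa>(2))
  have sub: "(\<lambda>x. \<theta> x - \<zeta> x) \<in> test_functions_in K'" if "\<theta> \<in> test_functions_in K" for \<theta>
  proof (rule test_functions_inI[OF _ K'(2)])
    show "(\<lambda>x. \<theta> x - \<zeta> x) \<in> test_functions" by (intro test_diff W(2) test_functions_inD(1)[OF that])
    show "\<theta> x - \<zeta> x = 0" if "x \<notin> K'" for x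
      using that in_test_functions_in_zero[OF \<open>\<theta> \<in> test_functions_in K\<close>, of x] not_in_supp[of x \<zeta>] by (auto simp: K'_def)
  qed
  have "\<forall>\<^sub>F m in F. (\<lambda>x. \<phi> m x - \<zeta> x) \<in> test_functions_in K' \<inter> W"
  proof (rule test_topology_in_eventually[OF W(4)[OF K'(1)]])
    show "\<kappa> \<in> test_functions_in K' \<inter> W" "\<kappa> \<in> test_functions_in K'"
      using \<kappa>(1) sub[OF \<eta>(2)] by (auto simp: \<kappa>e)
    show "(\<lambda>x. \<phi> m x - \<zeta> x) \<in> test_functions_in K'" for m by (rule sub[OF \<phi>])
    show "((\<lambda>m. CN_norm N (\<lambda>x. \<phi> m x - \<zeta> x - \<kappa> x)) \<longlongrightarrow> 0) F" for N
      using lim[of N] by (simp add: \<kappa>e)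
  qed
  then show "\<forall>\<^sub>F m in F. \<phi> m \<in> B"
  proof (rule eventually_mono)
    fix m assume "(\<lambda>x. \<phi> m x - \<zeta> x) \<in> test_functions_in K' \<inter> W"
    then have "(\<lambda>\<eta> x. \<zeta> x + \<eta> x) (\<lambda>x. \<phi> m x - \<zeta> x) \<in> B" unfolding W(1) by (intro imageI) simp
    then show "\<phi> m \<in> B" by simp
  qed
qed

lemma test_in_topspace:
  assumes "\<eta> \<in> test_functions"
  shows "\<eta> \<in> topspace test_topology"
proof -
  have zero: "(\<lambda>x. 0) \<in> test_functions_in K" if "compact K" for K :: "(real^'a) set"
    by (rule test_functions_inI[OF test_zero compact_imp_closed[OF that]]) simp
  have "openin (test_topology_in K) (test_functions_in K \<inter> test_functions)" if K: "compact K" for K :: "(real^'a) set"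
  proof -
    let ?B = "\<lambda>\<phi>. {\<eta> \<in> test_functions_in K. CN_norm 0 (\<lambda>x. \<eta> x - \<phi> x) < 1}"
    have "openin (test_topology_in K) (\<Union>\<phi>\<in>test_functions_in K. ?B \<phi>)"
    proof (rule openin_Union, safe)
      fix \<phi> assume "\<phi> \<in> test_functions_in K"
      then show "openin (test_topology_in K) (?B \<phi>)"
        unfolding test_topology_in_def
        by (intro topology_generated_by_Basis CollectI exI[of _ \<phi>] exI[of _ "0::nat"] exI[of _ "1::real"] conjI refl) auto
    qed
    moreover have "\<phi> \<in> ?B \<phi>" if "\<phi> \<in> test_functions_in K" for \<phi>
    proof -
      have "CN_norm 0 (\<lambda>x::real^'a. 0::complex) \<le> 0"
        by (rule CN_norm_le) (simp add: pderivs_outside_open[of UNIV])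
      then show ?thesis using that by simp
    qed
    then have "(\<Union>\<phi>\<in>test_functions_in K. ?B \<phi>) = test_functions_in K \<inter> test_functions"
      using test_functions_inD(1) by blast
    ultimately show ?thesis by simp
  qed
  moreover have "convex_balanced (test_functions :: (real^'a \<Rightarrow> complex) set)"
    unfolding convex_balanced_def
    by (auto simp: scaleR_conv_of_real intro!: test_add test_cmult)
  ultimately have "openin test_topology ((\<lambda>\<eta> x. 0 + \<eta> x) ` (test_functions :: (real^'a \<Rightarrow> complex) set))"
    unfolding test_topology_def using test_zero
    by (intro topology_generated_by_Basis CollectI exI[of _ "\<lambda>x. 0"] exI[of _ test_functions] conjI refl) auto
  then show ?thesis using assms openin_subset[of test_topology] by auto
qed

text \<open>The form in which the continuity of a distribution is used below: convergence of all derivatives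
  with supports in one compact set passes through \<open>f\<close>.\<close>

lemma distribution_sequential:
  assumes f: "f \<in> distributions" and K: "compact K"
    and \<phi>: "\<And>m. \<phi> m \<in> test_functions_in K" and \<eta>: "\<eta> \<in> test_functions_in K"
    and lim: "\<And>N. ((\<lambda>m. CN_norm N (\<lambda>x. \<phi> m x - \<eta> x)) \<longlongrightarrow> 0) F"
  shows "((\<lambda>m. f (\<phi> m)) \<longlongrightarrow> f \<eta>) F"
proof (rule topological_tendstoI)
  fix V :: "complex set" assume V: "open V" "f \<eta> \<in> V"
  have "continuous_map test_topology euclidean f" using f by (simp add: distributions_def)
  then have "openin test_topology {x \<in> topspace test_topology. f x \<in> V}"
    using V(1) by (auto simp: continuous_map_def)
  then have "\<forall>\<^sub>F m in F. \<phi> m \<in> {x \<in> topspace test_topology. f x \<in> V}"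
  proof (rule test_topology_eventually[OF _ _ \<eta> K \<phi> lim])
    show "\<eta> \<in> {x \<in> topspace test_topology. f x \<in> V}"
      using V(2) test_in_topspace[OF test_functions_inD(1)[OF \<eta>]] by simp
  qed
  then show "\<forall>\<^sub>F m in F. f (\<phi> m) \<in> V" by (rule eventually_mono) simp
qed

lemma distribution_add: "f \<in> distributions \<Longrightarrow> \<phi> \<in> test_functions \<Longrightarrow> \<eta> \<in> test_functions \<Longrightarrow> f (\<lambda>x. \<phi> x + \<eta> x) = f \<phi> + f \<eta>"
  by (simp add: distributions_def)

lemma distribution_cmult: "f \<in> distributions \<Longrightarrow> \<phi> \<in> test_functions \<Longrightarrow> f (\<lambda>x. c * \<phi> x) = c * f \<phi>"
  by (simp add: distributions_def)

lemma distribution_diff: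
  assumes "f \<in> distributions" "\<phi> \<in> test_functions" "\<eta> \<in> test_functions"
  shows "f (\<lambda>x. \<phi> x - \<eta> x) = f \<phi> - f \<eta>"
  using distribution_add[OF assms(1,2) test_cmult[OF assms(3), of "-1"]] distribution_cmult[OF assms(1,3), of "-1"] by simp

lemma distribution_sum:
  assumes f: "f \<in> distributions" and "finite I" "\<And>i. i \<in> I \<Longrightarrow> \<phi> i \<in> test_functions"
  shows "f (\<lambda>x. \<Sum>i\<in>I. \<phi> i x) = (\<Sum>i\<in>I. f (\<phi> i))"
  using assms(2,3)
proof (induction I rule: finite_induct)
  case empty
  show ?case using distribution_cmult[OF f test_zero, of 0] by simp
next
  case (insert i I)
  then have "\<phi> i \<in> test_functions" "(\<lambda>x. \<Sum>i\<in>I. \<phi> i x) \<in> test_functions" by (auto intro!: test_sum(1))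
  then show ?case using insert distribution_add[OF f] by simp
qed

lemma test_reflect:
  assumes "b \<in> test_functions"
  shows "(\<lambda>y. b (z - y)) \<in> test_functions"
    and "pderivs is (\<lambda>y. b (z - y)) = (\<lambda>y. (-1) ^ length is *\<^sub>R pderivs is b (z - y))"
  using test_affine[OF assms, of "-1" z] pderivs_affine(1)[OF assms, of "is" "-1" z]
  by (simp_all add: add.commute diff_conv_add_uminus[symmetric] del: diff_conv_add_uminus add_uminus_conv_diff)
    (simp_all add: algebra_simps)

text \<open>Translates of a test function depend continuously on the translation, with a Lipschitz bound
  for each derivative. Continuity makes the maximal function measurable and the integrals below exist.\<close>

lemma conv_continuous:
  assumes f: "f \<in> distributions" and b: "b \<in> test_functions"
  shows "continuous_on UNIV (conv b f)"
proof (intro continuous_at_imp_continuous_on ballI, unfold isCont_def)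
  fix x :: "real^'a"
  obtain \<rho> where \<rho>: "0 < \<rho>" "supp b \<subseteq> cball 0 \<rho>" using test_supp_cball[OF b] by blast
  define K where "K = cball x (\<rho> + 1)"
  have mem: "(\<lambda>y. b (x' - y)) \<in> test_functions_in K" if "dist x' x < 1" for x'
  proof (rule test_functions_inI[OF test_reflect(1)[OF b]])
    show "closed K" by (simp add: K_def)
    fix y assume y: "y \<notin> K"
    have "x' - y \<notin> cball 0 \<rho>"
    proof
      assume "x' - y \<in> cball 0 \<rho>"
      then have "dist x' y \<le> \<rho>" by (simp add: dist_norm norm_minus_commute)
      then have "dist x y \<le> \<rho> + 1" using that dist_triangle3[of x y x'] by simp
      then show False using y by (simp add: K_def)
    qed
    then show "b (x' - y) = 0" using \<rho>(2) not_in_supp[of "x' - y" b] by blast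
  qed
  have bound: "CN_norm N (\<lambda>y. b (x' - y) - b (x - y)) \<le> real CARD('a) * CN_norm (Suc N) b * norm (x' - x)" for N x'
  proof (rule CN_norm_le)
    fix "is" :: "'a list" and y assume len: "length is \<le> N"
    have "pderivs is (\<lambda>y. b (x' - y) - b (x - y)) y = (-1) ^ length is *\<^sub>R (pderivs is b (x' - y) - pderivs is b (x - y))"
      by (simp add: test_diff(2)[OF test_reflect(1)[OF b] test_reflect(1)[OF b]] test_reflect(2)[OF b] scaleR_diff_right)
    then have "cmod (pderivs is (\<lambda>y. b (x' - y) - b (x - y)) y) = cmod (pderivs is b (x' - y) - pderivs is b (x - y))"
      by (simp add: power_abs)
    also have "\<dots> \<le> real CARD('a) * CN_norm (Suc N) b * norm ((x' - y) - (x - y))"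
      by (rule test_Lipschitz[OF b]) (use len in simp)
    finally show "cmod (pderivs is (\<lambda>y. b (x' - y) - b (x - y)) y) \<le> real CARD('a) * CN_norm (Suc N) b * norm (x' - x)" by simp
  qed
  define \<phi> where "\<phi> x' = (if dist x' x < 1 then (\<lambda>y. b (x' - y)) else (\<lambda>y. b (x - y)))" for x'
  have "((\<lambda>x'. f (\<phi> x')) \<longlongrightarrow> f (\<lambda>y. b (x - y))) (at x)"
  proof (rule distribution_sequential[OF f, of K])
    show "compact K" by (simp add: K_def)
    show "\<phi> x' \<in> test_functions_in K" for x' using mem[of x'] mem[of x] by (auto simp: \<phi>_def)
    show "(\<lambda>y. b (x - y)) \<in> test_functions_in K" using mem[of x] by simp
    fix N
    have ev: "\<forall>\<^sub>F x' in at x. dist x' x < 1" by (rule eventually_at_ball[THEN eventually_mono, of 1]) (auto simp: dist_commute)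
    show "((\<lambda>m. CN_norm N (\<lambda>xa. \<phi> m xa - b (x - xa))) \<longlongrightarrow> 0) (at x)"
    proof (rule Lim_null_comparison)
      show "\<forall>\<^sub>F m in at x. norm (CN_norm N (\<lambda>xa. \<phi> m xa - b (x - xa))) \<le> real CARD('a) * CN_norm (Suc N) b * norm (m - x)"
        using ev
      proof (rule eventually_mono)
        fix m assume m: "dist m x < 1"
        have "0 \<le> cmod (pderivs [] (\<lambda>xa. b (m - xa) - b (x - xa)) 0)" by simp
        also have "\<dots> \<le> CN_norm N (\<lambda>xa. b (m - xa) - b (x - xa))"
          by (rule CN_norm_ge[OF test_diff(1)[OF test_reflect(1)[OF b] test_reflect(1)[OF b]]]) simp
        finally show "norm (CN_norm N (\<lambda>xa. \<phi> m xa - b (x - xa))) \<le> real CARD('a) * CN_norm (Suc N) b * norm (m - x)"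
          using bound[of N m] m by (simp add: \<phi>_def)
      qed
      show "((\<lambda>m. real CARD('a) * CN_norm (Suc N) b * norm (m - x)) \<longlongrightarrow> 0) (at x)"
        by (auto intro!: tendsto_eq_intros)
    qed
  qed
  moreover have "\<forall>\<^sub>F x' in at x. f (\<phi> x') = conv b f x'"
    by (rule eventually_at_ball[THEN eventually_mono, of 1]) (auto simp: dist_commute \<phi>_def conv_def)
  ultimately have "((\<lambda>x'. conv b f x') \<longlongrightarrow> f (\<lambda>y. b (x - y))) (at x)"
    by (rule Lim_transform_eventually)
  then show "((\<lambda>x'. conv b f x') \<longlongrightarrow> conv b f x) (at x)" by (simp only: conv_def)
qed

section \<open>Convolution with test functions\<close>

text \<open>The convolution of \<open>b\<close> with the dilate of \<open>a\<close> to scale \<open>s\<close>, in the variable in which the domain of integration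
  does not move with \<open>s\<close>.\<close>

definition smear :: "(real^'n \<Rightarrow> complex) \<Rightarrow> real \<Rightarrow> (real^'n \<Rightarrow> complex) \<Rightarrow> real^'n \<Rightarrow> complex" where
  "smear a s b x = integral UNIV (\<lambda>y. a y * b (x - s *\<^sub>R y))"

lemma test_supp_cbox:
  assumes "a \<in> test_functions"
  obtains u where "\<And>y. y \<notin> cbox (- u) u \<Longrightarrow> a y = 0"
proof -
  obtain u where u: "supp a \<subseteq> cbox (- u) u"
    using bounded_subset_cbox_symmetric[OF compact_imp_bounded[OF test_compact_supp[OF assms]]] by blast
  show ?thesis
  proof (rule that)
    fix y assume "y \<notin> cbox (- u) u"
    then show "a y = 0" using u by (intro not_in_supp) blast
  qed
qed

lemma integral_UNIV_eq_cbox: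
  fixes h :: "real^'n \<Rightarrow> complex"
  assumes "\<And>y. y \<notin> S \<Longrightarrow> h y = 0"
  shows "integral UNIV h = integral S h"
proof -
  have "h = (\<lambda>y. if y \<in> S then h y else 0)" using assms by auto
  then show ?thesis using Henstock_Kurzweil_Integration.integral_restrict_UNIV[of S h] by metis
qed

lemma smear_cbox:
  assumes "\<And>y. y \<notin> cbox u v \<Longrightarrow> a y = 0"
  shows "smear a s b x = integral (cbox u v) (\<lambda>y. a y * b (x - s *\<^sub>R y))"
  unfolding smear_def by (rule integral_UNIV_eq_cbox) (simp add: assms)

lemma continuous_test_compose:
  assumes "\<phi> \<in> test_functions" "continuous_on S g"
  shows "continuous_on S (\<lambda>x. pderivs is \<phi> (g x))"
  by (rule continuous_on_compose2[OF test_continuous[OF assms(1)] assms(2)]) auto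

lemma continuous_test_compose0:
  assumes "\<phi> \<in> test_functions" "continuous_on S g"
  shows "continuous_on S (\<lambda>x. \<phi> (g x))"
  using continuous_test_compose[OF assms, of "[]"] by simp

text \<open>Differentiation under the integral sign; the integral extends over a fixed box containing the
  support of \<open>a\<close>.\<close>

lemma smear_has_derivative:
  fixes a b :: "real^'n \<Rightarrow> complex"
  assumes a: "a \<in> test_functions" and b: "b \<in> test_functions"
  shows "(smear a s (pderivs is b) has_derivative (\<lambda>h. \<Sum>i\<in>UNIV. h $ i *\<^sub>R smear a s (pderivs (i # is) b) x)) (at x)"
proof -
  obtain u where u: "\<And>y. y \<notin> cbox (- u) u \<Longrightarrow> a y = 0" using test_supp_cbox[OF a] by blast
  define F where "F x t h = (\<Sum>i\<in>UNIV. h $ i *\<^sub>R (a t * pderivs (i # is) b (x - s *\<^sub>R t)))" for x t h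
  have bl: "bounded_linear (F x t)" for x t
    unfolding F_def by (intro bounded_linear_sum bounded_linear_scaleR_const bounded_linear_vec_nth)
  define fx where "fx x t = Blinfun (F x t)" for x t
  have fx: "blinfun_apply (fx x t) = F x t" for x t
    unfolding fx_def by (rule bounded_linear_Blinfun_apply[OF bl])
  have cont: "continuous_on (UNIV \<times> cbox (- u) u) (\<lambda>(x, t). fx x t)"
  proof (rule continuous_on_blinfun_componentwise)
    fix e :: "real^'n"
    show "continuous_on (UNIV \<times> cbox (- u) u) (\<lambda>p. blinfun_apply (case p of (x, t) \<Rightarrow> fx x t) e)"
      unfolding split_beta fx F_def
      by (intro continuous_intros continuous_test_compose[OF b] continuous_test_compose0[OF a])
  qed
  have der: "((\<lambda>x. integral (cbox (- u) u) (\<lambda>t. a t * pderivs is b (x - s *\<^sub>R t))) has_derivative integral (cbox (- u) u) (fx x)) (at x within UNIV)"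
  proof (rule leibniz_rule[OF _ _ cont])
    fix x t :: "real^'n"
    have "((\<lambda>x. x - s *\<^sub>R t) has_derivative (\<lambda>h. h)) (at x)" by (auto intro!: derivative_eq_intros)
    from has_derivative_compose[OF this test_has_derivative[OF b]]
    have "((\<lambda>x. a t * pderivs is b (x - s *\<^sub>R t)) has_derivative
        (\<lambda>h. a t * (\<Sum>i\<in>UNIV. h $ i *\<^sub>R pderivs (i # is) b (x - s *\<^sub>R t)))) (at x)"
      by (rule has_derivative_mult_right)
    then show "((\<lambda>x. a t * pderivs is b (x - s *\<^sub>R t)) has_derivative blinfun_apply (fx x t)) (at x within UNIV)"
      by (simp add: fx F_def[abs_def] sum_distrib_left)
  next
    fix x :: "real^'n"
    show "(\<lambda>t. a t * pderivs is b (x - s *\<^sub>R t)) integrable_on cbox (- u) u"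
      by (intro integrable_continuous continuous_intros continuous_test_compose[OF b] continuous_test_compose0[OF a])
  qed auto
  have int: "fx x integrable_on cbox (- u) u"
  proof (rule integrable_continuous)
    have "continuous_on (cbox (- u) u) ((\<lambda>(x, t). fx x t) \<circ> (\<lambda>t. (x, t)))"
      by (intro continuous_on_compose continuous_intros continuous_on_subset[OF cont]) auto
    then show "continuous_on (cbox (- u) u) (fx x)" by (simp add: o_def)
  qed
  have "blinfun_apply (integral (cbox (- u) u) (fx x)) h = (\<Sum>i\<in>UNIV. h $ i *\<^sub>R smear a s (pderivs (i # is) b) x)" for h
  proof -
    have "blinfun_apply (integral (cbox (- u) u) (fx x)) h = integral (cbox (- u) u) ((\<lambda>B. blinfun_apply B h) \<circ> fx x)"
      by (rule integral_linear[OF int, symmetric]) (rule blinfun.bounded_linear_left)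
    also have "\<dots> = integral (cbox (- u) u) (\<lambda>t. \<Sum>i\<in>UNIV. h $ i *\<^sub>R (a t * pderivs (i # is) b (x - s *\<^sub>R t)))"
      by (simp add: o_def fx F_def)
    also have "\<dots> = (\<Sum>i\<in>UNIV. integral (cbox (- u) u) (\<lambda>t. h $ i *\<^sub>R (a t * pderivs (i # is) b (x - s *\<^sub>R t))))"
      by (intro integral_sum integrable_continuous continuous_intros continuous_test_compose[OF b] continuous_test_compose0[OF a]) auto
    also have "\<dots> = (\<Sum>i\<in>UNIV. h $ i *\<^sub>R smear a s (pderivs (i # is) b) x)"
      by (simp add: smear_cbox[OF u])
    finally show ?thesis .
  qed
  then have "blinfun_apply (integral (cbox (- u) u) (fx x)) = (\<lambda>h. \<Sum>i\<in>UNIV. h $ i *\<^sub>R smear a s (pderivs (i # is) b) x)" ..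
  moreover have "smear a s (pderivs is b) = (\<lambda>x. integral (cbox (- u) u) (\<lambda>t. a t * pderivs is b (x - s *\<^sub>R t)))"
    by (rule ext) (rule smear_cbox[OF u])
  ultimately show ?thesis using der by simp
qed

lemma pderivs_smear:
  fixes a b :: "real^'n \<Rightarrow> complex"
  assumes a: "a \<in> test_functions" and b: "b \<in> test_functions"
  shows "pderivs is (smear a s b) = smear a s (pderivs is b)"
proof (induction "is")
  case (Cons i "is")
  show ?case
  proof
    fix x
    have "pderivs (i # is) (smear a s b) x = (\<Sum>j\<in>UNIV. axis i 1 $ j *\<^sub>R smear a s (pderivs (j # is) b) x)"
      by (rule pderivs_Cons_eqI) (unfold Cons, rule smear_has_derivative[OF a b])
    also have "\<dots> = smear a s (pderivs (i # is) b) x"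
      by (subst sum.remove[of UNIV i]) (auto simp: axis_def intro!: sum.neutral)
    finally show "pderivs (i # is) (smear a s b) x = smear a s (pderivs (i # is) b) x" .
  qed
qed simp

lemma smear_eq_0:
  assumes "supp a \<subseteq> cball 0 \<rho>" "supp b \<subseteq> cball 0 \<sigma>" "\<bar>s\<bar> * \<rho> + \<sigma> < norm x"
  shows "smear a s b x = 0"
proof -
  have "a y * b (x - s *\<^sub>R y) = 0" for y
  proof (cases "y \<in> supp a")
    case True
    then have "norm (s *\<^sub>R y) \<le> \<bar>s\<bar> * \<rho>" using assms(1) by (auto simp: mult_left_mono)
    then have "\<sigma> < norm (x - s *\<^sub>R y)" using assms(3) norm_triangle_ineq2[of x "s *\<^sub>R y"] by linarith
    then have "x - s *\<^sub>R y \<notin> cball 0 \<sigma>" by simp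
    then have "b (x - s *\<^sub>R y) = 0" using assms(2) not_in_supp[of "x - s *\<^sub>R y" b] by blast
    then show ?thesis by simp
  next
    case False
    then show ?thesis using not_in_supp[of y a] by simp
  qed
  then have "(\<lambda>y. a y * b (x - s *\<^sub>R y)) = (\<lambda>y. 0)" ..
  then show ?thesis unfolding smear_def by simp
qed

lemma smear_test:
  assumes a: "a \<in> test_functions" and b: "b \<in> test_functions"
  shows "smear a s b \<in> test_functions"
proof -
  obtain \<rho> where \<rho>: "supp a \<subseteq> cball 0 \<rho>" using test_supp_cball[OF a] by blast
  obtain \<sigma> where \<sigma>: "supp b \<subseteq> cball 0 \<sigma>" using test_supp_cball[OF b] by blast
  show ?thesis
  proof (rule test_functionI[of _ "cball 0 (\<bar>s\<bar> * \<rho> + \<sigma>)"])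
    show "\<exists>F. (pderivs is (smear a s b) has_derivative F) (at x)" for "is" x
      unfolding pderivs_smear[OF a b] using smear_has_derivative[OF a b] by blast
    show "smear a s b x = 0" if "x \<notin> cball 0 (\<bar>s\<bar> * \<rho> + \<sigma>)" for x
      by (rule smear_eq_0[OF \<rho> \<sigma>]) (use that in simp)
  qed simp
qed

lemma smear_integrable:
  assumes a: "a \<in> test_functions" and b: "b \<in> test_functions"
  shows "(\<lambda>y. a y * pderivs is b (x - s *\<^sub>R y)) integrable_on cbox u v"
  by (intro integrable_continuous continuous_intros continuous_test_compose[OF b] continuous_test_compose0[OF a])

lemma integral_cbox_bound:
  fixes h :: "real^'n \<Rightarrow> complex"
  assumes "0 \<le> B" "h integrable_on cbox u v" "\<And>y. y \<in> cbox u v \<Longrightarrow> cmod (h y) \<le> B"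
  shows "cmod (integral (cbox u v) h) \<le> B * measure lborel (cbox u v)"
  by (rule has_integral_bound[OF assms(1) integrable_integral[OF assms(2)]]) (rule assms(3))

lemma Riemann_sum_error:
  fixes h :: "real^'n \<Rightarrow> complex"
  assumes int: "h integrable_on cbox u v" and p: "p tagged_division_of cbox u v" and fine: "(\<lambda>x. ball x d) fine p"
    and B: "0 \<le> B" "\<And>y t. y \<in> cbox u v \<Longrightarrow> t \<in> cbox u v \<Longrightarrow> dist y t < d \<Longrightarrow> cmod (h y - h t) \<le> B"
  shows "cmod ((\<Sum>(y, K)\<in>p. measure lborel K *\<^sub>R h y) - integral (cbox u v) h) \<le> B * measure lborel (cbox u v)"
proof -
  have "(\<Sum>(y, K)\<in>p. measure lborel K *\<^sub>R h y) - integral (cbox u v) h = (\<Sum>(y, K)\<in>p. measure lborel K *\<^sub>R h y - integral K h)"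
    unfolding integral_combine_tagged_division_topdown[OF int p] by (simp add: sum_subtractf[symmetric] split_beta)
  also have "cmod \<dots> \<le> (\<Sum>(y, K)\<in>p. B * measure lborel K)"
  proof (rule sum_norm_le)
    fix yK assume yK: "yK \<in> p"
    obtain y K where [simp]: "yK = (y, K)" by (cases yK)
    obtain c e where K: "K = cbox c e" using tagged_division_ofD(4)[OF p] yK by force
    have sub: "K \<subseteq> cbox u v" "y \<in> K" "K \<subseteq> ball y d"
      using tagged_division_ofD(2,3)[OF p] yK fine by (auto simp: fine_def)
    have hK: "h integrable_on K" using int sub(1) K by (metis integrable_on_subcbox)
    have hi: "(\<lambda>t. h y - h t) integrable_on cbox c e" using hK unfolding K by (intro integrable_diff integrable_const)
    have "measure lborel K *\<^sub>R h y - integral K h = integral K (\<lambda>t. h y - h t)"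
      using hK unfolding K by (subst integral_diff) (auto simp: integrable_const)
    also have "cmod \<dots> \<le> B * measure lborel K"
      unfolding K using sub K by (intro integral_cbox_bound[OF B(1) hi] B(2)) auto
    finally show "norm (case yK of (y, K) \<Rightarrow> measure lborel K *\<^sub>R h y - integral K h) \<le> (case yK of (y, K) \<Rightarrow> B * measure lborel K)" by simp
  qed
  also have "\<dots> = B * (\<Sum>(y, K)\<in>p. measure lborel K)" by (simp add: sum_distrib_left split_beta)
  also have "(\<Sum>(y, K)\<in>p. measure lborel K) = measure lborel (cbox u v)" by (rule additive_content_tagged_division[OF p])
  finally show ?thesis .
qed

lemma smear_integrand_Lipschitz:
  fixes a b :: "real^'n \<Rightarrow> complex"
  assumes a: "a \<in> test_functions" and b: "b \<in> test_functions" and len: "length is \<le> N"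
  shows "cmod (a y * pderivs is b (w - y) - a t * pderivs is b (w - t))
    \<le> real CARD('n) * (CN_norm 1 a * CN_norm N b + CN_norm 0 a * CN_norm (Suc N) b) * dist y t"
proof -
  let ?g = "pderivs is b"
  have "cmod (a y * ?g (w - y) - a t * ?g (w - t)) = cmod ((a y - a t) * ?g (w - y) + a t * (?g (w - y) - ?g (w - t)))"
    by (simp add: algebra_simps)
  also have "\<dots> \<le> cmod (a y - a t) * cmod (?g (w - y)) + cmod (a t) * cmod (?g (w - y) - ?g (w - t))"
    by (metis norm_mult norm_triangle_ineq)
  also have "\<dots> \<le> (real CARD('n) * CN_norm 1 a * dist y t) * CN_norm N b + CN_norm 0 a * (real CARD('n) * CN_norm (Suc N) b * dist y t)"
  proof (intro add_mono mult_mono)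
    show "cmod (a y - a t) \<le> real CARD('n) * CN_norm 1 a * dist y t"
      using test_Lipschitz[OF a, of "[]" 1 y t] by (simp add: dist_norm)
    show "cmod (?g (w - y)) \<le> CN_norm N b" by (rule CN_norm_ge[OF b len])
    show "cmod (a t) \<le> CN_norm 0 a" using CN_norm_ge[OF a, of "[]" 0 t] by simp
    have "cmod (?g (w - y) - ?g (w - t)) \<le> real CARD('n) * CN_norm (Suc N) b * norm ((w - y) - (w - t))"
      by (rule test_Lipschitz[OF b]) (use len in simp)
    then show "cmod (?g (w - y) - ?g (w - t)) \<le> real CARD('n) * CN_norm (Suc N) b * dist y t"
      by (simp add: dist_norm norm_minus_commute)
    show "0 \<le> CN_norm 0 a" by (rule CN_norm_nonneg[OF a])
    show "0 \<le> real CARD('n) * CN_norm 1 a * dist y t" using CN_norm_nonneg[OF a] by simp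
  qed auto
  finally show ?thesis by (simp add: algebra_simps)
qed

text \<open>Riemann sums of the integral defining \<open>smear a 1 b\<close> are finite combinations of translates of \<open>b\<close>, on
  which \<open>f\<close> acts by linearity. They converge with all derivatives, since the integrands are Lipschitz uniformly
  in the point, so \<open>f\<close> commutes with the integral.\<close>

lemma distribution_smear:
  fixes a b :: "real^'n \<Rightarrow> complex"
  assumes f: "f \<in> distributions" and a: "a \<in> test_functions" and b: "b \<in> test_functions"
  shows "f (\<lambda>x. smear a 1 b (z - x)) = integral UNIV (\<lambda>y. a y * conv b f (z - y))"
proof -
  obtain u where u: "\<And>y. y \<notin> cbox (- u) u \<Longrightarrow> a y = 0" using test_supp_cbox[OF a] by blast
  let ?Q = "cbox (- u) u"
  define H where "H y = a y * conv b f (z - y)" for y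
  have Hint: "H integrable_on ?Q"
  proof (rule integrable_continuous)
    have "continuous_on ?Q (\<lambda>y. conv b f (z - y))"
      by (rule continuous_on_compose2[OF conv_continuous[OF f b]]) (auto intro!: continuous_intros)
    then show "continuous_on ?Q H" unfolding H_def
      by (intro continuous_intros test_continuous0[OF a])
  qed
  have HI: "integral UNIV (\<lambda>y. a y * conv b f (z - y)) = integral ?Q H"
    unfolding H_def by (rule integral_UNIV_eq_cbox) (simp add: u)
  have "\<exists>p. p tagged_division_of ?Q \<and> (\<lambda>x. ball x (1 / real (Suc m))) fine p \<and>
      cmod ((\<Sum>(y, K)\<in>p. measure lborel K *\<^sub>R H y) - integral ?Q H) < 1 / real (Suc m)" for m
  proof -
    have "(H has_integral integral ?Q H) ?Q" using Hint by (rule integrable_integral)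
    moreover have "0 < 1 / real (Suc m)" by simp
    ultimately obtain \<gamma> where \<gamma>: "gauge \<gamma>" "\<And>p. p tagged_division_of ?Q \<Longrightarrow> \<gamma> fine p \<Longrightarrow>
        cmod ((\<Sum>(y, K)\<in>p. measure lborel K *\<^sub>R H y) - integral ?Q H) < 1 / real (Suc m)"
      by (rule has_integralD) blast
    have "gauge (\<lambda>x. \<gamma> x \<inter> ball x (1 / real (Suc m)))"
      using \<gamma>(1) by (intro gauge_Int gauge_ball) auto
    then obtain p where p: "p tagged_division_of ?Q" "(\<lambda>x. \<gamma> x \<inter> ball x (1 / real (Suc m))) fine p"
      by (rule fine_division_exists)
    then show ?thesis using \<gamma>(2) by (auto simp: fine_Int)
  qed
  then have "\<forall>m. \<exists>p. p tagged_division_of ?Q \<and> (\<lambda>x. ball x (1 / real (Suc m))) fine p \<and>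
      cmod ((\<Sum>(y, K)\<in>p. measure lborel K *\<^sub>R H y) - integral ?Q H) < 1 / real (Suc m)" ..
  then obtain p where "\<forall>m. p m tagged_division_of ?Q \<and> (\<lambda>x. ball x (1 / real (Suc m))) fine p m \<and>
      cmod ((\<Sum>(y, K)\<in>p m. measure lborel K *\<^sub>R H y) - integral ?Q H) < 1 / real (Suc m)"
    by (rule exE[OF choice])
  then have p: "p m tagged_division_of ?Q" "(\<lambda>x. ball x (1 / real (Suc m))) fine p m"
      "cmod ((\<Sum>(y, K)\<in>p m. measure lborel K *\<^sub>R H y) - integral ?Q H) < 1 / real (Suc m)" for m
    by auto
  have pfin: "finite (p m)" for m using tagged_division_ofD(1)[OF p(1)] .
  define \<phi> where "\<phi> m x = (\<Sum>q\<in>p m. (measure lborel (snd q) *\<^sub>R a (fst q)) * b ((z - fst q) - x))" for m x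
  define \<eta> where "\<eta> x = smear a 1 b (z - x)" for x
  have terms: "(\<lambda>x. c * b ((z - y) - x)) \<in> test_functions" for c y
    by (rule test_cmult[OF test_reflect(1)[OF b]])
  have \<phi>t: "\<phi> m \<in> test_functions" for m
    unfolding \<phi>_def using pfin terms by (intro test_sum(1))
  have \<eta>t: "\<eta> \<in> test_functions" unfolding \<eta>_def by (rule test_reflect(1)[OF smear_test[OF a b]])
  have f\<phi>: "f (\<phi> m) = (\<Sum>(y, K)\<in>p m. measure lborel K *\<^sub>R H y)" for m
  proof -
    have "f (\<phi> m) = (\<Sum>q\<in>p m. f (\<lambda>x. (measure lborel (snd q) *\<^sub>R a (fst q)) * b ((z - fst q) - x)))"
      unfolding \<phi>_def using pfin terms by (intro distribution_sum[OF f])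
    also have "\<dots> = (\<Sum>q\<in>p m. (measure lborel (snd q) *\<^sub>R a (fst q)) * f (\<lambda>x. b ((z - fst q) - x)))"
      by (intro sum.cong refl distribution_cmult[OF f test_reflect(1)[OF b]])
    finally show ?thesis by (simp add: H_def conv_def split_beta)
  qed
  have lim1: "(\<lambda>m. f (\<phi> m)) \<longlonglongrightarrow> integral ?Q H"
  proof (rule Lim_transform_bound[of "\<lambda>m. f (\<phi> m) - integral ?Q H" "\<lambda>m. 1 / real (Suc m)", THEN Lim_null[THEN iffD2]])
    show "\<forall>\<^sub>F m in sequentially. norm (f (\<phi> m) - integral ?Q H) \<le> norm (1 / real (Suc m))"
      using p(3) by (intro always_eventually allI) (auto simp: f\<phi> intro: less_imp_le)
    show "(\<lambda>m. 1 / real (Suc m)) \<longlonglongrightarrow> 0" using LIMSEQ_inverse_real_of_nat by (simp add: inverse_eq_divide)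
  qed
  obtain \<rho> where \<rho>: "supp a \<subseteq> cball 0 \<rho>" using test_supp_cball[OF a] by blast
  obtain \<sigma> where \<sigma>: "supp b \<subseteq> cball 0 \<sigma>" using test_supp_cball[OF b] by blast
  obtain U where U: "0 < U" "\<And>y. y \<in> ?Q \<Longrightarrow> norm y \<le> U" using bounded_cbox[of "-u" u] by (auto simp: bounded_pos)
  define K where "K = cball z (max (\<bar>1\<bar> * \<rho> + \<sigma>) (\<sigma> + U))"
  have \<phi>K: "\<phi> m \<in> test_functions_in K" for m
  proof (rule test_functions_inI[OF \<phi>t])
    show "closed K" by (simp add: K_def)
    fix x assume "x \<notin> K"
    then have x: "\<sigma> + U < norm (z - x)" by (simp add: K_def dist_norm)
    have "b ((z - fst q) - x) = 0" if q: "q \<in> p m" for q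
    proof -
      obtain y k where [simp]: "q = (y, k)" by (cases q)
      have "y \<in> ?Q" using tagged_division_ofD(2,3)[OF p(1)] q by fastforce
      then have "norm y \<le> U" by (rule U(2))
      then have "\<sigma> < norm ((z - x) - y)" using x norm_triangle_ineq2[of "z - x" y] by linarith
      then have "(z - fst q) - x \<notin> cball 0 \<sigma>" by (simp add: algebra_simps)
      then have "(z - fst q) - x \<notin> supp b" using \<sigma> by blast
      then show ?thesis by (rule not_in_supp)
    qed
    then show "\<phi> m x = 0" by (simp add: \<phi>_def)
  qed
  have \<eta>K: "\<eta> \<in> test_functions_in K"
  proof (rule test_functions_inI[OF \<eta>t])
    show "closed K" by (simp add: K_def)
    fix x assume "x \<notin> K"
    then have x: "\<bar>1\<bar> * \<rho> + \<sigma> < norm (z - x)" by (simp add: K_def dist_norm)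
    then show "\<eta> x = 0" unfolding \<eta>_def by (rule smear_eq_0[OF \<rho> \<sigma>])
  qed
  have lim2: "(\<lambda>m. f (\<phi> m)) \<longlonglongrightarrow> f \<eta>"
  proof (rule distribution_sequential[OF f _ \<phi>K \<eta>K])
    show "compact K" by (simp add: K_def)
    fix N
    define L where "L = real CARD('n) * (CN_norm 1 a * CN_norm N b + CN_norm 0 a * CN_norm (Suc N) b)"
    have L: "0 \<le> L"
      using CN_norm_nonneg[OF a] CN_norm_nonneg[OF b] by (simp add: L_def)
    have le: "CN_norm N (\<lambda>x. \<phi> m x - \<eta> x) \<le> L * (1 / real (Suc m)) * measure lborel ?Q" for m
    proof (rule CN_norm_le)
      fix "is" :: "'n list" and x assume len: "length is \<le> N"
      let ?h = "\<lambda>y. a y * pderivs is b ((z - x) - y)"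
      have 1: "pderivs is (\<phi> m) x = (-1) ^ length is *\<^sub>R (\<Sum>(y, K)\<in>p m. measure lborel K *\<^sub>R ?h y)"
      proof -
        have "pderivs is (\<phi> m) x = (\<Sum>q\<in>p m. (measure lborel (snd q) *\<^sub>R a (fst q)) * ((-1) ^ length is *\<^sub>R pderivs is b ((z - fst q) - x)))"
        proof -
          have e: "\<phi> m = (\<lambda>x. \<Sum>q\<in>p m. (measure lborel (snd q) *\<^sub>R a (fst q)) * b ((z - fst q) - x))"
            by (rule ext) (simp only: \<phi>_def)
          show ?thesis unfolding e test_sum(2)[OF pfin terms] pderivs_cmult[OF test_reflect(1)[OF b]] test_reflect(2)[OF b] ..
        qed
        then show ?thesis by (simp add: scaleR_sum_right split_beta algebra_simps)
      qed
      have 2: "pderivs is \<eta> x = (-1) ^ length is *\<^sub>R integral ?Q ?h"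
      proof -
        have "\<eta> = (\<lambda>x. smear a 1 b (z - x))" by (rule ext) (simp only: \<eta>_def)
        moreover have "smear a 1 (pderivs is b) (z - x) = integral ?Q ?h"
          using smear_cbox[OF u, where s=1 and b="pderivs is b" and x="z - x"] by simp
        ultimately show ?thesis by (simp add: test_reflect(2)[OF smear_test[OF a b]] pderivs_smear[OF a b])
      qed
      have "cmod (pderivs is (\<lambda>x. \<phi> m x - \<eta> x) x) = cmod ((\<Sum>(y, K)\<in>p m. measure lborel K *\<^sub>R ?h y) - integral ?Q ?h)"
        unfolding test_diff(2)[OF \<phi>t \<eta>t] 1 2 scaleR_diff_right[symmetric] by (simp add: power_abs)
      also have "\<dots> \<le> L * (1 / real (Suc m)) * measure lborel ?Q"
      proof (rule Riemann_sum_error[OF _ p(1,2)])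
        show "?h integrable_on ?Q" using smear_integrable[OF a b, of "is" "z - x" 1] by simp
        show "0 \<le> L * (1 / real (Suc m))" using L by simp
        fix y t :: "real^'n" assume d: "dist y t < 1 / real (Suc m)"
        have "cmod (?h y - ?h t) \<le> L * dist y t" unfolding L_def by (rule smear_integrand_Lipschitz[OF a b len])
        also have "\<dots> \<le> L * (1 / real (Suc m))" using d L by (intro mult_left_mono) auto
        finally show "cmod (?h y - ?h t) \<le> L * (1 / real (Suc m))" .
      qed
      finally show "cmod (pderivs is (\<lambda>x. \<phi> m x - \<eta> x) x) \<le> L * (1 / real (Suc m)) * measure lborel ?Q" .
    qed
    show "(\<lambda>m. CN_norm N (\<lambda>x. \<phi> m x - \<eta> x)) \<longlonglongrightarrow> 0"
    proof (rule tendsto_sandwich[OF _ _ tendsto_const])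
      show "\<forall>\<^sub>F m in sequentially. 0 \<le> CN_norm N (\<lambda>x. \<phi> m x - \<eta> x)"
        by (intro always_eventually allI CN_norm_nonneg test_diff(1)[OF \<phi>t \<eta>t])
      show "\<forall>\<^sub>F m in sequentially. CN_norm N (\<lambda>x. \<phi> m x - \<eta> x) \<le> L * (1 / real (Suc m)) * measure lborel ?Q"
        using le by (intro always_eventually allI)
      have "(\<lambda>m. L * (1 / real (Suc m)) * measure lborel ?Q) \<longlonglongrightarrow> L * 0 * measure lborel ?Q"
        using LIMSEQ_inverse_real_of_nat by (intro tendsto_intros) (simp add: inverse_eq_divide)
      then show "(\<lambda>m. L * (1 / real (Suc m)) * measure lborel ?Q) \<longlonglongrightarrow> 0" by simp
    qed
  qed
  from LIMSEQ_unique[OF lim2 lim1] show ?thesis unfolding HI \<eta>_def[abs_def] .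
qed

text \<open>Substitution \<open>w = 2\<^sup>k (x - y)\<close>; the normalising factor of the dyadic dilation is the Jacobian.\<close>

lemma smear_dyadic:
  fixes a \<psi> :: "real^'n \<Rightarrow> complex"
  assumes a: "a \<in> test_functions" and \<psi>: "\<psi> \<in> test_functions"
  shows "smear a 1 (dyadic k \<psi>) x = smear \<psi> (1 / 2 ^ k) a x"
proof -
  obtain u where u: "\<And>y. y \<notin> cbox (- u) u \<Longrightarrow> \<psi> y = 0" using test_supp_cbox[OF \<psi>] by blast
  define h where "h w = \<psi> w * a (x - (1 / 2 ^ k) *\<^sub>R w)" for w
  let ?I = "smear \<psi> (1 / 2 ^ k) a x"
  have "(h has_integral ?I) (cbox (- u) u)"
  proof -
    have "h integrable_on cbox (- u) u"
      unfolding h_def using smear_integrable[OF \<psi> a, of "[]" x "1 / 2 ^ k"] by simp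
    moreover have "?I = integral (cbox (- u) u) h" unfolding h_def by (rule smear_cbox[OF u])
    ultimately show ?thesis using integrable_integral by metis
  qed
  then have "((\<lambda>y. h ((- (2 ^ k)) *\<^sub>R y + 2 ^ k *\<^sub>R x)) has_integral (1 / (\<bar>- (2 ^ k)\<bar> ^ DIM(real^'n))) *\<^sub>R ?I)
      ((\<lambda>y. (1 / (- (2 ^ k))) *\<^sub>R y + - ((1 / (- (2 ^ k))) *\<^sub>R (2 ^ k *\<^sub>R x))) ` cbox (- u) u)"
    by (rule has_integral_affinity) simp
  then have "((\<lambda>y. h ((- (2 ^ k)) *\<^sub>R y + 2 ^ k *\<^sub>R x)) has_integral (1 / (\<bar>- (2 ^ k)\<bar> ^ DIM(real^'n))) *\<^sub>R ?I) UNIV"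
  proof (rule has_integral_on_superset)
    fix y assume y: "y \<notin> (\<lambda>y. (1 / (- (2 ^ k))) *\<^sub>R y + - ((1 / (- (2 ^ k))) *\<^sub>R (2 ^ k *\<^sub>R x))) ` cbox (- u) u"
    have "y = (1 / (- (2 ^ k))) *\<^sub>R ((- (2 ^ k)) *\<^sub>R y + 2 ^ k *\<^sub>R x) + - ((1 / (- (2 ^ k))) *\<^sub>R (2 ^ k *\<^sub>R x))"
      by (simp add: scaleR_diff_right scaleR_add_right)
    with y have "(- (2 ^ k)) *\<^sub>R y + 2 ^ k *\<^sub>R x \<notin> cbox (- u) u" by blast
    then show "h ((- (2 ^ k)) *\<^sub>R y + 2 ^ k *\<^sub>R x) = 0" unfolding h_def using u by simp
  qed auto
  then have "((\<lambda>y. 2 ^ (k * CARD('n)) * h ((- (2 ^ k)) *\<^sub>R y + 2 ^ k *\<^sub>R x)) has_integral 2 ^ (k * CARD('n)) * ((1 / (\<bar>- (2 ^ k)\<bar> ^ DIM(real^'n))) *\<^sub>R ?I)) UNIV"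
    by (rule has_integral_mult_right)
  moreover have "2 ^ (k * CARD('n)) * h ((- (2 ^ k)) *\<^sub>R y + 2 ^ k *\<^sub>R x) = a y * dyadic k \<psi> (x - 1 *\<^sub>R y)" for y
    by (simp add: h_def dyadic_def scaleR_diff_right scaleR_add_right)
  moreover have "2 ^ (k * CARD('n)) * ((1 / (\<bar>- (2 ^ k)\<bar> ^ DIM(real^'n))) *\<^sub>R ?I) = ?I"
    by (simp add: power_mult scaleR_conv_of_real)
  ultimately have "((\<lambda>y. a y * dyadic k \<psi> (x - 1 *\<^sub>R y)) has_integral ?I) UNIV" by simp
  then show ?thesis unfolding smear_def[of a] by (rule integral_unique)
qed

lemma test_dyadic:
  assumes "\<psi> \<in> test_functions"
  shows "dyadic k \<psi> \<in> test_functions"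
  unfolding dyadic_def using test_cmult[OF test_affine[OF assms, of "2 ^ k" 0]] by simp

lemma distribution_smear_dyadic:
  assumes "f \<in> distributions" "a \<in> test_functions" "\<psi> \<in> test_functions"
  shows "f (\<lambda>x. smear \<psi> (1 / 2 ^ k) a (z - x)) = integral UNIV (\<lambda>y. a y * conv (dyadic k \<psi>) f (z - y))"
  using distribution_smear[OF assms(1,2) test_dyadic[OF assms(3)], of k z] by (simp only: smear_dyadic[OF assms(2,3)])

lemma smear_commute:
  fixes a b c :: "real^'n \<Rightarrow> complex"
  assumes a: "a \<in> test_functions" and b: "b \<in> test_functions" and c: "c \<in> test_functions"
  shows "smear a s (smear b t c) x = smear b t (smear a s c) x"
proof -
  obtain u where u: "\<And>y. y \<notin> cbox (- u) u \<Longrightarrow> a y = 0" using test_supp_cbox[OF a] by blast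
  obtain v where v: "\<And>y. y \<notin> cbox (- v) v \<Longrightarrow> b y = 0" using test_supp_cbox[OF b] by blast
  have sa: "smear a r g y = integral (cbox (- u) u) (\<lambda>w. a w * g (y - r *\<^sub>R w))" for r g y by (rule smear_cbox[OF u])
  have sb: "smear b r g y = integral (cbox (- v) v) (\<lambda>w. b w * g (y - r *\<^sub>R w))" for r g y by (rule smear_cbox[OF v])
  have "smear a s (smear b t c) x = integral (cbox (- u) u) (\<lambda>y. integral (cbox (- v) v) (\<lambda>w. a y * (b w * c ((x - s *\<^sub>R y) - t *\<^sub>R w))))"
    unfolding sa sb by simp
  also have "\<dots> = integral (cbox (- v) v) (\<lambda>w. integral (cbox (- u) u) (\<lambda>y. a y * (b w * c ((x - s *\<^sub>R y) - t *\<^sub>R w))))"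
    by (rule integral_swap_continuous)
      (simp only: split_beta', intro continuous_intros continuous_test_compose0[OF a] continuous_test_compose0[OF b] continuous_test_compose0[OF c])
  also have "\<dots> = integral (cbox (- v) v) (\<lambda>w. b w * integral (cbox (- u) u) (\<lambda>y. a y * c ((x - t *\<^sub>R w) - s *\<^sub>R y)))"
    by (simp add: integral_mult_right[symmetric] algebra_simps del: integral_mult_right)
  also have "\<dots> = smear b t (smear a s c) x"
    unfolding sa sb by simp
  finally show ?thesis .
qed

section \<open>Extrapolated mollifiers\<close>

text \<open>Coefficients for which \<open>\<Sum> c i * P(s / 2\<^sup>i) = P(0)\<close> for every polynomial \<open>P\<close> of degree below \<open>M\<close>, as in
  Richardson extrapolation.\<close>

definition richardson :: "nat \<Rightarrow> (nat \<Rightarrow> real) \<Rightarrow> bool" where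
  "richardson M c \<longleftrightarrow> (\<Sum>i<M. c i) = 1 \<and> (\<forall>k. 0 < k \<and> k < M \<longrightarrow> (\<Sum>i<M. c i * (1 / 2 ^ i) ^ k) = 0)"

text \<open>One more order is gained by passing from \<open>c\<close> to \<open>(2\<^sup>M c' - c) / (2\<^sup>M - 1)\<close>, where \<open>c'\<close> is \<open>c\<close> shifted to
  half the scale: the shift multiplies the moment of order \<open>k\<close> by \<open>2\<^sup>-\<^sup>k\<close>, so order \<open>M\<close> is annihilated,
  lower orders stay 0 and order 0 stays 1.\<close>

lemma richardson_exists: "\<exists>c. richardson (Suc M) c"
proof (induction M)
  case 0
  then show ?case by (intro exI[of _ "\<lambda>_. 1"]) (auto simp: richardson_def)
next
  case (Suc M)
  then obtain c :: "nat \<Rightarrow> real" where c: "(\<Sum>i<Suc M. c i) = 1" "\<And>k. 0 < k \<Longrightarrow> k < Suc M \<Longrightarrow> (\<Sum>i<Suc M. c i * (1 / 2 ^ i) ^ k) = 0"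
    unfolding richardson_def by blast
  let ?t = "(2::real) ^ Suc M"
  have t: "?t - 1 > 0" using one_less_power[of "2::real" "Suc M"] by simp
  define e where "e i = (?t * (if i = 0 then 0 else c (i - 1)) - (if i < Suc M then c i else 0)) / (?t - 1)" for i
  have key: "(\<Sum>i<Suc (Suc M). e i * (1 / 2 ^ i) ^ k) = (?t * (1 / 2) ^ k - 1) / (?t - 1) * (\<Sum>i<Suc M. c i * (1 / 2 ^ i) ^ k)" for k
  proof -
    have 1: "(\<Sum>i<Suc (Suc M). (if i = 0 then 0 else c (i - 1)) * (1 / 2 ^ i) ^ k) = (1 / 2) ^ k * (\<Sum>i<Suc M. c i * (1 / 2 ^ i) ^ k)"
      unfolding sum.lessThan_Suc_shift[of _ "Suc M"] by (simp add: sum_distrib_left power_divide power_mult_distrib algebra_simps del: sum.lessThan_Suc)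
    have 2: "(\<Sum>i<Suc (Suc M). (if i < Suc M then c i else 0) * (1 / 2 ^ i) ^ k) = (\<Sum>i<Suc M. c i * (1 / 2 ^ i) ^ k)"
      unfolding sum.lessThan_Suc[of _ "Suc M"] by (simp del: sum.lessThan_Suc)
    have "(\<Sum>i<Suc (Suc M). e i * (1 / 2 ^ i) ^ k) = (\<Sum>i<Suc (Suc M). ?t / (?t - 1) * ((if i = 0 then 0 else c (i - 1)) * (1 / 2 ^ i) ^ k)
        - 1 / (?t - 1) * ((if i < Suc M then c i else 0) * (1 / 2 ^ i) ^ k))"
      by (intro sum.cong refl) (simp only: e_def diff_divide_distrib left_diff_distrib times_divide_eq_left times_divide_eq_right mult_1 mult.assoc)
    also have "\<dots> = ?t / (?t - 1) * (\<Sum>i<Suc (Suc M). (if i = 0 then 0 else c (i - 1)) * (1 / 2 ^ i) ^ k)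
        - 1 / (?t - 1) * (\<Sum>i<Suc (Suc M). (if i < Suc M then c i else 0) * (1 / 2 ^ i) ^ k)"
      unfolding sum_subtractf sum_distrib_left ..
    also have "\<dots> = (?t * (1 / 2) ^ k - 1) / (?t - 1) * (\<Sum>i<Suc M. c i * (1 / 2 ^ i) ^ k)"
      unfolding 1 2 by (simp only: diff_divide_distrib left_diff_distrib times_divide_eq_left times_divide_eq_right mult_1 mult.assoc)
    finally show ?thesis .
  qed
  have "(\<Sum>i<Suc (Suc M). e i) = 1" using key[of 0] c(1) t by (simp del: sum.lessThan_Suc)
  moreover have "(\<Sum>i<Suc (Suc M). e i * (1 / 2 ^ i) ^ k) = 0" if k: "0 < k" "k < Suc (Suc M)" for k
  proof (cases "k = Suc M")
    case True
    have "?t * (1 / 2) ^ k = 1" unfolding True by (simp add: power_divide)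
    then show ?thesis unfolding key by simp
  next
    case False
    then show ?thesis unfolding key using c(2)[of k] k by (simp del: sum.lessThan_Suc)
  qed
  ultimately show ?case unfolding richardson_def by blast
qed

text \<open>Maclaurin's theorem is applied to the real and the imaginary part separately, whence the factor 2.\<close>

lemma vector_Taylor_bound:
  fixes d :: "nat \<Rightarrow> real \<Rightarrow> complex"
  assumes d: "\<And>m t. (d m has_vector_derivative d (Suc m) t) (at t)" and B: "\<And>t. cmod (d M t) \<le> B"
    and M: "0 < M" and h: "0 < h"
  shows "cmod (d 0 h - (\<Sum>m<M. (h ^ m / fact m) *\<^sub>R d m 0)) \<le> 2 * B * h ^ M"
proof -
  have part: "\<bar>g (d 0 h) - (\<Sum>m<M. g (d m 0) / fact m * h ^ m)\<bar> \<le> B * h ^ M"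
    if g: "\<And>m t. DERIV (\<lambda>t. g (d m t)) t :> g (d (Suc m) t)" "\<And>z. \<bar>g z\<bar> \<le> cmod z" for g :: "complex \<Rightarrow> real"
  proof -
    obtain t where t: "g (d 0 h) = (\<Sum>m<M. g (d m 0) / fact m * h ^ m) + g (d M t) / fact M * h ^ M"
      using Maclaurin[of h M "\<lambda>m t. g (d m t)" "\<lambda>t. g (d 0 t)"] h M g(1) by blast
    have "\<bar>g (d M t)\<bar> \<le> B" using g(2)[of "d M t"] B[of t] by simp
    moreover have "1 \<le> (fact M :: real)" by (simp add: fact_ge_1)
    ultimately have "\<bar>g (d M t)\<bar> / fact M \<le> B / 1" by (intro frac_le) auto
    then have "\<bar>g (d M t)\<bar> / fact M * h ^ M \<le> B * h ^ M"
      using h by (intro mult_right_mono) auto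
    then have "\<bar>g (d M t) / fact M * h ^ M\<bar> \<le> B * h ^ M"
      using h by (simp add: abs_mult)
    then show ?thesis using t by simp
  qed
  let ?z = "d 0 h - (\<Sum>m<M. (h ^ m / fact m) *\<^sub>R d m 0)"
  have "\<bar>Re ?z\<bar> \<le> B * h ^ M"
    using part[of Re] has_field_derivative_Re[OF d] abs_Re_le_cmod by (simp add: mult.commute)
  moreover have "\<bar>Im ?z\<bar> \<le> B * h ^ M"
    using part[of Im] has_field_derivative_Im[OF d] abs_Im_le_cmod by (simp add: mult.commute)
  ultimately show ?thesis using cmod_le[of ?z] by simp
qed

text \<open>The derivative of order \<open>m\<close> at \<open>t\<close> of \<open>t \<mapsto> \<phi> (x + t v)\<close>, expanded in partial derivatives; every list of
  coordinates contributes, so no multinomial coefficients occur.\<close>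

definition line_deriv :: "(real^'n \<Rightarrow> complex) \<Rightarrow> real^'n \<Rightarrow> real^'n \<Rightarrow> nat \<Rightarrow> real \<Rightarrow> complex" where
  "line_deriv \<phi> x v m t = (\<Sum>is\<in>{is. length is = m}. prod_list (map (\<lambda>i. v $ i) is) *\<^sub>R pderivs is \<phi> (x + t *\<^sub>R v))"

lemma line_deriv_has_derivative:
  fixes \<phi> :: "real^'n \<Rightarrow> complex"
  assumes \<phi>: "\<phi> \<in> test_functions"
  shows "(line_deriv \<phi> x v m has_vector_derivative line_deriv \<phi> x v (Suc m) t) (at t)"
proof -
  have 1: "((\<lambda>t. pderivs is \<phi> (x + t *\<^sub>R v)) has_vector_derivative (\<Sum>i\<in>UNIV. v $ i *\<^sub>R pderivs (i # is) \<phi> (x + t *\<^sub>R v))) (at t)" for "is"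
  proof -
    have "((\<lambda>t. x + t *\<^sub>R v) has_derivative (\<lambda>h. h *\<^sub>R v)) (at t)" by (auto intro!: derivative_eq_intros)
    from has_derivative_compose[OF this test_has_derivative[OF \<phi>]]
    have "((\<lambda>t. pderivs is \<phi> (x + t *\<^sub>R v)) has_derivative (\<lambda>h. \<Sum>i\<in>UNIV. (h *\<^sub>R v) $ i *\<^sub>R pderivs (i # is) \<phi> (x + t *\<^sub>R v))) (at t)" .
    then show ?thesis unfolding has_vector_derivative_def by (simp add: scaleR_sum_right mult.commute)
  qed
  have eq: "{is :: 'n list. length is = Suc m} = (\<lambda>(i, is). i # is) ` (UNIV \<times> {is. length is = m})"
    by (auto simp: length_Suc_conv image_iff)
  have "line_deriv \<phi> x v (Suc m) t = (\<Sum>(i, is)\<in>UNIV \<times> {is. length is = m}. prod_list (map (\<lambda>i. v $ i) (i # is)) *\<^sub>R pderivs (i # is) \<phi> (x + t *\<^sub>R v))"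
    unfolding line_deriv_def eq by (subst sum.reindex) (auto simp: inj_on_def split_beta)
  also have "\<dots> = (\<Sum>i\<in>UNIV. \<Sum>is\<in>{is. length is = m}. prod_list (map (\<lambda>i. v $ i) (i # is)) *\<^sub>R pderivs (i # is) \<phi> (x + t *\<^sub>R v))"
    by (rule sum.cartesian_product[symmetric])
  also have "\<dots> = (\<Sum>is\<in>{is. length is = m}. \<Sum>i\<in>UNIV. prod_list (map (\<lambda>i. v $ i) (i # is)) *\<^sub>R pderivs (i # is) \<phi> (x + t *\<^sub>R v))"
    by (rule sum.swap)
  also have "\<dots> = (\<Sum>is\<in>{is. length is = m}. prod_list (map (\<lambda>i. v $ i) is) *\<^sub>R (\<Sum>i\<in>UNIV. v $ i *\<^sub>R pderivs (i # is) \<phi> (x + t *\<^sub>R v)))"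
    by (simp add: scaleR_sum_right mult.commute)
  finally have "line_deriv \<phi> x v (Suc m) t = (\<Sum>is\<in>{is. length is = m}. prod_list (map (\<lambda>i. v $ i) is) *\<^sub>R (\<Sum>i\<in>UNIV. v $ i *\<^sub>R pderivs (i # is) \<phi> (x + t *\<^sub>R v)))" .
  moreover have "(line_deriv \<phi> x v m has_vector_derivative (\<Sum>is\<in>{is. length is = m}. prod_list (map (\<lambda>i. v $ i) is) *\<^sub>R (\<Sum>i\<in>UNIV. v $ i *\<^sub>R pderivs (i # is) \<phi> (x + t *\<^sub>R v)))) (at t)"
    unfolding line_deriv_def[abs_def]
    by (intro has_vector_derivative_sum bounded_linear.has_vector_derivative[OF bounded_linear_scaleR_right] 1)
  ultimately show ?thesis by simp
qed

lemma line_deriv_bound: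
  fixes \<phi> :: "real^'n \<Rightarrow> complex"
  assumes \<phi>: "\<phi> \<in> test_functions"
  shows "cmod (line_deriv \<phi> x v m t) \<le> (real CARD('n) * norm v) ^ m * CN_norm m \<phi>"
proof -
  have pl: "\<bar>prod_list (map (\<lambda>i. v $ i) is)\<bar> \<le> norm v ^ length is" for "is"
  proof (induction "is")
    case (Cons i "is")
    then show ?case using component_le_norm_cart[of v i] by (simp add: abs_mult mult_mono)
  qed simp
  have "cmod (line_deriv \<phi> x v m t) \<le> (\<Sum>is\<in>{is :: 'n list. length is = m}. norm v ^ m * CN_norm m \<phi>)"
    unfolding line_deriv_def
  proof (rule sum_norm_le)
    fix "is" :: "'n list" assume "is \<in> {is. length is = m}"
    then have len: "length is = m" by simp
    show "norm (prod_list (map (\<lambda>i. v $ i) is) *\<^sub>R pderivs is \<phi> (x + t *\<^sub>R v)) \<le> norm v ^ m * CN_norm m \<phi>"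
      unfolding norm_scaleR using pl[of "is"] len CN_norm_ge[OF \<phi>, of "is" m]
      by (intro mult_mono) auto
  qed
  also have "\<dots> = real (CARD('n) ^ m) * (norm v ^ m * CN_norm m \<phi>)"
    using card_lists_length_eq[of "UNIV :: 'n set" m] by simp
  finally show ?thesis by (simp add: power_mult_distrib mult.assoc)
qed

text \<open>The combination reproduces the Taylor polynomial along the line at \<open>t = 0\<close>, so only the
  remainders of order \<open>M\<close> survive.\<close>

lemma richardson_error:
  fixes \<phi> :: "real^'n \<Rightarrow> complex"
  assumes \<phi>: "\<phi> \<in> test_functions" and c: "richardson M c" and M: "0 < M" and s: "0 < s"
  shows "cmod ((\<Sum>i<M. c i *\<^sub>R \<phi> (x - (s / 2 ^ i) *\<^sub>R y)) - \<phi> x)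
    \<le> (\<Sum>i<M. \<bar>c i\<bar>) * (2 * ((real CARD('n) * norm y) ^ M * CN_norm M \<phi>) * s ^ M)"
proof -
  let ?d = "line_deriv \<phi> x (- y)"
  let ?B = "(real CARD('n) * norm y) ^ M * CN_norm M \<phi>"
  have d0: "?d 0 t = \<phi> (x - t *\<^sub>R y)" for t by (simp add: line_deriv_def)
  have B0: "0 \<le> ?B" using CN_norm_nonneg[OF \<phi>] by simp
  define E where "E i = ?d 0 (s / 2 ^ i) - (\<Sum>m<M. ((s / 2 ^ i) ^ m / fact m) *\<^sub>R ?d m 0)" for i :: nat
  have E: "cmod (E i) \<le> 2 * ?B * s ^ M" for i
  proof -
    have "cmod (E i) \<le> 2 * ?B * (s / 2 ^ i) ^ M"
      unfolding E_def using s line_deriv_bound[OF \<phi>, of x "- y" M]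
      by (intro vector_Taylor_bound line_deriv_has_derivative[OF \<phi>] M) auto
    also have "\<dots> \<le> 2 * ?B * s ^ M"
      using s B0 by (intro mult_left_mono power_mono) (auto simp: field_simps)
    finally show ?thesis .
  qed
  have "(\<Sum>i<M. c i *\<^sub>R (\<Sum>m<M. ((s / 2 ^ i) ^ m / fact m) *\<^sub>R ?d m 0)) = \<phi> x"
  proof -
    have "(\<Sum>i<M. c i *\<^sub>R (\<Sum>m<M. ((s / 2 ^ i) ^ m / fact m) *\<^sub>R ?d m 0))
      = (\<Sum>m<M. \<Sum>i<M. c i *\<^sub>R ((s / 2 ^ i) ^ m / fact m) *\<^sub>R ?d m 0)"
      unfolding scaleR_sum_right by (rule sum.swap)
    also have "\<dots> = (\<Sum>m<M. (\<Sum>i<M. c i * (1 / 2 ^ i) ^ m) *\<^sub>R ((s ^ m / fact m) *\<^sub>R ?d m 0))"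
      unfolding scaleR_sum_left by (intro sum.cong refl) (simp add: power_divide)
    also have "\<dots> = (\<Sum>m<M. if m = 0 then ?d 0 0 else 0)"
      using c by (intro sum.cong refl) (auto simp: richardson_def)
    also have "\<dots> = ?d 0 0" using M by (simp add: sum.delta)
    finally show ?thesis by (simp add: d0)
  qed
  then have "(\<Sum>i<M. c i *\<^sub>R \<phi> (x - (s / 2 ^ i) *\<^sub>R y)) - \<phi> x = (\<Sum>i<M. c i *\<^sub>R E i)"
    by (simp add: E_def d0 scaleR_diff_right sum_subtractf)
  also have "cmod \<dots> \<le> (\<Sum>i<M. \<bar>c i\<bar> * (2 * ?B * s ^ M))"
    using E by (intro sum_norm_le) (simp add: mult_left_mono)
  finally show ?thesis by (simp add: sum_distrib_right)
qed

text \<open>Convolution with an approximate identity of order \<open>M\<close>, built from the dilates of \<open>\<psi>\<close> at the dyadic levels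
  \<open>j, \<dots>, j + M - 1\<close>, hence expressible by the averages that enter the maximal functions of \<open>\<psi>\<close>.\<close>

definition mollify :: "(nat \<Rightarrow> real) \<Rightarrow> nat \<Rightarrow> (real^'n \<Rightarrow> complex) \<Rightarrow> nat \<Rightarrow> (real^'n \<Rightarrow> complex) \<Rightarrow> real^'n \<Rightarrow> complex" where
  "mollify c M \<psi> j \<phi> x = (\<Sum>i<M. (of_real (c i) / integral UNIV \<psi>) * smear \<psi> (1 / 2 ^ (j + i)) \<phi> x)"

lemma pderivs_append: "pderivs is (pderivs js \<phi>) = pderivs (is @ js) \<phi>"
  by (induction "is") (simp_all add: pderivs.simps(2))

lemma test_pderivs:
  assumes "\<phi> \<in> test_functions"
  shows "pderivs js \<phi> \<in> test_functions"
proof (rule test_functionI[of _ "supp \<phi>"])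
  show "\<exists>F. (pderivs is (pderivs js \<phi>) has_derivative F) (at x)" for "is" x
    unfolding pderivs_append using test_has_derivative[OF assms] by blast
qed (use assms pderivs_outside_supp[of _ \<phi> js] in \<open>auto intro: test_compact_supp\<close>)

lemma mollify_test:
  assumes \<psi>: "\<psi> \<in> test_functions" and \<phi>: "\<phi> \<in> test_functions"
  shows "mollify c M \<psi> j \<phi> \<in> test_functions"
    and "pderivs is (mollify c M \<psi> j \<phi>) = mollify c M \<psi> j (pderivs is \<phi>)"
proof -
  have eq: "mollify c M \<psi> j \<phi> = (\<lambda>x. \<Sum>i<M. (of_real (c i) / integral UNIV \<psi>) * smear \<psi> (1 / 2 ^ (j + i)) \<phi> x)"
    by (rule ext) (rule mollify_def)
  note t = smear_test[OF \<psi> \<phi>]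
  show "mollify c M \<psi> j \<phi> \<in> test_functions" unfolding eq by (intro test_sum(1) test_cmult t) simp
  show "pderivs is (mollify c M \<psi> j \<phi>) = mollify c M \<psi> j (pderivs is \<phi>)"
    unfolding eq test_sum(2)[OF finite_lessThan test_cmult[OF t]] pderivs_cmult[OF t] pderivs_smear[OF \<psi> \<phi>]
    by (rule ext) (simp only: mollify_def)
qed

lemma mollify_eq_0:
  assumes "supp \<psi> \<subseteq> cball 0 \<rho>" "supp \<phi> \<subseteq> cball 0 \<sigma>" "0 \<le> \<rho>" "\<rho> / 2 ^ j + \<sigma> < norm x"
  shows "mollify c M \<psi> j \<phi> x = 0"
proof -
  have "smear \<psi> (1 / 2 ^ (j + i)) \<phi> x = 0" for i
  proof (rule smear_eq_0[OF assms(1,2)])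
    have "\<bar>1 / 2 ^ (j + i)\<bar> * \<rho> \<le> \<rho> / 2 ^ j"
      using assms(3) mult_left_mono[of 1 "2 ^ i" \<rho>] by (simp add: power_add divide_simps)
    then show "\<bar>1 / 2 ^ (j + i)\<bar> * \<rho> + \<sigma> < norm x" using assms(4) by linarith
  qed
  then show ?thesis by (simp add: mollify_def)
qed

lemma smear_diff:
  assumes a: "a \<in> test_functions" and b: "b \<in> test_functions" and c: "c \<in> test_functions"
  shows "smear a s (\<lambda>x. b x - c x) x = smear a s b x - smear a s c x"
proof -
  obtain u where u: "\<And>y. y \<notin> cbox (- u) u \<Longrightarrow> a y = 0" using test_supp_cbox[OF a] by blast
  have sa: "smear a r g y = integral (cbox (- u) u) (\<lambda>w. a w * g (y - r *\<^sub>R w))" for r g y by (rule smear_cbox[OF u])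
  show ?thesis unfolding sa right_diff_distrib
    using smear_integrable[OF a b, of "[]" x s] smear_integrable[OF a c, of "[]" x s]
    by (subst integral_diff[symmetric]) auto
qed

lemma mollify_diff:
  assumes "\<psi> \<in> test_functions" "b \<in> test_functions" "c \<in> test_functions"
  shows "mollify d M \<psi> j (\<lambda>x. b x - c x) x = mollify d M \<psi> j b x - mollify d M \<psi> j c x"
  unfolding mollify_def smear_diff[OF assms] by (simp add: right_diff_distrib sum_subtractf)

lemma smear_linear_sum:
  fixes a :: "real^'n \<Rightarrow> complex"
  assumes a: "a \<in> test_functions" and "finite I" and b: "\<And>i. i \<in> I \<Longrightarrow> b i \<in> test_functions"
  shows "smear a s (\<lambda>x. \<Sum>i\<in>I. k i * b i x) x = (\<Sum>i\<in>I. k i * smear a s (b i) x)"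
proof -
  obtain u where u: "\<And>y. y \<notin> cbox (- u) u \<Longrightarrow> a y = 0" using test_supp_cbox[OF a] by blast
  have sa: "smear a r g y = integral (cbox (- u) u) (\<lambda>w. a w * g (y - r *\<^sub>R w))" for r g y by (rule smear_cbox[OF u])
  have "smear a s (\<lambda>x. \<Sum>i\<in>I. k i * b i x) x = integral (cbox (- u) u) (\<lambda>w. \<Sum>i\<in>I. k i * (a w * b i (x - s *\<^sub>R w)))"
    unfolding sa by (simp add: sum_distrib_left mult.left_commute)
  also have "\<dots> = (\<Sum>i\<in>I. integral (cbox (- u) u) (\<lambda>w. k i * (a w * b i (x - s *\<^sub>R w))))"
    using assms(2) smear_integrable[OF a b, of _ "[]" x s "-u" u]
    by (intro integral_sum integrable_on_mult_right) auto
  finally show ?thesis unfolding sa by simp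
qed

text \<open>Both sides are double sums of iterated convolutions with dilates of \<open>\<psi>\<close>, which commute by Fubini.\<close>

lemma mollify_commute:
  assumes \<psi>: "\<psi> \<in> test_functions" and \<phi>: "\<phi> \<in> test_functions"
  shows "mollify c M \<psi> j (mollify c M \<psi> k \<phi>) x = mollify c M \<psi> k (mollify c M \<psi> j \<phi>) x"
proof -
  let ?e = "\<lambda>i. of_real (c i) / integral UNIV \<psi>"
  have 1: "mollify c M \<psi> j (mollify c M \<psi> k \<phi>) x
     = (\<Sum>i<M. \<Sum>l<M. ?e i * ?e l * smear \<psi> (1 / 2 ^ (j + i)) (smear \<psi> (1 / 2 ^ (k + l)) \<phi>) x)" for j k
  proof -
    have "mollify c M \<psi> k \<phi> = (\<lambda>x. \<Sum>l<M. ?e l * smear \<psi> (1 / 2 ^ (k + l)) \<phi> x)" by (rule ext) (rule mollify_def)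
    then have "smear \<psi> s (mollify c M \<psi> k \<phi>) x = (\<Sum>l<M. ?e l * smear \<psi> s (smear \<psi> (1 / 2 ^ (k + l)) \<phi>) x)" for s
      using smear_linear_sum[OF \<psi>, of "{..<M}" "\<lambda>l. smear \<psi> (1 / 2 ^ (k + l)) \<phi>" s ?e x] smear_test[OF \<psi> \<phi>] by simp
    then show ?thesis unfolding mollify_def[of _ _ _ j] by (simp add: sum_distrib_left mult.assoc)
  qed
  have "(\<Sum>i<M. \<Sum>l<M. ?e i * ?e l * smear \<psi> (1 / 2 ^ (j + i)) (smear \<psi> (1 / 2 ^ (k + l)) \<phi>) x)
     = (\<Sum>l<M. \<Sum>i<M. ?e i * ?e l * smear \<psi> (1 / 2 ^ (j + i)) (smear \<psi> (1 / 2 ^ (k + l)) \<phi>) x)"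
    by (rule sum.swap)
  also have "\<dots> = (\<Sum>l<M. \<Sum>i<M. ?e l * ?e i * smear \<psi> (1 / 2 ^ (k + l)) (smear \<psi> (1 / 2 ^ (j + i)) \<phi>) x)"
    by (intro sum.cong refl) (simp only: smear_commute[OF \<psi> \<psi> \<phi>, of "1 / 2 ^ (j + _)"] mult.commute)
  finally show ?thesis unfolding 1 .
qed

lemma smear_bound:
  fixes a :: "real^'n \<Rightarrow> complex"
  assumes a: "a \<in> test_functions"
  obtains C where "0 \<le> C"
    "\<And>b s x B. b \<in> test_functions \<Longrightarrow> 0 \<le> B \<Longrightarrow> (\<And>y. cmod (b y) \<le> B) \<Longrightarrow> cmod (smear a s b x) \<le> C * B"
proof -
  obtain u where u: "\<And>y. y \<notin> cbox (- u) u \<Longrightarrow> a y = 0" using test_supp_cbox[OF a] by blast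
  obtain A where A: "0 \<le> A" "\<And>y. cmod (a y) \<le> A" using test_bounded[OF a, of "[]"] by auto
  show ?thesis
  proof
    show "0 \<le> A * measure lborel (cbox (- u) u)" using A by simp
    fix b :: "real^'n \<Rightarrow> complex" and s x B assume b: "b \<in> test_functions" and B: "0 \<le> B" "\<And>y. cmod (b y) \<le> B"
    have "cmod (smear a s b x) = cmod (integral (cbox (- u) u) (\<lambda>y. a y * b (x - s *\<^sub>R y)))"
      by (rule arg_cong[where f=cmod]) (rule smear_cbox[OF u])
    also have "\<dots> \<le> (A * B) * measure lborel (cbox (- u) u)"
    proof (rule integral_cbox_bound)
      show "0 \<le> A * B" using A B by simp
      show "(\<lambda>y. a y * b (x - s *\<^sub>R y)) integrable_on cbox (- u) u"
        using smear_integrable[OF a b, of "[]" x s] by simp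
      show "cmod (a y * b (x - s *\<^sub>R y)) \<le> A * B" for y
        unfolding norm_mult using A B by (intro mult_mono) auto
    qed
    finally show "cmod (smear a s b x) \<le> A * measure lborel (cbox (- u) u) * B" by (simp add: mult_ac)
  qed
qed

lemma mollify_bound:
  fixes \<psi> :: "real^'n \<Rightarrow> complex"
  assumes \<psi>: "\<psi> \<in> test_functions"
  obtains C where "0 \<le> C"
    "\<And>\<phi> j x B. \<phi> \<in> test_functions \<Longrightarrow> 0 \<le> B \<Longrightarrow> (\<And>y. cmod (\<phi> y) \<le> B) \<Longrightarrow> cmod (mollify c M \<psi> j \<phi> x) \<le> C * B"
proof -
  obtain D where D: "0 \<le> D"
    "\<And>b s x B. b \<in> test_functions \<Longrightarrow> 0 \<le> B \<Longrightarrow> (\<And>y. cmod (b y) \<le> B) \<Longrightarrow> cmod (smear \<psi> s b x) \<le> D * B"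
    using smear_bound[OF \<psi>] by blast
  let ?e = "\<lambda>i. of_real (c i) / integral UNIV \<psi>"
  show ?thesis
  proof
    show "0 \<le> (\<Sum>i<M. cmod (?e i)) * D" using D by (simp add: sum_nonneg)
    fix \<phi> :: "real^'n \<Rightarrow> complex" and j x B assume *: "\<phi> \<in> test_functions" "0 \<le> B" "\<And>y. cmod (\<phi> y) \<le> B"
    have "cmod (mollify c M \<psi> j \<phi> x) \<le> (\<Sum>i<M. cmod (?e i) * (D * B))"
      unfolding mollify_def using D(2)[OF *] by (intro sum_norm_le) (simp only: norm_mult mult_left_mono norm_ge_zero)
    then show "cmod (mollify c M \<psi> j \<phi> x) \<le> (\<Sum>i<M. cmod (?e i)) * D * B" by (simp add: sum_distrib_right mult.assoc)
  qed
qed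

text \<open>The difference is the average, with weight \<open>\<psi>\<close>, of the extrapolation errors of \<open>\<phi>\<close> along the
  lines through \<open>x\<close>.\<close>

lemma mollify_error:
  fixes \<psi> :: "real^'n \<Rightarrow> complex"
  assumes \<psi>: "\<psi> \<in> test_functions" and I: "integral UNIV \<psi> \<noteq> 0" and c: "richardson M c" and M: "0 < M"
  obtains C where "0 \<le> C"
    "\<And>\<phi> j x. \<phi> \<in> test_functions \<Longrightarrow> cmod (mollify c M \<psi> j \<phi> x - \<phi> x) \<le> C * CN_norm M \<phi> * (1 / 2 ^ j) ^ M"
proof -
  obtain u where u: "\<And>y. y \<notin> cbox (- u) u \<Longrightarrow> \<psi> y = 0" using test_supp_cbox[OF \<psi>] by blast
  let ?Q = "cbox (- u) u" and ?I = "integral UNIV \<psi>"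
  obtain A where A: "0 \<le> A" "\<And>y. cmod (\<psi> y) \<le> A" using test_bounded[OF \<psi>, of "[]"] by auto
  obtain U where U: "0 < U" "\<And>y. y \<in> ?Q \<Longrightarrow> norm y \<le> U" using bounded_cbox[of "-u" u] by (auto simp: bounded_pos)
  have IQ: "?I = integral ?Q \<psi>" by (rule integral_UNIV_eq_cbox) (rule u)
  have sa: "smear \<psi> r g y = integral ?Q (\<lambda>w. \<psi> w * g (y - r *\<^sub>R w))" for r g y by (rule smear_cbox[OF u])
  define S where "S = (\<Sum>i<M. \<bar>c i\<bar>)"
  have S: "0 \<le> S" by (simp add: S_def sum_nonneg)
  define D where "D = A * S * (2 * (real CARD('n) * U) ^ M) * measure lborel ?Q"
  have D: "0 \<le> D" using A S U by (simp add: D_def)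
  show ?thesis
  proof
    show "0 \<le> D / cmod ?I" using D by simp
    fix \<phi> :: "real^'n \<Rightarrow> complex" and j x assume \<phi>: "\<phi> \<in> test_functions"
    let ?E = "\<lambda>w. (\<Sum>i<M. c i *\<^sub>R \<phi> (x - ((1 / 2 ^ j) / 2 ^ i) *\<^sub>R w)) - \<phi> x"
    have int1: "(\<lambda>w. \<psi> w * \<phi> (x - r *\<^sub>R w)) integrable_on ?Q" for r
      using smear_integrable[OF \<psi> \<phi>, of "[]" x r] by simp
    have int0: "\<psi> integrable_on ?Q" by (intro integrable_continuous test_continuous0[OF \<psi>])
    have intS: "(\<lambda>w. \<Sum>i<M. of_real (c i) * (\<psi> w * \<phi> (x - ((1 / 2 ^ j) / 2 ^ i) *\<^sub>R w))) integrable_on ?Q"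
      by (intro integrable_sum integrable_on_mult_right int1) simp
    have eqE: "\<psi> w * ?E w = (\<Sum>i<M. of_real (c i) * (\<psi> w * \<phi> (x - ((1 / 2 ^ j) / 2 ^ i) *\<^sub>R w))) - \<psi> w * \<phi> x" for w
      by (simp add: right_diff_distrib sum_distrib_left scaleR_conv_of_real mult.left_commute)
    have intE: "(\<lambda>w. \<psi> w * ?E w) integrable_on ?Q"
      unfolding eqE by (intro integrable_diff intS integrable_on_mult_left int0)
    have "?I * (mollify c M \<psi> j \<phi> x - \<phi> x) = (\<Sum>i<M. of_real (c i) * smear \<psi> (1 / 2 ^ (j + i)) \<phi> x) - ?I * \<phi> x"
      using I by (simp add: mollify_def right_diff_distrib sum_distrib_left)
    also have "(\<Sum>i<M. of_real (c i) * smear \<psi> (1 / 2 ^ (j + i)) \<phi> x) = integral ?Q (\<lambda>w. \<Sum>i<M. of_real (c i) * (\<psi> w * \<phi> (x - ((1 / 2 ^ j) / 2 ^ i) *\<^sub>R w)))"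
      using int1 by (subst integral_sum) (auto simp: sa power_add intro!: integrable_on_mult_right)
    also have "?I * \<phi> x = integral ?Q (\<lambda>w. \<psi> w * \<phi> x)" unfolding IQ by simp
    also have "integral ?Q (\<lambda>w. \<Sum>i<M. of_real (c i) * (\<psi> w * \<phi> (x - ((1 / 2 ^ j) / 2 ^ i) *\<^sub>R w))) - integral ?Q (\<lambda>w. \<psi> w * \<phi> x)
        = integral ?Q (\<lambda>w. \<psi> w * ?E w)"
      unfolding eqE by (rule integral_diff[symmetric]) (intro intS integrable_on_mult_left int0)+
    finally have "cmod ?I * cmod (mollify c M \<psi> j \<phi> x - \<phi> x) = cmod (integral ?Q (\<lambda>w. \<psi> w * ?E w))"
      by (metis norm_mult)
    also have "\<dots> \<le> (A * (S * (2 * ((real CARD('n) * U) ^ M * CN_norm M \<phi>) * (1 / 2 ^ j) ^ M))) * measure lborel ?Q"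
    proof (rule integral_cbox_bound[OF _ intE])
      have N0: "0 \<le> CN_norm M \<phi>" by (rule CN_norm_nonneg[OF \<phi>])
      show "0 \<le> A * (S * (2 * ((real CARD('n) * U) ^ M * CN_norm M \<phi>) * (1 / 2 ^ j) ^ M))"
        using A S U N0 by simp
      fix w assume w: "w \<in> ?Q"
      have "cmod (?E w) \<le> S * (2 * ((real CARD('n) * norm w) ^ M * CN_norm M \<phi>) * (1 / 2 ^ j) ^ M)"
        unfolding S_def by (rule richardson_error[OF \<phi> c M]) simp
      also have "\<dots> \<le> S * (2 * ((real CARD('n) * U) ^ M * CN_norm M \<phi>) * (1 / 2 ^ j) ^ M)"
        using U(2)[OF w] S N0 by (intro mult_left_mono mult_right_mono power_mono) auto
      finally show "cmod (\<psi> w * ?E w) \<le> A * (S * (2 * ((real CARD('n) * U) ^ M * CN_norm M \<phi>) * (1 / 2 ^ j) ^ M))"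
        unfolding norm_mult using A by (intro mult_mono) auto
    qed
    also have "\<dots> = D * CN_norm M \<phi> * (1 / 2 ^ j) ^ M" by (simp add: D_def)
    finally show "cmod (mollify c M \<psi> j \<phi> x - \<phi> x) \<le> D / cmod ?I * CN_norm M \<phi> * (1 / 2 ^ j) ^ M"
      using I by (simp add: field_simps)
  qed
qed

text \<open>Mollification commutes with derivatives and does not increase their size by more than a constant,
  so the error bound for \<open>\<phi>\<close> applies to every derivative and gives convergence in the space of test
  functions.\<close>

lemma distribution_mollify_limit:
  fixes \<psi> :: "real^'n \<Rightarrow> complex"
  assumes f: "f \<in> distributions" and \<psi>: "\<psi> \<in> test_functions" and I: "integral UNIV \<psi> \<noteq> 0"
    and c: "richardson M c" and M: "0 < M" and \<phi>: "\<phi> \<in> test_functions"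
  shows "(\<lambda>j. f (\<lambda>y. mollify c M \<psi> j (mollify c M \<psi> j \<phi>) (z - y))) \<longlonglongrightarrow> f (\<lambda>y. \<phi> (z - y))"
proof -
  let ?T = "\<lambda>j. mollify c M \<psi> j"
  obtain C where C: "0 \<le> C"
    "\<And>\<phi> j x. \<phi> \<in> test_functions \<Longrightarrow> cmod (?T j \<phi> x - \<phi> x) \<le> C * CN_norm M \<phi> * (1 / 2 ^ j) ^ M"
    using mollify_error[OF \<psi> I c M] by blast
  obtain D where D: "0 \<le> D"
    "\<And>\<phi> j x B. \<phi> \<in> test_functions \<Longrightarrow> 0 \<le> B \<Longrightarrow> (\<And>y. cmod (\<phi> y) \<le> B) \<Longrightarrow> cmod (?T j \<phi> x) \<le> D * B"
    using mollify_bound[OF \<psi>] by blast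
  obtain \<rho> where \<rho>: "0 < \<rho>" "supp \<psi> \<subseteq> cball 0 \<rho>" using test_supp_cball[OF \<psi>] by blast
  obtain \<sigma> where \<sigma>: "0 < \<sigma>" "supp \<phi> \<subseteq> cball 0 \<sigma>" using test_supp_cball[OF \<phi>] by blast
  note T = mollify_test[OF \<psi>]
  have TN: "CN_norm N (?T j \<eta>) \<le> D * CN_norm N \<eta>" if \<eta>: "\<eta> \<in> test_functions" for N j \<eta>
  proof (rule CN_norm_le)
    fix "is" :: "'n list" and x assume len: "length is \<le> N"
    show "cmod (pderivs is (?T j \<eta>) x) \<le> D * CN_norm N \<eta>"
      unfolding T(2)[OF \<eta>] by (intro D(2) test_pderivs[OF \<eta>] CN_norm_nonneg[OF \<eta>] CN_norm_ge[OF \<eta> len])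
  qed
  have T2: "cmod (?T j (?T j \<eta>) x - \<eta> x) \<le> (C * D * CN_norm M \<eta> + C * CN_norm M \<eta>) * (1 / 2) ^ j" if \<eta>: "\<eta> \<in> test_functions" for j \<eta> x
  proof -
    have p: "(1 / 2 ^ j) ^ M \<le> (1 / 2 :: real) ^ j"
    proof -
      have "(1 / 2 ^ j :: real) ^ M \<le> (1 / 2 ^ j) ^ 1" using M by (intro power_decreasing) auto
      then show ?thesis by (simp add: power_divide)
    qed
    have "cmod (?T j (?T j \<eta>) x - \<eta> x) \<le> cmod (?T j (?T j \<eta>) x - ?T j \<eta> x) + cmod (?T j \<eta> x - \<eta> x)"
      using norm_triangle_ineq[of "?T j (?T j \<eta>) x - ?T j \<eta> x" "?T j \<eta> x - \<eta> x"] by simp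
    also have "\<dots> \<le> C * CN_norm M (?T j \<eta>) * (1 / 2 ^ j) ^ M + C * CN_norm M \<eta> * (1 / 2 ^ j) ^ M"
      by (intro add_mono C(2) T(1) \<eta>)
    also have "\<dots> \<le> C * (D * CN_norm M \<eta>) * (1 / 2) ^ j + C * CN_norm M \<eta> * (1 / 2) ^ j"
      using p C(1) D(1) CN_norm_nonneg[OF \<eta>] CN_norm_nonneg[OF T(1)[OF \<eta>]]
      by (intro add_mono mult_mono TN \<eta>) auto
    finally show ?thesis by (simp add: algebra_simps)
  qed
  define K where "K = cball z (\<rho> + (\<rho> + \<sigma>))"
  have TT: "?T j (?T j \<phi>) \<in> test_functions" for j by (intro T(1) \<phi>)
  show ?thesis
  proof (rule distribution_sequential[OF f])
    show "compact K" by (simp add: K_def)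
    have \<rho>j: "\<rho> / 2 ^ j \<le> \<rho>" for j :: nat using \<rho>(1) by (simp add: divide_le_eq)
    have sup1: "supp (?T j \<phi>) \<subseteq> cball 0 (\<rho> + \<sigma>)" for j
    proof (rule supp_subsetI(1))
      show "?T j \<phi> x = 0" if "x \<notin> cball 0 (\<rho> + \<sigma>)" for x
        using \<rho>(1) \<rho>j[of j] that by (intro mollify_eq_0[OF \<rho>(2) \<sigma>(2)]) auto
    qed simp
    have 0: "?T j (?T j \<phi>) x = 0" if "x \<notin> cball 0 (\<rho> + (\<rho> + \<sigma>))" for x j
      using \<rho>(1) \<rho>j[of j] that by (intro mollify_eq_0[OF \<rho>(2) sup1]) auto
    show "(\<lambda>y. ?T j (?T j \<phi>) (z - y)) \<in> test_functions_in K" for j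
    proof (rule test_functions_inI[OF test_reflect(1)[OF TT]])
      show "?T j (?T j \<phi>) (z - y) = 0" if "y \<notin> K" for y
        using that by (intro 0) (auto simp: K_def dist_norm norm_minus_commute)
    qed (simp add: K_def)
    show "(\<lambda>y. \<phi> (z - y)) \<in> test_functions_in K"
    proof (rule test_functions_inI[OF test_reflect(1)[OF \<phi>]])
      show "\<phi> (z - y) = 0" if "y \<notin> K" for y
      proof (rule not_in_supp)
        have "z - y \<notin> cball 0 \<sigma>" using that \<rho>(1) by (auto simp: K_def dist_norm norm_minus_commute)
        then show "z - y \<notin> supp \<phi>" using \<sigma>(2) by blast
      qed
    qed (simp add: K_def)
    fix N
    define B where "B = C * D * CN_norm (M + N) \<phi> + C * CN_norm (M + N) \<phi>"
    have le: "CN_norm N (\<lambda>y. ?T j (?T j \<phi>) (z - y) - \<phi> (z - y)) \<le> B * (1 / 2) ^ j" for j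
    proof (rule CN_norm_le)
      fix "is" :: "'n list" and y assume len: "length is \<le> N"
      have "CN_norm M (pderivs is \<phi>) \<le> CN_norm (M + N) \<phi>"
        by (rule CN_norm_le) (unfold pderivs_append, rule CN_norm_ge[OF \<phi>], use len in simp)
      then have 1: "(C * D * CN_norm M (pderivs is \<phi>) + C * CN_norm M (pderivs is \<phi>)) * (1 / 2) ^ j \<le> B * (1 / 2) ^ j"
        unfolding B_def using C(1) D(1) by (intro mult_right_mono add_mono mult_left_mono) auto
      have 2: "pderivs is (\<lambda>y. ?T j (?T j \<phi>) (z - y) - \<phi> (z - y)) y
          = (-1) ^ length is *\<^sub>R (?T j (?T j (pderivs is \<phi>)) (z - y) - pderivs is \<phi> (z - y))"
        unfolding test_diff(2)[OF test_reflect(1)[OF TT] test_reflect(1)[OF \<phi>]] test_reflect(2)[OF TT] test_reflect(2)[OF \<phi>] T(2)[OF T(1)[OF \<phi>]] T(2)[OF \<phi>]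
        by (simp add: scaleR_diff_right)
      have 3: "cmod (?T j (?T j (pderivs is \<phi>)) (z - y) - pderivs is \<phi> (z - y))
          \<le> (C * D * CN_norm M (pderivs is \<phi>) + C * CN_norm M (pderivs is \<phi>)) * (1 / 2) ^ j"
        by (rule T2[OF test_pderivs[OF \<phi>]])
      have "cmod (pderivs is (\<lambda>y. ?T j (?T j \<phi>) (z - y) - \<phi> (z - y)) y) = cmod (?T j (?T j (pderivs is \<phi>)) (z - y) - pderivs is \<phi> (z - y))"
        unfolding 2 by (simp add: power_abs)
      also have "\<dots> \<le> B * (1 / 2) ^ j" by (rule order_trans[OF 3 1])
      finally show "cmod (pderivs is (\<lambda>y. ?T j (?T j \<phi>) (z - y) - \<phi> (z - y)) y) \<le> B * (1 / 2) ^ j" .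
    qed
    show "(\<lambda>j. CN_norm N (\<lambda>y. ?T j (?T j \<phi>) (z - y) - \<phi> (z - y))) \<longlonglongrightarrow> 0"
    proof (rule tendsto_sandwich[OF _ _ tendsto_const])
      show "\<forall>\<^sub>F j in sequentially. 0 \<le> CN_norm N (\<lambda>y. ?T j (?T j \<phi>) (z - y) - \<phi> (z - y))"
        by (intro always_eventually allI CN_norm_nonneg test_diff(1) test_reflect(1) TT \<phi>)
      show "\<forall>\<^sub>F j in sequentially. CN_norm N (\<lambda>y. ?T j (?T j \<phi>) (z - y) - \<phi> (z - y)) \<le> B * (1 / 2) ^ j"
        using le by (intro always_eventually allI)
      have "(\<lambda>j. B * (1 / 2) ^ j) \<longlonglongrightarrow> B * 0" by (intro tendsto_intros LIMSEQ_power_zero) simp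
      then show "(\<lambda>j. B * (1 / 2) ^ j) \<longlonglongrightarrow> 0" by simp
    qed
  qed
qed

section \<open>The grand maximal function\<close>

lemma conv_le_peetre:
  assumes "peetre_max \<psi> A B f x = ennreal p" "0 \<le> p"
  shows "cmod (conv (dyadic k \<psi>) f (x - y)) \<le> p * mfac k A B y"
proof -
  have "ennreal (cmod (conv (dyadic k \<psi>) f (x - y)) / mfac k A B y) \<le> peetre \<psi> A B k f x"
    unfolding peetre_def by (rule SUP_upper) simp
  also have "\<dots> \<le> peetre_max \<psi> A B f x" unfolding peetre_max_def by (rule SUP_upper) simp
  finally have "cmod (conv (dyadic k \<psi>) f (x - y)) / mfac k A B y \<le> p"
    unfolding assms(1) using assms(2) by (simp add: ennreal_le_iff)
  moreover have "0 < 1 + 2 ^ k * norm y" by (rule add_pos_nonneg) auto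
  then have "0 < mfac k A B y" by (simp add: mfac_def)
  ultimately show ?thesis by (simp add: field_simps)
qed

text \<open>Tested against \<open>f\<close>, the mollified function becomes a sum of integrals of \<open>\<kappa> y\<close> against the dyadic averages of \<open>f\<close>
  at \<open>z - y\<close>. On the support of \<open>\<kappa>\<close> these points have distance at most \<open>(1 + H) t\<close> from \<open>x\<close>, so the Peetre
  maximal function at \<open>x\<close> controls the averages up to the factor \<open>(2\<^sup>j t)\<^sup>A\<close>; the factor \<open>t\<^sup>n\<close> is the volume of
  the support.\<close>

lemma distribution_mollify_bound:
  fixes \<psi> :: "real^'n \<Rightarrow> complex"
  assumes \<psi>: "\<psi> \<in> test_functions" and A: "0 \<le> A" and B: "0 \<le> B" and H: "0 < H"
  obtains C where "0 \<le> C"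
    "\<And>f x p t z \<kappa> b j. f \<in> distributions \<Longrightarrow> peetre_max \<psi> A B f x = ennreal p \<Longrightarrow> 0 \<le> p \<Longrightarrow>
      0 < t \<Longrightarrow> t < 1 \<Longrightarrow> norm (x - z) < t \<Longrightarrow> \<kappa> \<in> test_functions \<Longrightarrow> 0 \<le> b \<Longrightarrow> (\<And>y. cmod (\<kappa> y) \<le> b) \<Longrightarrow>
      (\<And>y. H * t < norm y \<Longrightarrow> \<kappa> y = 0) \<Longrightarrow> 1 \<le> 2 ^ j * t \<Longrightarrow>
      cmod (f (\<lambda>y. mollify c M \<psi> j \<kappa> (z - y))) \<le> C * p * b * t ^ CARD('n) * (2 ^ j * t) powr A"
proof -
  let ?e = "\<lambda>i. of_real (c i) / integral UNIV \<psi>"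
  define G where "G = (2 ^ M * (2 + H)) powr A * 2 powr (B * (1 + H))"
  have G: "0 \<le> G" by (simp add: G_def)
  define C where "C = (\<Sum>i<M. cmod (?e i)) * (G * (2 * H) ^ CARD('n))"
  show ?thesis
  proof
    show "0 \<le> C" using G H by (simp add: C_def sum_nonneg)
    fix f x p t z j and \<kappa> :: "real^'n \<Rightarrow> complex" and b :: real
    assume f: "f \<in> distributions" and P: "peetre_max \<psi> A B f x = ennreal p" "0 \<le> p"
      and t: "0 < t" "t < 1" and xz: "norm (x - z) < t" and \<kappa>: "\<kappa> \<in> test_functions"
      and b: "0 \<le> b" "\<And>y. cmod (\<kappa> y) \<le> b" and out: "\<And>y. H * t < norm y \<Longrightarrow> \<kappa> y = 0" and j: "1 \<le> 2 ^ j * t"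
    define a where "a = (\<chi> i. - (H * t) :: real^'n)"
    let ?Q = "cbox a (a + (2 * H * t) *\<^sub>R One)"
    have Q: "measure lborel ?Q = (2 * H * t) ^ CARD('n)"
      using cube_measure(1)[of "2 * H * t" a] H t by simp
    have one: "cmod (integral UNIV (\<lambda>y. \<kappa> y * conv (dyadic (j + i) \<psi>) f (z - y))) \<le> (b * (p * (G * (2 ^ j * t) powr A))) * (2 * H * t) ^ CARD('n)"
      if i: "i < M" for i
    proof -
      let ?h = "\<lambda>y. \<kappa> y * conv (dyadic (j + i) \<psi>) f (z - y)"
      have "integral UNIV ?h = integral ?Q ?h"
      proof (rule integral_UNIV_eq_cbox)
        fix y assume y: "y \<notin> ?Q"
        have "H * t < norm y"
        proof (rule ccontr)
          assume "\<not> H * t < norm y"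
          then have "\<bar>y $ i\<bar> \<le> H * t" for i using component_le_norm_cart[of y i] by linarith
          then have "- (H * t) \<le> y $ i \<and> y $ i \<le> H * t" for i by (simp add: abs_le_iff minus_le_iff)
          then have "y \<in> ?Q" unfolding mem_cube_iff a_def by simp
          with y show False by simp
        qed
        then show "?h y = 0" by (simp add: out)
      qed
      moreover have "cmod (integral ?Q ?h) \<le> (b * (p * (G * (2 ^ j * t) powr A))) * measure lborel ?Q"
      proof (rule integral_cbox_bound)
        show "0 \<le> b * (p * (G * (2 ^ j * t) powr A))" using b(1) P(2) G by simp
        have "continuous_on ?Q (\<lambda>y. conv (dyadic (j + i) \<psi>) f (z - y))"
          by (rule continuous_on_compose2[OF conv_continuous[OF f test_dyadic[OF \<psi>]]]) (auto intro!: continuous_intros)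
        then show "?h integrable_on ?Q"
          by (intro integrable_continuous continuous_intros test_continuous0[OF \<kappa>])
        fix y
        show "cmod (?h y) \<le> b * (p * (G * (2 ^ j * t) powr A))"
        proof (cases "H * t < norm y")
          case True
          then show ?thesis using out b(1) P(2) G by simp
        next
          case False
          let ?y = "x - z + y"
          have ny: "norm ?y \<le> (1 + H) * t"
            using norm_triangle_ineq[of "x - z" y] xz False by (simp add: algebra_simps)
          have "mfac (j + i) A B ?y \<le> G * (2 ^ j * t) powr A"
          proof -
            have "2 ^ (j + i) * norm ?y \<le> 2 ^ (j + i) * ((1 + H) * t)" by (intro mult_left_mono ny) simp
            also have "\<dots> = 2 ^ i * (2 ^ j * t) * (1 + H)" by (simp add: power_add)
            also have "\<dots> \<le> 2 ^ M * (2 ^ j * t) * (1 + H)"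
              using i H t by (intro mult_right_mono power_increasing) auto
            finally have "2 ^ (j + i) * norm ?y \<le> 2 ^ M * (2 ^ j * t) * (1 + H)" .
            moreover have "1 * 1 \<le> 2 ^ M * (2 ^ j * t)" using j by (intro mult_mono) auto
            ultimately have "1 + 2 ^ (j + i) * norm ?y \<le> (2 ^ M * (2 + H)) * (2 ^ j * t)" by (simp add: algebra_simps)
            then have "(1 + 2 ^ (j + i) * norm ?y) powr A \<le> ((2 ^ M * (2 + H)) * (2 ^ j * t)) powr A"
              using A by (intro powr_mono2) auto
            also have "\<dots> = (2 ^ M * (2 + H)) powr A * (2 ^ j * t) powr A" by (rule powr_mult)
            finally have 1: "(1 + 2 ^ (j + i) * norm ?y) powr A \<le> (2 ^ M * (2 + H)) powr A * (2 ^ j * t) powr A" .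
            have "(1 + H) * t \<le> (1 + H) * 1" using H t by (intro mult_left_mono) auto
            then have "norm ?y \<le> 1 + H" using ny by simp
            then have 2: "2 powr (B * norm ?y) \<le> 2 powr (B * (1 + H))" using B by (intro powr_mono mult_left_mono) auto
            have "mfac (j + i) A B ?y \<le> ((2 ^ M * (2 + H)) powr A * (2 ^ j * t) powr A) * 2 powr (B * (1 + H))"
              unfolding mfac_def by (intro mult_mono 1 2) auto
            then show ?thesis by (simp add: G_def mult_ac)
          qed
          then have "p * mfac (j + i) A B ?y \<le> p * (G * (2 ^ j * t) powr A)" using P(2) by (rule mult_left_mono)
          moreover have "cmod (conv (dyadic (j + i) \<psi>) f (x - ?y)) \<le> p * mfac (j + i) A B ?y"
            by (rule conv_le_peetre[OF P])
          moreover have "x - ?y = z - y" by simp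
          ultimately have "cmod (conv (dyadic (j + i) \<psi>) f (z - y)) \<le> p * (G * (2 ^ j * t) powr A)" by simp
          then show ?thesis unfolding norm_mult using b by (intro mult_mono) auto
        qed
      qed
      ultimately show ?thesis unfolding Q by simp
    qed
    have "f (\<lambda>y. mollify c M \<psi> j \<kappa> (z - y)) = (\<Sum>i<M. ?e i * integral UNIV (\<lambda>y. \<kappa> y * conv (dyadic (j + i) \<psi>) f (z - y)))"
    proof -
      have st: "(\<lambda>y. smear \<psi> (1 / 2 ^ (j + i)) \<kappa> (z - y)) \<in> test_functions" for i
        by (rule test_reflect(1)[OF smear_test[OF \<psi> \<kappa>]])
      have "f (\<lambda>y. mollify c M \<psi> j \<kappa> (z - y)) = (\<Sum>i<M. f (\<lambda>y. ?e i * smear \<psi> (1 / 2 ^ (j + i)) \<kappa> (z - y)))"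
        unfolding mollify_def by (rule distribution_sum[OF f finite_lessThan test_cmult[OF st]])
      also have "\<dots> = (\<Sum>i<M. ?e i * f (\<lambda>y. smear \<psi> (1 / 2 ^ (j + i)) \<kappa> (z - y)))"
        by (intro sum.cong refl distribution_cmult[OF f st])
      finally show ?thesis unfolding distribution_smear_dyadic[OF f \<kappa> \<psi>] .
    qed
    also have "cmod \<dots> \<le> (\<Sum>i<M. cmod (?e i) * ((b * (p * (G * (2 ^ j * t) powr A))) * (2 * H * t) ^ CARD('n)))"
    proof (rule sum_norm_le)
      fix i assume "i \<in> {..<M}"
      then show "norm (?e i * integral UNIV (\<lambda>y. \<kappa> y * conv (dyadic (j + i) \<psi>) f (z - y))) \<le> cmod (?e i) * ((b * (p * (G * (2 ^ j * t) powr A))) * (2 * H * t) ^ CARD('n))"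
        unfolding norm_mult[of "?e i"] by (intro mult_left_mono one) auto
    qed
    also have "\<dots> = C * p * b * t ^ CARD('n) * (2 ^ j * t) powr A"
      unfolding sum_distrib_right[symmetric] C_def power_mult_distrib[of "2 * H" t] by (simp only: mult_ac)
    finally show "cmod (f (\<lambda>y. mollify c M \<psi> j \<kappa> (z - y))) \<le> C * p * b * t ^ CARD('n) * (2 ^ j * t) powr A" .
  qed
qed

text \<open>Every derivative costs a factor \<open>1 / t\<close>; as \<open>t < 1\<close>, the highest order dominates.\<close>

lemma dilate_test:
  fixes \<psi> :: "real^'n \<Rightarrow> complex"
  assumes \<psi>: "\<psi> \<in> test_functions" and t: "0 < t" "t < 1"
  shows "dilate t \<psi> \<in> test_functions"
    and "CN_norm N (dilate t \<psi>) \<le> (1 / t) ^ (CARD('n) + N) * CN_norm N \<psi>"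
proof -
  have eq: "dilate t \<psi> = (\<lambda>x. of_real (1 / t ^ CARD('n)) * \<psi> ((1 / t) *\<^sub>R x + 0))"
    by (rule ext) (simp add: dilate_def scaleR_conv_of_real)
  have t0: "1 / t \<noteq> 0" using t by simp
  show "dilate t \<psi> \<in> test_functions"
    unfolding eq by (rule test_cmult[OF test_affine[OF \<psi> t0]])
  show "CN_norm N (dilate t \<psi>) \<le> (1 / t) ^ (CARD('n) + N) * CN_norm N \<psi>"
  proof (rule CN_norm_le)
    fix "is" :: "'n list" and x assume len: "length is \<le> N"
    have "cmod (pderivs is (dilate t \<psi>) x) = (1 / t) ^ CARD('n) * ((1 / t) ^ length is * cmod (pderivs is \<psi> ((1 / t) *\<^sub>R x + 0)))"
      unfolding eq pderivs_cmult[OF test_affine[OF \<psi> t0]] pderivs_affine(1)[OF \<psi>]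
      using t by (simp add: norm_mult norm_power norm_divide power_divide)
    also have "\<dots> \<le> (1 / t) ^ CARD('n) * ((1 / t) ^ N * CN_norm N \<psi>)"
      using t len by (intro mult_left_mono mult_mono power_increasing CN_norm_ge[OF \<psi> len]) auto
    finally show "cmod (pderivs is (dilate t \<psi>) x) \<le> (1 / t) ^ (CARD('n) + N) * CN_norm N \<psi>"
      by (simp add: power_add mult.assoc)
  qed
qed

text \<open>For \<open>\<phi> = \<psi>\<^sub>t\<close> write the action of \<open>f\<close> on \<open>\<phi>\<close> as the limit of its action on \<open>S\<^sub>j S\<^sub>j \<phi>\<close>, where \<open>S\<^sub>j\<close> is mollification
  of order \<open>N\<close> at level \<open>j\<close>. The series starts at the first level \<open>j0\<close> with \<open>2\<^sup>-\<^sup>j\<^sup>0 \<le> t\<close>. The first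
  term is harmless because \<open>2\<^sup>j\<^sup>0 t \<le> 2\<close>. In the increments the function \<open>(S\<^sub>j\<^sub>+\<^sub>1 - S\<^sub>j) \<phi>\<close> has size
  \<open>t\<^sup>-\<^sup>n (2\<^sup>j t)\<^sup>-\<^sup>N\<close>, and \<open>distribution_mollify_bound\<close> gives \<open>(2\<^sup>j t)\<^sup>A\<^sup>-\<^sup>N\<close>, which is summable
  for \<open>A < N\<close>.\<close>

lemma grand_max_le_peetre_max:
  fixes \<psi>0 :: "real^'n \<Rightarrow> complex"
  assumes \<psi>0: "\<psi>0 \<in> test_functions" and I0: "integral\<^sup>L lebesgue \<psi>0 \<noteq> 0"
    and R: "0 < R" and A: "0 \<le> A" "A < real N" and B: "0 \<le> B"
  obtains C where "0 < C" "\<And>f x. f \<in> distributions \<Longrightarrow> grand_max N R f x \<le> ennreal C * peetre_max \<psi>0 A B f x"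
proof -
  let ?n = "CARD('n)"
  have I: "integral UNIV \<psi>0 \<noteq> 0"
  proof -
    have "integrable lebesgue \<psi>0" using I0 not_integrable_integral_eq by blast
    then have "integral UNIV \<psi>0 = integral\<^sup>L lebesgue \<psi>0"
      using has_integral_integral_lebesgue by blast
    then show ?thesis using I0 by simp
  qed
  have N: "0 < N" using A by (cases N) auto
  obtain c where c: "richardson N c" using richardson_exists[of "N - 1"] N by auto
  obtain \<rho> where \<rho>: "0 < \<rho>" "supp \<psi>0 \<subseteq> cball 0 \<rho>" using test_supp_cball[OF \<psi>0] by blast
  let ?T = "\<lambda>j. mollify c N \<psi>0 j"
  note T = mollify_test[OF \<psi>0]
  obtain E where E: "0 \<le> E"
    "\<And>\<phi> j x. \<phi> \<in> test_functions \<Longrightarrow> cmod (?T j \<phi> x - \<phi> x) \<le> E * CN_norm N \<phi> * (1 / 2 ^ j) ^ N"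
    using mollify_error[OF \<psi>0 I c N] by blast
  obtain D where D: "0 \<le> D"
    "\<And>\<phi> j x b. \<phi> \<in> test_functions \<Longrightarrow> 0 \<le> b \<Longrightarrow> (\<And>y. cmod (\<phi> y) \<le> b) \<Longrightarrow> cmod (?T j \<phi> x) \<le> D * b"
    using mollify_bound[OF \<psi>0] by blast
  have H: "0 < \<rho> + R" using \<rho> R by simp
  obtain G where G: "0 \<le> G"
    "\<And>f x p t z \<kappa> b j. f \<in> distributions \<Longrightarrow> peetre_max \<psi>0 A B f x = ennreal p \<Longrightarrow> 0 \<le> p \<Longrightarrow>
      0 < t \<Longrightarrow> t < 1 \<Longrightarrow> norm (x - z) < t \<Longrightarrow> \<kappa> \<in> test_functions \<Longrightarrow> 0 \<le> b \<Longrightarrow> (\<And>y. cmod (\<kappa> y) \<le> b) \<Longrightarrow>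
      (\<And>y. (\<rho> + R) * t < norm y \<Longrightarrow> \<kappa> y = 0) \<Longrightarrow> 1 \<le> 2 ^ j * t \<Longrightarrow>
      cmod (f (\<lambda>y. ?T j \<kappa> (z - y))) \<le> G * p * b * t ^ ?n * (2 ^ j * t) powr A"
    using distribution_mollify_bound[OF \<psi>0 A(1) B H] by blast
  define q where "q = 2 powr (A - real N)"
  have q: "0 < q" "q < 1" using A by (auto simp: q_def powr_less_one)
  define L where "L = 2 * G * E * (2 powr A + 1)"
  have L: "0 \<le> L" using G E by (simp add: L_def)
  define C where "C = G * D * 2 powr A + L / (1 - q)"
  have C: "0 \<le> C" using G D L q by (simp add: C_def)
  have main: "cmod (conv (dilate t \<psi>) f z) \<le> C * p"
    if f: "f \<in> distributions" and P: "peetre_max \<psi>0 A B f x = ennreal p" "0 \<le> p"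
      and t: "0 < t" "t < 1" and xz: "norm (x - z) < t" and \<psi>: "\<psi> \<in> grand_class N R" for f x p t z \<psi>
  proof -
    have \<psi>t: "\<psi> \<in> test_functions" "supp \<psi> \<subseteq> ball 0 R" "CN_norm N \<psi> \<le> 1" using \<psi> by (auto simp: grand_class_def)
    define \<phi> where "\<phi> = dilate t \<psi>"
    have \<phi>: "\<phi> \<in> test_functions" unfolding \<phi>_def by (rule dilate_test(1)[OF \<psi>t(1) t])
    have \<phi>N: "CN_norm N \<phi> \<le> (1 / t) ^ (?n + N)"
    proof -
      have "CN_norm N \<phi> \<le> (1 / t) ^ (?n + N) * CN_norm N \<psi>" unfolding \<phi>_def by (rule dilate_test(2)[OF \<psi>t(1) t])
      also have "\<dots> \<le> (1 / t) ^ (?n + N) * 1" using t by (intro mult_left_mono \<psi>t(3)) auto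
      finally show ?thesis by simp
    qed
    have \<phi>b: "cmod (\<phi> y) \<le> (1 / t) ^ ?n" for y
    proof -
      have "cmod (pderivs [] \<phi> y) \<le> CN_norm 0 \<phi>" by (rule CN_norm_ge[OF \<phi>]) simp
      also have "\<dots> \<le> (1 / t) ^ (?n + 0) * CN_norm 0 \<psi>" unfolding \<phi>_def by (rule dilate_test(2)[OF \<psi>t(1) t])
      also have "\<dots> \<le> (1 / t) ^ (?n + 0) * 1"
      proof (rule mult_left_mono)
        have "CN_norm 0 \<psi> \<le> CN_norm N \<psi>" by (rule CN_norm_le) (rule CN_norm_ge[OF \<psi>t(1)], simp)
        then show "CN_norm 0 \<psi> \<le> 1" using \<psi>t(3) by simp
      qed (use t in simp)
      finally show ?thesis by simp
    qed
    have \<phi>s: "supp \<phi> \<subseteq> cball 0 (R * t)"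
    proof (rule supp_subsetI(1))
      fix y :: "real^'n" assume "y \<notin> cball 0 (R * t)"
      then have "R < norm ((1 / t) *\<^sub>R y)" using t by (simp add: field_simps)
      then have "(1 / t) *\<^sub>R y \<notin> supp \<psi>" using \<psi>t(2) by auto
      then show "\<phi> y = 0" using not_in_supp[of "(1 / t) *\<^sub>R y" \<psi>] by (simp add: \<phi>_def dilate_def)
    qed simp
    \<comment> \<open>Minimality gives \<open>2\<^sup>j\<^sup>0 t \<le> 2\<close>; here \<open>t < 1\<close> excludes \<open>j0 = 0\<close>.\<close>
    define j0 where "j0 = (LEAST j. 1 \<le> 2 ^ j * t)"
    have ex: "\<exists>j. 1 \<le> 2 ^ j * t"
    proof -
      obtain j where "1 / t < 2 ^ j" using real_arch_pow[of 2 "1 / t"] by auto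
      then show ?thesis using t by (intro exI[of _ j]) (simp add: field_simps)
    qed
    have j0: "1 \<le> 2 ^ j0 * t" unfolding j0_def by (rule LeastI_ex[OF ex])
    have j0': "2 ^ j0 * t \<le> 2"
    proof -
      have "j0 \<noteq> 0"
      proof
        assume "j0 = 0"
        then show False using j0 t by simp
      qed
      then obtain k where k: "j0 = Suc k" by (cases j0) auto
      have "\<not> 1 \<le> 2 ^ k * t" using not_less_Least[of k "\<lambda>j. 1 \<le> 2 ^ j * t"] k by (simp add: j0_def)
      then show ?thesis unfolding k by simp
    qed
    have jt: "2 ^ m \<le> 2 ^ (j0 + m) * t" for m
      using mult_left_mono[OF j0, of "2 ^ m"] by (simp add: power_add mult_ac)
    have jt1: "1 \<le> 2 ^ (j0 + m) * t" for m
      using jt[of m] one_le_power[of "2::real" m] by linarith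
    have out: "?T j \<phi> y = 0" if j: "1 \<le> 2 ^ j * t" and y: "(\<rho> + R) * t < norm y" for j y
    proof (rule mollify_eq_0[OF \<rho>(2) \<phi>s])
      have "\<rho> * 1 \<le> \<rho> * (2 ^ j * t)" using \<rho> j by (intro mult_left_mono) auto
      then have "\<rho> / 2 ^ j \<le> \<rho> * t" by (simp add: field_simps)
      then show "\<rho> / 2 ^ j + R * t < norm y" using y by (simp add: algebra_simps)
    qed (use \<rho> in simp)
    define F where "F j = f (\<lambda>y. ?T j (?T j \<phi>) (z - y))" for j
    \<comment> \<open>The increments of \<open>F\<close> are actions of \<open>f\<close> on mollifications of these small functions.\<close>
    define \<delta> where "\<delta> j y = ?T (Suc j) \<phi> y - ?T j \<phi> y" for j y
    have \<delta>t: "\<delta> j \<in> test_functions" for j unfolding \<delta>_def by (intro test_diff(1) T(1) \<phi>)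
    have \<delta>b: "cmod (\<delta> j y) \<le> 2 * E * (1 / t) ^ (?n + N) * (1 / 2 ^ j) ^ N" for j y
    proof -
      have e: "cmod (?T k \<phi> y - \<phi> y) \<le> E * (1 / t) ^ (?n + N) * (1 / 2 ^ j) ^ N" if "j \<le> k" for k
      proof -
        have "cmod (?T k \<phi> y - \<phi> y) \<le> E * CN_norm N \<phi> * (1 / 2 ^ k) ^ N" by (rule E(2)[OF \<phi>])
        also have "\<dots> \<le> E * (1 / t) ^ (?n + N) * (1 / 2 ^ j) ^ N"
          using E(1) t that by (intro mult_mono mult_left_mono \<phi>N power_mono divide_left_mono power_increasing) auto
        finally show ?thesis .
      qed
      have "cmod (\<delta> j y) \<le> cmod (?T (Suc j) \<phi> y - \<phi> y) + cmod (?T j \<phi> y - \<phi> y)"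
        unfolding \<delta>_def by (metis norm_triangle_ineq4 add_diff_cancel diff_diff_eq2 diff_add_cancel)
      also have "\<dots> \<le> 2 * (E * (1 / t) ^ (?n + N) * (1 / 2 ^ j) ^ N)" using e[of "Suc j"] e[of j] by simp
      finally show ?thesis by (simp only: mult.assoc)
    qed
    have \<delta>0: "\<delta> j y = 0" if "1 \<le> 2 ^ j * t" "(\<rho> + R) * t < norm y" for j y
    proof -
      have "1 \<le> 2 ^ Suc j * t" using that(1) by simp
      then show ?thesis unfolding \<delta>_def using out that by simp
    qed
    have base: "cmod (F j0) \<le> G * D * 2 powr A * p"
    proof -
      have "cmod (F j0) \<le> G * p * (D * (1 / t) ^ ?n) * t ^ ?n * (2 ^ j0 * t) powr A"
        unfolding F_def
      proof (rule G(2)[OF f P t xz T(1)[OF \<phi>] _ _ out[OF j0] j0])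
        show "0 \<le> D * (1 / t) ^ ?n" using D(1) t by simp
        show "cmod (?T j0 \<phi> y) \<le> D * (1 / t) ^ ?n" for y
          using t by (intro D(2) \<phi> \<phi>b) auto
      qed
      also have "\<dots> = G * p * D * (2 ^ j0 * t) powr A" using t by (simp add: power_divide)
      also have "\<dots> \<le> G * p * D * 2 powr A"
        using j0' A(1) t G(1) D(1) P(2) by (intro mult_left_mono powr_mono2) auto
      finally show ?thesis by (simp add: mult_ac)
    qed
    have step: "cmod (F (Suc (j0 + m)) - F (j0 + m)) \<le> L * p * q ^ m" for m
    proof -
      let ?j = "j0 + m" and ?b = "2 * E * (1 / t) ^ (?n + N) * (1 / 2 ^ (j0 + m)) ^ N"
      have b0: "0 \<le> ?b" using E(1) t by simp
      have jS: "1 \<le> 2 ^ Suc ?j * t" using jt1[of m] by simp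
      have tt: "?T k \<eta> \<in> test_functions" if "\<eta> \<in> test_functions" for k \<eta> using T(1)[OF that] .
      have id: "?T (Suc ?j) (?T (Suc ?j) \<phi>) y - ?T ?j (?T ?j \<phi>) y = ?T (Suc ?j) (\<delta> ?j) y + ?T ?j (\<delta> ?j) y" for y
      proof -
        have 1: "?T k (\<delta> ?j) y = ?T k (?T (Suc ?j) \<phi>) y - ?T k (?T ?j \<phi>) y" for k
          unfolding \<delta>_def by (rule mollify_diff[OF \<psi>0 T(1)[OF \<phi>] T(1)[OF \<phi>]])
        show ?thesis unfolding 1 using mollify_commute[OF \<psi>0 \<phi>, of c N "Suc ?j" ?j y] by simp
      qed
      have "F (Suc ?j) - F ?j = f (\<lambda>y. ?T (Suc ?j) (?T (Suc ?j) \<phi>) (z - y) - ?T ?j (?T ?j \<phi>) (z - y))"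
        unfolding F_def by (rule distribution_diff[OF f, symmetric]) (intro test_reflect(1) tt \<phi>)+
      also have "\<dots> = f (\<lambda>y. ?T (Suc ?j) (\<delta> ?j) (z - y) + ?T ?j (\<delta> ?j) (z - y))" unfolding id ..
      also have "\<dots> = f (\<lambda>y. ?T (Suc ?j) (\<delta> ?j) (z - y)) + f (\<lambda>y. ?T ?j (\<delta> ?j) (z - y))"
        by (rule distribution_add[OF f]) (intro test_reflect(1) tt \<delta>t)+
      finally have "cmod (F (Suc ?j) - F ?j) \<le> cmod (f (\<lambda>y. ?T (Suc ?j) (\<delta> ?j) (z - y))) + cmod (f (\<lambda>y. ?T ?j (\<delta> ?j) (z - y)))"
        by (simp add: norm_triangle_ineq)
      also have "\<dots> \<le> G * p * ?b * t ^ ?n * (2 ^ Suc ?j * t) powr A + G * p * ?b * t ^ ?n * (2 ^ ?j * t) powr A"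
        using \<delta>0[OF jt1]
        by (intro add_mono G(2)[OF f P t xz \<delta>t b0 \<delta>b _ jS] G(2)[OF f P t xz \<delta>t b0 \<delta>b _ jt1]) auto
      also have "(2 ^ Suc ?j * t) powr A = 2 powr A * (2 ^ ?j * t) powr A"
        using powr_mult[of 2 "2 ^ ?j * t" A] by (simp add: mult.assoc)
      also have "G * p * ?b * t ^ ?n * (2 powr A * (2 ^ ?j * t) powr A) + G * p * ?b * t ^ ?n * (2 ^ ?j * t) powr A
          = G * p * (2 powr A + 1) * (?b * t ^ ?n) * (2 ^ ?j * t) powr A" by (simp add: algebra_simps)
      also have "?b * t ^ ?n = 2 * E * (2 ^ ?j * t) powr (- real N)"
      proof -
        have "(2 ^ ?j * t) powr (- real N) = 1 / (2 ^ ?j * t) ^ N"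
          using t by (simp add: powr_minus_divide powr_realpow)
        also have "\<dots> = (1 / t) ^ N * (1 / 2 ^ ?j) ^ N" by (simp add: power_divide power_mult_distrib)
        finally have 1: "(2 ^ ?j * t) powr (- real N) = (1 / t) ^ N * (1 / 2 ^ ?j) ^ N" .
        have 2: "(1 / t) ^ (?n + N) * t ^ ?n = (1 / t) ^ N" using t by (simp add: power_add power_divide)
        have "?b * t ^ ?n = 2 * E * (((1 / t) ^ (?n + N) * t ^ ?n) * (1 / 2 ^ ?j) ^ N)" by (simp only: mult_ac)
        then show ?thesis unfolding 1 2 .
      qed
      also have "G * p * (2 powr A + 1) * (2 * E * (2 ^ ?j * t) powr (- real N)) * (2 ^ ?j * t) powr A
          = L * p * (2 ^ ?j * t) powr (A - real N)"
      proof -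
        have "(2 ^ ?j * t) powr (- real N) * (2 ^ ?j * t) powr A = (2 ^ ?j * t) powr (A - real N)"
          unfolding powr_add[symmetric] by simp
        then have "L * p * (2 ^ ?j * t) powr (A - real N) = L * p * ((2 ^ ?j * t) powr (- real N) * (2 ^ ?j * t) powr A)" by simp
        then show ?thesis unfolding L_def by (simp only: mult_ac)
      qed
      also have "\<dots> \<le> L * p * q ^ m"
      proof (rule mult_left_mono)
        have "(2 ^ ?j * t) powr (A - real N) \<le> (2 ^ m) powr (A - real N)"
          using jt[of m] A by (intro powr_mono2') auto
        also have "\<dots> = q ^ m"
          unfolding q_def by (simp add: powr_powr powr_realpow[symmetric] mult.commute)
        finally show "(2 ^ ?j * t) powr (A - real N) \<le> q ^ m" .
        show "0 \<le> L * p" using L P(2) by simp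
      qed
      finally show ?thesis .
    qed
    have partial: "cmod (F (j0 + m)) \<le> G * D * 2 powr A * p + L * p * (\<Sum>i<m. q ^ i)" for m
    proof (induction m)
      case 0
      then show ?case using base by simp
    next
      case (Suc m)
      have "cmod (F (Suc (j0 + m))) \<le> cmod (F (Suc (j0 + m)) - F (j0 + m)) + cmod (F (j0 + m))"
        using norm_triangle_ineq[of "F (Suc (j0 + m)) - F (j0 + m)" "F (j0 + m)"] by simp
      also have "\<dots> \<le> L * p * q ^ m + (G * D * 2 powr A * p + L * p * (\<Sum>i<m. q ^ i))" by (intro add_mono step Suc)
      finally show ?case by (simp add: algebra_simps)
    qed
    have unif: "cmod (F (m + j0)) \<le> C * p" for m
    proof -
      have "(\<Sum>i<m. q ^ i) = (1 - q ^ m) / (1 - q)" using q by (simp add: sum_gp_strict)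
      also have "\<dots> \<le> 1 / (1 - q)" using q by (intro divide_right_mono) auto
      finally have "L * p * (\<Sum>i<m. q ^ i) \<le> L * p * (1 / (1 - q))" using L P(2) by (intro mult_left_mono) auto
      then have "cmod (F (m + j0)) \<le> G * D * 2 powr A * p + L * p * (1 / (1 - q))" using partial[of m] by (simp add: add.commute)
      then show ?thesis by (simp add: C_def algebra_simps)
    qed
    have "F \<longlonglongrightarrow> f (\<lambda>y. \<phi> (z - y))"
      unfolding F_def by (rule distribution_mollify_limit[OF f \<psi>0 I c N \<phi>])
    then have "(\<lambda>m. F (m + j0)) \<longlonglongrightarrow> f (\<lambda>y. \<phi> (z - y))" by (rule LIMSEQ_ignore_initial_segment)
    then have "(\<lambda>m. cmod (F (m + j0))) \<longlonglongrightarrow> cmod (f (\<lambda>y. \<phi> (z - y)))" by (rule tendsto_norm)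
    then have "cmod (f (\<lambda>y. \<phi> (z - y))) \<le> C * p" by (rule LIMSEQ_le_const2) (use unif in blast)
    then show ?thesis by (simp add: conv_def \<phi>_def)
  qed
  show ?thesis
  proof
    show "0 < C + 1" using C by simp
    fix f :: "(real^'n \<Rightarrow> complex) \<Rightarrow> complex" and x assume f: "f \<in> distributions"
    show "grand_max N R f x \<le> ennreal (C + 1) * peetre_max \<psi>0 A B f x"
    proof (cases "peetre_max \<psi>0 A B f x")
      case top
      then show ?thesis using C by (simp add: ennreal_mult_top)
    next
      case (real p)
      show ?thesis unfolding grand_max_def
      proof (rule Sup_least)
        fix v assume "v \<in> {ennreal (cmod (conv (dilate t \<psi>) f z)) | t z \<psi>. norm (x - z) < t \<and> t < 1 \<and> \<psi> \<in> grand_class N R}"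
        then obtain t z \<psi> where v: "v = ennreal (cmod (conv (dilate t \<psi>) f z))" "norm (x - z) < t" "t < 1" "\<psi> \<in> grand_class N R" by blast
        have "0 < t" using v(2) norm_ge_zero[of "x - z"] by linarith
        then have "cmod (conv (dilate t \<psi>) f z) \<le> C * p" by (intro main[OF f real(2,1)] v)
        also have "\<dots> \<le> (C + 1) * p" using real by (simp add: algebra_simps)
        finally have "v \<le> ennreal ((C + 1) * p)" unfolding v(1) by (rule ennreal_leI)
        also have "\<dots> = ennreal (C + 1) * ennreal p" using C real(1) by (intro ennreal_mult) auto
        finally show "v \<le> ennreal (C + 1) * peetre_max \<psi>0 A B f x" by (simp only: real(2))
      qed
    qed
  qed
qed

section \<open>The operators on bounded functions and the Orlicz norm\<close>

text \<open>The polynomial factor is absorbed by half of the exponential decay: with \<open>c\<close> proportional to \<open>b / n\<close>,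
  \<open>(c (k + 1))\<^sup>n \<le> exp(n c (k + 1))\<close>.\<close>

lemma exp_decay_summable_bound:
  fixes b :: real
  assumes b: "0 < b"
  obtains C where "0 < C" "\<And>k::nat. 2 powr (- b * real k) * (2 * (real k + 1)) ^ n \<le> C * (2 powr (- b / 2)) ^ k"
proof -
  define c where "c = b * ln 2 / (2 * (real n + 1))"
  have c: "0 < c" using b by (simp add: c_def)
  have nc: "real n * c \<le> b * ln 2 / 2"
  proof -
    have "real n * c = (b * ln 2 / 2) * (real n / (real n + 1))" by (simp add: c_def)
    also have "\<dots> \<le> (b * ln 2 / 2) * 1" using b by (intro mult_left_mono) auto
    finally show ?thesis by simp
  qed
  show ?thesis
  proof
    show "0 < (2 / c) ^ n * 2 powr (b / 2)" using c by simp
    fix k :: nat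
    have "c * (real k + 1) \<le> exp (c * (real k + 1))"
      using exp_ge_add_one_self[of "c * (real k + 1)"] by linarith
    then have "(c * (real k + 1)) ^ n \<le> exp (c * (real k + 1)) ^ n"
      using c by (intro power_mono) auto
    also have "\<dots> = exp (real n * c * (real k + 1))" by (simp add: exp_of_nat_mult[symmetric] mult.assoc)
    also have "\<dots> \<le> exp (b * ln 2 / 2 * (real k + 1))" using nc by (simp add: mult_right_mono)
    also have "\<dots> = 2 powr (b / 2) * 2 powr (b / 2 * real k)"
      unfolding powr_add[symmetric] by (simp add: powr_def algebra_simps)
    finally have "(c * (real k + 1)) ^ n \<le> 2 powr (b / 2) * 2 powr (b / 2 * real k)" .
    then have "(2 / c) ^ n * (c * (real k + 1)) ^ n \<le> (2 / c) ^ n * (2 powr (b / 2) * 2 powr (b / 2 * real k))"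
      using c by (intro mult_left_mono) auto
    moreover have "(2 / c) ^ n * (c * (real k + 1)) ^ n = (2 * (real k + 1)) ^ n"
      using c by (simp add: power_mult_distrib[symmetric])
    ultimately have "2 powr (- b * real k) * (2 * (real k + 1)) ^ n \<le> 2 powr (- b * real k) * ((2 / c) ^ n * (2 powr (b / 2) * 2 powr (b / 2 * real k)))"
      by (intro mult_left_mono) auto
    also have "\<dots> = (2 / c) ^ n * 2 powr (b / 2) * (2 powr (- b * real k) * 2 powr (b / 2 * real k))" by (simp only: mult_ac)
    also have "2 powr (- b * real k) * 2 powr (b / 2 * real k) = (2 powr (- b / 2)) ^ k"
    proof -
      have "(2 powr (- b / 2)) ^ k = 2 powr (- b / 2 * real k)" by (simp add: powr_realpow[symmetric] powr_powr)
      then show ?thesis unfolding powr_add[symmetric] by (simp add: algebra_simps)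
    qed
    finally show "2 powr (- b * real k) * (2 * (real k + 1)) ^ n \<le> (2 / c) ^ n * 2 powr (b / 2) * (2 powr (- b / 2)) ^ k" .
  qed
qed

text \<open>The kernel is majorised on the shells \<open>k \<le> |x - y| < k + 1\<close>, whose measure grows polynomially in \<open>k\<close>.\<close>

lemma exp_kernel_integral_bound:
  fixes b :: real
  assumes b: "0 < b"
  obtains C where "0 < C" "\<And>x :: real^'n. (\<integral>\<^sup>+y. ennreal (2 powr (- b * norm (x - y))) \<partial>lebesgue) \<le> ennreal C"
proof -
  let ?n = "CARD('n)"
  obtain D where D: "0 < D" "\<And>k::nat. 2 powr (- b * real k) * (2 * (real k + 1)) ^ ?n \<le> D * (2 powr (- b / 2)) ^ k"
    using exp_decay_summable_bound[OF b, of ?n] by blast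
  define q where "q = 2 powr (- b / 2)"
  have q: "0 < q" "q < 1" using b by (auto simp: q_def powr_less_one)
  show ?thesis
  proof
    show "0 < D * (1 / (1 - q))" using D q by simp
    fix x :: "real^'n"
    have "(\<integral>\<^sup>+y. ennreal (2 powr (- b * norm (x - y))) \<partial>lebesgue)
      \<le> (\<integral>\<^sup>+y. (\<Sum>k. ennreal (2 powr (- b * real k)) * indicator (cball x (real k + 1)) y) \<partial>lebesgue)"
    proof (rule nn_integral_mono)
      fix y
      define k where "k = nat \<lfloor>norm (x - y)\<rfloor>"
      have "0 \<le> \<lfloor>norm (x - y)\<rfloor>" by simp
      then have k: "real k \<le> norm (x - y)" "norm (x - y) \<le> real k + 1"
        unfolding k_def by linarith+
      define f where "f k = (ennreal (2 powr (- b * real k)) * indicator (cball x (real k + 1)) y :: ennreal)" for k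
      have "ennreal (2 powr (- b * norm (x - y))) \<le> ennreal (2 powr (- b * real k))"
        using k(1) b by (intro ennreal_leI powr_mono) auto
      also have "\<dots> = f k" using k(2) by (simp add: dist_norm f_def)
      also have "\<dots> = sum f {k}" by simp
      also have "\<dots> \<le> (\<Sum>k. f k)" by (rule sum_le_suminf) auto
      finally show "ennreal (2 powr (- b * norm (x - y))) \<le> (\<Sum>k. ennreal (2 powr (- b * real k)) * indicator (cball x (real k + 1)) y)"
        unfolding f_def .
    qed
    also have "\<dots> = (\<Sum>k. ennreal (2 powr (- b * real k)) * emeasure lebesgue (cball x (real k + 1)))"
    proof -
      have "(\<integral>\<^sup>+y. (\<Sum>k. ennreal (2 powr (- b * real k)) * indicator (cball x (real k + 1)) y) \<partial>lebesgue)
        = (\<Sum>k. \<integral>\<^sup>+y. ennreal (2 powr (- b * real k)) * indicator (cball x (real k + 1)) y \<partial>lebesgue)"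
        by (rule nn_integral_suminf) (intro borel_measurable_times_ennreal borel_measurable_indicator borel_measurable_const, simp)
      also have "\<dots> = (\<Sum>k. ennreal (2 powr (- b * real k)) * emeasure lebesgue (cball x (real k + 1)))"
        by (intro arg_cong[where f=suminf] ext nn_integral_cmult_indicator) simp
      finally show ?thesis .
    qed
    also have "\<dots> \<le> (\<Sum>k. ennreal (D * q ^ k))"
    proof (rule suminf_le)
      fix k
      define a where "a = x - (\<chi> i. real k + 1)"
      have "cball x (real k + 1) \<subseteq> cbox a (a + (2 * (real k + 1)) *\<^sub>R One)"
      proof
        fix y assume "y \<in> cball x (real k + 1)"
        then have n: "norm (y - x) \<le> real k + 1" by (simp add: dist_norm norm_minus_commute)
        show "y \<in> cbox a (a + (2 * (real k + 1)) *\<^sub>R One)" unfolding mem_cube_iff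
        proof
          fix i
          have d: "\<bar>y $ i - x $ i\<bar> \<le> real k + 1" using component_le_norm_cart[of "y - x" i] n by simp
          have "a $ i = x $ i - (real k + 1)" by (simp add: a_def)
          then show "a $ i \<le> y $ i \<and> y $ i \<le> a $ i + 2 * (real k + 1)"
            using abs_le_D1[OF d] abs_le_D2[OF d] by simp
        qed
      qed
      then have "emeasure lebesgue (cball x (real k + 1)) \<le> emeasure lebesgue (cbox a (a + (2 * (real k + 1)) *\<^sub>R One))"
        by (rule emeasure_mono) simp
      also have "\<dots> = ennreal ((2 * (real k + 1)) ^ ?n)" by (rule cube_measure(2)) simp
      finally have "ennreal (2 powr (- b * real k)) * emeasure lebesgue (cball x (real k + 1))
          \<le> ennreal (2 powr (- b * real k)) * ennreal ((2 * (real k + 1)) ^ ?n)" by (rule mult_left_mono) simp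
      also have "\<dots> = ennreal (2 powr (- b * real k) * (2 * (real k + 1)) ^ ?n)" by (rule ennreal_mult[symmetric]) auto
      also have "\<dots> \<le> ennreal (D * q ^ k)" unfolding q_def by (rule ennreal_leI[OF D(2)])
      finally show "ennreal (2 powr (- b * real k)) * emeasure lebesgue (cball x (real k + 1)) \<le> ennreal (D * q ^ k)" .
    qed auto
    also have "\<dots> = ennreal (D * (1 / (1 - q)))"
      using q D(1) by (intro suminf_ennreal_eq sums_mult geometric_sums) auto
    finally show "(\<integral>\<^sup>+y. ennreal (2 powr (- b * norm (x - y))) \<partial>lebesgue) \<le> ennreal (D * (1 / (1 - q)))" .
  qed
qed

lemma local_maximal_mono:
  assumes "\<And>y. f y \<le> g y"
  shows "local_maximal f x \<le> local_maximal g x"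
  unfolding local_maximal_def
  by (rule SUP_mono, erule bexI[rotated]) (intro divide_right_mono_ennreal nn_integral_mono mult_right_mono assms, simp)

lemma exp_kernel_op_mono: "(\<And>y. f y \<le> g y) \<Longrightarrow> exp_kernel_op B f x \<le> exp_kernel_op B g x"
  unfolding exp_kernel_op_def by (intro nn_integral_mono mult_right_mono) auto

lemma local_cubes_sets: "Q \<in> local_cubes \<Longrightarrow> Q \<in> sets lebesgue"
  by (auto simp: local_cubes_def cubes_def)

lemma local_maximal_add:
  assumes f: "f \<in> borel_measurable borel" and g: "g \<in> borel_measurable borel"
  shows "local_maximal (\<lambda>y. f y + g y) x \<le> local_maximal f x + local_maximal g x"
  unfolding local_maximal_def[of "\<lambda>y. f y + g y"]
proof (rule SUP_least)
  have [measurable]: "f \<in> borel_measurable lebesgue" "g \<in> borel_measurable lebesgue"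
    using f g by (auto intro: measurable_lebesgueI)
  fix Q :: "(real^'a) set" assume Q: "Q \<in> {Q \<in> local_cubes. x \<in> Q}"
  have [measurable]: "Q \<in> sets lebesgue" using Q local_cubes_sets by blast
  have "(\<integral>\<^sup>+y\<in>Q. (f y + g y) \<partial>lebesgue) = (\<integral>\<^sup>+y\<in>Q. f y \<partial>lebesgue) + (\<integral>\<^sup>+y\<in>Q. g y \<partial>lebesgue)"
    by (simp add: distrib_right nn_integral_add)
  then have "(\<integral>\<^sup>+y\<in>Q. (f y + g y) \<partial>lebesgue) / emeasure lebesgue Q
      = (\<integral>\<^sup>+y\<in>Q. f y \<partial>lebesgue) / emeasure lebesgue Q + (\<integral>\<^sup>+y\<in>Q. g y \<partial>lebesgue) / emeasure lebesgue Q"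
    by (simp only: add_divide_distrib_ennreal)
  also have "\<dots> \<le> local_maximal f x + local_maximal g x"
    unfolding local_maximal_def by (intro add_mono SUP_upper Q)
  finally show "(\<integral>\<^sup>+y\<in>Q. (f y + g y) \<partial>lebesgue) / emeasure lebesgue Q \<le> local_maximal f x + local_maximal g x" .
qed

lemma exp_kernel_op_add:
  assumes f: "f \<in> borel_measurable borel" and g: "g \<in> borel_measurable borel"
  shows "exp_kernel_op B (\<lambda>y. f y + g y) x = exp_kernel_op B f x + exp_kernel_op B g x"
proof -
  have [measurable]: "f \<in> borel_measurable borel" "g \<in> borel_measurable borel" by fact+
  show ?thesis by (simp add: exp_kernel_op_lborel distrib_right nn_integral_add)
qed

lemma local_maximal_cmult:
  assumes f: "f \<in> borel_measurable borel"
  shows "local_maximal (\<lambda>y. ennreal c * f y) x = ennreal c * local_maximal f x"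
proof -
  have [measurable]: "f \<in> borel_measurable lebesgue" using f by (rule measurable_lebesgueI)
  have "(\<integral>\<^sup>+y\<in>Q. ennreal c * f y \<partial>lebesgue) / emeasure lebesgue Q = ennreal c * ((\<integral>\<^sup>+y\<in>Q. f y \<partial>lebesgue) / emeasure lebesgue Q)"
    if "Q \<in> local_cubes" for Q
  proof -
    have [measurable]: "Q \<in> sets lebesgue" using that by (rule local_cubes_sets)
    have "(\<integral>\<^sup>+y\<in>Q. ennreal c * f y \<partial>lebesgue) = ennreal c * (\<integral>\<^sup>+y\<in>Q. f y \<partial>lebesgue)"
      by (simp add: mult.assoc nn_integral_cmult)
    then show ?thesis by (simp add: ennreal_times_divide)
  qed
  then show ?thesis unfolding local_maximal_def by (simp add: SUP_mult_left_ennreal)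
qed

lemma exp_kernel_op_cmult:
  assumes f: "f \<in> borel_measurable borel"
  shows "exp_kernel_op B (\<lambda>y. ennreal c * f y) x = ennreal c * exp_kernel_op B f x"
proof -
  have [measurable]: "f \<in> borel_measurable borel" by fact
  show ?thesis by (simp add: exp_kernel_op_lborel mult.assoc nn_integral_cmult)
qed

lemma local_maximal_bounded:
  fixes x :: "real^'n"
  assumes "0 \<le> s" "\<And>y. f y \<le> ennreal s"
  shows "local_maximal f x \<le> ennreal s"
  unfolding local_maximal_def
proof (rule SUP_least)
  fix Q :: "(real^'n) set" assume Q: "Q \<in> {Q \<in> local_cubes. x \<in> Q}"
  obtain a l where al: "Q = cbox a (a + l *\<^sub>R One)" "0 < l" using Q local_cubesE by blast
  have "(\<integral>\<^sup>+y\<in>Q. f y \<partial>lebesgue) \<le> (\<integral>\<^sup>+y. ennreal s * indicator Q y \<partial>lebesgue)"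
    using assms(2) by (intro nn_integral_mono mult_right_mono) auto
  also have "\<dots> = ennreal s * emeasure lebesgue Q"
    by (rule nn_integral_cmult_indicator) (simp add: al)
  finally have 1: "(\<integral>\<^sup>+y\<in>Q. f y \<partial>lebesgue) / emeasure lebesgue Q \<le> ennreal s * emeasure lebesgue Q / emeasure lebesgue Q"
    by (rule divide_right_mono_ennreal)
  have e: "emeasure lebesgue Q = ennreal (l ^ CARD('n))" unfolding al(1) by (rule cube_measure(2)) (use al in simp)
  have "ennreal s * emeasure lebesgue Q / emeasure lebesgue Q = ennreal s"
    unfolding e using al(2) assms(1) by (simp add: divide_ennreal flip: ennreal_mult)
  then show "(\<integral>\<^sup>+y\<in>Q. f y \<partial>lebesgue) / emeasure lebesgue Q \<le> ennreal s" using 1 by simp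
qed

lemma exp_kernel_op_bounded:
  assumes C: "(\<integral>\<^sup>+y. ennreal (2 powr (- B * norm (x - y))) \<partial>lebesgue) \<le> ennreal C" "0 \<le> C"
    and s: "0 \<le> s" "\<And>y. f y \<le> ennreal s"
  shows "exp_kernel_op B f x \<le> ennreal (C * s)"
proof -
  have "exp_kernel_op B f x \<le> (\<integral>\<^sup>+y. ennreal s * ennreal (2 powr (- B * norm (x - y))) \<partial>lebesgue)"
    unfolding exp_kernel_op_def using s(2) by (intro nn_integral_mono mult_right_mono) auto
  also have "\<dots> = ennreal s * (\<integral>\<^sup>+y. ennreal (2 powr (- B * norm (x - y))) \<partial>lebesgue)"
    by (rule nn_integral_cmult) (rule measurable_lebesgueI, measurable)
  also have "\<dots> \<le> ennreal s * ennreal C" by (rule mult_left_mono[OF C(1)]) simp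
  also have "\<dots> = ennreal (C * s)" using s(1) C(2) by (simp add: ennreal_mult mult.commute)
  finally show ?thesis .
qed

lemma measurable_radial_max:
  assumes f: "f \<in> distributions" and \<psi>: "\<psi> \<in> test_functions"
  shows "radial_max \<psi> f \<in> borel_measurable borel"
proof -
  have "(\<lambda>x. conv (dyadic j \<psi>) f x) \<in> borel_measurable borel" for j
    by (rule borel_measurable_continuous_onI[OF conv_continuous[OF f test_dyadic[OF \<psi>]]])
  note [measurable] = this
  have e: "radial_max \<psi> f = (\<lambda>x. SUP j. ennreal (cmod (conv (dyadic j \<psi>) f x)))"
    by (rule ext) (rule radial_max_def)
  show ?thesis unfolding e by measurable
qed

lemma infsum_geometric_bound:
  fixes X :: ennreal and h :: "nat \<Rightarrow> ennreal"
  assumes d: "0 < d" and h: "\<And>k. h k \<le> X"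
  shows "(\<Sum>\<^sub>\<infinity>k\<in>{j..}. ennreal (2 powr ((real j - real k) * d)) * h k) \<le> ennreal (1 / (1 - 2 powr (- d))) * X"
proof (rule infsum_le_finite_sums)
  show "(\<lambda>k. ennreal (2 powr ((real j - real k) * d)) * h k) summable_on {j..}"
    by (rule nonneg_summable_on_complete) simp
  fix F :: "nat set" assume F: "finite F" "F \<subseteq> {j..}"
  define q where "q = 2 powr (- d)"
  have q: "0 < q" "q < 1" using d by (auto simp: q_def powr_less_one)
  have pw: "2 powr ((real j - real k) * d) = q ^ (k - j)" if "k \<in> F" for k
  proof -
    have "j \<le> k" using that F(2) by auto
    then show ?thesis unfolding q_def by (simp add: powr_realpow[symmetric] powr_powr of_nat_diff algebra_simps)
  qed
  have inj: "inj_on (\<lambda>k. k - j) F"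
  proof (rule inj_onI)
    fix x y assume "x \<in> F" "y \<in> F" "x - j = y - j"
    moreover then have "j \<le> x" "j \<le> y" using F(2) by auto
    ultimately show "x = y" by linarith
  qed
  have "(\<Sum>k\<in>F. 2 powr ((real j - real k) * d)) = (\<Sum>i\<in>(\<lambda>k. k - j) ` F. q ^ i)"
    unfolding sum.reindex[OF inj] o_def by (intro sum.cong refl pw)
  also have "\<dots> \<le> (\<Sum>i. q ^ i)" using F(1) q by (intro sum_le_suminf summable_geometric) auto
  also have "\<dots> = 1 / (1 - q)" using q by (intro suminf_geometric) auto
  finally have s: "(\<Sum>k\<in>F. 2 powr ((real j - real k) * d)) \<le> 1 / (1 - q)" .
  have "(\<Sum>k\<in>F. ennreal (2 powr ((real j - real k) * d)) * h k) \<le> (\<Sum>k\<in>F. ennreal (2 powr ((real j - real k) * d)) * X)"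
    by (intro sum_mono mult_left_mono h) auto
  also have "\<dots> = ennreal (\<Sum>k\<in>F. 2 powr ((real j - real k) * d)) * X"
    by (simp add: sum_distrib_right[symmetric])
  also have "\<dots> \<le> ennreal (1 / (1 - 2 powr (- d))) * X"
    using s unfolding q_def by (intro mult_right_mono ennreal_leI) auto
  finally show "(\<Sum>k\<in>F. ennreal (2 powr ((real j - real k) * d)) * h k) \<le> ennreal (1 / (1 - 2 powr (- d))) * X" .
qed

lemma orlicz_norm_mono:
  assumes \<Phi>: "orlicz_function \<Phi>" and le: "\<And>x. G x \<le> H x"
  shows "orlicz_norm \<Phi> w G \<le> orlicz_norm \<Phi> w H"
  unfolding orlicz_norm_def
proof (rule Inf_superset_mono, rule subsetI)
  fix v assume "v \<in> {ennreal c |c. 0 < c \<and> (\<integral>\<^sup>+x. orlicz_ext \<Phi> (H x / ennreal c) * ennreal (w x) \<partial>lebesgue) \<le> 1}"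
  then obtain c where c: "v = ennreal c" "0 < c" "(\<integral>\<^sup>+x. orlicz_ext \<Phi> (H x / ennreal c) * ennreal (w x) \<partial>lebesgue) \<le> 1" by blast
  have "(\<integral>\<^sup>+x. orlicz_ext \<Phi> (G x / ennreal c) * ennreal (w x) \<partial>lebesgue) \<le> (\<integral>\<^sup>+x. orlicz_ext \<Phi> (H x / ennreal c) * ennreal (w x) \<partial>lebesgue)"
    by (intro nn_integral_mono mult_right_mono orlicz_ext_mono[OF \<Phi>] divide_right_mono_ennreal le) auto
  then have "(\<integral>\<^sup>+x. orlicz_ext \<Phi> (G x / ennreal c) * ennreal (w x) \<partial>lebesgue) \<le> 1" using c(3) by order
  then show "v \<in> {ennreal c |c. 0 < c \<and> (\<integral>\<^sup>+x. orlicz_ext \<Phi> (G x / ennreal c) * ennreal (w x) \<partial>lebesgue) \<le> 1}"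
    using c(1,2) by blast
qed

lemma orlicz_norm_cmult:
  assumes k: "0 < k"
  shows "orlicz_norm \<Phi> w (\<lambda>x. ennreal k * G x) \<le> ennreal k * orlicz_norm \<Phi> w G"
proof -
  let ?N = "orlicz_norm \<Phi> w (\<lambda>x. ennreal k * G x)"
  have "?N / ennreal k \<le> orlicz_norm \<Phi> w G"
    unfolding orlicz_norm_def[of \<Phi> w G]
  proof (rule Inf_greatest)
    fix v assume "v \<in> {ennreal c |c. 0 < c \<and> (\<integral>\<^sup>+x. orlicz_ext \<Phi> (G x / ennreal c) * ennreal (w x) \<partial>lebesgue) \<le> 1}"
    then obtain c where c: "v = ennreal c" "0 < c" "(\<integral>\<^sup>+x. orlicz_ext \<Phi> (G x / ennreal c) * ennreal (w x) \<partial>lebesgue) \<le> 1" by blast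
    have eq: "ennreal k * u / ennreal (k * c) = u / ennreal c" for u
    proof (cases u)
      case (real a)
      then show ?thesis using k c(2) by (simp add: divide_ennreal flip: ennreal_mult)
    next
      case top
      then show ?thesis using k c(2) by (simp add: ennreal_mult_top ennreal_top_divide)
    qed
    have "?N \<le> ennreal (k * c)"
      unfolding orlicz_norm_def eq using k c(2,3)
      by (intro Inf_lower CollectI exI[of _ "k * c"]) (simp add: eq)
    then have "?N / ennreal k \<le> ennreal (k * c) / ennreal k" by (rule divide_right_mono_ennreal)
    also have "\<dots> = v" using k c by (simp add: divide_ennreal)
    finally show "?N / ennreal k \<le> v" .
  qed
  then have "ennreal k * (?N / ennreal k) \<le> ennreal k * orlicz_norm \<Phi> w G"
    by (rule mult_left_mono) simp
  moreover have "ennreal k * (?N / ennreal k) = ?N"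
    using k ennreal_mult_divide_eq[of "ennreal k" ?N]
    by (simp add: ennreal_times_divide mult.commute[of "ennreal k" ?N])
  ultimately show ?thesis by simp
qed

section \<open>The maximal inequalities\<close>

text \<open>Each function \<open>|(\<psi>)\<^sub>k * f|\<close> is at most the radial maximal function, which can therefore be taken out
  of the series; \<open>A > n / r\<close> makes the remaining geometric series converge.\<close>

lemma peetre_max_pointwise:
  fixes \<psi> :: "real^'n \<Rightarrow> complex"
  assumes A0: "admissible_A0 (supp \<psi>) A0" and \<psi>: "\<psi> \<in> test_functions" "integral\<^sup>L lebesgue \<psi> \<noteq> 0"
    and r: "0 < r" and A: "max A0 (real CARD('n) / r) < A" and B: "0 \<le> B"
  obtains C where "0 < C"
    "\<And>f x. f \<in> distributions \<Longrightarrow> peetre_max \<psi> A B f x \<le>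
      epowr (ennreal C * (local_maximal (\<lambda>z. epowr (radial_max \<psi> f z) r) x
        + exp_kernel_op (B * r) (\<lambda>z. epowr (radial_max \<psi> f z) r) x)) (1 / r)"
proof -
  obtain C where C: "0 < C" "\<And>f x j. f \<in> distributions \<Longrightarrow>
          epowr (peetre \<psi> A B j f x) r \<le>
          ennreal C *
            (\<Sum>\<^sub>\<infinity>k\<in>{j..}. ennreal (2 powr ((real j - real k) * (A * r - real CARD('n)))) *
               (local_maximal (\<lambda>z. ennreal (cmod (conv (dyadic k \<psi>) f z) powr r)) x +
                exp_kernel_op (B * r) (\<lambda>z. ennreal (cmod (conv (dyadic k \<psi>) f z) powr r)) x))"
    using mp[OF bspec[OF conjunct2[OF A0[unfolded admissible_A0_def]] \<psi>(1)] conjI[OF refl \<psi>(2)], rule_format, OF r A B]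
    by (elim exE conjE) (rule that, assumption, simp)
  define d where "d = A * r - real CARD('n)"
  have d: "0 < d" using A r by (simp add: d_def field_simps)
  define D where "D = 1 / (1 - 2 powr (- d))"
  have D: "0 < D" using d by (simp add: D_def powr_less_one)
  show ?thesis
  proof
    show "0 < C * D" using C D by simp
    fix f :: "(real^'n \<Rightarrow> complex) \<Rightarrow> complex" and x assume f: "f \<in> distributions"
    let ?g = "\<lambda>z. epowr (radial_max \<psi> f z) r"
    let ?X = "local_maximal ?g x + exp_kernel_op (B * r) ?g x"
    have hg: "ennreal (cmod (conv (dyadic k \<psi>) f z) powr r) \<le> ?g z" for k z
    proof -
      have "ennreal (cmod (conv (dyadic k \<psi>) f z)) \<le> radial_max \<psi> f z"
        unfolding radial_max_def by (rule SUP_upper) simp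
      then have "epowr (ennreal (cmod (conv (dyadic k \<psi>) f z))) r \<le> ?g z" using r by (intro epowr_mono) auto
      then show ?thesis by (simp add: epowr_ennreal)
    qed
    have "peetre \<psi> A B j f x \<le> epowr (ennreal (C * D) * ?X) (1 / r)" for j
    proof -
      have "epowr (peetre \<psi> A B j f x) r \<le> ennreal C * (ennreal D * ?X)"
      proof (rule order_trans[OF C(2)[OF f] mult_left_mono])
        show "(\<Sum>\<^sub>\<infinity>k\<in>{j..}. ennreal (2 powr ((real j - real k) * (A * r - real CARD('n)))) *
               (local_maximal (\<lambda>z. ennreal (cmod (conv (dyadic k \<psi>) f z) powr r)) x +
                exp_kernel_op (B * r) (\<lambda>z. ennreal (cmod (conv (dyadic k \<psi>) f z) powr r)) x)) \<le> ennreal D * ?X"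
          unfolding D_def d_def[symmetric]
          by (intro infsum_geometric_bound d add_mono local_maximal_mono exp_kernel_op_mono hg)
      qed simp
      also have "\<dots> = ennreal (C * D) * ?X" using C(1) D by (simp add: ennreal_mult mult.assoc)
      finally have "epowr (epowr (peetre \<psi> A B j f x) r) (1 / r) \<le> epowr (ennreal (C * D) * ?X) (1 / r)"
        using r by (intro epowr_mono) auto
      then show ?thesis using r by (simp add: epowr_epowr epowr_one)
    qed
    then show "peetre_max \<psi> A B f x \<le> epowr (ennreal (C * D) * ?X) (1 / r)"
      unfolding peetre_max_def by (intro SUP_least)
  qed
qed

text \<open>The parameters are chosen in the order \<open>v\<close>, \<open>p\<close>, \<open>p0\<close>, \<open>r\<close>. Both \<open>n q / A\<close>, with \<open>q\<close> the critical index, and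
  \<open>B0 / B\<close> are below the critical lower type of \<open>\<Phi>\<close>; \<open>v\<close> lies strictly in between. Then \<open>q < A v / n\<close>
  leaves room for \<open>p\<close>, the supremum defining the critical lower type provides \<open>p0 > v\<close>, and \<open>r = v / p\<close>
  turns the bounds on \<open>v\<close> into \<open>n / r < A\<close> and \<open>B0 / p \<le> B r\<close>.\<close>

lemma peetre_max_orlicz_norm:
  fixes \<psi> :: "real^'n \<Rightarrow> complex" and w :: "real^'n \<Rightarrow> real"
  assumes \<Phi>: "orlicz_function \<Phi>" and w: "w \<in> Ainf_loc"
    and \<psi>: "\<psi> \<in> test_functions" "integral\<^sup>L lebesgue \<psi> \<noteq> 0"
    and A0: "admissible_A0 (supp \<psi>) A0" and B0: "admissible_B0 w B0"
    and A: "max A0 (real CARD('n) * crit_index w / crit_lower_type \<Phi>) < A"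
    and B: "B0 / crit_lower_type \<Phi> < B"
  obtains L where "0 < L"
    "\<And>f. f \<in> distributions \<Longrightarrow> orlicz_norm \<Phi> w (peetre_max \<psi> A B f) \<le> ennreal L * orlicz_norm \<Phi> w (radial_max \<psi> f)"
proof -
  let ?n = "real CARD('n)" and ?P = "crit_lower_type \<Phi>"
  have wt: "weight w" using w by (simp add: Ainf_loc_def)
  have P: "0 < ?P" using \<Phi> by (simp add: orlicz_function_def)
  have A0p: "0 < A0" and B0p: "0 < B0" using A0 B0 by (auto simp: admissible_A0_def admissible_B0_def)
  have Ap: "0 < A" using A A0p by simp
  have Bp: "0 < B" using B B0p P by (meson divide_pos_pos less_trans)
  define m where "m = max (?n * crit_index w / A) (B0 / B)"
  have m: "0 < m" "m < ?P"
  proof -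
    show "0 < m" using B0p Bp by (simp add: m_def less_max_iff_disj)
    have "?n * crit_index w / ?P < A" using A by simp
    then have "?n * crit_index w / A < ?P" using P Ap by (simp add: field_simps)
    moreover have "B0 / B < ?P" using B P Bp by (simp add: field_simps)
    ultimately show "m < ?P" by (simp add: m_def)
  qed
  obtain v where v: "m < v" "v < ?P" using m(2) dense by blast
  have v0: "0 < v" using m v by simp
  have "crit_index w < A * v / ?n"
    using v(1) Ap by (simp add: m_def field_simps)
  then obtain p where p: "1 < p" "p < A * v / ?n" "w \<in> Ap_loc p"
    using Ainf_Ap_near_crit_index[OF w] by blast
  have "{p. 0 < p \<and> lower_type \<Phi> p} \<noteq> {}" using \<Phi> by (auto simp: orlicz_function_def)
  then obtain p0 where p0: "0 < p0" "lower_type \<Phi> p0" "v < p0"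
    using less_cSupE[OF v(2)[unfolded crit_lower_type_def]] by blast
  define r where "r = v / p"
  have r: "0 < r" "r * p = v" using v0 p(1) by (auto simp: r_def)
  have Ar: "max A0 (?n / r) < A"
  proof -
    have "?n / r = ?n * p / v" by (simp add: r_def)
    also have "\<dots> < A" using p(2) v0 by (simp add: field_simps)
    finally show ?thesis using A by simp
  qed
  have Br: "B0 / p \<le> B * r"
  proof -
    have "B0 \<le> B * v" using v(1) Bp by (simp add: m_def field_simps)
    then show ?thesis using p(1) by (simp add: r_def divide_right_mono)
  qed
  have Br0: "0 < B * r" using Bp r by simp
  obtain C where C: "0 < C"
    "\<And>f x. f \<in> distributions \<Longrightarrow> peetre_max \<psi> A B f x \<le>
      epowr (ennreal C * (local_maximal (\<lambda>z. epowr (radial_max \<psi> f z) r) x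
        + exp_kernel_op (B * r) (\<lambda>z. epowr (radial_max \<psi> f z) r) x)) (1 / r)"
    using peetre_max_pointwise[OF A0 \<psi> r(1) Ar less_imp_le[OF Bp]] by blast
  define T where "T g x = ennreal C * (local_maximal g x + exp_kernel_op (B * r) g x)" for g and x :: "real^'n"
  have weak: "weak_type w p T"
    unfolding T_def[abs_def] using p(1) C(1)
    by (intro weak_type_add[OF wt local_maximal_weak_type[OF w p(3,1)] exp_kernel_op_weak_type[OF B0 p(1,3) Br]]) auto
  have sub: "T (\<lambda>y. f y + g y) x \<le> T f x + T g x" if "f \<in> borel_measurable borel" "g \<in> borel_measurable borel" for f g x
  proof -
    have "T (\<lambda>y. f y + g y) x \<le> ennreal C * ((local_maximal f x + local_maximal g x) + (exp_kernel_op (B * r) f x + exp_kernel_op (B * r) g x))"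
      unfolding T_def exp_kernel_op_add[OF that] by (intro mult_left_mono add_right_mono local_maximal_add that) simp
    also have "\<dots> = T f x + T g x" by (simp add: T_def distrib_left add_ac)
    finally show ?thesis .
  qed
  obtain E where E: "0 < E" "\<And>x :: real^'n. (\<integral>\<^sup>+y. ennreal (2 powr (- (B * r) * norm (x - y))) \<partial>lebesgue) \<le> ennreal E"
    using exp_kernel_integral_bound[OF Br0] by blast
  have bd: "T f x \<le> ennreal (C * (1 + E) * s)" if "0 \<le> s" "\<And>y. f y \<le> ennreal s" for f s x
  proof -
    have "T f x \<le> ennreal C * (ennreal s + ennreal (E * s))"
      unfolding T_def using that by (intro mult_left_mono add_mono local_maximal_bounded exp_kernel_op_bounded[OF E(2) less_imp_le[OF E(1)]]) auto
    also have "ennreal s + ennreal (E * s) = ennreal (s + E * s)" by (rule ennreal_plus[symmetric]) (use E(1) that(1) in auto)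
    also have "ennreal C * \<dots> = ennreal (C * (s + E * s))" by (rule ennreal_mult[symmetric]) (use C(1) E(1) that(1) in auto)
    finally show ?thesis by (simp add: algebra_simps)
  qed
  have cT: "0 < C * (1 + E)" using C E by simp
  have rp: "r * p < p0" using r(2) p0(3) by simp
  have p': "0 < p" using p(1) by simp
  obtain D where D: "0 < D"
    "\<And>g. g \<in> borel_measurable borel \<Longrightarrow>
       (\<integral>\<^sup>+x. orlicz_ext \<Phi> (epowr (T (\<lambda>y. epowr (g y) r) x) (1 / r)) * ennreal (w x) \<partial>lebesgue)
       \<le> ennreal D * (\<integral>\<^sup>+x. orlicz_ext \<Phi> (g x) * ennreal (w x) \<partial>lebesgue)"
    using orlicz_weak_type_interpolation[OF \<Phi> p0(2) wt r(1) p' rp weak sub bd cT] by blast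
  define L where "L = (D + 1) powr (1 / p0)"
  have L: "1 < L" "D \<le> L powr p0"
  proof -
    show "1 < L" unfolding L_def using D(1) p0(1) by (intro gr_one_powr) auto
    show "D \<le> L powr p0" unfolding L_def using D(1) p0(1) by (simp add: powr_powr)
  qed
  show ?thesis
  proof
    show "0 < L" using L by simp
    fix f :: "(real^'n \<Rightarrow> complex) \<Rightarrow> complex" assume f: "f \<in> distributions"
    have gm[measurable]: "radial_max \<psi> f \<in> borel_measurable borel" by (rule measurable_radial_max[OF f \<psi>(1)])
    show "orlicz_norm \<Phi> w (peetre_max \<psi> A B f) \<le> ennreal L * orlicz_norm \<Phi> w (radial_max \<psi> f)"
    proof (rule orlicz_norm_le[OF \<Phi> p0(2,1) wt gm L D(1)])
      fix c :: real assume c: "0 < c"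
      define g where "g x = radial_max \<psi> f x / ennreal c" for x
      have g: "g \<in> borel_measurable borel" unfolding g_def by measurable
      have div: "u / ennreal c = ennreal (1 / c) * u" for u
        using c by (cases u) (auto simp: divide_ennreal ennreal_top_divide ennreal_mult_top simp flip: ennreal_mult)
      have "peetre_max \<psi> A B f x / ennreal c \<le> epowr (T (\<lambda>y. epowr (g y) r) x) (1 / r)" for x
      proof -
        have hm: "(\<lambda>z. epowr (radial_max \<psi> f z) r) \<in> borel_measurable borel" by measurable
        have gr: "epowr (g y) r = ennreal ((1 / c) powr r) * epowr (radial_max \<psi> f y) r" for y
          unfolding g_def div using r(1) c by (simp add: epowr_mult epowr_ennreal)
        have "T (\<lambda>y. epowr (g y) r) x = ennreal ((1 / c) powr r) * T (\<lambda>y. epowr (radial_max \<psi> f y) r) x"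
          unfolding gr T_def local_maximal_cmult[OF hm] exp_kernel_op_cmult[OF hm]
          by (simp add: distrib_left mult.left_commute)
        then have "epowr (T (\<lambda>y. epowr (g y) r) x) (1 / r) = ennreal (1 / c) * epowr (T (\<lambda>y. epowr (radial_max \<psi> f y) r) x) (1 / r)"
          using r(1) c by (simp add: epowr_mult epowr_ennreal powr_powr)
        moreover have "peetre_max \<psi> A B f x \<le> epowr (T (\<lambda>y. epowr (radial_max \<psi> f y) r) x) (1 / r)"
          unfolding T_def by (rule C(2)[OF f])
        ultimately show ?thesis unfolding div by (simp add: mult_left_mono)
      qed
      then have "(\<integral>\<^sup>+x. orlicz_ext \<Phi> (peetre_max \<psi> A B f x / ennreal c) * ennreal (w x) \<partial>lebesgue)
        \<le> (\<integral>\<^sup>+x. orlicz_ext \<Phi> (epowr (T (\<lambda>y. epowr (g y) r) x) (1 / r)) * ennreal (w x) \<partial>lebesgue)"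
        by (intro nn_integral_mono mult_right_mono orlicz_ext_mono[OF \<Phi>]) auto
      also have "\<dots> \<le> ennreal D * (\<integral>\<^sup>+x. orlicz_ext \<Phi> (g x) * ennreal (w x) \<partial>lebesgue)" by (rule D(2)[OF g])
      finally show "(\<integral>\<^sup>+x. orlicz_ext \<Phi> (peetre_max \<psi> A B f x / ennreal c) * ennreal (w x) \<partial>lebesgue)
        \<le> ennreal D * (\<integral>\<^sup>+x. orlicz_ext \<Phi> (radial_max \<psi> f x / ennreal c) * ennreal (w x) \<partial>lebesgue)"
        unfolding g_def .
    qed
  qed
qed

theorem theorem3p12:
  fixes \<Phi> :: "real \<Rightarrow> real" and \<omega> :: "real^'n \<Rightarrow> real" and \<psi>\<^sub>0 :: "real^'n \<Rightarrow> complex"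
    and R A\<^sub>0 B\<^sub>0 A\<^sub>1 B\<^sub>1 A B :: real and N\<^sub>0 N :: int
  assumes "orlicz_function \<Phi>"
    and "\<omega> \<in> Ainf_loc"
    and "0 < R"
    and "\<psi>\<^sub>0 \<in> test_functions" and "integral\<^sup>L lebesgue \<psi>\<^sub>0 \<noteq> 0"
    and "admissible_A0 (supp \<psi>\<^sub>0) A\<^sub>0"
    and "admissible_B0 \<omega> B\<^sub>0"
    and "A\<^sub>1 = max A\<^sub>0 (real CARD('n) * crit_index \<omega> / crit_lower_type \<Phi>)"
    and "B\<^sub>1 = B\<^sub>0 / crit_lower_type \<Phi>"
    and "N\<^sub>0 = \<lfloor>2 * A\<^sub>1\<rfloor> + 1"
    and "A\<^sub>1 < A" and "B\<^sub>1 < B" and "N\<^sub>0 \<le> N"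
  shows "\<exists>C>0. \<forall>f\<in>distributions.
           orlicz_norm \<Phi> \<omega> (peetre_max \<psi>\<^sub>0 A B f)
             \<le> ennreal C * orlicz_norm \<Phi> \<omega> (radial_max \<psi>\<^sub>0 f) \<and>
           orlicz_norm \<Phi> \<omega> (grand_max (nat N) R f)
             \<le> ennreal C * orlicz_norm \<Phi> \<omega> (radial_max \<psi>\<^sub>0 f)"
proof -
  note \<Phi> = assms(1) and w = assms(2) and \<psi> = assms(4,5) and A0 = assms(6) and B0 = assms(7)
  have A1: "0 < A\<^sub>1" using A0 assms(8) by (auto simp: admissible_A0_def less_max_iff_disj)
  have "2 * A\<^sub>1 < real_of_int N" using assms(10,13) by linarith
  then have N: "A\<^sub>1 < real (nat N)" "0 < N" using A1 by linarith+
  \<comment> \<open>The given \<open>A\<close> may exceed \<open>N\<close>, so the grand maximal function is compared with a Peetre maximal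
    function of smaller exponent.\<close>
  obtain A' where A': "A\<^sub>1 < A'" "A' < real (nat N)" using dense[OF N(1)] by blast
  have B: "0 \<le> B"
  proof -
    have "0 < B\<^sub>1" using B0 \<Phi> assms(9) by (simp add: admissible_B0_def orlicz_function_def)
    then show ?thesis using assms(12) by simp
  qed
  obtain K where K: "0 < K"
    "\<And>f. f \<in> distributions \<Longrightarrow> orlicz_norm \<Phi> \<omega> (peetre_max \<psi>\<^sub>0 A B f) \<le> ennreal K * orlicz_norm \<Phi> \<omega> (radial_max \<psi>\<^sub>0 f)"
    using peetre_max_orlicz_norm[OF \<Phi> w \<psi> A0 B0 assms(11)[unfolded assms(8)] assms(12)[unfolded assms(9)]] by blast
  obtain K' where K': "0 < K'"
    "\<And>f. f \<in> distributions \<Longrightarrow> orlicz_norm \<Phi> \<omega> (peetre_max \<psi>\<^sub>0 A' B f) \<le> ennreal K' * orlicz_norm \<Phi> \<omega> (radial_max \<psi>\<^sub>0 f)"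
    using peetre_max_orlicz_norm[OF \<Phi> w \<psi> A0 B0 A'(1)[unfolded assms(8)] assms(12)[unfolded assms(9)]] by blast
  have "0 \<le> A'" using A1 A'(1) by simp
  then obtain G where G: "0 < G" "\<And>f x. f \<in> distributions \<Longrightarrow> grand_max (nat N) R f x \<le> ennreal G * peetre_max \<psi>\<^sub>0 A' B f x"
    using grand_max_le_peetre_max[OF \<psi> assms(3) _ A'(2) B] by blast
  show ?thesis
  proof (intro exI conjI ballI)
    show "0 < K + G * K'" using K(1) K'(1) G(1) by (simp add: add_pos_pos)
    fix f :: "(real^'n \<Rightarrow> complex) \<Rightarrow> complex" assume f: "f \<in> distributions"
    have "orlicz_norm \<Phi> \<omega> (peetre_max \<psi>\<^sub>0 A B f) \<le> ennreal K * orlicz_norm \<Phi> \<omega> (radial_max \<psi>\<^sub>0 f)" by (rule K(2)[OF f])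
    also have "\<dots> \<le> ennreal (K + G * K') * orlicz_norm \<Phi> \<omega> (radial_max \<psi>\<^sub>0 f)"
      using K'(1) G(1) by (intro mult_right_mono ennreal_leI) auto
    finally show "orlicz_norm \<Phi> \<omega> (peetre_max \<psi>\<^sub>0 A B f) \<le> ennreal (K + G * K') * orlicz_norm \<Phi> \<omega> (radial_max \<psi>\<^sub>0 f)" .
    have "orlicz_norm \<Phi> \<omega> (grand_max (nat N) R f) \<le> orlicz_norm \<Phi> \<omega> (\<lambda>x. ennreal G * peetre_max \<psi>\<^sub>0 A' B f x)"
      by (rule orlicz_norm_mono[OF \<Phi> G(2)[OF f]])
    also have "\<dots> \<le> ennreal G * orlicz_norm \<Phi> \<omega> (peetre_max \<psi>\<^sub>0 A' B f)" by (rule orlicz_norm_cmult[OF G(1)])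
    also have "\<dots> \<le> ennreal G * (ennreal K' * orlicz_norm \<Phi> \<omega> (radial_max \<psi>\<^sub>0 f))"
      by (rule mult_left_mono[OF K'(2)[OF f]]) simp
    also have "\<dots> = ennreal (G * K') * orlicz_norm \<Phi> \<omega> (radial_max \<psi>\<^sub>0 f)"
      using G(1) K'(1) by (simp add: ennreal_mult mult.assoc)
    also have "\<dots> \<le> ennreal (K + G * K') * orlicz_norm \<Phi> \<omega> (radial_max \<psi>\<^sub>0 f)"
      using K(1) by (intro mult_right_mono ennreal_leI) auto
    finally show "orlicz_norm \<Phi> \<omega> (grand_max (nat N) R f) \<le> ennreal (K + G * K') * orlicz_norm \<Phi> \<omega> (radial_max \<psi>\<^sub>0 f)" .
  qed
qed

end
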